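(* There is an isomorphism of (differential graded) properads $\mathsf{cBIB}_\infty\cong\mathsf{cDPois}_\infty$.
   Context: Ground field $\Bbbk$ of characteristic $0$; graded modules, Koszul sign rule. A $\Sigma$-bimodule $\mathsf{E}$ is a collection of $(\Sigma_m,\Sigma_n)$-bimodules $\mathsf{E}(m,n)$ ($m$ outputs, $n$ inputs) with $\mathsf{E}(0,n)=0$. A properad is an algebra over the monad $\mathcal{G}$ of connected directed graphs (without directed cycles) with vertices decorated by $\mathsf{E}$; $\mathcal{G}(\mathsf{E})$ is the free properad. Elements are written as composites of operations: $f\circ g$ means that $g$ is applied first, $f\otimes g=(f\otimes\mathrm{id})\circ(\mathrm{id}\otimes g)$, and $\tau$ is the symmetry exchanging two strands (degree $0$; it only permutes labels). $\mathsf{uBIB}^!$ is the unital extension of the Koszul dual properad $\mathsf{BIB}^!$ of the properad of balanced infinitesimal bialgebras with coproduct of degree $-1$: it is generated by $u$ of arity $(1,0)$ and degree $1$, $m$ of arity $(1,2)$ and degree $-1$, and $\Delta$ of arity $(2,1)$ and degree $0$ ($m$ and $\Delta$ each generating a free $\Sigma_2$-module), with relations generated by $m(\mathrm{id}\otimes m)+m(m\otimes \mathrm{id})$; $(\mathrm{id}\otimes\Delta)\Delta-(\Delta\otimes\mathrm{id})\Delta$; $-\Delta m+(m\otimes \mathrm{id})(\mathrm{id}\otimes\Delta)$; $-\Delta m+(\mathrm{id}\otimes m)(\Delta\otimes\mathrm{id})$; $B+\tau B\tau$; $B+D\tau$; $m\Delta$; $m\tau\Delta$, where $B=(\mathrm{id}\otimes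 m)(\tau\otimes\mathrm{id})(\mathrm{id}\otimes\Delta)$ and $D=(m\otimes\mathrm{id})(\mathrm{id}\otimes\tau)(\Delta\otimes\mathrm{id})$, together with the unit relations $m(u\otimes\mathrm{id})=-\mathrm{id}$ and $m(\mathrm{id}\otimes u)=\mathrm{id}$. $\mathsf{uDPois}^!$ is the unital extension of the Koszul dual properad of the properad of double Poisson gebras: it is generated by $u$ of arity $(1,0)$ and degree $1$; $m$ of arity $(1,2)$ and degree $-1$ (free $\Sigma_2$-module); $w$ of arity $(2,2)$ and degree $-1$ with $\tau w\tau=-w$; with relations $m(\mathrm{id}\otimes m)+m(m\otimes\mathrm{id})=0$; $m(u\otimes \mathrm{id})=-\mathrm{id}$, $m(\mathrm{id}\otimes u)=\mathrm{id}$; $(m\otimes\mathrm{id})(\mathrm{id}\otimes w)+w(\mathrm{id}\otimes m)(\tau\otimes\mathrm{id})=0$; $(m\otimes\mathrm{id})(\mathrm{id}\otimes\tau)(w\otimes\mathrm{id})+w(m\otimes\mathrm{id})(\mathrm{id}\otimes\tau)=0$; $(w\otimes\mathrm{id})(\mathrm{id}\otimes w)=c^{-1}(w\otimes\mathrm{id})(\mathrm{id}\otimes w)c$ where $c$ is the cyclic permutation of three strands; $m w=0$; $w w=0$ (both outputs of the first $w$ plugged into the two inputs of the next operation). $\mathsf{cDPois}^{¡}:=(\mathsf{uDPois}^!)^*$ and $\mathsf{cBIB}^{¡}:=(\mathsf{uBIB}^!)^*$ (componentwise linear duals). Dualizing the infinitesimal (two-vertex) composition map gives partial decomposition maps $\Delta_{(1,1)}\colon\mathsf{C}\to\mathcal{G}^c(\mathsf{C})^{(2)}$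 (sums of connected directed graphs with two vertices labelled by $\mathsf{C}$), making $\mathsf{C}$ a partial coproperad: a $\Sigma$-bimodule with a partial decomposition map satisfying the properties of the restriction of a comonadic product. For a partial coproperad $\mathsf{C}$, the cobar construction $\mathbf{\Omega}(\mathsf{C})$ has underlying properad $\mathcal{G}(s^{-1}\mathsf{C})$ (no reduction of $\mathsf{C}$; $s^{-1}$ is desuspension), with differential the derivation induced by the partial decomposition maps and the internal differential (here zero). $\mathsf{cDPois}_\infty:=\mathbf{\Omega}(\mathsf{cDPois}^{¡})$ and $\mathsf{cBIB}_\infty:=\mathbf{\Omega}(\mathsf{cBIB}^{¡})$. *)

theory Defs
  imports Complex_Main "HOL-Library.Poly_Mapping" "HOL-Combinatorics.Permutations"
begin

section \<open>Formal linear combinations\<close>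

abbreviation "lookup \<equiv> poly_mapping.lookup"
abbreviation "keys \<equiv> Poly_Mapping.keys"

definition fscale :: "'k::field \<Rightarrow> ('a \<Rightarrow>\<^sub>0 'k) \<Rightarrow> ('a \<Rightarrow>\<^sub>0 'k)" where
  "fscale c x = Poly_Mapping.map (\<lambda>y. c * y) x"

lemma lookup_fscale [simp]: "lookup (fscale c x) a = c * lookup x a"
  by (cases "lookup x a = 0") (simp_all add: fscale_def Poly_Mapping.map.rep_eq when_def)

interpretation fspace: vector_space "fscale :: 'k::field \<Rightarrow> ('a \<Rightarrow>\<^sub>0 'k) \<Rightarrow> ('a \<Rightarrow>\<^sub>0 'k)"
  by unfold_locales (auto intro!: poly_mapping_eqI simp: lookup_add algebra_simps)

abbreviation basis :: "'a \<Rightarrow> ('a \<Rightarrow>\<^sub>0 'k::field)" where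
  "basis a \<equiv> Poly_Mapping.single a 1"

definition lin :: "('a \<Rightarrow> ('b \<Rightarrow>\<^sub>0 'k)) \<Rightarrow> ('a \<Rightarrow>\<^sub>0 'k::field) \<Rightarrow> ('b \<Rightarrow>\<^sub>0 'k)" where
  "lin f x = (\<Sum>a\<in>keys x. fscale (lookup x a) (f a))"

definition parity_sign :: "int \<Rightarrow> 'k::field" where
  "parity_sign d = (if even d then 1 else -1)"


section \<open>Directed graphs with decorated vertices\<close>

text \<open>
  A wire leads from a source to a target. As a source, \<open>Ext j\<close> is the \<open>j\<close>-th input of the
  graph and \<open>Vtx i p\<close> is the \<open>p\<close>-th output of the \<open>i\<close>-th vertex; as a target,
  \<open>Ext j\<close> is the \<open>j\<close>-th output of the graph and \<open>Vtx i q\<close> is the \<open>q\<close>-th input of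
  the \<open>i\<close>-th vertex. The order of the list of vertices is the order of the factors in the
  tensor product of the decorations, and so it matters for signs.
\<close>

datatype port = Ext nat | Vtx nat nat

datatype 'e vertex = Vertex (outs: nat) (ins: nat) (vdeg: int) (dec: 'e)

datatype 'e dgraph =
  DGraph (gout: nat) (gin: nat) (verts: "'e vertex list") (edges: "(port \<times> port) set")

definition gdeg :: "'e dgraph \<Rightarrow> int" where
  "gdeg g = (\<Sum>v\<leftarrow>verts g. vdeg v)"

definition sources :: "'e dgraph \<Rightarrow> port set" where
  "sources g = Ext ` {..<gin g} \<union> {Vtx i p |i p. i < length (verts g) \<and> p < outs (verts g ! i)}"

definition targets :: "'e dgraph \<Rightarrow> port set" where
  "targets g = Ext ` {..<gout g} \<union> {Vtx i q |i q. i < length (verts g) \<and> q < ins (verts g ! i)}"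

definition wired :: "'e dgraph \<Rightarrow> bool" where
  "wired g \<longleftrightarrow> edges g \<subseteq> sources g \<times> targets g \<and>
     (\<forall>s\<in>sources g. \<exists>!t. (s, t) \<in> edges g) \<and> (\<forall>t\<in>targets g. \<exists>!s. (s, t) \<in> edges g)"

definition steps :: "'e dgraph \<Rightarrow> (nat \<times> nat) set" where
  "steps g = {(i, j). \<exists>p q. (Vtx i p, Vtx j q) \<in> edges g}"

text \<open>The only connected graph without vertices is a single strand.\<close>

definition connected_graph :: "'e dgraph \<Rightarrow> bool" where
  "connected_graph g \<longleftrightarrow>
     (if verts g = [] then gin g = 1 \<and> gout g = 1
      else (\<forall>j k. (Ext j, Ext k) \<notin> edges g) \<and>
           (\<forall>i<length (verts g). \<forall>j<length (verts g). (i, j) \<in> (steps g \<union> (steps g)\<inverse>)\<^sup>*))"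

definition wf_graph :: "'e dgraph \<Rightarrow> bool" where
  "wf_graph g \<longleftrightarrow> wired g \<and> acyclic (steps g) \<and> connected_graph g"

definition corolla :: "'e vertex \<Rightarrow> 'e dgraph" where
  "corolla v = DGraph (outs v) (ins v) [v]
     ({(Ext q, Vtx 0 q) |q. q < ins v} \<union> {(Vtx 0 p, Ext p) |p. p < outs v})"

text \<open>
  Composites of not necessarily connected diagrams: in \<open>f \<cdot> g\<close> the diagram \<open>g\<close> is applied
  first, and \<open>f \<otimes> g = (f \<otimes> id) \<cdot> (id \<otimes> g)\<close>. In both cases the vertices of \<open>f\<close> come
  first, so that no sign is involved.
\<close>

fun shift_port :: "nat \<Rightarrow> nat \<Rightarrow> port \<Rightarrow> port" where
  "shift_port k a (Ext j) = Ext (a + j)"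
| "shift_port k a (Vtx i p) = Vtx (k + i) p"

definition vcomp :: "'e dgraph \<Rightarrow> 'e dgraph \<Rightarrow> 'e dgraph" (infixr \<open>\<cdot>\<close> 70) where
  "f \<cdot> g =
     (let G = map_prod (shift_port (length (verts f)) 0) (shift_port (length (verts f)) 0) ` edges g
      in DGraph (gout f) (gin g) (verts f @ verts g)
           ({(s, t) \<in> edges f. s \<notin> range Ext} \<union> {(s, t) \<in> G. t \<notin> range Ext} \<union>
            {(s, t). \<exists>j. (s, Ext j) \<in> G \<and> (Ext j, t) \<in> edges f}))"

definition hcomp :: "'e dgraph \<Rightarrow> 'e dgraph \<Rightarrow> 'e dgraph" (infixr \<open>\<otimes>\<close> 75) where
  "f \<otimes> g = DGraph (gout f + gout g) (gin f + gin g) (verts f @ verts g)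
     (edges f \<union> map_prod (shift_port (length (verts f)) (gin f))
                         (shift_port (length (verts f)) (gout f)) ` edges g)"

definition strands :: "nat \<Rightarrow> (nat \<Rightarrow> nat) \<Rightarrow> 'e dgraph" where
  "strands n \<sigma> = DGraph n n [] {(Ext i, Ext (\<sigma> i)) |i. i < n}"

abbreviation idd :: "'e dgraph" where "idd \<equiv> strands 1 id"
abbreviation tau :: "'e dgraph" where "tau \<equiv> strands 2 (\<lambda>i. 1 - i)"
abbreviation cyc :: "'e dgraph" where "cyc \<equiv> strands 3 (\<lambda>i. (i + 1) mod 3)"
abbreviation cyc_inv :: "'e dgraph" where "cyc_inv \<equiv> strands 3 (\<lambda>i. (i + 2) mod 3)"


section \<open>Substitution of graphs into the vertices of a graph\<close>

text \<open>
  \<open>JIn i q\<close> (resp. \<open>JOut i p\<close>) is the point where the \<open>q\<close>-th input (resp. \<open>p\<close>-th output)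
  of the \<open>i\<close>-th vertex of the outer graph is glued to the corresponding leg of the \<open>i\<close>-th
  inner graph. A wire of the result is a path through such points; paths through several of them
  arise when inner graphs are single strands.
\<close>

datatype junction = Src port | Tgt port | JIn nat nat | JOut nat nat

fun outer_src :: "port \<Rightarrow> junction" where
  "outer_src (Ext j) = Src (Ext j)"
| "outer_src (Vtx i p) = JOut i p"

fun outer_tgt :: "port \<Rightarrow> junction" where
  "outer_tgt (Ext j) = Tgt (Ext j)"
| "outer_tgt (Vtx i q) = JIn i q"

fun inner_src :: "nat \<Rightarrow> nat \<Rightarrow> port \<Rightarrow> junction" where
  "inner_src i k (Ext q) = JIn i q"
| "inner_src i k (Vtx j p) = Src (Vtx (k + j) p)"

fun inner_tgt :: "nat \<Rightarrow> nat \<Rightarrow> port \<Rightarrow> junction" where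
  "inner_tgt i k (Ext p) = JOut i p"
| "inner_tgt i k (Vtx j q) = Tgt (Vtx (k + j) q)"

definition junction_wires :: "'x dgraph \<Rightarrow> 'e dgraph list \<Rightarrow> (junction \<times> junction) set" where
  "junction_wires \<Gamma> gs =
     map_prod outer_src outer_tgt ` edges \<Gamma> \<union>
     (\<Union>i<length gs. let k = (\<Sum>j<i. length (verts (gs ! j)))
                    in map_prod (inner_src i k) (inner_tgt i k) ` edges (gs ! i))"

definition subst_graph :: "'x dgraph \<Rightarrow> 'e dgraph list \<Rightarrow> 'e dgraph" where
  "subst_graph \<Gamma> gs = DGraph (gout \<Gamma>) (gin \<Gamma>) (concat (map verts gs))
     {(s, t). (Src s, Tgt t) \<in> (junction_wires \<Gamma> gs)\<^sup>+}"

definition msubst :: "'x dgraph \<Rightarrow> ('e dgraph \<Rightarrow>\<^sub>0 'k::field) list \<Rightarrow> ('e dgraph \<Rightarrow>\<^sub>0 'k)" where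
  "msubst \<Gamma> xs = (\<Sum>gs\<in>listset (map keys xs).
     fscale (\<Prod>i<length xs. lookup (xs ! i) (gs ! i)) (basis (subst_graph \<Gamma> gs)))"


section \<open>Graded \<open>\<Sigma>\<close>-bimodules and free properads\<close>

text \<open>
  The component indexed by \<open>m n d\<close> has \<open>m\<close> outputs, \<open>n\<close> inputs and degree \<open>d\<close>. A
  permutation \<open>\<sigma>\<close> stands for the bundle of strands leading from position \<open>i\<close> to position
  \<open>\<sigma> i\<close>, and \<open>act \<sigma> \<tau> x\<close> is \<open>\<sigma> \<circ> x \<circ> \<tau>\<close>: a left action of \<open>\<sigma>\<close> and a right action of
  \<open>\<tau>\<close>.
\<close>

record ('k, 'a) sbimod =
  car :: "nat \<Rightarrow> nat \<Rightarrow> int \<Rightarrow> 'a set"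
  add :: "nat \<Rightarrow> nat \<Rightarrow> int \<Rightarrow> 'a \<Rightarrow> 'a \<Rightarrow> 'a"
  smul :: "nat \<Rightarrow> nat \<Rightarrow> int \<Rightarrow> 'k \<Rightarrow> 'a \<Rightarrow> 'a"
  act :: "nat \<Rightarrow> nat \<Rightarrow> int \<Rightarrow> (nat \<Rightarrow> nat) \<Rightarrow> (nat \<Rightarrow> nat) \<Rightarrow> 'a \<Rightarrow> 'a"

definition dgraphs :: "('k, 'e, 'z) sbimod_scheme \<Rightarrow> nat \<Rightarrow> nat \<Rightarrow> int \<Rightarrow> 'e dgraph set" where
  "dgraphs E m n d = {g. wf_graph g \<and> gout g = m \<and> gin g = n \<and> gdeg g = d \<and>
     (\<forall>v\<in>set (verts g). dec v \<in> car E (outs v) (ins v) (vdeg v))}"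

definition formal :: "('k::field, 'e, 'z) sbimod_scheme \<Rightarrow> nat \<Rightarrow> nat \<Rightarrow> int \<Rightarrow>
    ('e dgraph \<Rightarrow>\<^sub>0 'k) set" where
  "formal E m n d = {x. keys x \<subseteq> dgraphs E m n d}"

definition set_dec :: "'e dgraph \<Rightarrow> nat \<Rightarrow> 'e \<Rightarrow> 'e dgraph" where
  "set_dec g i e = DGraph (gout g) (gin g)
     ((verts g)[i := Vertex (outs (verts g ! i)) (ins (verts g ! i)) (vdeg (verts g ! i)) e]) (edges g)"

text \<open>The sign of the permutation \<open>\<pi>\<close> of homogeneous factors of degrees \<open>ds\<close>.\<close>

definition koszul :: "(nat \<Rightarrow> nat) \<Rightarrow> int list \<Rightarrow> 'k::field" where
  "koszul \<pi> ds = (\<Prod>(i, j)\<in>{(i, j). i < j \<and> j < length ds \<and> \<pi> j < \<pi> i}. parity_sign (ds ! i * ds ! j))"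

fun move_vertex :: "(nat \<Rightarrow> nat) \<Rightarrow> port \<Rightarrow> port" where
  "move_vertex \<pi> (Ext j) = Ext j"
| "move_vertex \<pi> (Vtx i p) = Vtx (\<pi> i) p"

definition permute_vertices :: "(nat \<Rightarrow> nat) \<Rightarrow> 'e dgraph \<Rightarrow> 'e dgraph" where
  "permute_vertices \<pi> g = DGraph (gout g) (gin g) (permute_list (inv \<pi>) (verts g))
     (map_prod (move_vertex \<pi>) (move_vertex \<pi>) ` edges g)"

fun move_port :: "nat \<Rightarrow> (nat \<Rightarrow> nat) \<Rightarrow> port \<Rightarrow> port" where
  "move_port i \<sigma> (Ext j) = Ext j"
| "move_port i \<sigma> (Vtx k p) = (if k = i then Vtx k (\<sigma> p) else Vtx k p)"

text \<open>Replaces the decoration \<open>e\<close> of the \<open>i\<close>-th vertex by \<open>\<sigma> \<circ> e \<circ> \<tau>\<close> and rewires.\<close>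

definition twist :: "('k, 'e, 'z) sbimod_scheme \<Rightarrow> nat \<Rightarrow> (nat \<Rightarrow> nat) \<Rightarrow> (nat \<Rightarrow> nat) \<Rightarrow>
    'e dgraph \<Rightarrow> 'e dgraph" where
  "twist E i \<sigma> \<tau> g =
     (let v = verts g ! i
      in DGraph (gout g) (gin g)
           (verts (set_dec g i (act E (outs v) (ins v) (vdeg v) \<sigma> \<tau> (dec v))))
           (map_prod (move_port i \<sigma>) (move_port i (inv \<tau>)) ` edges g))"

text \<open>
  The relations that turn formal combinations of decorated graphs into elements of the free
  properad: multilinearity in the decorations and invariance under isomorphisms of graphs.
\<close>

inductive graph_relator :: "('k::field, 'e, 'z) sbimod_scheme \<Rightarrow> nat \<Rightarrow> nat \<Rightarrow> int \<Rightarrow>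
    ('e dgraph \<Rightarrow>\<^sub>0 'k) \<Rightarrow> bool" for E m n d where
  additive: "\<lbrakk>g \<in> dgraphs E m n d; i < length (verts g); verts g ! i = Vertex a b k e\<^sub>0;
     e \<in> car E a b k; e' \<in> car E a b k\<rbrakk> \<Longrightarrow>
   graph_relator E m n d
     (basis (set_dec g i (add E a b k e e')) - basis (set_dec g i e) - basis (set_dec g i e'))"
| homogeneous: "\<lbrakk>g \<in> dgraphs E m n d; i < length (verts g); verts g ! i = Vertex a b k e\<^sub>0;
     e \<in> car E a b k\<rbrakk> \<Longrightarrow>
   graph_relator E m n d (basis (set_dec g i (smul E a b k c e)) - fscale c (basis (set_dec g i e)))"
| reorder: "\<lbrakk>g \<in> dgraphs E m n d; \<pi> permutes {..<length (verts g)}\<rbrakk> \<Longrightarrow>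
   graph_relator E m n d
     (basis g - fscale (koszul \<pi> (map vdeg (verts g))) (basis (permute_vertices \<pi> g)))"
| equivariant: "\<lbrakk>g \<in> dgraphs E m n d; i < length (verts g);
     \<sigma> permutes {..<outs (verts g ! i)}; \<tau> permutes {..<ins (verts g ! i)}\<rbrakk> \<Longrightarrow>
   graph_relator E m n d (basis (twist E i \<sigma> \<tau> g) - basis g)"

definition graph_rels :: "('k::field, 'e, 'z) sbimod_scheme \<Rightarrow> nat \<Rightarrow> nat \<Rightarrow> int \<Rightarrow>
    ('e dgraph \<Rightarrow>\<^sub>0 'k) set" where
  "graph_rels E m n d = fspace.span (Collect (graph_relator E m n d))"

text \<open>
  A dg properad is an algebra over the monad of connected directed acyclic graphs: \<open>ev\<close> evaluates
  a decorated graph. The strand without vertices evaluates to the identity operation.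
\<close>

record ('k, 'a) dg_properad = "('k, 'a) sbimod" +
  ev :: "'a dgraph \<Rightarrow> 'a"
  diff :: "nat \<Rightarrow> nat \<Rightarrow> int \<Rightarrow> 'a \<Rightarrow> 'a"

definition coset :: "('b \<Rightarrow>\<^sub>0 'k::field) set \<Rightarrow> ('b \<Rightarrow>\<^sub>0 'k) \<Rightarrow> ('b \<Rightarrow>\<^sub>0 'k) set" where
  "coset N x = {y. y - x \<in> N}"

fun move_ext :: "(nat \<Rightarrow> nat) \<Rightarrow> port \<Rightarrow> port" where
  "move_ext \<sigma> (Ext j) = Ext (\<sigma> j)"
| "move_ext \<sigma> (Vtx i p) = Vtx i p"

definition act_graph :: "(nat \<Rightarrow> nat) \<Rightarrow> (nat \<Rightarrow> nat) \<Rightarrow> 'e dgraph \<Rightarrow> 'e dgraph" where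
  "act_graph \<sigma> \<tau> g = DGraph (gout g) (gin g) (verts g)
     (map_prod (move_ext (inv \<tau>)) (move_ext \<sigma>) ` edges g)"

text \<open>
  The quotient of formal combinations of graphs by a family of subspaces \<open>N\<close>, which is to contain
  the relations above and to be closed under substitution. Its elements are cosets, and graphs
  decorated by cosets are evaluated by substituting representatives. The differential is zero.
\<close>

definition graph_quotient :: "('k::field, 'e, 'z) sbimod_scheme \<Rightarrow>
    (nat \<Rightarrow> nat \<Rightarrow> int \<Rightarrow> ('e dgraph \<Rightarrow>\<^sub>0 'k) set) \<Rightarrow>
    ('k, ('e dgraph \<Rightarrow>\<^sub>0 'k) set) dg_properad" where
  "graph_quotient E N = \<lparr>
     car = (\<lambda>m n d. coset (N m n d) ` formal E m n d),
     add = (\<lambda>m n d X Y. \<Union>x\<in>X. \<Union>y\<in>Y. coset (N m n d) (x + y)),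
     smul = (\<lambda>m n d c X. \<Union>x\<in>X. coset (N m n d) (fscale c x)),
     act = (\<lambda>m n d \<sigma> \<tau> X. \<Union>x\<in>X. coset (N m n d) (lin (\<lambda>g. basis (act_graph \<sigma> \<tau> g)) x)),
     ev = (\<lambda>\<Gamma>. \<Union>xs\<in>{xs. list_all2 (\<lambda>x v. x \<in> dec v) xs (verts \<Gamma>)}.
             coset (N (gout \<Gamma>) (gin \<Gamma>) (gdeg \<Gamma>)) (msubst \<Gamma> xs)),
     diff = (\<lambda>m n d X. N m n (d - 1))\<rparr>"

definition free_properad :: "('k::field, 'e, 'z) sbimod_scheme \<Rightarrow>
    ('k, ('e dgraph \<Rightarrow>\<^sub>0 'k) set) dg_properad" where
  "free_properad E = graph_quotient E (graph_rels E)"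

text \<open>The preimage, among formal combinations, of the ideal of the free properad generated by \<open>R\<close>.\<close>

inductive ideal :: "('k::field, 'e, 'z) sbimod_scheme \<Rightarrow> ('e dgraph \<Rightarrow>\<^sub>0 'k) set \<Rightarrow>
    nat \<Rightarrow> nat \<Rightarrow> int \<Rightarrow> ('e dgraph \<Rightarrow>\<^sub>0 'k) \<Rightarrow> bool" for E R where
  rel: "\<lbrakk>r \<in> R; r \<in> formal E m n d\<rbrakk> \<Longrightarrow> ideal E R m n d r"
| graph: "r \<in> graph_rels E m n d \<Longrightarrow> ideal E R m n d r"
| add: "\<lbrakk>ideal E R m n d x; ideal E R m n d y\<rbrakk> \<Longrightarrow> ideal E R m n d (x + y)"
| scale: "ideal E R m n d x \<Longrightarrow> ideal E R m n d (fscale c x)"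
| subst: "\<lbrakk>wf_graph (\<Gamma> :: unit dgraph);
     list_all2 (\<lambda>x v. x \<in> formal E (outs v) (ins v) (vdeg v)) xs (verts \<Gamma>);
     i < length xs; verts \<Gamma> ! i = Vertex a b k (); ideal E R a b k (xs ! i)\<rbrakk> \<Longrightarrow>
   ideal E R (gout \<Gamma>) (gin \<Gamma>) (gdeg \<Gamma>) (msubst \<Gamma> xs)"

definition presented_properad :: "('k::field, 'e, 'z) sbimod_scheme \<Rightarrow> ('e dgraph \<Rightarrow>\<^sub>0 'k) set \<Rightarrow>
    ('k, ('e dgraph \<Rightarrow>\<^sub>0 'k) set) dg_properad" where
  "presented_properad E R = graph_quotient E (\<lambda>m n d. Collect (ideal E R m n d))"

text \<open>The free \<open>\<Sigma>\<close>-bimodule on generators \<open>g\<close> with (outputs, inputs, degree) given by \<open>ar g\<close>;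
  the triple \<open>(\<sigma>, g, \<tau>)\<close> is \<open>\<sigma> \<circ> g \<circ> \<tau>\<close>.\<close>

type_synonym ('k, 'g) free_elt = "((nat \<Rightarrow> nat) \<times> 'g \<times> (nat \<Rightarrow> nat)) \<Rightarrow>\<^sub>0 'k"

definition free_sbimod :: "('g \<Rightarrow> nat \<times> nat \<times> int) \<Rightarrow> ('k::field, ('k, 'g) free_elt) sbimod" where
  "free_sbimod ar = \<lparr>
     car = (\<lambda>m n d. {x. keys x \<subseteq> {(\<sigma>, g, \<tau>). ar g = (m, n, d) \<and> \<sigma> permutes {..<m} \<and> \<tau> permutes {..<n}}}),
     add = (\<lambda>m n d. (+)),
     smul = (\<lambda>m n d. fscale),
     act = (\<lambda>m n d \<sigma> \<tau>. lin (\<lambda>(\<sigma>', g, \<tau>'). basis (\<sigma> \<circ> \<sigma>', g, \<tau>' \<circ> \<tau>)))\<rparr>"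

definition gen :: "('g \<Rightarrow> nat \<times> nat \<times> int) \<Rightarrow> 'g \<Rightarrow> ('k::field, 'g) free_elt dgraph" where
  "gen ar g = (case ar g of (m, n, d) \<Rightarrow> corolla (Vertex m n d (basis (id, g, id))))"


section \<open>Partial coproperads and the cobar construction\<close>

definition two_level :: "'e dgraph \<Rightarrow> bool" where
  "two_level g \<longleftrightarrow> wf_graph g \<and> length (verts g) = 2 \<and> steps g = {(1, 0)}"

text \<open>
  The cofree side is made of invariants: a two-vertex element is an equivariant family of tensors,
  one for each way of wiring two vertices with labelled legs, where the first vertex is the one
  applied last. Such a family is given by a formal combination of decorated two-level graphs, up
  to multilinearity in the decorations; \<open>decomp m n d x\<close> is the class of all formal combinations
  that represent the decomposition of \<open>x\<close>. The identity operation and its dual take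
  part in it: nothing is reduced.
\<close>

record (overloaded) ('k::zero, 'a) partial_coproperad = "('k, 'a) sbimod" +
  decomp :: "nat \<Rightarrow> nat \<Rightarrow> int \<Rightarrow> 'a \<Rightarrow> ('a dgraph \<Rightarrow>\<^sub>0 'k) set"

definition dual_sbimod :: "('k::field, 'a, 'z) sbimod_scheme \<Rightarrow> ('k, 'a \<Rightarrow> 'k) sbimod" where
  "dual_sbimod P = \<lparr>
     car = (\<lambda>m n d. {\<phi>. (\<forall>x. x \<notin> car P m n (- d) \<longrightarrow> \<phi> x = 0) \<and>
       (\<forall>x\<in>car P m n (- d). \<forall>y\<in>car P m n (- d). \<phi> (add P m n (- d) x y) = \<phi> x + \<phi> y) \<and>
       (\<forall>c. \<forall>x\<in>car P m n (- d). \<phi> (smul P m n (- d) c x) = c * \<phi> x)}),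
     add = (\<lambda>m n d \<phi> \<psi> x. \<phi> x + \<psi> x),
     smul = (\<lambda>m n d c \<phi> x. c * \<phi> x),
     act = (\<lambda>m n d \<sigma> \<tau> \<phi> x.
       if x \<in> car P m n (- d) then \<phi> (act P m n (- d) (inv \<sigma>) (inv \<tau>) x) else 0)\<rparr>"

text \<open>The pairing \<open>(\<phi> \<otimes> \<psi>) (x \<otimes> y) = (-1)\<^bsup>|\<psi>| |x|\<^esup> \<phi> x \<psi> y\<close> on each two-level shape.\<close>

definition pairing :: "('a \<Rightarrow> 'k::field) dgraph \<Rightarrow> 'a dgraph \<Rightarrow> 'k" where
  "pairing h g =
     (if edges h = edges g \<and>
         map (\<lambda>v. (outs v, ins v, vdeg v)) (verts h) = map (\<lambda>v. (outs v, ins v, - vdeg v)) (verts g)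
      then parity_sign (vdeg (verts h ! 1) * vdeg (verts g ! 0)) *
           dec (verts h ! 0) (dec (verts g ! 0)) * dec (verts h ! 1) (dec (verts g ! 1))
      else 0)"

text \<open>The decomposition of a functional \<open>\<phi>\<close> is \<open>\<phi>\<close> composed with the evaluation of two-level
  graphs. For the two properads below it is represented by finite sums: their components are finite
  dimensional, and composites along two or more wires vanish.\<close>

definition dual_coproperad :: "('k::field, 'a) dg_properad \<Rightarrow> ('k, 'a \<Rightarrow> 'k) partial_coproperad" where
  "dual_coproperad P = (let C = dual_sbimod P in \<lparr>
     car = car C, add = add C, smul = smul C, act = act C,
     decomp = (\<lambda>m n d \<phi>. {t. keys t \<subseteq> {h \<in> dgraphs C m n d. two_level h} \<and>
       (\<forall>g\<in>dgraphs P m n (- d). two_level g \<longrightarrow>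
          (\<Sum>h\<in>keys t. lookup t h * pairing h g) = \<phi> (ev P g))})\<rparr>)"

definition desusp :: "('k, 'a, 'z) sbimod_scheme \<Rightarrow> ('k, 'a) sbimod" where
  "desusp C = \<lparr>car = (\<lambda>m n d. car C m n (d + 1)), add = (\<lambda>m n d. add C m n (d + 1)),
     smul = (\<lambda>m n d. smul C m n (d + 1)), act = (\<lambda>m n d. act C m n (d + 1))\<rparr>"

text \<open>
  Applies \<open>s\<inverse> \<otimes> s\<inverse>\<close>, with its Koszul sign, and passes from the family of tensors to
  a sum over isomorphism classes of two-level graphs weighted by the inverses of the orders of the
  automorphism groups: a class with automorphism group \<open>A\<close> has as many labelled members as the
  product of factorials below divided by \<open>|A|\<close>.
\<close>

definition desusp_two :: "'a dgraph \<Rightarrow> ('a dgraph \<Rightarrow>\<^sub>0 'k::field_char_0)" where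
  "desusp_two h = fscale
     (parity_sign (vdeg (verts h ! 0)) / (\<Prod>v\<leftarrow>verts h. fact (outs v) * fact (ins v)))
     (basis (DGraph (gout h) (gin h)
       (map (\<lambda>v. Vertex (outs v) (ins v) (vdeg v - 1) (dec v)) (verts h)) (edges h)))"

text \<open>The derivation of degree \<open>-1\<close> that replaces a vertex \<open>v\<close> by \<open>\<delta> v\<close>.\<close>

definition deriv_graph :: "('e vertex \<Rightarrow> ('e dgraph \<Rightarrow>\<^sub>0 'k::field)) \<Rightarrow> 'e dgraph \<Rightarrow> ('e dgraph \<Rightarrow>\<^sub>0 'k)" where
  "deriv_graph \<delta> g = (\<Sum>i<length (verts g).
     fscale (parity_sign (\<Sum>j<i. vdeg (verts g ! j)))
       (msubst g ((map (\<lambda>v. basis (corolla v)) (verts g))[i := \<delta> (verts g ! i)])))"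

definition cobar :: "('k::field_char_0, 'a) partial_coproperad \<Rightarrow>
    ('k, ('a dgraph \<Rightarrow>\<^sub>0 'k) set) dg_properad" where
  "cobar C = (free_properad (desusp C))\<lparr>diff := (\<lambda>m n d X.
     \<Union>{coset (graph_rels (desusp C) m n (d - 1)) (lin (deriv_graph \<delta>) x) |x \<delta>.
        x \<in> X \<and> (\<forall>g\<in>keys x. \<forall>v\<in>set (verts g).
          \<delta> v \<in> lin desusp_two ` decomp C (outs v) (ins v) (vdeg v + 1) (dec v))})\<rparr>"


section \<open>Isomorphisms of dg properads\<close>

definition map_decs :: "(nat \<Rightarrow> nat \<Rightarrow> int \<Rightarrow> 'a \<Rightarrow> 'b) \<Rightarrow> 'a dgraph \<Rightarrow> 'b dgraph" where
  "map_decs f g = DGraph (gout g) (gin g)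
     (map (\<lambda>v. Vertex (outs v) (ins v) (vdeg v) (f (outs v) (ins v) (vdeg v) (dec v))) (verts g))
     (edges g)"

definition dg_properad_iso :: "('k, 'a) dg_properad \<Rightarrow> ('k, 'b) dg_properad \<Rightarrow>
    (nat \<Rightarrow> nat \<Rightarrow> int \<Rightarrow> 'a \<Rightarrow> 'b) \<Rightarrow> bool" where
  "dg_properad_iso P Q f \<longleftrightarrow> (\<forall>m n d.
     bij_betw (f m n d) (car P m n d) (car Q m n d) \<and>
     (\<forall>x\<in>car P m n d. \<forall>y\<in>car P m n d.
        f m n d (add P m n d x y) = add Q m n d (f m n d x) (f m n d y)) \<and>
     (\<forall>c. \<forall>x\<in>car P m n d. f m n d (smul P m n d c x) = smul Q m n d c (f m n d x)) \<and>
     (\<forall>\<sigma> \<tau>. \<forall>x\<in>car P m n d. \<sigma> permutes {..<m} \<longrightarrow> \<tau> permutes {..<n} \<longrightarrow>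
        f m n d (act P m n d \<sigma> \<tau> x) = act Q m n d \<sigma> \<tau> (f m n d x)) \<and>
     (\<forall>g\<in>dgraphs P m n d. f m n d (ev P g) = ev Q (map_decs f g)) \<and>
     (\<forall>x\<in>car P m n d. f m n (d - 1) (diff P m n d x) = diff Q m n d (f m n d x)))"


section \<open>Balanced infinitesimal bialgebras and double Poisson gebras\<close>

datatype bib_gen = BU | BM | BDelta

fun bib_arity :: "bib_gen \<Rightarrow> nat \<times> nat \<times> int" where
  "bib_arity BU = (1, 0, 1)"
| "bib_arity BM = (1, 2, -1)"
| "bib_arity BDelta = (2, 1, 0)"

definition bib_rels :: "(('k::field, bib_gen) free_elt dgraph \<Rightarrow>\<^sub>0 'k) set" where
  "bib_rels =
     (let u = gen bib_arity BU; m = gen bib_arity BM; \<Delta> = gen bib_arity BDelta;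
          B = (idd \<otimes> m) \<cdot> (tau \<otimes> idd) \<cdot> (idd \<otimes> \<Delta>);
          D = (m \<otimes> idd) \<cdot> (idd \<otimes> tau) \<cdot> (\<Delta> \<otimes> idd)
      in {basis (m \<cdot> (idd \<otimes> m)) + basis (m \<cdot> (m \<otimes> idd)),
          basis ((idd \<otimes> \<Delta>) \<cdot> \<Delta>) - basis ((\<Delta> \<otimes> idd) \<cdot> \<Delta>),
          - basis (\<Delta> \<cdot> m) + basis ((m \<otimes> idd) \<cdot> (idd \<otimes> \<Delta>)),
          - basis (\<Delta> \<cdot> m) + basis ((idd \<otimes> m) \<cdot> (\<Delta> \<otimes> idd)),
          basis B + basis (tau \<cdot> B \<cdot> tau),
          basis B + basis (D \<cdot> tau),
          basis (m \<cdot> \<Delta>),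
          basis (m \<cdot> tau \<cdot> \<Delta>),
          basis (m \<cdot> (u \<otimes> idd)) + basis idd,
          basis (m \<cdot> (idd \<otimes> u)) - basis idd})"

definition uBIB :: "('k::field, _) dg_properad" where
  "uBIB = presented_properad (free_sbimod bib_arity) bib_rels"

text \<open>The generator \<open>w\<close> with \<open>\<tau> w \<tau> = - w\<close> is a free generator subject to one more relation.\<close>

datatype dpois_gen = PU | PM | PW

fun dpois_arity :: "dpois_gen \<Rightarrow> nat \<times> nat \<times> int" where
  "dpois_arity PU = (1, 0, 1)"
| "dpois_arity PM = (1, 2, -1)"
| "dpois_arity PW = (2, 2, -1)"

definition dpois_rels :: "(('k::field, dpois_gen) free_elt dgraph \<Rightarrow>\<^sub>0 'k) set" where
  "dpois_rels =
     (let u = gen dpois_arity PU; m = gen dpois_arity PM; w = gen dpois_arity PW;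
          ww = (w \<otimes> idd) \<cdot> (idd \<otimes> w)
      in {basis (tau \<cdot> w \<cdot> tau) + basis w,
          basis (m \<cdot> (idd \<otimes> m)) + basis (m \<cdot> (m \<otimes> idd)),
          basis (m \<cdot> (u \<otimes> idd)) + basis idd,
          basis (m \<cdot> (idd \<otimes> u)) - basis idd,
          basis ((m \<otimes> idd) \<cdot> (idd \<otimes> w)) + basis (w \<cdot> (idd \<otimes> m) \<cdot> (tau \<otimes> idd)),
          basis ((m \<otimes> idd) \<cdot> (idd \<otimes> tau) \<cdot> (w \<otimes> idd)) + basis (w \<cdot> (m \<otimes> idd) \<cdot> (idd \<otimes> tau)),
          basis ww - basis (cyc_inv \<cdot> ww \<cdot> cyc),
          basis (m \<cdot> w),
          basis (w \<cdot> w)})"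

definition uDPois :: "('k::field, _) dg_properad" where
  "uDPois = presented_properad (free_sbimod dpois_arity) dpois_rels"

definition cBIB_inf :: "('k::field_char_0, _) dg_properad" where
  "cBIB_inf = cobar (dual_coproperad uBIB)"

definition cDPois_inf :: "('k::field_char_0, _) dg_properad" where
  "cDPois_inf = cobar (dual_coproperad uDPois)"

end

theory Submission
  imports Defs
begin

text \<open>
  The two unital properads are already isomorphic before dualization. The morphism from \<open>uDPois\<close> to
  \<open>uBIB\<close> sends the bracket \<open>w\<close> to \<open>B = (id \<otimes> m) (\<tau> \<otimes> id) (id \<otimes> \<Delta>)\<close>, and the one back sends the
  coproduct \<open>\<Delta>\<close> to \<open>- w (u \<otimes> id)\<close>; the unit \<open>u\<close> and the product \<open>m\<close> are kept. It is the unit relations that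
  make these assignments inverse to each other: inserting \<open>u\<close> into the first input of \<open>B\<close> leaves
  \<open>- \<Delta>\<close>, because \<open>m (u \<otimes> id) = - id\<close>, and conversely the derivation rule for \<open>w\<close> pulls the factor
  \<open>m\<close> of \<open>B\<close> through \<open>w\<close> until it meets the unit (\<open>dpois_mult_unit\<close>, \<open>bib_comult_recovered\<close>). It
  remains that each assignment respects the relations. Under this dictionary \<open>B + \<tau> B \<tau>\<close> is the
  antisymmetry of \<open>w\<close>, the compatibility of \<open>\<Delta>\<close> with \<open>m\<close> is the derivation rule, the cyclic relation
  for \<open>w\<close> is coassociativity, and the vanishing composites correspond to each other up to
  associativity (\<open>hom_bib_to_dpois_relation\<close>, \<open>hom_dpois_to_bib_relation\<close>).

  The remaining two operations, the dual partial coproperad and the cobar construction, depend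
  functorially on an isomorphism and involve no further choice: a pair of mutually inverse
  morphisms of properads transposes to mutually inverse maps of the dual coproperads
  (\<open>coproperad_map_dual\<close>), and such a pair acts on decorated graphs vertex by vertex
  (\<open>cobar_iso\<close>).

  What needs care is that a map given on generators extends to the concrete quotient of formal
  combinations of decorated graphs. This rests on the associativity of substitution of graphs and on
  its compatibility with the symmetric groups and with Koszul signs
  (\<open>subst_graph_assoc\<close>, \<open>subst_permute_vertices\<close>, \<open>subst_twist\<close>, \<open>koszul_block\<close>), which give
  \<open>hom_msubst\<close> and \<open>hom_ideal\<close>. The geometric arguments are replaced by labels. The wires
  of a wired graph form a bijection from sources to targets, so two graphs on the same vertices are
  equal as soon as the wires of one are among those of the other, and this is witnessed by a
  label on ports that is constant along the wires of the first graph and tells those of the second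
  apart (\<open>wired_label_eq\<close>). A label on the ports of a composite graph
  extends to all the junctions inside (\<open>extend_labels\<close>), and so can be carried from one description
  of a composite to another. Connectivity has the same form: it says that
  a two-colouring which is constant along wires and on vertices is constant.

  Labels by natural numbers also give the calculus in which the relations are compared. A diagram is
  a list of generators with named wires, composition identifies names, and an equation may be applied
  inside any larger diagram after renaming its wires (\<open>eqn_context\<close>).
\<close>


section \<open>Linear and multilinear extension\<close>

lemma lin_superset:
  assumes "finite S" "keys x \<subseteq> S"
  shows "lin f x = (\<Sum>a\<in>S. fscale (lookup x a) (f a))"
  unfolding lin_def using assms
  by (intro sum.mono_neutral_left) (auto simp: in_keys_iff)

lemma lin_zero [simp]: "lin f 0 = 0"
  by (simp add: lin_def)

lemma lin_basis [simp]: "lin f (basis a) = f a"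
  by (simp add: lin_def)

lemma lin_add: "lin f (x + y) = lin f x + lin f y"
proof -
  let ?S = "keys x \<union> keys y"
  have "keys (x + y) \<subseteq> ?S" by (rule keys_add)
  then show ?thesis
    by (simp add: lin_superset[of ?S] lookup_add fspace.scale_left_distrib sum.distrib)
qed

lemma lin_fscale: "lin f (fscale c x) = fscale c (lin f x)"
proof -
  have "keys (fscale c x) \<subseteq> keys x" by (auto simp: in_keys_iff)
  then show ?thesis
    by (simp add: lin_superset[of "keys x"] fspace.scale_sum_right)
qed

lemma lin_uminus: "lin f (- x) = - lin f x"
  using lin_fscale[of f "- 1" x] by simp

lemma lin_diff: "lin f (x - y) = lin f x - lin f y"
  using lin_add[of f x "- y"] by (simp add: lin_uminus)

lemma lin_sum: "lin f (sum h A) = (\<Sum>a\<in>A. lin f (h a))"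
  by (induction A rule: infinite_finite_induct) (auto simp: lin_add)

lemma lin_cong: "(\<And>a. a \<in> keys x \<Longrightarrow> f a = g a) \<Longrightarrow> lin f x = lin g x"
  by (simp add: lin_def)

lemma lin_lin: "lin f (lin g x) = lin (\<lambda>a. lin f (g a)) x"
  by (simp add: lin_def[of g] lin_def[of "\<lambda>a. lin f (g a)"] lin_sum lin_fscale)

lemma lin_swap: "lin (\<lambda>a. lin (\<lambda>b. h a b) y) x = lin (\<lambda>b. lin (\<lambda>a. h a b) x) y"
  unfolding lin_def fspace.scale_sum_right
  by (subst sum.swap) (simp add: mult.commute)

lemma lin_basis_id: "lin basis x = x"
  by (rule poly_mapping_eqI)
     (simp add: lin_def lookup_sum lookup_single when_def in_keys_iff if_distrib cong: if_cong)

lemma lin_fun_scale: "lin (\<lambda>a. fscale c (f a)) x = fscale c (lin f x)"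
  by (simp add: lin_def fspace.scale_sum_right mult.commute)

lemma lin_closed:
  assumes "0 \<in> S" "\<And>x y. x \<in> S \<Longrightarrow> y \<in> S \<Longrightarrow> x + y \<in> S" "\<And>c x. x \<in> S \<Longrightarrow> fscale c x \<in> S"
    and "\<And>a. a \<in> keys x \<Longrightarrow> f a \<in> S"
  shows "lin f x \<in> S"
proof -
  have "finite A \<Longrightarrow> A \<subseteq> keys x \<Longrightarrow> (\<Sum>a\<in>A. fscale (lookup x a) (f a)) \<in> S" for A
    by (induction A rule: finite_induct) (use assms in auto)
  then show ?thesis by (simp add: lin_def)
qed

lemma keys_lin: "keys (lin f x) \<subseteq> (\<Union>a\<in>keys x. keys (f a))"
proof -
  have "lin f x \<in> {y. keys y \<subseteq> (\<Union>a\<in>keys x. keys (f a))}"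
  proof (rule lin_closed)
    show "x + y \<in> {y. keys y \<subseteq> (\<Union>a\<in>keys z. keys (f a))}"
      if "x \<in> {y. keys y \<subseteq> (\<Union>a\<in>keys z. keys (f a))}" "y \<in> {y. keys y \<subseteq> (\<Union>a\<in>keys z. keys (f a))}" for x y z
      using that keys_add[of x y] by blast
  qed (auto simp: in_keys_iff)
  then show ?thesis by simp
qed

text \<open>
  \<open>mext f\<close> is the multilinear extension of \<open>f\<close>; its recursive form makes multilinearity and
  the composition laws inductions on the list of arguments.
\<close>

fun mext :: "('a list \<Rightarrow> ('b \<Rightarrow>\<^sub>0 'k::field)) \<Rightarrow> ('a \<Rightarrow>\<^sub>0 'k) list \<Rightarrow> ('b \<Rightarrow>\<^sub>0 'k)" where
  "mext f [] = f []"
| "mext f (x # xs) = lin (\<lambda>a. mext (\<lambda>as. f (a # as)) xs) x"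

lemma mext_cong:
  assumes "\<And>as. list_all2 (\<lambda>a x. a \<in> keys x) as xs \<Longrightarrow> f as = g as"
  shows "mext f xs = mext g xs"
  using assms
proof (induction xs arbitrary: f g)
  case (Cons x xs)
  have "mext (\<lambda>as. f (a # as)) xs = mext (\<lambda>as. g (a # as)) xs" if "a \<in> keys x" for a
    by (rule Cons.IH) (use that in \<open>auto intro: Cons.prems\<close>)
  then show ?case by (simp cong: lin_cong)
qed simp

lemma mext_append: "mext f (xs @ ys) = mext (\<lambda>as. mext (\<lambda>bs. f (as @ bs)) ys) xs"
  by (induction xs arbitrary: f) auto

lemma mext_basis: "mext f (map basis as) = f as"
  by (induction as arbitrary: f) auto

lemma lin_mext: "lin h (mext f xs) = mext (\<lambda>as. lin h (f as)) xs"
  by (induction xs arbitrary: f) (auto simp: lin_lin)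

lemma mext_lin_swap: "mext (\<lambda>as. lin (\<lambda>b. h as b) y) xs = lin (\<lambda>b. mext (\<lambda>as. h as b) xs) y"
proof (induction xs arbitrary: h)
  case (Cons x xs)
  show ?case by (simp add: Cons) (rule lin_swap)
qed auto

lemma mext_slot: "mext f (xs @ x # ys) = lin (\<lambda>a. mext f (xs @ basis a # ys)) x"
  by (simp add: mext_append mext_lin_swap)

lemma mext_fscale: "mext f (xs @ fscale c x # ys) = fscale c (mext f (xs @ x # ys))"
  by (simp add: mext_slot[of f xs "fscale c x"] mext_slot[of f xs x] lin_fscale)

lemma mext_add: "mext f (xs @ (x + y) # ys) = mext f (xs @ x # ys) + mext f (xs @ y # ys)"
  by (simp add: mext_slot[of f xs "x + y"] mext_slot[of f xs x] mext_slot[of f xs y] lin_add)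

lemma mext_diff: "mext f (xs @ (x - y) # ys) = mext f (xs @ x # ys) - mext f (xs @ y # ys)"
  by (simp add: mext_slot[of f xs "x - y"] mext_slot[of f xs x] mext_slot[of f xs y] lin_diff)

lemma mext_map_lin: "mext f (map (lin h) xs) = mext (\<lambda>as. mext f (map h as)) xs"
  by (induction xs arbitrary: f) (auto simp: lin_lin lin_mext mext_lin_swap)

text \<open>Nested multilinear extensions collapse. This turns the associativity of an operation on lists of
  basis elements, here of the substitution of graphs, into that of its multilinear extension.\<close>

lemma mext_mext:
  assumes "length xss = length ks"
    and "\<And>hss. list_all2 (list_all2 (\<lambda>a x. a \<in> keys x)) hss xss \<Longrightarrow>
           f' (concat hss) = mext f (map2 h ks hss)"
  shows "mext f' (concat xss) = mext f (map2 (\<lambda>k xs. mext (h k) xs) ks xss)"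
  using assms
proof (induction xss ks arbitrary: f f' rule: list_induct2)
  case Nil
  then show ?case using Nil(1)[of "[]"] by simp
next
  case (Cons xs xss k ks)
  have "mext f' (concat (xs # xss)) = mext (\<lambda>as. mext (\<lambda>bs. f' (as @ bs)) (concat xss)) xs"
    by (simp add: mext_append)
  also have "\<dots> = mext (\<lambda>as. lin (\<lambda>b. mext (\<lambda>bs. f (b # bs))
                    (map2 (\<lambda>k xs. mext (h k) xs) ks xss)) (h k as)) xs"
  proof (rule mext_cong)
    fix as assume as: "list_all2 (\<lambda>a x. a \<in> keys x) as xs"
    have "mext (\<lambda>bs. f' (as @ bs)) (concat xss) =
        mext (\<lambda>cs. lin (\<lambda>b. f (b # cs)) (h k as)) (map2 (\<lambda>k xs. mext (h k) xs) ks xss)"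
    proof (rule Cons.IH)
      fix hss assume "list_all2 (list_all2 (\<lambda>a x. a \<in> keys x)) hss xss"
      then show "f' (as @ concat hss) = mext (\<lambda>cs. lin (\<lambda>b. f (b # cs)) (h k as)) (map2 h ks hss)"
        using as Cons.prems[of "as # hss"] by (simp add: mext_lin_swap)
    qed
    then show "mext (\<lambda>bs. f' (as @ bs)) (concat xss) = lin (\<lambda>b. mext (\<lambda>bs. f (b # bs))
                    (map2 (\<lambda>k xs. mext (h k) xs) ks xss)) (h k as)"
      by (simp add: mext_lin_swap)
  qed
  finally show ?case by (simp add: lin_mext)
qed

lemma mext_closed:
  assumes "0 \<in> S" "\<And>x y. x \<in> S \<Longrightarrow> y \<in> S \<Longrightarrow> x + y \<in> S" "\<And>c x. x \<in> S \<Longrightarrow> fscale c x \<in> S"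
    and "\<And>as. list_all2 (\<lambda>a x. a \<in> keys x) as xs \<Longrightarrow> f as \<in> S"
  shows "mext f xs \<in> S"
  using assms(4)
proof (induction xs arbitrary: f)
  case (Cons x xs)
  then show ?case by (auto intro!: lin_closed assms(1-3))
qed auto

lemma listset_iff: "as \<in> listset As \<longleftrightarrow> list_all2 (\<in>) as As"
  by (induction As arbitrary: as) (auto simp: set_Cons_def list_all2_Cons2)

lemma mext_sum:
  "mext f xs = (\<Sum>as\<in>listset (map keys xs). fscale (\<Prod>i<length xs. lookup (xs ! i) (as ! i)) (f as))"
proof (induction xs arbitrary: f)
  case (Cons x xs)
  let ?c = "\<lambda>xs as. \<Prod>i<length xs. lookup (xs ! i) (as ! i)"
  have eq: "listset (map keys (x # xs)) = (\<lambda>(a, as). a # as) ` (keys x \<times> listset (map keys xs))"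
    by (auto simp: set_Cons_def)
  have inj: "inj_on (\<lambda>(a, as). a # as) (keys x \<times> listset (map keys xs))"
    by (auto simp: inj_on_def)
  have c: "?c (x # xs) (a # as) = lookup x a * ?c xs as" for a as
    by (simp add: prod.lessThan_Suc_shift del: prod.lessThan_Suc)
  have "(\<Sum>as\<in>listset (map keys (x # xs)). fscale (?c (x # xs) as) (f as)) =
      (\<Sum>(a, as)\<in>keys x \<times> listset (map keys xs). fscale (lookup x a * ?c xs as) (f (a # as)))"
    unfolding eq by (subst sum.reindex[OF inj]) (simp only: o_def case_prod_unfold fst_conv snd_conv c)
  also have "\<dots> = (\<Sum>a\<in>keys x. \<Sum>as\<in>listset (map keys xs). fscale (lookup x a * ?c xs as) (f (a # as)))"
    by (simp add: sum.cartesian_product)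
  also have "\<dots> = lin (\<lambda>a. mext (\<lambda>as. f (a # as)) xs) x"
    by (simp add: lin_def Cons.IH fspace.scale_sum_right)
  finally show ?case by simp
qed simp

lemma msubst_mext: "msubst \<Gamma> xs = mext (\<lambda>gs. basis (subst_graph \<Gamma> gs)) xs"
  by (simp add: msubst_def mext_sum)

lemma mext_permute:
  fixes xs :: "('a \<Rightarrow>\<^sub>0 'k::field) list"
  assumes \<pi>: "\<pi> permutes {..<length xs}"
  shows "mext f (permute_list \<pi> xs) = mext (\<lambda>as. f (permute_list \<pi> as)) xs"
proof -
  let ?n = "length xs"
  have ip: "inv \<pi> permutes {..<?n}" using \<pi> by (rule permutes_inv)
  have nth: "i < ?n \<Longrightarrow> \<pi> i < ?n" for i using permutes_in_image[OF \<pi>, of i] by simp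
  have nthi: "i < ?n \<Longrightarrow> inv \<pi> i < ?n" for i using permutes_in_image[OF ip, of i] by simp
  have len: "length as = ?n" if "as \<in> listset (map keys xs)" for as
    using that by (auto simp: listset_iff dest: list_all2_lengthD)
  have mem: "as \<in> listset (map keys ys) \<longleftrightarrow> length as = length ys \<and> (\<forall>i<length ys. as ! i \<in> keys (ys ! i))"
    for as and ys :: "('a \<Rightarrow>\<^sub>0 'k) list"
    by (auto simp: listset_iff list_all2_conv_all_nth)
  have fwd: "permute_list \<pi> as \<in> listset (map keys (permute_list \<pi> xs))" if "as \<in> listset (map keys xs)" for as
    using that \<pi> nth by (auto simp: mem permute_list_nth)
  have bwd: "permute_list (inv \<pi>) as \<in> listset (map keys xs)"
    if "as \<in> listset (map keys (permute_list \<pi> xs))" for as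
  proof -
    from that have l: "length as = ?n" and k: "i < ?n \<Longrightarrow> as ! i \<in> keys (xs ! \<pi> i)" for i
      using \<pi> by (auto simp: mem permute_list_nth)
    have "permute_list (inv \<pi>) as ! i \<in> keys (xs ! i)" if "i < ?n" for i
      using k[OF nthi[OF that]] that l ip \<pi> by (simp add: permute_list_nth permutes_inverses)
    then show ?thesis using l by (simp add: mem)
  qed
  have inv1: "permute_list (inv \<pi>) (permute_list \<pi> as) = as" if "length as = ?n" for as :: "'a list"
    using that \<pi> ip nthi by (intro nth_equalityI) (auto simp: permute_list_nth permutes_inverses)
  have inv2: "permute_list \<pi> (permute_list (inv \<pi>) as) = as" if "length as = ?n" for as :: "'a list"
    using that \<pi> ip nth by (intro nth_equalityI) (auto simp: permute_list_nth permutes_inverses)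
  have len2: "length as = ?n" if "as \<in> listset (map keys (permute_list \<pi> xs))" for as
    using that by (auto simp: mem)
  have pr: "(\<Prod>i<?n. lookup (xs ! i) (as ! i)) =
      (\<Prod>i<?n. lookup (permute_list \<pi> xs ! i) (permute_list \<pi> as ! i))" if "length as = ?n" for as
  proof -
    have "(\<Prod>i<?n. lookup (xs ! i) (as ! i)) = (\<Prod>i<?n. lookup (xs ! \<pi> i) (as ! \<pi> i))"
      using prod.permute[OF \<pi>, of "\<lambda>i. lookup (xs ! i) (as ! i)"] by (simp add: o_def)
    then show ?thesis using \<pi> that by (simp add: permute_list_nth)
  qed
  show ?thesis unfolding mext_sum
    by (rule sum.reindex_bij_witness[of _ "permute_list \<pi>" "permute_list (inv \<pi>)"])
       (use fwd bwd inv1 inv2 len len2 pr in auto)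
qed

section \<open>Labelled wires\<close>

text \<open>The label of a wire can be read off at its source and at its target. A graph is compared with
  another one through such labels; boundedness and totality of its edges are the parts of being wired
  that this comparison uses.\<close>

definition labelled :: "'e dgraph \<Rightarrow> (port \<Rightarrow> 'w) \<Rightarrow> (port \<Rightarrow> 'w) \<Rightarrow> bool" where
  "labelled g a b \<longleftrightarrow> (\<forall>(s, t)\<in>edges g. a s = b t)"

definition bounded_edges :: "'e dgraph \<Rightarrow> bool" where
  "bounded_edges g \<longleftrightarrow> edges g \<subseteq> sources g \<times> targets g"

definition total_edges :: "'e dgraph \<Rightarrow> bool" where
  "total_edges g \<longleftrightarrow> (\<forall>s\<in>sources g. \<exists>t. (s, t) \<in> edges g)"

lemma wired_bounded: "wired g \<Longrightarrow> bounded_edges g"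
  and wired_total: "wired g \<Longrightarrow> total_edges g"
  by (auto simp: wired_def bounded_edges_def total_edges_def)

lemma labelledD: "labelled g a b \<Longrightarrow> (s, t) \<in> edges g \<Longrightarrow> a s = b t"
  by (auto simp: labelled_def)

lemma boundedD:
  assumes "bounded_edges g" "(s, t) \<in> edges g"
  shows "s \<in> sources g" "t \<in> targets g"
  using assms by (auto simp: bounded_edges_def)

lemma in_sources [simp]:
  "Ext j \<in> sources g \<longleftrightarrow> j < gin g"
  "Vtx i p \<in> sources g \<longleftrightarrow> i < length (verts g) \<and> p < outs (verts g ! i)"
  by (auto simp: sources_def)

lemma in_targets [simp]:
  "Ext j \<in> targets g \<longleftrightarrow> j < gout g"
  "Vtx i p \<in> targets g \<longleftrightarrow> i < length (verts g) \<and> p < ins (verts g ! i)"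
  by (auto simp: targets_def)

lemma finite_sources: "finite (sources g)"
proof -
  have "sources g \<subseteq> Ext ` {..<gin g} \<union> (\<Union>i<length (verts g). Vtx i ` {..<outs (verts g ! i)})"
    by (auto simp: sources_def)
  then show ?thesis by (rule finite_subset) auto
qed

lemma finite_targets: "finite (targets g)"
proof -
  have "targets g \<subseteq> Ext ` {..<gout g} \<union> (\<Union>i<length (verts g). Vtx i ` {..<ins (verts g ! i)})"
    by (auto simp: targets_def)
  then show ?thesis by (rule finite_subset) auto
qed

lemma finite_edges: "bounded_edges g \<Longrightarrow> finite (edges g)"
  unfolding bounded_edges_def
  by (rule finite_subset[of _ "sources g \<times> targets g"]) (simp_all add: finite_sources finite_targets)

text \<open>
  Wires of a wired graph form a bijection, so an inclusion of wires is an equality. This is what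
  reduces identities between graphs to the construction of labels.
\<close>

lemma wired_subset_eq:
  assumes "wired h" "total_edges g" "edges g \<subseteq> edges h"
    and eq: "gout g = gout h" "gin g = gin h" "verts g = verts h"
  shows "g = h"
proof -
  have "edges h \<subseteq> edges g"
  proof clarify
    fix s t assume st: "(s, t) \<in> edges h"
    have src: "sources g = sources h" using eq by (simp add: sources_def)
    then have "s \<in> sources g" using st assms(1) by (auto simp: wired_def)
    then obtain t' where "(s, t') \<in> edges g" using assms(2) by (auto simp: total_edges_def)
    moreover have "t' = t"
      using calculation st assms(1,3) \<open>s \<in> sources g\<close> src unfolding wired_def by blast
    ultimately show "(s, t) \<in> edges g" by simp
  qed
  then show ?thesis using assms by (cases g; cases h) auto
qed

text \<open>The labels by which a wired graph is determined: every source is named after its target.\<close>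

definition end_of :: "'e dgraph \<Rightarrow> port \<Rightarrow> port" where
  "end_of g s = (THE t. (s, t) \<in> edges g)"

lemma end_of_eq: "wired g \<Longrightarrow> (s, t) \<in> edges g \<Longrightarrow> end_of g s = t"
  unfolding end_of_def wired_def by (rule the_equality) blast+

lemma labelled_end_of: "wired g \<Longrightarrow> labelled g (end_of g) id"
  by (auto simp: labelled_def end_of_eq)

text \<open>The criterion by which identities between composite graphs are proved: \<open>g\<close> carries labels that pair a
  source with a target only if they are joined in \<open>h\<close>.\<close>

lemma wired_label_eq:
  assumes h: "wired h" and g: "total_edges g" "bounded_edges g"
    and l: "labelled g a b"
    and ab: "\<And>s t. s \<in> sources h \<Longrightarrow> t \<in> targets h \<Longrightarrow> a s = b t \<Longrightarrow> (s, t) \<in> edges h"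
    and eq: "gout g = gout h" "gin g = gin h" "verts g = verts h"
  shows "g = h"
proof (rule wired_subset_eq[OF h g(1) _ eq])
  have st: "sources g = sources h" "targets g = targets h" using eq by (simp_all add: sources_def targets_def)
  show "edges g \<subseteq> edges h"
    using g(2) l ab unfolding st bounded_edges_def labelled_def st by blast
qed

section \<open>Positions in a concatenation\<close>

fun block :: "nat list \<Rightarrow> nat \<Rightarrow> nat \<times> nat" where
  "block [] k = (0, k)"
| "block (l # ls) k = (if k < l then (0, k) else map_prod Suc id (block ls (k - l)))"

lemma block_sum:
  "i < length ls \<Longrightarrow> j < ls ! i \<Longrightarrow> block ls (sum_list (take i ls) + j) = (i, j)"
proof (induction ls arbitrary: i)
  case (Cons l ls)
  then show ?case by (cases i) auto
qed simp

lemma block_cases: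
  fixes ls :: "nat list"
  assumes "k < sum_list ls"
  obtains i j where "i < length ls" "j < ls ! i" "k = sum_list (take i ls) + j"
  using assms
proof (induction ls arbitrary: k thesis)
  case (Cons l ls)
  show ?case
  proof (cases "k < l")
    case True
    then show ?thesis using Cons.prems(1)[of 0 k] by simp
  next
    case False
    then have "k - l < sum_list ls" using Cons.prems(2) by simp
    then obtain i j where "i < length ls" "j < ls ! i" "k - l = sum_list (take i ls) + j"
      using Cons.IH by blast
    then show ?thesis using Cons.prems(1)[of "Suc i" j] False by simp
  qed
qed simp

lemma concat_nth_sum:
  "i < length xss \<Longrightarrow> j < length (xss ! i) \<Longrightarrow>
   concat xss ! (sum_list (take i (map length xss)) + j) = xss ! i ! j"
proof (induction xss arbitrary: i)
  case (Cons xs xss)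
  then show ?case by (cases i) (auto simp: nth_append)
qed simp

lemma sum_take_less:
  "i < length ls \<Longrightarrow> j < ls ! i \<Longrightarrow> sum_list (take i ls) + j < sum_list (ls :: nat list)"
proof (induction ls arbitrary: i)
  case (Cons l ls)
  then show ?case by (cases i) auto
qed simp

text \<open>The vertices of the \<open>i\<close>-th graph substituted occupy the positions from \<open>off gs i\<close> on in the
  result; \<open>locus\<close> recovers the graph and the vertex from the position.\<close>

definition off :: "'e dgraph list \<Rightarrow> nat \<Rightarrow> nat" where
  "off gs i = sum_list (take i (map (\<lambda>g. length (verts g)) gs))"

lemma off_sum: "i \<le> length gs \<Longrightarrow> (\<Sum>j<i. length (verts (gs ! j))) = off gs i"
proof (induction i)
  case (Suc i)
  then show ?case by (simp add: off_def take_Suc_conv_app_nth)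
qed (simp add: off_def)

lemma verts_concat_nth:
  assumes "i < length gs" "j < length (verts (gs ! i))"
  shows "concat (map verts gs) ! (off gs i + j) = verts (gs ! i) ! j"
  using concat_nth_sum[of i "map verts gs" j] assms by (simp add: off_def o_def)

lemma off_less:
  assumes "i < length gs" "j < length (verts (gs ! i))"
  shows "off gs i + j < length (concat (map verts gs))"
  using sum_take_less[of i "map (\<lambda>g. length (verts g)) gs" j] assms
  by (simp add: off_def length_concat o_def)

lemma off_cases:
  assumes "k < length (concat (map verts gs))"
  obtains i j where "i < length gs" "j < length (verts (gs ! i))" "k = off gs i + j"
  using assms block_cases[of k "map (\<lambda>g. length (verts g)) gs"]
  by (auto simp: off_def length_concat o_def)

definition locus :: "'e dgraph list \<Rightarrow> nat \<Rightarrow> nat \<times> nat" where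
  "locus gs k = block (map (\<lambda>g. length (verts g)) gs) k"

lemma locus_off [simp]: "i < length gs \<Longrightarrow> j < length (verts (gs ! i)) \<Longrightarrow> locus gs (off gs i + j) = (i, j)"
  by (simp add: locus_def off_def block_sum)

lemma off_inj:
  assumes "off gs i + j = off gs i' + j'"
    "i < length gs" "j < length (verts (gs ! i))" "i' < length gs" "j' < length (verts (gs ! i'))"
  shows "i = i' \<and> j = j'"
  using locus_off[OF assms(2,3)] locus_off[OF assms(4,5)] unfolding assms(1) by simp


section \<open>Paths through junctions\<close>

lemma outer_src_eq [simp]:
  "outer_src s = Src (Ext j) \<longleftrightarrow> s = Ext j" "outer_src s = JOut i p \<longleftrightarrow> s = Vtx i p"
  "outer_src s \<noteq> JIn i p" "outer_src s \<noteq> Src (Vtx i p)" "outer_src s \<noteq> Tgt t"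
  by (cases s; auto)+

lemma outer_tgt_eq [simp]:
  "outer_tgt s = Tgt (Ext j) \<longleftrightarrow> s = Ext j" "outer_tgt s = JIn i p \<longleftrightarrow> s = Vtx i p"
  "outer_tgt s \<noteq> JOut i p" "outer_tgt s \<noteq> Tgt (Vtx i p)" "outer_tgt s \<noteq> Src t"
  by (cases s; auto)+

lemma inner_src_eq [simp]:
  "inner_src i k s = JIn i' q \<longleftrightarrow> i = i' \<and> s = Ext q"
  "inner_src i k s = Src (Vtx l p) \<longleftrightarrow> (\<exists>j. s = Vtx j p \<and> l = k + j)"
  "inner_src i k s \<noteq> Src (Ext q)" "inner_src i k s \<noteq> JOut i' q" "inner_src i k s \<noteq> Tgt t"
  by (cases s; auto)+

lemma inner_tgt_eq [simp]:
  "inner_tgt i k s = JOut i' q \<longleftrightarrow> i = i' \<and> s = Ext q"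
  "inner_tgt i k s = Tgt (Vtx l p) \<longleftrightarrow> (\<exists>j. s = Vtx j p \<and> l = k + j)"
  "inner_tgt i k s \<noteq> Tgt (Ext q)" "inner_tgt i k s \<noteq> JIn i' q" "inner_tgt i k s \<noteq> Src t"
  by (cases s; auto)+

lemma junction_wires_iff:
  "(x, y) \<in> junction_wires \<Gamma> gs \<longleftrightarrow>
     (\<exists>s t. (s, t) \<in> edges \<Gamma> \<and> x = outer_src s \<and> y = outer_tgt t) \<or>
     (\<exists>i s t. i < length gs \<and> (s, t) \<in> edges (gs ! i) \<and>
        x = inner_src i (off gs i) s \<and> y = inner_tgt i (off gs i) t)"
  (is "?L \<longleftrightarrow> ?R")
proof -
  have "junction_wires \<Gamma> gs = map_prod outer_src outer_tgt ` edges \<Gamma> \<union>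
     (\<Union>i<length gs. map_prod (inner_src i (off gs i)) (inner_tgt i (off gs i)) ` edges (gs ! i))"
    by (simp add: junction_wires_def Let_def off_sum)
  then show ?thesis by fastforce
qed

lemma subst_graph_sel [simp]:
  "gout (subst_graph \<Gamma> gs) = gout \<Gamma>" "gin (subst_graph \<Gamma> gs) = gin \<Gamma>"
  "verts (subst_graph \<Gamma> gs) = concat (map verts gs)"
  "edges (subst_graph \<Gamma> gs) = {(s, t). (Src s, Tgt t) \<in> (junction_wires \<Gamma> gs)\<^sup>+}"
  by (simp_all add: subst_graph_def)

text \<open>A labelling of all junctions that is constant along wires is the same as compatible
  labellings of the outer graph and of the inner graphs.\<close>

definition invariant :: "'x dgraph \<Rightarrow> 'e dgraph list \<Rightarrow> (junction \<Rightarrow> 'w) \<Rightarrow> bool" where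
  "invariant \<Gamma> gs l \<longleftrightarrow> (\<forall>(x, y)\<in>junction_wires \<Gamma> gs. l x = l y)"

lemma invariant_iff:
  "invariant \<Gamma> gs l \<longleftrightarrow> labelled \<Gamma> (l \<circ> outer_src) (l \<circ> outer_tgt) \<and>
     (\<forall>i<length gs. labelled (gs ! i) (l \<circ> inner_src i (off gs i)) (l \<circ> inner_tgt i (off gs i)))"
  unfolding invariant_def labelled_def by (fastforce simp: junction_wires_iff)

lemma invariant_labelled:
  assumes "invariant \<Gamma> gs l"
  shows "labelled (subst_graph \<Gamma> gs) (l \<circ> Src) (l \<circ> Tgt)"
proof -
  have "(x, y) \<in> (junction_wires \<Gamma> gs)\<^sup>+ \<Longrightarrow> l x = l y" for x y
    by (induction rule: trancl_induct) (use assms in \<open>auto simp: invariant_def\<close>)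
  then show ?thesis by (auto simp: labelled_def)
qed

text \<open>Following wires from a point of \<open>D\<close> never branches, and it ends by well-foundedness; it can only end
  outside \<open>D\<close>, that is, in \<open>T\<close>.\<close>

lemma unique_path_end:
  assumes wf: "wf (W\<inverse>)" and sub: "W \<subseteq> D \<times> C" and un: "\<And>x. x \<in> D \<Longrightarrow> \<exists>!y. (x, y) \<in> W"
    and C: "C \<subseteq> D \<union> T" and DT: "D \<inter> T = {}"
  shows "x \<in> D \<Longrightarrow> \<exists>!t. t \<in> T \<and> (x, t) \<in> W\<^sup>+"
  using wf
proof (induction x rule: wf_induct_rule)
  case (less x)
  obtain y where y: "(x, y) \<in> W" "\<And>z. (x, z) \<in> W \<Longrightarrow> z = y" using un[OF less.prems] by blast
  have trans: "(x, t) \<in> W\<^sup>+ \<longleftrightarrow> t = y \<or> (y, t) \<in> W\<^sup>+" for t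
    using y by (metis r_into_trancl rtranclD trancl_into_trancl2 tranclD)
  show ?case
  proof (cases "y \<in> D")
    case True
    then have "\<exists>!t. t \<in> T \<and> (y, t) \<in> W\<^sup>+" using less.IH[of y] y(1) by simp
    moreover have "y \<notin> T" using True DT by auto
    ultimately show ?thesis unfolding trans by metis
  next
    case False
    then have "y \<in> T" using y(1) sub C by blast
    moreover have "(y, t) \<notin> W\<^sup>+" for t using False sub by (meson SigmaD1 subsetD tranclD)
    ultimately show ?thesis unfolding trans by blast
  qed
qed

definition fits :: "'x dgraph \<Rightarrow> 'e dgraph list \<Rightarrow> bool" where
  "fits \<Gamma> gs \<longleftrightarrow> list_all2 (\<lambda>g v. gout g = outs v \<and> gin g = ins v) gs (verts \<Gamma>)"

text \<open>Acyclicity of a finite graph is used in the form of a rank that decreases along the edges: ranks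
  of an outer graph and of inner graphs combine lexicographically.\<close>

definition ranked :: "'e dgraph \<Rightarrow> (nat \<Rightarrow> nat) \<Rightarrow> bool" where
  "ranked g r \<longleftrightarrow> (\<forall>(i, j)\<in>steps g. r j < r i)"

lemma steps_less: "bounded_edges g \<Longrightarrow> (i, j) \<in> steps g \<Longrightarrow> i < length (verts g) \<and> j < length (verts g)"
  by (auto simp: steps_def bounded_edges_def dest!: subsetD)

lemma acyclic_ranked:
  assumes "bounded_edges g" "acyclic (steps g)"
  obtains r where "ranked g r"
proof -
  define r where "r i = card {j. (i, j) \<in> (steps g)\<^sup>+}" for i
  have "{j. (i, j) \<in> (steps g)\<^sup>+} \<subseteq> {..<length (verts g)}" for i
    using steps_less[OF assms(1)] by (auto dest: tranclD2)
  then have fin: "finite {j. (i, j) \<in> (steps g)\<^sup>+}" for i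
    by (rule finite_subset) simp
  have "r j < r i" if "(i, j) \<in> steps g" for i j
    unfolding r_def
  proof (rule psubset_card_mono[OF fin])
    show "{l. (j, l) \<in> (steps g)\<^sup>+} \<subset> {l. (i, l) \<in> (steps g)\<^sup>+}"
      using that assms(2) by (auto simp: acyclic_def intro: trancl_into_trancl2)
  qed
  then show thesis using that[of r] by (auto simp: ranked_def)
qed

lemma ranked_acyclic: "ranked g r \<Longrightarrow> acyclic (steps g)"
proof -
  assume "ranked g r"
  then have "(steps g)\<inverse> \<subseteq> measure r" by (auto simp: ranked_def)
  then have "acyclic ((steps g)\<inverse>)" by (intro wf_acyclic) (rule wf_subset[OF wf_measure])
  then show ?thesis by simp
qed

section \<open>Substitution preserves well-formedness\<close>

text \<open>What paths of wires through the junctions of a substitution depend on: they do not branch, and they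
  come to an end.\<close>

definition acyclic_wired :: "'e dgraph \<Rightarrow> bool" where
  "acyclic_wired g \<longleftrightarrow> wired g \<and> acyclic (steps g)"

lemma wf_graph_acyclic_wired: "wf_graph g \<Longrightarrow> acyclic_wired g"
  by (simp add: wf_graph_def acyclic_wired_def)

locale substitution =
  fixes \<Gamma> :: "'x dgraph" and gs :: "'e dgraph list"
  assumes outer: "acyclic_wired \<Gamma>"
    and inner: "\<And>i. i < length gs \<Longrightarrow> acyclic_wired (gs ! i)"
    and fits: "fits \<Gamma> gs"
begin

abbreviation "W \<equiv> junction_wires \<Gamma> gs"
abbreviation "R \<equiv> subst_graph \<Gamma> gs"

definition joints :: "junction set" where
  "joints = {JIn i q |i q. i < length gs \<and> q < gin (gs ! i)} \<union>
            {JOut i p |i p. i < length gs \<and> p < gout (gs ! i)}"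

lemma in_joints [simp]:
  "JIn i q \<in> joints \<longleftrightarrow> i < length gs \<and> q < gin (gs ! i)"
  "JOut i q \<in> joints \<longleftrightarrow> i < length gs \<and> q < gout (gs ! i)"
  "Src s \<notin> joints" "Tgt t \<notin> joints"
  by (auto simp: joints_def)

lemma outer_wired: "wired \<Gamma>" and inner_wired: "i < length gs \<Longrightarrow> wired (gs ! i)"
  using outer inner by (auto simp: acyclic_wired_def)

lemma arity:
  "length (verts \<Gamma>) = length gs"
  "i < length gs \<Longrightarrow> outs (verts \<Gamma> ! i) = gout (gs ! i)"
  "i < length gs \<Longrightarrow> ins (verts \<Gamma> ! i) = gin (gs ! i)"
  using fits by (auto simp: fits_def list_all2_conv_all_nth)

lemma Src_Vtx_cases:
  assumes "Vtx k p \<in> sources R"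
  obtains i j where "i < length gs" "k = off gs i + j" "j < length (verts (gs ! i))"
    "Vtx j p \<in> sources (gs ! i)"
  using assms by (auto elim!: off_cases simp: verts_concat_nth)

lemma Tgt_Vtx_cases:
  assumes "Vtx k p \<in> targets R"
  obtains i j where "i < length gs" "k = off gs i + j" "j < length (verts (gs ! i))"
    "Vtx j p \<in> targets (gs ! i)"
  using assms by (auto elim!: off_cases simp: verts_concat_nth)

lemma inner_src_in:
  "i < length gs \<Longrightarrow> s \<in> sources (gs ! i) \<Longrightarrow> inner_src i (off gs i) s \<in> Src ` sources R \<union> joints"
  by (cases s) (auto simp: verts_concat_nth off_less)

lemma inner_tgt_in:
  "i < length gs \<Longrightarrow> t \<in> targets (gs ! i) \<Longrightarrow> inner_tgt i (off gs i) t \<in> Tgt ` targets R \<union> joints"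
  by (cases t) (auto simp: verts_concat_nth off_less)

lemma outer_src_in: "s \<in> sources \<Gamma> \<Longrightarrow> outer_src s \<in> Src ` sources R \<union> joints"
  by (cases s) (auto simp: arity)

lemma outer_tgt_in: "t \<in> targets \<Gamma> \<Longrightarrow> outer_tgt t \<in> Tgt ` targets R \<union> joints"
  by (cases t) (auto simp: arity)

lemma W_sub: "W \<subseteq> (Src ` sources R \<union> joints) \<times> (Tgt ` targets R \<union> joints)"
proof clarify
  fix x y assume "(x, y) \<in> W"
  then consider s t where "(s, t) \<in> edges \<Gamma>" "x = outer_src s" "y = outer_tgt t"
    | i s t where "i < length gs" "(s, t) \<in> edges (gs ! i)"
        "x = inner_src i (off gs i) s" "y = inner_tgt i (off gs i) t"
    by (auto simp: junction_wires_iff)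
  then show "x \<in> Src ` sources R \<union> joints \<and> y \<in> Tgt ` targets R \<union> joints"
  proof cases
    case 1
    then show ?thesis
      using outer_src_in outer_tgt_in boundedD[OF wired_bounded[OF outer_wired]] by blast
  next
    case 2
    then show ?thesis
      using inner_src_in inner_tgt_in boundedD[OF wired_bounded[OF inner_wired]] by blast
  qed
qed

lemma W_inner: "i < length gs \<Longrightarrow> (s, t) \<in> edges (gs ! i) \<Longrightarrow>
    (inner_src i (off gs i) s, inner_tgt i (off gs i) t) \<in> W"
  unfolding junction_wires_iff by blast

lemma outer_src_inj: "outer_src s = outer_src s' \<longleftrightarrow> s = s'"
  by (cases s; cases s') auto

lemma outer_tgt_inj: "outer_tgt s = outer_tgt s' \<longleftrightarrow> s = s'"
  by (cases s; cases s') auto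

lemma outer_inner_src: "outer_src s \<noteq> inner_src i k s'" 
  by (cases s; cases s') auto

lemma outer_inner_tgt: "outer_tgt s \<noteq> inner_tgt i k s'" 
  by (cases s; cases s') auto

lemma inner_src_inj:
  assumes "i < length gs" "i' < length gs" "s \<in> sources (gs ! i)" "s' \<in> sources (gs ! i')"
    "inner_src i (off gs i) s = inner_src i' (off gs i') s'"
  shows "i = i' \<and> s = s'"
  using assms by (cases s; cases s') (auto dest!: off_inj)

lemma inner_tgt_inj:
  assumes "i < length gs" "i' < length gs" "s \<in> targets (gs ! i)" "s' \<in> targets (gs ! i')"
    "inner_tgt i (off gs i) s = inner_tgt i' (off gs i') s'"
  shows "i = i' \<and> s = s'"
  using assms by (cases s; cases s') (auto dest!: off_inj)

lemma src_cases:
  assumes "x \<in> Src ` sources R \<union> joints"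
  obtains s where "s \<in> sources \<Gamma>" "x = outer_src s"
    | i s where "i < length gs" "s \<in> sources (gs ! i)" "x = inner_src i (off gs i) s"
proof (cases x)
  case (Src s)
  show ?thesis
  proof (cases s)
    case (Ext j)
    then show ?thesis using assms Src that(1)[of s] by auto
  next
    case (Vtx k p)
    then have "Vtx k p \<in> sources R" using assms Src by auto
    then obtain i j where "i < length gs" "k = off gs i + j" "Vtx j p \<in> sources (gs ! i)"
      by (rule Src_Vtx_cases)
    then show ?thesis using Src Vtx that(2)[of i "Vtx j p"] by simp
  qed
next
  case (JIn i q)
  then show ?thesis using assms that(2)[of i "Ext q"] by auto
next
  case (JOut i p)
  then show ?thesis using assms that(1)[of "Vtx i p"] by (auto simp: arity)
qed (use assms in auto)

lemma tgt_cases: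
  assumes "x \<in> Tgt ` targets R \<union> joints"
  obtains s where "s \<in> targets \<Gamma>" "x = outer_tgt s"
    | i s where "i < length gs" "s \<in> targets (gs ! i)" "x = inner_tgt i (off gs i) s"
proof (cases x)
  case (Tgt s)
  show ?thesis
  proof (cases s)
    case (Ext j)
    then show ?thesis using assms Tgt that(1)[of s] by auto
  next
    case (Vtx k p)
    then have "Vtx k p \<in> targets R" using assms Tgt by auto
    then obtain i j where "i < length gs" "k = off gs i + j" "Vtx j p \<in> targets (gs ! i)"
      by (rule Tgt_Vtx_cases)
    then show ?thesis using Tgt Vtx that(2)[of i "Vtx j p"] by simp
  qed
next
  case (JIn i q)
  then show ?thesis using assms that(1)[of "Vtx i q"] by (auto simp: arity)
next
  case (JOut i p)
  then show ?thesis using assms that(2)[of i "Ext p"] by auto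
qed (use assms in auto)

lemma W_src:
  assumes "x \<in> Src ` sources R \<union> joints"
  shows "\<exists>!y. (x, y) \<in> W"
  using assms
proof (cases rule: src_cases)
  case (1 s)
  then have "\<exists>!t. (s, t) \<in> edges \<Gamma>" using outer_wired by (auto simp: wired_def)
  then show ?thesis
    using 1 by (auto simp: junction_wires_iff outer_src_inj outer_inner_src)
next
  case (2 i s)
  then have "\<exists>!t. (s, t) \<in> edges (gs ! i)" using inner_wired by (auto simp: wired_def)
  then obtain t where t: "(s, t) \<in> edges (gs ! i)" "\<forall>t'. (s, t') \<in> edges (gs ! i) \<longrightarrow> t' = t"
    unfolding Ex1_def by blast
  show ?thesis
  proof
    show "(x, inner_tgt i (off gs i) t) \<in> W" using W_inner[OF 2(1) t(1)] 2(3) by simp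
    fix y assume "(x, y) \<in> W"
    then obtain i' s' t' where i': "i' < length gs" "(s', t') \<in> edges (gs ! i')"
        "x = inner_src i' (off gs i') s'" "y = inner_tgt i' (off gs i') t'"
      using 2(3) outer_inner_src unfolding junction_wires_iff by metis
    moreover have "s' \<in> sources (gs ! i')" using boundedD[OF wired_bounded[OF inner_wired]] i' by blast
    ultimately have "i = i' \<and> s = s'" using inner_src_inj 2 by metis
    then show "y = inner_tgt i (off gs i) t" using i' t(2) by blast
  qed
qed

lemma W_tgt:
  assumes "y \<in> Tgt ` targets R \<union> joints"
  shows "\<exists>!x. (x, y) \<in> W"
  using assms
proof (cases rule: tgt_cases)
  case (1 s)
  then have "\<exists>!t. (t, s) \<in> edges \<Gamma>" using outer_wired by (auto simp: wired_def)
  then show ?thesis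
    using 1 by (auto simp: junction_wires_iff outer_tgt_inj outer_inner_tgt)
next
  case (2 i s)
  then have "\<exists>!t. (t, s) \<in> edges (gs ! i)" using inner_wired by (auto simp: wired_def)
  then obtain t where t: "(t, s) \<in> edges (gs ! i)" "\<forall>t'. (t', s) \<in> edges (gs ! i) \<longrightarrow> t' = t"
    unfolding Ex1_def by blast
  show ?thesis
  proof
    show "(inner_src i (off gs i) t, y) \<in> W" using W_inner[OF 2(1) t(1)] 2(3) by simp
    fix x assume "(x, y) \<in> W"
    then obtain i' s' t' where i': "i' < length gs" "(t', s') \<in> edges (gs ! i')"
        "y = inner_tgt i' (off gs i') s'" "x = inner_src i' (off gs i') t'"
      using 2(3) outer_inner_tgt unfolding junction_wires_iff by metis
    moreover have "s' \<in> targets (gs ! i')" using boundedD[OF wired_bounded[OF inner_wired]] i' by blast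
    ultimately have "i = i' \<and> s = s'" using inner_tgt_inj 2 by metis
    then show "x = inner_src i (off gs i) t" using i' t(2) by blast
  qed
qed

lemma finite_W: "finite W"
proof -
  have "W = map_prod outer_src outer_tgt ` edges \<Gamma> \<union>
     (\<Union>i<length gs. map_prod (inner_src i (off gs i)) (inner_tgt i (off gs i)) ` edges (gs ! i))"
    by (simp add: junction_wires_def Let_def off_sum)
  then show ?thesis
    by (auto intro!: finite_imageI finite_edges wired_bounded outer_wired inner_wired)
qed

text \<open>
  Along wires the pair (rank of the outer vertex, rank of the inner vertex) decreases
  lexicographically, the input and output junctions of an outer vertex lying above
  and below all of its inner vertices.
\<close>

lemma potential:
  obtains f :: "junction \<Rightarrow> nat \<times> nat \<times> nat \<times> nat"
    where "\<And>x y. (x, y) \<in> W \<Longrightarrow> (f y, f x) \<in> less_than <*lex*> less_than <*lex*> less_than <*lex*> less_than"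
      and "\<And>k p q. f (Src (Vtx k p)) = f (Tgt (Vtx k q))"
proof -
  obtain r where r: "ranked \<Gamma> r"
    using acyclic_ranked outer by (auto simp: acyclic_wired_def dest!: wired_bounded)
  have "\<forall>i. \<exists>r. i < length gs \<longrightarrow> ranked (gs ! i) r"
    using acyclic_ranked inner unfolding acyclic_wired_def by (metis wired_bounded)
  then obtain r' where r': "\<And>i. i < length gs \<Longrightarrow> ranked (gs ! i) (r' i)" by metis
  define f where "f x = ((case x of
      Src (Ext j) \<Rightarrow> (2, 0, 0, 0) | Tgt (Ext j) \<Rightarrow> (0, 0, 0, 0)
    | JIn i q \<Rightarrow> (1, r i, 2, 0) | JOut i p \<Rightarrow> (1, r i, 0, 0)
    | Src (Vtx k p) \<Rightarrow> (let (i, j) = locus gs k in (1, r i, 1, r' i j))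
    | Tgt (Vtx k p) \<Rightarrow> (let (i, j) = locus gs k in (1, r i, 1, r' i j)))
      :: nat \<times> nat \<times> nat \<times> nat)" for x :: junction
  show thesis
  proof (rule that[of f])
    show "f (Src (Vtx k p)) = f (Tgt (Vtx k q))" for k p q by (simp add: f_def)
    fix x y assume "(x, y) \<in> W"
    then consider s t where "(s, t) \<in> edges \<Gamma>" "x = outer_src s" "y = outer_tgt t"
      | i s t where "i < length gs" "(s, t) \<in> edges (gs ! i)"
          "x = inner_src i (off gs i) s" "y = inner_tgt i (off gs i) t"
      by (auto simp: junction_wires_iff)
    then show "(f y, f x) \<in> less_than <*lex*> less_than <*lex*> less_than <*lex*> less_than"
    proof cases
      case 1
      then show ?thesis using r
        by (cases s; cases t) (auto simp: f_def ranked_def steps_def)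
    next
      case 2
      have "s \<in> sources (gs ! i)" "t \<in> targets (gs ! i)"
        using 2 boundedD[OF wired_bounded[OF inner_wired]] by auto
      then show ?thesis using 2 r'[of i]
        by (cases s; cases t) (auto simp: f_def ranked_def steps_def)
    qed
  qed
qed

lemma acyclic_W: "acyclic W" and acyclic_R: "acyclic (steps R)"
proof -
  obtain f :: "junction \<Rightarrow> nat \<times> nat \<times> nat \<times> nat"
    where f: "\<And>x y. (x, y) \<in> W \<Longrightarrow> (f y, f x) \<in> less_than <*lex*> less_than <*lex*> less_than <*lex*> less_than"
      and ST: "\<And>k p q. f (Src (Vtx k p)) = f (Tgt (Vtx k q))"
    by (rule potential) blast
  define L where "L = less_than <*lex*> less_than <*lex*> less_than <*lex*> (less_than :: (nat \<times> nat) set)"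
  have wfL: "wf L" unfolding L_def by (intro wf_lex_prod wf_less_than)
  have transL: "trans L" unfolding L_def by (intro trans_lex_prod trans_less_than)
  have dec: "(x, y) \<in> W\<^sup>+ \<Longrightarrow> (f y, f x) \<in> L" for x y
    by (induction rule: trancl_induct) (use f transL in \<open>auto simp: L_def[symmetric] elim: transE\<close>)
  have "(W\<^sup>+)\<inverse> \<subseteq> inv_image L f" using dec by auto
  then have "acyclic (W\<inverse>)"
    by (intro wf_acyclic wf_subset[OF wf_inv_image[OF wfL]]) auto
  then show "acyclic W" by simp
  have "(steps R)\<inverse> \<subseteq> inv_image L (\<lambda>k. f (Src (Vtx k 0)))"
  proof clarify
    fix k l assume "(l, k) \<in> steps R"
    then obtain p q where "(Src (Vtx l p), Tgt (Vtx k q)) \<in> W\<^sup>+" by (auto simp: steps_def)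
    from dec[OF this] show "(k, l) \<in> inv_image L (\<lambda>k. f (Src (Vtx k 0)))"
      using ST by (simp add: in_inv_image) metis
  qed
  then have "acyclic ((steps R)\<inverse>)"
    by (intro wf_acyclic wf_subset[OF wf_inv_image[OF wfL]]) auto
  then show "acyclic (steps R)" by simp
qed

lemma forward_end:
  "x \<in> Src ` sources R \<union> joints \<Longrightarrow> \<exists>!y. y \<in> Tgt ` targets R \<and> (x, y) \<in> W\<^sup>+"
  by (rule unique_path_end[OF finite_acyclic_wf_converse[OF finite_W acyclic_W] W_sub W_src]) auto

lemma backward_end:
  "y \<in> Tgt ` targets R \<union> joints \<Longrightarrow> \<exists>!x. x \<in> Src ` sources R \<and> (x, y) \<in> W\<^sup>+"
proof -
  assume y: "y \<in> Tgt ` targets R \<union> joints"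
  have "wf ((W\<inverse>)\<inverse>)" using finite_acyclic_wf[OF finite_W acyclic_W] by simp
  moreover have "W\<inverse> \<subseteq> (Tgt ` targets R \<union> joints) \<times> (Src ` sources R \<union> joints)" using W_sub by blast
  ultimately have "\<exists>!x. x \<in> Src ` sources R \<and> (y, x) \<in> (W\<inverse>)\<^sup>+"
    by (rule unique_path_end) (use y W_tgt in auto)
  then show ?thesis by (simp add: trancl_converse)
qed

text \<open>Each wire of the result is the unique maximal path of junction wires through its ends.\<close>

lemma R_wired: "wired R"
  unfolding wired_def
proof (intro conjI ballI)
  show "edges R \<subseteq> sources R \<times> targets R"
  proof clarify
    fix s t assume "(s, t) \<in> edges R"
    then have "(Src s, Tgt t) \<in> W\<^sup>+" by simp
    then obtain x y where "(Src s, y) \<in> W" "(x, Tgt t) \<in> W" by (meson tranclD tranclD2)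
    then show "s \<in> sources R \<and> t \<in> targets R" using W_sub by auto
  qed
  show "\<exists>!t. (s, t) \<in> edges R" if "s \<in> sources R" for s
  proof -
    have *: "t \<in> targets R" if "(Src s, Tgt t) \<in> W\<^sup>+" for t
      using tranclD2[OF that] W_sub by auto
    have "\<exists>!y. y \<in> Tgt ` targets R \<and> (Src s, y) \<in> W\<^sup>+" using that by (intro forward_end) auto
    then have "\<exists>!t. (Src s, Tgt t) \<in> W\<^sup>+"
      using * by (metis (no_types, lifting) imageE imageI junction.inject(2))
    then show ?thesis by simp
  qed
  show "\<exists>!s. (s, t) \<in> edges R" if "t \<in> targets R" for t
  proof -
    have *: "s \<in> sources R" if "(Src s, Tgt t) \<in> W\<^sup>+" for s
      using tranclD[OF that] W_sub by auto
    have "\<exists>!y. y \<in> Src ` sources R \<and> (y, Tgt t) \<in> W\<^sup>+" using that by (intro backward_end) auto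
    then have "\<exists>!s. (Src s, Tgt t) \<in> W\<^sup>+"
      using * by (metis (no_types, lifting) imageE imageI junction.inject(1))
    then show ?thesis by simp
  qed
qed

lemma R_acyclic_wired: "acyclic_wired R"
  using R_wired acyclic_R by (simp add: acyclic_wired_def)

text \<open>Every junction lies on a path to a target, whose label it inherits.\<close>

lemma extend_labels:
  assumes lab: "labelled R a b"
  obtains l where "invariant \<Gamma> gs l" "\<And>s. s \<in> sources R \<Longrightarrow> l (Src s) = a s" "\<And>t. l (Tgt t) = b t"
proof -
  define e where "e x = (THE y. y \<in> Tgt ` targets R \<and> (x, y) \<in> W\<^sup>+)" for x
  have e: "e x \<in> Tgt ` targets R \<and> (x, e x) \<in> W\<^sup>+" if "x \<in> Src ` sources R \<union> joints" for x
    unfolding e_def using forward_end[OF that] by (rule theI')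
  have eu: "e x = y" if "x \<in> Src ` sources R \<union> joints" "y \<in> Tgt ` targets R" "(x, y) \<in> W\<^sup>+" for x y
    using e[OF that(1)] forward_end[OF that(1)] that(2,3) by blast
  define v where "v y = (case y of Tgt t \<Rightarrow> b t | _ \<Rightarrow> undefined)" for y
  define l where "l x = (case x of Tgt t \<Rightarrow> b t | _ \<Rightarrow> v (e x))" for x
  have "invariant \<Gamma> gs l"
    unfolding invariant_def
  proof clarify
    fix x y assume xy: "(x, y) \<in> W"
    then have x: "x \<in> Src ` sources R \<union> joints" and y: "y \<in> Tgt ` targets R \<union> joints" using W_sub by auto
    have lx: "l x = v (e x)" using x by (cases x) (auto simp: l_def)
    show "l x = l y"
    proof (cases "y \<in> joints")
      case True
      then have "e x = e y" using eu[OF x, of "e y"] e[of y] xy by (auto intro: trancl_into_trancl2)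
      then show ?thesis using lx True by (cases y) (auto simp: l_def)
    next
      case False
      then have "e x = y" using eu[OF x, of y] xy y by auto
      then show ?thesis using lx False y by (auto simp: l_def v_def)
    qed
  qed
  moreover have "l (Src s) = a s" if s: "s \<in> sources R" for s
  proof -
    have "Src s \<in> Src ` sources R \<union> joints" using s by simp
    from e[OF this] obtain t where "e (Src s) = Tgt t" "(s, t) \<in> edges R" by auto
    then show ?thesis using labelledD[OF lab] by (simp add: l_def v_def)
  qed
  moreover have "l (Tgt t) = b t" for t by (simp add: l_def)
  ultimately show thesis by (rule that)
qed

end

section \<open>Connectivity by two-colourings\<close>

lemma labelled_from_targets: "wired g \<Longrightarrow> labelled g (\<lambda>s. b (end_of g s)) b"
  by (auto simp: labelled_def end_of_eq)

lemma wired_source_unique: "wired g \<Longrightarrow> (s, t) \<in> edges g \<Longrightarrow> (s', t) \<in> edges g \<Longrightarrow> s = s'"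
  unfolding wired_def by blast

lemma wired_target_unique: "wired g \<Longrightarrow> (s, t) \<in> edges g \<Longrightarrow> (s, t') \<in> edges g \<Longrightarrow> t = t'"
  unfolding wired_def by blast

lemma wired_target_ex: "wired g \<Longrightarrow> s \<in> sources g \<Longrightarrow> \<exists>t. (s, t) \<in> edges g \<and> t \<in> targets g"
  unfolding wired_def by blast

lemma wired_source_ex: "wired g \<Longrightarrow> t \<in> targets g \<Longrightarrow> \<exists>s. (s, t) \<in> edges g \<and> s \<in> sources g"
  unfolding wired_def by blast

text \<open>A colouring of the wires and vertices that is compatible with incidence. The graph is connected when
  every such two-colouring is constant. In this form connectivity passes to substitutions,
  since the colours extend to the junctions.\<close>

definition monochrome :: "'e dgraph \<Rightarrow> bool" where
  "monochrome g \<longleftrightarrow> (\<forall>(a :: port \<Rightarrow> bool) b (D :: nat \<Rightarrow> bool). labelled g a b \<longrightarrow>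
     (\<forall>i p. Vtx i p \<in> sources g \<longrightarrow> a (Vtx i p) = D i) \<longrightarrow>
     (\<forall>i q. Vtx i q \<in> targets g \<longrightarrow> b (Vtx i q) = D i) \<longrightarrow>
     (\<exists>c. (\<forall>s\<in>sources g. a s = c) \<and> (\<forall>t\<in>targets g. b t = c) \<and> (\<forall>i<length (verts g). D i = c)))"

lemma connected_monochrome:
  assumes w: "wired g" and c: "connected_graph g"
  shows "monochrome g"
  unfolding monochrome_def
proof (intro allI impI)
  fix a b :: "port \<Rightarrow> bool" and D :: "nat \<Rightarrow> bool"
  assume lab: "labelled g a b"
    and a: "\<forall>i p. Vtx i p \<in> sources g \<longrightarrow> a (Vtx i p) = D i"
    and b: "\<forall>i q. Vtx i q \<in> targets g \<longrightarrow> b (Vtx i q) = D i"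
  note bd = boundedD[OF wired_bounded[OF w]]
  show "\<exists>c. (\<forall>s\<in>sources g. a s = c) \<and> (\<forall>t\<in>targets g. b t = c) \<and> (\<forall>i<length (verts g). D i = c)"
  proof (cases "verts g = []")
    case True
    then have 1: "gin g = 1" "gout g = 1" using c by (auto simp: connected_graph_def)
    have s: "sources g = {Ext 0}" and t: "targets g = {Ext 0}"
      using 1 True by (auto simp: sources_def targets_def)
    have "(Ext 0, Ext 0) \<in> edges g" using wired_target_ex[OF w, of "Ext 0"] s t by auto
    then show ?thesis using labelledD[OF lab] s t True by auto
  next
    case False
    then have noext: "(Ext j, Ext k) \<notin> edges g" for j k using c by (auto simp: connected_graph_def)
    have conn: "(i, j) \<in> (steps g \<union> (steps g)\<inverse>)\<^sup>*" if "i < length (verts g)" "j < length (verts g)" for i j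
      using c that False by (auto simp: connected_graph_def)
    have step: "D i = D j" if ij: "(i, j) \<in> steps g" for i j
    proof -
      obtain p q where "(Vtx i p, Vtx j q) \<in> edges g" using ij by (auto simp: steps_def)
      then show ?thesis using a b bd labelledD[OF lab] by metis
    qed
    have "D i = D j" if "(i, j) \<in> (steps g \<union> (steps g)\<inverse>)\<^sup>*" for i j
      using that by (induction rule: rtrancl_induct) (use step in auto)
    then have D: "D i = D 0" if "i < length (verts g)" for i using conn that False by blast
    have "a s = D 0" if sg: "s \<in> sources g" for s
    proof (cases s)
      case (Ext j)
      obtain t where t: "(s, t) \<in> edges g" using wired_target_ex[OF w sg] by blast
      then obtain i q where "t = Vtx i q" using Ext noext by (cases t) auto
      then show ?thesis using labelledD[OF lab t] b bd(2)[OF t] D by auto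
    next
      case (Vtx i p)
      then show ?thesis using a D that by auto
    qed
    moreover have "b s = D 0" if sg: "s \<in> targets g" for s
    proof (cases s)
      case (Ext j)
      obtain t where t: "(t, s) \<in> edges g" using wired_source_ex[OF w sg] by blast
      then obtain i q where "t = Vtx i q" using Ext noext by (cases t) auto
      then show ?thesis using labelledD[OF lab t] a bd(1)[OF t] D by auto
    next
      case (Vtx i p)
      then show ?thesis using b D that by auto
    qed
    ultimately show ?thesis using D by blast
  qed
qed

text \<open>A colour class is exhibited in each case: the component of a vertex, or a single strand that would
  be disconnected from the rest. The graph without inputs and vertices, which is vacuously
  monochrome, has to be excluded.\<close>

lemma monochrome_connected:
  assumes w: "wired g" and m: "monochrome g" and ne: "verts g \<noteq> [] \<or> gin g > 0"
  shows "connected_graph g"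
proof (cases "verts g = []")
  case True
  then have E: "s \<in> sources g \<longleftrightarrow> (\<exists>j<gin g. s = Ext j)" "t \<in> targets g \<longleftrightarrow> (\<exists>j<gout g. t = Ext j)" for s t
    by (auto simp: sources_def targets_def)
  have "\<exists>c. (\<forall>t\<in>targets g. (t = Ext 0) = c)"
    using m[unfolded monochrome_def, rule_format, of "\<lambda>s. end_of g s = Ext 0" "\<lambda>t. t = Ext 0"]
      labelled_from_targets[OF w, of "\<lambda>t. t = Ext 0"] True by auto
  then obtain c where c: "\<And>t. t \<in> targets g \<Longrightarrow> (t = Ext 0) = c" by blast
  have "gout g \<le> 1"
  proof (rule ccontr)
    assume "\<not> gout g \<le> 1"
    then show False using c[of "Ext 0"] c[of "Ext 1"] by auto
  qed
  moreover have "0 < gin g" using ne True by simp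
  then obtain t where "t \<in> targets g" using wired_target_ex[OF w, of "Ext 0"] by auto
  ultimately have g1: "gout g = 1" unfolding E by auto
  have "(Ext j, Ext 0) \<in> edges g" if "j < gin g" for j
    using wired_target_ex[OF w, of "Ext j"] that g1 unfolding E by auto
  then have "j = 0" if "j < gin g" for j
    using wired_source_unique[OF w] that \<open>0 < gin g\<close> by blast
  then have "gin g = 1" using \<open>0 < gin g\<close> by (metis One_nat_def Suc_lessI zero_neq_one)
  then show ?thesis using True g1 by (simp add: connected_graph_def)
next
  case False
  have "(Ext j, Ext k) \<notin> edges g" for j k
  proof
    assume jk: "(Ext j, Ext k) \<in> edges g"
    have "\<exists>c. (\<forall>t\<in>targets g. (t = Ext k) = c) \<and> (\<forall>i<length (verts g). False = c)"
    proof -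
      have "\<forall>i p. Vtx i p \<in> sources g \<longrightarrow> (end_of g (Vtx i p) = Ext k) = False"
        using wired_target_ex[OF w] wired_source_unique[OF w jk] end_of_eq[OF w] by (metis port.distinct(1))
      then show ?thesis
        using m[unfolded monochrome_def, rule_format, of "\<lambda>s. end_of g s = Ext k" "\<lambda>t. t = Ext k" "\<lambda>_. False"]
          labelled_from_targets[OF w, of "\<lambda>t. t = Ext k"] by blast
    qed
    then show False using boundedD[OF wired_bounded[OF w] jk] False by blast
  qed
  moreover have "(i, j) \<in> (steps g \<union> (steps g)\<inverse>)\<^sup>*"
    if i: "i < length (verts g)" and j: "j < length (verts g)" for i j
  proof -
    define D where "D l \<longleftrightarrow> (i, l) \<in> (steps g \<union> (steps g)\<inverse>)\<^sup>*" for l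
    define b where "b t = (case t of Ext k \<Rightarrow> (\<exists>l p. (Vtx l p, Ext k) \<in> edges g \<and> D l) | Vtx l q \<Rightarrow> D l)" for t
    have step: "D l = D l'" if "(l, l') \<in> steps g" for l l'
    proof -
      have "(l, l') \<in> steps g \<union> (steps g)\<inverse>" "(l', l) \<in> steps g \<union> (steps g)\<inverse>" using that by auto
      then show ?thesis unfolding D_def by (meson rtrancl.rtrancl_into_rtrancl)
    qed
    have "b (end_of g (Vtx l p)) = D l" if lp: "Vtx l p \<in> sources g" for l p
    proof -
      obtain t where t: "(Vtx l p, t) \<in> edges g" using wired_target_ex[OF w lp] by auto
      show ?thesis
      proof (cases t)
        case (Ext k)
        then show ?thesis using t wired_source_unique[OF w] by (auto simp: b_def end_of_eq[OF w t])
      next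
        case (Vtx l' q)
        then have "(l, l') \<in> steps g" using t by (auto simp: steps_def)
        then show ?thesis using step Vtx by (simp add: b_def end_of_eq[OF w t])
      qed
    qed
    moreover have "b (Vtx l q) = D l" for l q by (simp add: b_def)
    ultimately have "\<exists>c. \<forall>l<length (verts g). D l = c"
      using m[unfolded monochrome_def, rule_format, of "\<lambda>s. b (end_of g s)" b D]
        labelled_from_targets[OF w, of b] by blast
    moreover have "D i" by (simp add: D_def)
    ultimately have "D j" using i j by blast
    then show ?thesis by (simp add: D_def)
  qed
  ultimately show ?thesis using False by (simp add: connected_graph_def)
qed

lemma wf_graph_monochrome:
  "wf_graph g \<longleftrightarrow> acyclic_wired g \<and> monochrome g \<and> (verts g \<noteq> [] \<or> gin g > 0)"
proof
  assume g: "wf_graph g"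
  then have "verts g \<noteq> [] \<or> gin g > 0"
    by (cases "verts g = []") (simp_all add: wf_graph_def connected_graph_def)
  then show "acyclic_wired g \<and> monochrome g \<and> (verts g \<noteq> [] \<or> gin g > 0)"
    using g connected_monochrome[of g] by (simp add: wf_graph_def acyclic_wired_def)
next
  assume "acyclic_wired g \<and> monochrome g \<and> (verts g \<noteq> [] \<or> gin g > 0)"
  then show "wf_graph g"
    using monochrome_connected[of g] by (simp add: wf_graph_def acyclic_wired_def)
qed

text \<open>A colouring of the result is extended to the junctions. It is constant on each inner graph, hence
  it defines a colouring of the outer graph, which is constant.\<close>

lemma wf_subst_graph:
  assumes G: "wf_graph \<Gamma>" and gs: "\<And>g. g \<in> set gs \<Longrightarrow> wf_graph g" and fits: "fits \<Gamma> gs"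
  shows "wf_graph (subst_graph \<Gamma> gs)"
proof -
  interpret substitution \<Gamma> gs
    using assms by unfold_locales (auto simp: wf_graph_acyclic_wired)
  have mono: "monochrome \<Gamma>" "\<And>i. i < length gs \<Longrightarrow> monochrome (gs ! i)"
    and ne: "verts \<Gamma> \<noteq> [] \<or> gin \<Gamma> > 0" "\<And>i. i < length gs \<Longrightarrow> verts (gs ! i) \<noteq> [] \<or> gin (gs ! i) > 0"
    using G gs by (auto simp: wf_graph_monochrome)
  have "monochrome R"
    unfolding monochrome_def
  proof (intro allI impI)
    fix a b :: "port \<Rightarrow> bool" and D :: "nat \<Rightarrow> bool"
    assume lab: "labelled R a b"
      and a: "\<forall>i p. Vtx i p \<in> sources R \<longrightarrow> a (Vtx i p) = D i"
      and b: "\<forall>i q. Vtx i q \<in> targets R \<longrightarrow> b (Vtx i q) = D i"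
    obtain l where l: "invariant \<Gamma> gs l" "\<And>s. s \<in> sources R \<Longrightarrow> l (Src s) = a s" "\<And>t. l (Tgt t) = b t"
      using extend_labels[OF lab] by blast
    define P where "P i c \<longleftrightarrow> (\<forall>s\<in>sources (gs ! i). l (inner_src i (off gs i) s) = c) \<and>
        (\<forall>t\<in>targets (gs ! i). l (inner_tgt i (off gs i) t) = c) \<and>
        (\<forall>j<length (verts (gs ! i)). D (off gs i + j) = c)" for i c
    have "\<exists>c. P i c" if i: "i < length gs" for i
      unfolding P_def
      using mono(2)[OF i, unfolded monochrome_def, rule_format,
          of "l \<circ> inner_src i (off gs i)" "l \<circ> inner_tgt i (off gs i)" "\<lambda>j. D (off gs i + j)"]
        l i a b by (auto simp: invariant_iff off_less verts_concat_nth)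
    then obtain c where "\<And>i. i < length gs \<Longrightarrow> P i (c i)" by metis
    then have c: "\<And>i s. i < length gs \<Longrightarrow> s \<in> sources (gs ! i) \<Longrightarrow> l (inner_src i (off gs i) s) = c i"
        "\<And>i s. i < length gs \<Longrightarrow> s \<in> targets (gs ! i) \<Longrightarrow> l (inner_tgt i (off gs i) s) = c i"
        "\<And>i j. i < length gs \<Longrightarrow> j < length (verts (gs ! i)) \<Longrightarrow> D (off gs i + j) = c i"
      by (simp_all add: P_def)
    have "\<exists>c'. (\<forall>s\<in>sources \<Gamma>. l (outer_src s) = c') \<and> (\<forall>t\<in>targets \<Gamma>. l (outer_tgt t) = c') \<and>
        (\<forall>i<length (verts \<Gamma>). c i = c')"
    proof -
      have "l (JOut i p) = c i" if "Vtx i p \<in> sources \<Gamma>" for i p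
        using c(2)[of i "Ext p"] that by (auto simp: arity)
      moreover have "l (JIn i q) = c i" if "Vtx i q \<in> targets \<Gamma>" for i q
        using c(1)[of i "Ext q"] that by (auto simp: arity)
      ultimately show ?thesis
        using mono(1)[unfolded monochrome_def, rule_format, of "l \<circ> outer_src" "l \<circ> outer_tgt" c] l(1)
        by (auto simp: invariant_iff)
    qed
    then obtain c' where c': "\<And>s. s \<in> sources \<Gamma> \<Longrightarrow> l (outer_src s) = c'"
        "\<And>s. s \<in> targets \<Gamma> \<Longrightarrow> l (outer_tgt s) = c'" "\<And>i. i < length gs \<Longrightarrow> c i = c'"
      by (auto simp: arity)
    have 1: "a s = c'" if s: "s \<in> sources R" for s
    proof -
      have "Src s \<in> Src ` sources R \<union> joints" using s by auto
      then have "l (Src s) = c'" by (cases rule: src_cases) (use c c' in auto)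
      then show ?thesis using l(2)[OF s] by simp
    qed
    have 2: "b t = c'" if t: "t \<in> targets R" for t
    proof -
      have "Tgt t \<in> Tgt ` targets R \<union> joints" using t by auto
      then have "l (Tgt t) = c'" by (cases rule: tgt_cases) (use c c' in auto)
      then show ?thesis using l(3) by simp
    qed
    have 3: "D k = c'" if "k < length (verts R)" for k
      using that by (auto elim!: off_cases simp: c c')
    show "\<exists>c. (\<forall>s\<in>sources R. a s = c) \<and> (\<forall>t\<in>targets R. b t = c) \<and> (\<forall>i<length (verts R). D i = c)"
      using 1 2 3 by (intro exI[of _ c']) (simp del: subst_graph_sel)
  qed
  moreover have "verts R \<noteq> [] \<or> gin R > 0"
  proof (rule ccontr)
    assume e: "\<not> ?thesis"
    then have "verts \<Gamma> \<noteq> []" using ne(1) by auto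
    then have 0: "0 < length gs" using arity by auto
    then have "verts (gs ! 0) = []" using e by auto
    then have "gin (gs ! 0) > 0" using ne(2)[OF 0] by auto
    then have "\<exists>!x. x \<in> Src ` sources R \<and> (x, JIn 0 0) \<in> W\<^sup>+" using 0 by (intro backward_end) auto
    then obtain s where "s \<in> sources R" by blast
    moreover have "sources R = {}" using e by (auto simp: sources_def simp del: subst_graph_sel)
    ultimately show False by simp
  qed
  ultimately show ?thesis using R_acyclic_wired by (simp add: wf_graph_monochrome)
qed


section \<open>Relabelling ports\<close>

text \<open>The permutations of the legs, of the vertices and of the legs of a vertex all rename the ports
  bijectively, keeping external ports external.\<close>

lemma wf_relabel:
  assumes g: "wf_graph g" and e: "edges g' = map_prod f h ` edges g"
    and f: "bij_betw f (sources g) (sources g')" and h: "bij_betw h (targets g) (targets g')"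
    and \<pi>: "bij_betw \<pi> {..<length (verts g)} {..<length (verts g')}"
    and fV: "\<And>i p. Vtx i p \<in> sources g \<Longrightarrow> \<exists>p'. f (Vtx i p) = Vtx (\<pi> i) p'"
    and hV: "\<And>i p. Vtx i p \<in> targets g \<Longrightarrow> \<exists>p'. h (Vtx i p) = Vtx (\<pi> i) p'"
    and fE: "\<And>j. \<exists>j'. f (Ext j) = Ext j'" and hE: "\<And>j. \<exists>j'. h (Ext j) = Ext j'"
  shows "wf_graph g'"
proof -
  have w: "wired g" and ac: "acyclic (steps g)" and m: "monochrome g" and ne: "verts g \<noteq> [] \<or> gin g > 0"
    using g by (auto simp: wf_graph_monochrome acyclic_wired_def)
  note bd = boundedD[OF wired_bounded[OF w]]
  have fi: "s = s'" if "f s = f s'" "s \<in> sources g" "s' \<in> sources g" for s s'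
    using f that by (auto simp: bij_betw_def inj_on_def)
  have hi: "s = s'" if "h s = h s'" "s \<in> targets g" "s' \<in> targets g" for s s'
    using h that by (auto simp: bij_betw_def inj_on_def)
  have fim: "s \<in> sources g' \<longleftrightarrow> (\<exists>r\<in>sources g. s = f r)" for s using f by (auto simp: bij_betw_def)
  have him: "s \<in> targets g' \<longleftrightarrow> (\<exists>r\<in>targets g. s = h r)" for s using h by (auto simp: bij_betw_def)
  have len: "length (verts g) = length (verts g')" using bij_betw_same_card[OF \<pi>] by simp
  have ed: "(x, y) \<in> edges g' \<longleftrightarrow> (\<exists>s t. (s, t) \<in> edges g \<and> x = f s \<and> y = h t)" for x y
    using e by auto
  have w': "wired g'"
    unfolding wired_def
  proof (intro conjI ballI)
    show "edges g' \<subseteq> sources g' \<times> targets g'"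
      using bd by (auto simp: e fim him; blast)
    show "\<exists>!t. (s, t) \<in> edges g'" if s: "s \<in> sources g'" for s
    proof -
      obtain r where r: "r \<in> sources g" "s = f r" using s fim by auto
      obtain t where t: "(r, t) \<in> edges g" using wired_target_ex[OF w r(1)] by auto
      show ?thesis
      proof
        show "(s, h t) \<in> edges g'" using ed r t by auto
        show "y = h t" if "(s, y) \<in> edges g'" for y
          using that r t fi bd wired_target_unique[OF w] unfolding ed by metis
      qed
    qed
    show "\<exists>!s. (s, t) \<in> edges g'" if t: "t \<in> targets g'" for t
    proof -
      obtain r where r: "r \<in> targets g" "t = h r" using t him by auto
      obtain s where s: "(s, r) \<in> edges g" using wired_source_ex[OF w r(1)] by auto
      show ?thesis
      proof
        show "(f s, t) \<in> edges g'" using ed r s by auto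
        show "y = f s" if "(y, t) \<in> edges g'" for y
          using that r s hi bd wired_source_unique[OF w] unfolding ed by metis
      qed
    qed
  qed
  obtain r where r: "ranked g r" using acyclic_ranked[OF wired_bounded[OF w] ac] by blast
  define \<rho> where "\<rho> = the_inv_into {..<length (verts g)} \<pi>"
  have \<rho>: "\<rho> (\<pi> i) = i" if "i < length (verts g)" for i
    using \<pi> that unfolding \<rho>_def by (intro the_inv_into_f_f) (auto simp: bij_betw_def)
  have "ranked g' (r \<circ> \<rho>)"
    unfolding ranked_def
  proof clarify
    fix i' j' assume "(i', j') \<in> steps g'"
    then obtain p' q' s t where st: "(s, t) \<in> edges g" "f s = Vtx i' p'" "h t = Vtx j' q'"
      by (auto simp: steps_def ed) metis
    obtain i p where s: "s = Vtx i p" using st(2) fE by (cases s) (auto, metis port.distinct(1))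
    obtain j q where t: "t = Vtx j q" using st(3) hE by (cases t) (auto, metis port.distinct(1))
    have "i' = \<pi> i" "j' = \<pi> j" using fV hV bd[OF st(1)] st(2,3) unfolding s t by (metis port.inject(2))+
    moreover have "(i, j) \<in> steps g" using st(1) s t by (auto simp: steps_def)
    ultimately show "(r \<circ> \<rho>) j' < (r \<circ> \<rho>) i'"
      using r \<rho> bd[OF st(1)] by (auto simp: s t ranked_def)
  qed
  then have "acyclic (steps g')" by (rule ranked_acyclic)
  moreover have "monochrome g'"
    unfolding monochrome_def
  proof (intro allI impI)
    fix a b :: "port \<Rightarrow> bool" and D :: "nat \<Rightarrow> bool"
    assume lab: "labelled g' a b"
      and a: "\<forall>i p. Vtx i p \<in> sources g' \<longrightarrow> a (Vtx i p) = D i"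
      and b: "\<forall>i q. Vtx i q \<in> targets g' \<longrightarrow> b (Vtx i q) = D i"
    have "labelled g (a \<circ> f) (b \<circ> h)" using lab by (auto simp: labelled_def e)
    moreover have "(a \<circ> f) (Vtx i p) = (D \<circ> \<pi>) i" if ip: "Vtx i p \<in> sources g" for i p
    proof -
      obtain p' where p': "f (Vtx i p) = Vtx (\<pi> i) p'" using fV[OF ip] by blast
      have "f (Vtx i p) \<in> sources g'" using fim ip by blast
      then show ?thesis using a p' by simp
    qed
    moreover have "(b \<circ> h) (Vtx i p) = (D \<circ> \<pi>) i" if ip: "Vtx i p \<in> targets g" for i p
    proof -
      obtain p' where p': "h (Vtx i p) = Vtx (\<pi> i) p'" using hV[OF ip] by blast
      have "h (Vtx i p) \<in> targets g'" using him ip by blast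
      then show ?thesis using b p' by simp
    qed
    ultimately obtain c where c: "\<forall>s\<in>sources g. (a \<circ> f) s = c" "\<forall>t\<in>targets g. (b \<circ> h) t = c"
        "\<forall>i<length (verts g). (D \<circ> \<pi>) i = c"
      using m[unfolded monochrome_def, rule_format, of "a \<circ> f" "b \<circ> h" "D \<circ> \<pi>"] by blast
    have "\<forall>i<length (verts g'). D i = c"
    proof (intro allI impI)
      fix i assume "i < length (verts g')"
      then have "i \<in> \<pi> ` {..<length (verts g)}" using \<pi> by (simp add: bij_betw_def)
      then obtain j where "j < length (verts g)" "i = \<pi> j" by auto
      then show "D i = c" using c(3) by auto
    qed
    moreover have "\<forall>s\<in>sources g'. a s = c" using c(1) fim by (metis comp_apply)
    moreover have "\<forall>t\<in>targets g'. b t = c" using c(2) him by (metis comp_apply)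
    ultimately show "\<exists>c. (\<forall>s\<in>sources g'. a s = c) \<and> (\<forall>t\<in>targets g'. b t = c) \<and> (\<forall>i<length (verts g'). D i = c)"
      by (intro exI[of _ c] conjI)
  qed
  moreover have "verts g' \<noteq> [] \<or> gin g' > 0"
  proof (cases "verts g = []")
    case True
    then have "Ext 0 \<in> sources g" using ne by simp
    then have "f (Ext 0) \<in> sources g'" using fim by auto
    then show ?thesis using fE[of 0] by auto
  qed (use len in auto)
  ultimately show ?thesis using w' by (simp add: wf_graph_monochrome acyclic_wired_def)
qed

section \<open>Identities between substitutions\<close>

lemma labelled_cong:
  assumes "bounded_edges g" "labelled g a b"
    and "\<And>s. s \<in> sources g \<Longrightarrow> a' s = a s" "\<And>t. t \<in> targets g \<Longrightarrow> b' t = b t"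
  shows "labelled g a' b'"
  unfolding labelled_def
proof clarify
  fix s t assume st: "(s, t) \<in> edges g"
  show "a' s = b' t"
    using labelledD[OF assms(2) st] assms(3,4) boundedD[OF assms(1) st] by simp
qed

lemma concat_map_nested: "concat (map (\<lambda>xs. concat (map f xs)) xss) = concat (map f (concat xss))"
  by (induction xss) auto

lemma take_concat:
  "i < length xss \<Longrightarrow> j \<le> length (xss ! i) \<Longrightarrow>
   take (sum_list (take i (map length xss)) + j) (concat xss) = concat (take i xss) @ take j (xss ! i)"
proof (induction xss arbitrary: i)
  case (Cons xs xss)
  then show ?case by (cases i) (auto simp: add.assoc)
qed simp

lemma off_take: "off gs i = length (concat (map verts (take i gs)))"
  by (simp add: off_def length_concat take_map o_def)

text \<open>Each wire of the right-hand graph is labelled by its end. The label extends to the junctions of the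
  outer substitution on the right, and then to those of the inner ones (\<open>l1\<close>, \<open>l2\<close>). Together these
  are labels for both substitutions on the left (\<open>l3\<close>, \<open>l4\<close>), so the wires of the left-hand graph
  have ends with equal labels.\<close>

lemma subst_graph_assoc:
  fixes \<Gamma> :: "'x dgraph" and gs :: "'y dgraph list" and hss :: "'e dgraph list list"
  assumes \<Gamma>: "acyclic_wired \<Gamma>" and gs: "\<And>i. i < length gs \<Longrightarrow> acyclic_wired (gs ! i)"
    and fit: "fits \<Gamma> gs" and len: "length hss = length gs"
    and fit2: "\<And>i. i < length gs \<Longrightarrow> fits (gs ! i) (hss ! i)"
    and hs: "\<And>i j. i < length gs \<Longrightarrow> j < length (hss ! i) \<Longrightarrow> acyclic_wired (hss ! i ! j)"
  shows "subst_graph (subst_graph \<Gamma> gs) (concat hss) = subst_graph \<Gamma> (map2 subst_graph gs hss)"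
proof -
  define Hs where "Hs = map2 subst_graph gs hss"
  have lenH: "length Hs = length gs" by (simp add: Hs_def len)
  have nthH: "Hs ! i = subst_graph (gs ! i) (hss ! i)" if "i < length gs" for i
    using that by (simp add: Hs_def len)
  have subi: "substitution (gs ! i) (hss ! i)" if "i < length gs" for i
    using that gs hs fit2 by unfold_locales auto
  have lenv: "length (verts (gs ! i)) = length (hss ! i)" if "i < length gs" for i
    using fit2[OF that] by (auto simp: fits_def dest: list_all2_lengthD)
  interpret O: substitution \<Gamma> gs using \<Gamma> gs fit by unfold_locales auto
  have "fits \<Gamma> Hs" using fit by (auto simp: fits_def list_all2_conv_all_nth lenH nthH)
  then interpret H: substitution \<Gamma> Hs
    using \<Gamma> substitution.R_acyclic_wired[OF subi] by unfold_locales (auto simp: lenH nthH)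
  have mlen: "map (\<lambda>g. length (verts g)) gs = map length hss"
    using len lenv by (intro nth_equalityI) auto
  have idx: "concat hss ! (off gs i + j) = hss ! i ! j" "off gs i + j < length (concat hss)"
    if "i < length gs" "j < length (hss ! i)" for i j
    using concat_nth_sum[of i hss j] sum_take_less[of i "map length hss" j] that len
    by (auto simp: off_def mlen length_concat)
  have idx_ex: "\<exists>i j. i < length gs \<and> j < length (hss ! i) \<and> k = off gs i + j" if k: "k < length (concat hss)" for k
  proof -
    have "k < sum_list (map length hss)" using k by (simp add: length_concat)
    then obtain i j where "i < length (map length hss)" "j < map length hss ! i"
        "k = sum_list (take i (map length hss)) + j"
      by (rule block_cases)
    then show ?thesis using len by (auto simp: off_def mlen)
  qed
  have off2: "off (concat hss) (off gs i + j) = off Hs i + off (hss ! i) j"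
    if "i < length gs" "j < length (hss ! i)" for i j
  proof -
    have "take i (map verts Hs) = map (\<lambda>hs. concat (map verts hs)) (take i hss)"
      using that(1) len lenH by (intro nth_equalityI) (auto simp: nthH)
    then have "off Hs i = length (concat (map verts (concat (take i hss))))"
      by (simp add: off_take take_map concat_map_nested)
    moreover have "take (off gs i + j) (concat hss) = concat (take i hss) @ take j (hss ! i)"
      using that len by (simp add: off_def mlen take_concat)
    ultimately show ?thesis by (simp add: off_take)
  qed
  have fitK: "fits (subst_graph \<Gamma> gs) (concat hss)"
    unfolding fits_def list_all2_conv_all_nth
  proof (intro conjI allI impI)
    show "length (concat hss) = length (verts (subst_graph \<Gamma> gs))"
      by (simp add: length_concat mlen[symmetric] o_def)
    fix k assume "k < length (concat hss)"
    then obtain i j where ij: "i < length gs" "j < length (hss ! i)" "k = off gs i + j" using idx_ex by blast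
    then show "gout (concat hss ! k) = outs (verts (subst_graph \<Gamma> gs) ! k)"
      "gin (concat hss ! k) = ins (verts (subst_graph \<Gamma> gs) ! k)"
      using fit2[OF ij(1)] lenv[OF ij(1)]
      by (auto simp: idx verts_concat_nth fits_def list_all2_conv_all_nth)
  qed
  have awK: "acyclic_wired (concat hss ! k)" if "k < length (concat hss)" for k
    using idx_ex[OF that] hs by (auto simp: idx)
  interpret K: substitution "subst_graph \<Gamma> gs" "concat hss"
    using O.R_acyclic_wired awK fitK by unfold_locales auto
  obtain l1 where l1: "invariant \<Gamma> Hs l1" "\<And>s. s \<in> sources H.R \<Longrightarrow> l1 (Src s) = end_of H.R s"
      "\<And>t. l1 (Tgt t) = t"
    using H.extend_labels[OF labelled_end_of[OF H.R_wired]] by auto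
  have "\<exists>l. invariant (gs ! i) (hss ! i) l \<and>
      (\<forall>s\<in>sources (Hs ! i). l (Src s) = l1 (inner_src i (off Hs i) s)) \<and>
      (\<forall>t. l (Tgt t) = l1 (inner_tgt i (off Hs i) t))" if i: "i < length gs" for i
  proof -
    have "labelled (Hs ! i) (l1 \<circ> inner_src i (off Hs i)) (l1 \<circ> inner_tgt i (off Hs i))"
      using l1(1) i by (simp add: invariant_iff lenH)
    then show ?thesis
      using substitution.extend_labels[OF subi[OF i]] unfolding nthH[OF i] by (metis comp_apply)
  qed
  then obtain l2 where l2: "\<And>i. i < length gs \<Longrightarrow> invariant (gs ! i) (hss ! i) (l2 i) \<and>
      (\<forall>s\<in>sources (Hs ! i). l2 i (Src s) = l1 (inner_src i (off Hs i) s)) \<and>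
      (\<forall>t. l2 i (Tgt t) = l1 (inner_tgt i (off Hs i) t))" by metis
  define A where "A s = (case s of Ext j \<Rightarrow> l1 (Src s) | Vtx k p \<Rightarrow> (let (i, j) = locus gs k in l2 i (JOut j p)))" for s
  define B where "B s = (case s of Ext j \<Rightarrow> l1 (Tgt s) | Vtx k p \<Rightarrow> (let (i, j) = locus gs k in l2 i (JIn j p)))" for s
  define l3 where "l3 x = (case x of Src s \<Rightarrow> A s | Tgt t \<Rightarrow> B t | _ \<Rightarrow> l1 x)" for x
  define l4 where "l4 x = (case x of JIn k q \<Rightarrow> B (Vtx k q) | JOut k p \<Rightarrow> A (Vtx k p) | _ \<Rightarrow> l1 x)" for x
  have "invariant \<Gamma> gs l3"
    unfolding invariant_iff
  proof (intro conjI allI impI)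
    have 1: "l3 \<circ> outer_src = l1 \<circ> outer_src"
    proof
      show "(l3 \<circ> outer_src) s = (l1 \<circ> outer_src) s" for s by (cases s) (auto simp: l3_def A_def)
    qed
    have 2: "l3 \<circ> outer_tgt = l1 \<circ> outer_tgt"
    proof
      show "(l3 \<circ> outer_tgt) s = (l1 \<circ> outer_tgt) s" for s by (cases s) (auto simp: l3_def B_def)
    qed
    show "labelled \<Gamma> (l3 \<circ> outer_src) (l3 \<circ> outer_tgt)"
      using l1(1) unfolding 1 2 invariant_iff by blast
    fix i assume i: "i < length gs"
    have "labelled (gs ! i) (l2 i \<circ> outer_src) (l2 i \<circ> outer_tgt)"
      using l2[OF i] unfolding invariant_iff by blast
    then show "labelled (gs ! i) (l3 \<circ> inner_src i (off gs i)) (l3 \<circ> inner_tgt i (off gs i))"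
    proof (rule labelled_cong[OF wired_bounded[OF O.inner_wired[OF i]]])
      fix s assume "s \<in> sources (gs ! i)"
      then show "(l3 \<circ> inner_src i (off gs i)) s = (l2 i \<circ> outer_src) s"
        using l2[OF i] i by (cases s) (auto simp: l3_def A_def nthH)
    next
      fix s assume "s \<in> targets (gs ! i)"
      then show "(l3 \<circ> inner_tgt i (off gs i)) s = (l2 i \<circ> outer_tgt) s"
        using l2[OF i] i by (cases s) (auto simp: l3_def B_def nthH)
    qed
  qed
  from invariant_labelled[OF this] have AB: "labelled (subst_graph \<Gamma> gs) A B"
    by (simp add: l3_def o_def)
  have "invariant (subst_graph \<Gamma> gs) (concat hss) l4"
    unfolding invariant_iff
  proof (intro conjI allI impI)
    have 1: "l4 \<circ> outer_src = A"
    proof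
      show "(l4 \<circ> outer_src) s = A s" for s by (cases s) (auto simp: l4_def A_def)
    qed
    have 2: "l4 \<circ> outer_tgt = B"
    proof
      show "(l4 \<circ> outer_tgt) s = B s" for s by (cases s) (auto simp: l4_def B_def)
    qed
    show "labelled (subst_graph \<Gamma> gs) (l4 \<circ> outer_src) (l4 \<circ> outer_tgt)"
      using AB unfolding 1 2 .
    fix k assume "k < length (concat hss)"
    then obtain i j where i: "i < length gs" and j: "j < length (hss ! i)" and k: "k = off gs i + j"
      using idx_ex by blast
    have lo: "locus gs k = (i, j)" using i j k lenv by simp
    have "labelled (hss ! i ! j) (l2 i \<circ> inner_src j (off (hss ! i) j)) (l2 i \<circ> inner_tgt j (off (hss ! i) j))"
      using l2[OF i] j unfolding invariant_iff by blast
    then have "labelled (hss ! i ! j) (l4 \<circ> inner_src k (off (concat hss) k)) (l4 \<circ> inner_tgt k (off (concat hss) k))"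
    proof (rule labelled_cong[rotated])
      show "bounded_edges (hss ! i ! j)"
        using hs[OF i j] by (simp add: acyclic_wired_def wired_bounded)
      fix s assume s: "s \<in> sources (hss ! i ! j)"
      show "(l4 \<circ> inner_src k (off (concat hss) k)) s = (l2 i \<circ> inner_src j (off (hss ! i) j)) s"
      proof (cases s)
        case (Vtx l p)
        have "Vtx (off (hss ! i) j + l) p \<in> sources (Hs ! i)"
          using s Vtx i j by (simp add: nthH verts_concat_nth off_less)
        then show ?thesis using l2[OF i] Vtx by (simp add: l4_def k off2[OF i j] add.assoc)
      qed (simp add: l4_def A_def B_def lo)
    next
      fix s assume s: "s \<in> targets (hss ! i ! j)"
      show "(l4 \<circ> inner_tgt k (off (concat hss) k)) s = (l2 i \<circ> inner_tgt j (off (hss ! i) j)) s"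
      proof (cases s)
        case (Vtx l p)
        then show ?thesis using l2[OF i] by (simp add: l4_def k off2[OF i j] add.assoc)
      qed (simp add: l4_def A_def B_def lo)
    qed
    then show "labelled (concat hss ! k) (l4 \<circ> inner_src k (off (concat hss) k)) (l4 \<circ> inner_tgt k (off (concat hss) k))"
      using idx(1)[OF i j] k by simp
  qed
  from invariant_labelled[OF this] have lab: "labelled K.R (\<lambda>s. l1 (Src s)) (\<lambda>t. t)"
    by (simp add: l4_def o_def l1(3))
  have "concat (map verts (concat hss)) = concat (map verts Hs)"
  proof -
    have "map verts Hs = map (\<lambda>hs. concat (map verts hs)) hss"
      using len lenH by (intro nth_equalityI) (auto simp: nthH)
    then show ?thesis by (simp only: concat_map_nested)
  qed
  then show ?thesis
    unfolding Hs_def[symmetric]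
    using l1(2) wired_target_ex[OF H.R_wired] end_of_eq[OF H.R_wired]
    by (intro wired_label_eq[OF H.R_wired wired_total[OF K.R_wired] wired_bounded[OF K.R_wired] lab])
      (simp_all, metis)
qed

lemma acyclic_corolla: "acyclic_wired (corolla v)"
proof -
  have "steps (corolla v) = {}" by (auto simp: steps_def corolla_def)
  moreover have "wired (corolla v)"
    by (auto simp: wired_def sources_def targets_def corolla_def)
  ultimately show ?thesis by (simp add: acyclic_wired_def acyclic_def)
qed

lemma corolla_sel [simp]:
  "verts (corolla v) = [v]" "gout (corolla v) = outs v" "gin (corolla v) = ins v"
  by (simp_all add: corolla_def)

lemma wf_corolla: "wf_graph (corolla v)"
  using acyclic_corolla[of v] by (auto simp: wf_graph_def acyclic_wired_def connected_graph_def corolla_def)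

lemma off_corollas: "i \<le> length vs \<Longrightarrow> off (map corolla vs) i = i"
  by (simp add: off_take take_map concat_map_singleton o_def)

text \<open>Substituting corollas only changes the decorations.\<close>

lemma subst_corollas:
  assumes \<Gamma>: "acyclic_wired \<Gamma>" and ar: "list_all2 (\<lambda>v w. outs v = outs w \<and> ins v = ins w) vs (verts \<Gamma>)"
  shows "subst_graph \<Gamma> (map corolla vs) = DGraph (gout \<Gamma>) (gin \<Gamma>) vs (edges \<Gamma>)"
    (is "?L = ?R")
proof -
  interpret substitution \<Gamma> "map corolla vs"
    using \<Gamma> ar by unfold_locales (auto simp: acyclic_corolla fits_def list_all2_conv_all_nth)
  have w: "wired \<Gamma>" by (rule outer_wired)
  have src: "sources ?R = sources \<Gamma>" "targets ?R = targets \<Gamma>"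
    using ar by (auto simp: sources_def targets_def list_all2_conv_all_nth)
  have wR: "wired ?R" using w unfolding wired_def src by simp
  define l where "l x = (case x of Src s \<Rightarrow> end_of \<Gamma> s | Tgt t \<Rightarrow> t
      | JIn i q \<Rightarrow> Vtx i q | JOut i p \<Rightarrow> end_of \<Gamma> (Vtx i p))" for x
  have "invariant \<Gamma> (map corolla vs) l"
    unfolding invariant_iff
  proof (intro conjI allI impI)
    show "labelled \<Gamma> (l \<circ> outer_src) (l \<circ> outer_tgt)"
    proof (rule labelled_cong[OF wired_bounded[OF w] labelled_end_of[OF w]])
      show "(l \<circ> outer_src) s = end_of \<Gamma> s" for s by (cases s) (auto simp: l_def)
      show "(l \<circ> outer_tgt) s = id s" for s by (cases s) (auto simp: l_def)
    qed
    show "labelled (map corolla vs ! i) (l \<circ> inner_src i (off (map corolla vs) i))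
        (l \<circ> inner_tgt i (off (map corolla vs) i))" if "i < length (map corolla vs)" for i
      using that by (auto simp: labelled_def corolla_def off_corollas l_def)
  qed
  from invariant_labelled[OF this] have lab: "labelled ?L (end_of \<Gamma>) (\<lambda>t. t)"
    by (simp add: l_def o_def)
  show ?thesis
    using wired_target_ex[OF w] end_of_eq[OF w]
    by (intro wired_label_eq[OF wR wired_total[OF R_wired] wired_bounded[OF R_wired] lab])
      (auto simp: src concat_map_singleton o_def simp del: in_sources in_targets)
qed

lemma subst_corollas_id: "acyclic_wired \<Gamma> \<Longrightarrow> subst_graph \<Gamma> (map corolla (verts \<Gamma>)) = \<Gamma>"
  by (subst subst_corollas) (auto simp: list_all2_same)

lemma act_graph_sel [simp]:
  "verts (act_graph \<sigma> \<tau> g) = verts g" "gout (act_graph \<sigma> \<tau> g) = gout g" "gin (act_graph \<sigma> \<tau> g) = gin g"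
  "edges (act_graph \<sigma> \<tau> g) = map_prod (move_ext (inv \<tau>)) (move_ext \<sigma>) ` edges g"
  by (simp_all add: act_graph_def)

lemma bij_move_sources:
  assumes "\<tau> permutes {..<gin g}" shows "bij_betw (move_ext (inv \<tau>)) (sources g) (sources g)"
proof (rule bij_betw_byWitness[where f' = "move_ext \<tau>"])
  have ip: "inv \<tau> permutes {..<gin g}" using assms by (rule permutes_inv)
  show "\<forall>s\<in>sources g. move_ext \<tau> (move_ext (inv \<tau>) s) = s" "\<forall>s\<in>sources g. move_ext (inv \<tau>) (move_ext \<tau> s) = s"
    using assms by (auto simp: sources_def permutes_inverses)
  show "move_ext (inv \<tau>) ` sources g \<subseteq> sources g" "move_ext \<tau> ` sources g \<subseteq> sources g"
    using permutes_in_image[OF ip] permutes_in_image[OF assms] by (auto simp: sources_def)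
qed

lemma bij_move_targets:
  assumes "\<sigma> permutes {..<gout g}" shows "bij_betw (move_ext \<sigma>) (targets g) (targets g)"
proof (rule bij_betw_byWitness[where f' = "move_ext (inv \<sigma>)"])
  have ip: "inv \<sigma> permutes {..<gout g}" using assms by (rule permutes_inv)
  show "\<forall>s\<in>targets g. move_ext (inv \<sigma>) (move_ext \<sigma> s) = s" "\<forall>s\<in>targets g. move_ext \<sigma> (move_ext (inv \<sigma>) s) = s"
    using assms by (auto simp: targets_def permutes_inverses)
  show "move_ext \<sigma> ` targets g \<subseteq> targets g" "move_ext (inv \<sigma>) ` targets g \<subseteq> targets g"
    using permutes_in_image[OF ip] permutes_in_image[OF assms] by (auto simp: targets_def)
qed

lemma wf_act_graph:
  assumes "wf_graph g" "\<sigma> permutes {..<gout g}" "\<tau> permutes {..<gin g}"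
  shows "wf_graph (act_graph \<sigma> \<tau> g)"
proof -
  have "sources (act_graph \<sigma> \<tau> g) = sources g" "targets (act_graph \<sigma> \<tau> g) = targets g"
    by (simp_all add: sources_def targets_def)
  then show ?thesis
    using bij_move_sources[OF assms(3)] bij_move_targets[OF assms(2)]
    by (intro wf_relabel[OF assms(1), where f = "move_ext (inv \<tau>)" and h = "move_ext \<sigma>" and \<pi> = id]) auto
qed

lemma act_graph_subst:
  assumes g: "wf_graph g" and \<sigma>: "\<sigma> permutes {..<gout g}" and \<tau>: "\<tau> permutes {..<gin g}"
    and v: "outs v = gout g" "ins v = gin g"
  shows "subst_graph (act_graph \<sigma> \<tau> (corolla v)) [g] = act_graph \<sigma> \<tau> g" (is "?L = ?R")
proof -
  have wa: "wf_graph (act_graph \<sigma> \<tau> (corolla v))" using wf_act_graph[OF wf_corolla[of v]] \<sigma> \<tau> v by auto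
  interpret substitution "act_graph \<sigma> \<tau> (corolla v)" "[g]"
    using wa g v by unfold_locales (auto simp: fits_def wf_graph_acyclic_wired)
  have w: "wired g" using g by (auto simp: wf_graph_def)
  have w': "wired ?R" using wf_act_graph[OF g \<sigma> \<tau>] by (auto simp: wf_graph_def)
  define l where "l x = (case x of
      Src s \<Rightarrow> end_of g (move_ext \<tau> s) | Tgt t \<Rightarrow> move_ext (inv \<sigma>) t
    | JIn i q \<Rightarrow> end_of g (Ext q) | JOut i p \<Rightarrow> Ext p)" for x
  have "invariant (act_graph \<sigma> \<tau> (corolla v)) [g] l"
    unfolding invariant_iff
  proof (intro conjI allI impI)
    show "labelled (act_graph \<sigma> \<tau> (corolla v)) (l \<circ> outer_src) (l \<circ> outer_tgt)"
      using permutes_inverses[OF \<sigma>] permutes_inverses[OF \<tau>]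
      by (auto simp: labelled_def corolla_def act_graph_def l_def)
    fix i assume "i < length [g]"
    then have i: "i = 0" by simp
    have "labelled g (l \<circ> inner_src 0 0) (l \<circ> inner_tgt 0 0)"
    proof (rule labelled_cong[OF wired_bounded[OF w] labelled_end_of[OF w]])
      show "(l \<circ> inner_src 0 0) s = end_of g s" for s by (cases s) (auto simp: l_def)
      show "(l \<circ> inner_tgt 0 0) s = id s" for s by (cases s) (auto simp: l_def)
    qed
    then show "labelled ([g] ! i) (l \<circ> inner_src i (off [g] i)) (l \<circ> inner_tgt i (off [g] i))"
      by (simp add: i off_def)
  qed
  from invariant_labelled[OF this] have lab: "labelled ?L (\<lambda>s. end_of g (move_ext \<tau> s)) (move_ext (inv \<sigma>))"
    by (simp add: l_def o_def)
  show ?thesis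
  proof (rule wired_label_eq[OF w' wired_total[OF R_wired] wired_bounded[OF R_wired] lab])
    fix s t assume s: "s \<in> sources ?R" and t: "t \<in> targets ?R"
      and eq: "end_of g (move_ext \<tau> s) = move_ext (inv \<sigma>) t"
    have "move_ext \<tau> s \<in> sources g" using s permutes_in_image[OF \<tau>] by (cases s) auto
    then have "(move_ext \<tau> s, move_ext (inv \<sigma>) t) \<in> edges g"
      using wired_target_ex[OF w] end_of_eq[OF w] eq by metis
    moreover have "move_ext (inv \<tau>) (move_ext \<tau> s) = s"
      using permutes_inverses[OF \<tau>] by (cases s) simp_all
    moreover have "move_ext \<sigma> (move_ext (inv \<sigma>) t) = t"
      using permutes_inverses[OF \<sigma>] by (cases t) simp_all
    ultimately show "(s, t) \<in> edges ?R" by force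
  qed (use v in simp_all)
qed

section \<open>Reordering vertices and permuting their legs\<close>

lemma permute_vertices_sel [simp]:
  "gout (permute_vertices \<pi> g) = gout g" "gin (permute_vertices \<pi> g) = gin g"
  "verts (permute_vertices \<pi> g) = permute_list (inv \<pi>) (verts g)"
  "edges (permute_vertices \<pi> g) = map_prod (move_vertex \<pi>) (move_vertex \<pi>) ` edges g"
  by (simp_all add: permute_vertices_def)

lemma permutes_lessThan: "\<pi> permutes {..<n} \<Longrightarrow> \<pi> i < n \<longleftrightarrow> i < (n::nat)"
  using permutes_in_image[of \<pi> "{..<n}" i] by simp

lemma verts_permuted:
  assumes "\<pi> permutes {..<length xs}" "i < length xs"
  shows "permute_list (inv \<pi>) xs ! \<pi> i = xs ! i"
  using assms permutes_lessThan[OF assms(1)]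
  by (simp add: permute_list_nth permutes_inv permutes_inverses)

lemma in_permuted_sources:
  assumes "\<pi> permutes {..<length (verts g)}"
  shows "move_vertex \<pi> s \<in> sources (permute_vertices \<pi> g) \<longleftrightarrow> s \<in> sources g"
  using assms by (cases s) (auto simp: permutes_lessThan verts_permuted)

lemma in_permuted_targets:
  assumes "\<pi> permutes {..<length (verts g)}"
  shows "move_vertex \<pi> s \<in> targets (permute_vertices \<pi> g) \<longleftrightarrow> s \<in> targets g"
  using assms by (cases s) (auto simp: permutes_lessThan verts_permuted)

lemma move_vertex_inverse:
  assumes "\<pi> permutes S"
  shows "move_vertex (inv \<pi>) (move_vertex \<pi> s) = s" "move_vertex \<pi> (move_vertex (inv \<pi>) s) = s"
  using permutes_inverses[OF assms] by (cases s; simp)+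

lemma bij_move_vertex:
  assumes "\<pi> permutes {..<length (verts g)}"
  shows "bij_betw (move_vertex \<pi>) (sources g) (sources (permute_vertices \<pi> g))"
    "bij_betw (move_vertex \<pi>) (targets g) (targets (permute_vertices \<pi> g))"
proof -
  have *: "s = move_vertex \<pi> (move_vertex (inv \<pi>) s)" for s using move_vertex_inverse[OF assms] by simp
  show "bij_betw (move_vertex \<pi>) (sources g) (sources (permute_vertices \<pi> g))"
    by (rule bij_betw_byWitness[where f' = "move_vertex (inv \<pi>)"])
      (use in_permuted_sources[OF assms] move_vertex_inverse[OF assms] * in \<open>auto, metis\<close>)
  show "bij_betw (move_vertex \<pi>) (targets g) (targets (permute_vertices \<pi> g))"
    by (rule bij_betw_byWitness[where f' = "move_vertex (inv \<pi>)"])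
      (use in_permuted_targets[OF assms] move_vertex_inverse[OF assms] * in \<open>auto, metis\<close>)
qed

lemma wf_permute_vertices:
  assumes "wf_graph g" "\<pi> permutes {..<length (verts g)}"
  shows "wf_graph (permute_vertices \<pi> g)"
  using bij_move_vertex[OF assms(2)] assms(2)
  by (intro wf_relabel[OF assms(1), where f = "move_vertex \<pi>" and h = "move_vertex \<pi>" and \<pi> = \<pi>])
     (auto simp: permutes_imp_bij)

text \<open>The permutation of the vertices of a substitution that moves the blocks of vertices.\<close>

definition block_permutation :: "(nat \<Rightarrow> nat) \<Rightarrow> 'e dgraph list \<Rightarrow> nat \<Rightarrow> nat" where
  "block_permutation \<pi> gs k = (if k < length (concat (map verts gs))
     then (let (i, j) = locus gs k in off (permute_list (inv \<pi>) gs) (\<pi> i) + j) else k)"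

context
  fixes \<pi> :: "nat \<Rightarrow> nat" and gs :: "'e dgraph list"
  assumes \<pi>: "\<pi> permutes {..<length gs}"
begin

abbreviation "gs' \<equiv> permute_list (inv \<pi>) gs"
abbreviation "\<Xi> \<equiv> block_permutation \<pi> gs"

lemma block_permutation_off:
  "i < length gs \<Longrightarrow> j < length (verts (gs ! i)) \<Longrightarrow> \<Xi> (off gs i + j) = off gs' (\<pi> i) + j"
  by (simp add: block_permutation_def off_less)

lemma gs'_nth: "i < length gs \<Longrightarrow> gs' ! (\<pi> i) = gs ! i"
  by (rule verts_permuted[OF \<pi>])

lemma length_permuted: "length (concat (map verts gs')) = length (concat (map verts gs))"
proof -
  have "mset (map (\<lambda>g. length (verts g)) gs') = mset (map (\<lambda>g. length (verts g)) gs)"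
    using mset_permute_list[of "inv \<pi>" gs] permutes_inv[OF \<pi>] by (simp only: mset_map)
  then have "sum_list (map (\<lambda>g. length (verts g)) gs') = sum_list (map (\<lambda>g. length (verts g)) gs)"
    by (metis sum_mset_sum_list)
  then show ?thesis by (simp add: length_concat o_def)
qed

lemma block_permutes: "\<Xi> permutes {..<length (concat (map verts gs))}"
proof (rule bij_imp_permutes)
  let ?N = "length (concat (map verts gs))"
  have lt: "\<Xi> k < ?N" if k: "k < ?N" for k
  proof -
    obtain i j where ij: "i < length gs" "j < length (verts (gs ! i))" "k = off gs i + j"
      using off_cases[OF k] by blast
    then show ?thesis
      using off_less[of "\<pi> i" gs' j] by (simp add: block_permutation_off gs'_nth permutes_lessThan[OF \<pi>] length_permuted)
  qed
  have inj: "inj_on \<Xi> {..<?N}"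
  proof (rule inj_onI)
    fix k k' assume k: "k \<in> {..<?N}" "k' \<in> {..<?N}" and e: "\<Xi> k = \<Xi> k'"
    obtain i j where ij: "i < length gs" "j < length (verts (gs ! i))" "k = off gs i + j"
      using off_cases[of k gs] k by auto
    obtain i' j' where ij': "i' < length gs" "j' < length (verts (gs ! i'))" "k' = off gs i' + j'"
      using off_cases[of k' gs] k by auto
    have "\<pi> i = \<pi> i' \<and> j = j'"
      using e ij ij' by (intro off_inj[of gs']) (auto simp: block_permutation_off gs'_nth permutes_lessThan[OF \<pi>])
    then show "k = k'" using ij ij' permutes_inj[OF \<pi>] by (auto dest: injD)
  qed
  have "\<Xi> ` {..<?N} = {..<?N}"
    by (rule endo_inj_surj) (use lt inj in auto)
  then show "bij_betw \<Xi> {..<?N} {..<?N}" using inj by (simp add: bij_betw_def)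
  show "\<Xi> k = k" if "k \<notin> {..<?N}" for k using that by (simp add: block_permutation_def)
qed

text \<open>Reordering the vertices of the outer graph only moves the junctions, so labels are carried over by
  moving them along with their vertex.\<close>

lemma subst_permute_vertices:
  fixes \<Gamma> :: "'x dgraph"
  assumes \<Gamma>: "wf_graph \<Gamma>" and gs: "\<And>g. g \<in> set gs \<Longrightarrow> wf_graph g" and fit: "fits \<Gamma> gs"
  shows "subst_graph (permute_vertices \<pi> \<Gamma>) gs' = permute_vertices \<Xi> (subst_graph \<Gamma> gs)"
    (is "?L = ?R")
proof -
  have len: "length (verts \<Gamma>) = length gs" using fit by (auto simp: fits_def dest: list_all2_lengthD)
  have \<pi>\<Gamma>: "\<pi> permutes {..<length (verts \<Gamma>)}" using \<pi> len by simp
  have nth': "gs' ! i = gs ! inv \<pi> i" if "i < length gs" for i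
    using that permutes_inv[OF \<pi>] by (simp add: permute_list_nth)
  have ilt: "inv \<pi> i < length gs \<longleftrightarrow> i < length gs" for i using permutes_lessThan[OF permutes_inv[OF \<pi>]] by simp
  have pinv: "\<pi> (inv \<pi> i) = i" "inv \<pi> (\<pi> i) = i" for i using permutes_inverses[OF \<pi>] by auto
  interpret S: substitution \<Gamma> gs
    using \<Gamma> gs fit by unfold_locales (auto simp: wf_graph_acyclic_wired)
  have fit': "fits (permute_vertices \<pi> \<Gamma>) gs'"
    using fit ilt permutes_inv[OF \<pi>]
    by (auto simp: fits_def list_all2_conv_all_nth permute_list_nth len)
  have wfp: "wf_graph (permute_vertices \<pi> \<Gamma>)" by (rule wf_permute_vertices[OF \<Gamma> \<pi>\<Gamma>])
  interpret S': substitution "permute_vertices \<pi> \<Gamma>" gs'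
    using wfp gs fit' nth' ilt by unfold_locales (auto simp: wf_graph_acyclic_wired)
  have wfR: "wf_graph S.R" by (rule wf_subst_graph[OF \<Gamma> gs fit])
  have \<Xi>R: "\<Xi> permutes {..<length (verts S.R)}" using block_permutes by simp
  have wR: "wired ?R" using wf_permute_vertices[OF wfR \<Xi>R] by (simp only: wf_graph_def)
  obtain l where l: "invariant \<Gamma> gs l" "\<And>s. s \<in> sources S.R \<Longrightarrow> l (Src s) = end_of S.R s" "\<And>t. l (Tgt t) = t"
    using S.extend_labels[OF labelled_end_of[OF S.R_wired]] by auto
  define l' where "l' x = (case x of JIn i q \<Rightarrow> l (JIn (inv \<pi> i) q) | JOut i p \<Rightarrow> l (JOut (inv \<pi> i) p)
      | Src s \<Rightarrow> l (Src (move_vertex (inv \<Xi>) s)) | Tgt s \<Rightarrow> l (Tgt (move_vertex (inv \<Xi>) s)))" for x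
  have iP: "inv \<Xi> (off gs' (\<pi> i) + j) = off gs i + j" if "i < length gs" "j < length (verts (gs ! i))" for i j
    using block_permutation_off[OF that] permutes_inverses[OF block_permutes] by metis
  have "invariant (permute_vertices \<pi> \<Gamma>) gs' l'"
    unfolding invariant_iff
  proof (intro conjI allI impI)
    have lab: "labelled \<Gamma> (l \<circ> outer_src) (l \<circ> outer_tgt)" using l(1) by (simp add: invariant_iff)
    have 0: "l (outer_src s) = l (outer_tgt t)" if "(s, t) \<in> edges \<Gamma>" for s t
      using labelledD[OF lab that] by simp
    have 1: "l' (outer_src (move_vertex \<pi> s)) = l (outer_src s)" for s
      by (cases s) (auto simp: l'_def pinv)
    have 2: "l' (outer_tgt (move_vertex \<pi> s)) = l (outer_tgt s)" for s
      by (cases s) (auto simp: l'_def pinv)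
    show "labelled (permute_vertices \<pi> \<Gamma>) (l' \<circ> outer_src) (l' \<circ> outer_tgt)"
      by (auto simp: labelled_def 0 1 2)
    fix i' assume "i' < length gs'"
    then obtain i where i: "i < length gs" "i' = \<pi> i" using ilt pinv by (metis length_permute_list)
    have "labelled (gs ! i) (l \<circ> inner_src i (off gs i)) (l \<circ> inner_tgt i (off gs i))"
      using l(1) i by (simp add: invariant_iff)
    then have "labelled (gs ! i) (l' \<circ> inner_src i' (off gs' i')) (l' \<circ> inner_tgt i' (off gs' i'))"
    proof (rule labelled_cong[OF wired_bounded[OF S.inner_wired[OF i(1)]]])
      fix s assume "s \<in> sources (gs ! i)"
      then show "(l' \<circ> inner_src i' (off gs' i')) s = (l \<circ> inner_src i (off gs i)) s"
        using i by (cases s) (auto simp: l'_def pinv iP)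
    next
      fix s assume "s \<in> targets (gs ! i)"
      then show "(l' \<circ> inner_tgt i' (off gs' i')) s = (l \<circ> inner_tgt i (off gs i)) s"
        using i by (cases s) (auto simp: l'_def pinv iP)
    qed
    then show "labelled (gs' ! i') (l' \<circ> inner_src i' (off gs' i')) (l' \<circ> inner_tgt i' (off gs' i'))"
      using i gs'_nth by simp
  qed
  from invariant_labelled[OF this]
  have lab: "labelled ?L (\<lambda>s. l (Src (move_vertex (inv \<Xi>) s))) (move_vertex (inv \<Xi>))"
    by (simp add: l'_def o_def l(3))
  note mv = move_vertex_inverse[OF block_permutes]
  show ?thesis
  proof (rule wired_label_eq[OF wR wired_total[OF S'.R_wired] wired_bounded[OF S'.R_wired] lab])
    fix s t assume st: "s \<in> sources ?R" "t \<in> targets ?R"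
      and eq: "l (Src (move_vertex (inv \<Xi>) s)) = move_vertex (inv \<Xi>) t"
    have "move_vertex (inv \<Xi>) s \<in> sources S.R"
      using in_permuted_sources[OF \<Xi>R, of "move_vertex (inv \<Xi>) s"] st(1) unfolding mv by blast
    then have "(move_vertex (inv \<Xi>) s, move_vertex (inv \<Xi>) t) \<in> edges S.R"
      using wired_target_ex[OF S.R_wired] end_of_eq[OF S.R_wired] eq l(2) by metis
    then have "(move_vertex \<Xi> (move_vertex (inv \<Xi>) s), move_vertex \<Xi> (move_vertex (inv \<Xi>) t)) \<in> edges ?R"
      by (simp only: permute_vertices_sel) (rule image_eqI[rotated], auto)
    then show "(s, t) \<in> edges ?R" unfolding mv .
  next
    have "concat (map verts gs') ! k = concat (map verts gs) ! inv \<Xi> k" if k: "k < length (concat (map verts gs))" for k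
    proof -
      have "k < length (concat (map verts gs'))" using k length_permuted by simp
      then obtain i' j where i': "i' < length gs'" "j < length (verts (gs' ! i'))" "k = off gs' i' + j"
        by (rule off_cases)
      then obtain i where i: "i < length gs" "i' = \<pi> i" using ilt pinv by (metis length_permute_list)
      show ?thesis using i i' by (simp add: iP gs'_nth verts_concat_nth)
    qed
    then show "verts ?L = verts ?R"
      using permutes_inv[OF block_permutes] length_permuted
      by (intro nth_equalityI) (auto simp: permute_list_nth)
  qed simp_all
qed

text \<open>The Koszul sign of a permutation of blocks is the one of the total degrees of the blocks:
  pairs inside a block are never inverted.\<close>

lemma off_block_mono:
  assumes "i < j" "j < length hs" "a < length (verts (hs ! i))"
  shows "off hs i + a < off hs j"
proof -
  have "off hs (Suc i) \<le> off hs j"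
  proof -
    have "(\<Sum>k<Suc i. length (verts (hs ! k))) \<le> (\<Sum>k<j. length (verts (hs ! k)))"
      by (rule sum_mono2) (use assms(1) in auto)
    then show ?thesis using assms(1,2) by (simp only: off_sum less_imp_le Suc_leI)
  qed
  moreover have "off hs (Suc i) = off hs i + length (verts (hs ! i))"
    using assms by (simp add: off_sum[symmetric])
  ultimately show ?thesis using assms(3) by simp
qed

lemma off_less_iff:
  assumes "i < length hs" "j < length hs" "a < length (verts (hs ! i))" "b < length (verts (hs ! j))"
  shows "off hs i + a < off hs j + b \<longleftrightarrow> i < j \<or> i = j \<and> a < b"
proof (cases i j rule: linorder_cases)
  case less
  then show ?thesis using off_block_mono[of i j hs a] assms by auto
next
  case greater
  then show ?thesis using off_block_mono[of j i hs b] assms by auto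
qed auto

lemma parity_sign_add: "parity_sign (a + b) = (parity_sign a * parity_sign b :: 'k::field)"
  by (auto simp: parity_sign_def)

lemma parity_sign_0 [simp]: "parity_sign 0 = 1"
  by (simp add: parity_sign_def)

lemma parity_sign_sum: "finite A \<Longrightarrow> parity_sign (sum f A) = (\<Prod>a\<in>A. parity_sign (f a) :: 'k::field)"
  by (induction A rule: finite_induct) (auto simp: parity_sign_add)

lemma gdeg_sum: "gdeg g = (\<Sum>a<length (verts g). vdeg (verts g ! a))"
  by (simp add: gdeg_def sum_list_sum_nth atLeast0LessThan)

lemma koszul_block:
  "koszul \<Xi> (map vdeg (concat (map verts gs))) = (koszul \<pi> (map gdeg gs) :: 'k::field)"
proof -
  let ?N = "length (concat (map verts gs))" and ?len = "\<lambda>i. length (verts (gs ! i))"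
  let ?d = "\<lambda>i a. vdeg (verts (gs ! i) ! a)"
  define T where "T = {(i, j). i < j \<and> j < length gs \<and> \<pi> j < \<pi> i}"
  define U where "U = (SIGMA p:T. {..<?len (fst p)} \<times> {..<?len (snd p)})"
  define f where "f = (\<lambda>(p, q). (off gs (fst p) + fst q, off gs (snd p) + snd q))"
  define S where "S = {(k, l). k < l \<and> l < ?N \<and> \<Xi> l < \<Xi> k}"
  have finT: "finite T" by (rule finite_subset[of _ "{..<length gs} \<times> {..<length gs}"]) (auto simp: T_def)
  have inv: "(\<Xi> (off gs j + b) < \<Xi> (off gs i + a)) \<longleftrightarrow> \<pi> j < \<pi> i \<or> i = j \<and> b < a"
    if "i < length gs" "j < length gs" "a < ?len i" "b < ?len j" for i j a b
  proof -
    have "\<pi> i = \<pi> j \<longleftrightarrow> i = j" using permutes_inj[OF \<pi>] by (auto dest: injD)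
    then show ?thesis
      using that off_less_iff[of "\<pi> j" gs' "\<pi> i" b a]
      by (auto simp: block_permutation_off gs'_nth permutes_lessThan[OF \<pi>])
  qed
  have inj: "inj_on f U"
  proof (rule inj_onI)
    fix x y assume x: "x \<in> U" and y: "y \<in> U" and e: "f x = f y"
    obtain i j a b where X: "x = ((i, j), (a, b))" by (metis surj_pair)
    obtain i' j' a' b' where Y: "y = ((i', j'), (a', b'))" by (metis surj_pair)
    have "i = i' \<and> a = a'" "j = j' \<and> b = b'"
      using e x y unfolding X Y by (auto simp: f_def U_def T_def dest!: off_inj)
    then show "x = y" using X Y by simp
  qed
  have "S = f ` U"
  proof (intro equalityI subsetI)
    fix x assume "x \<in> S"
    then obtain k l where x: "x = (k, l)" "k < l" "l < ?N" "\<Xi> l < \<Xi> k" by (auto simp: S_def)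
    obtain i a where i: "i < length gs" "a < ?len i" "k = off gs i + a"
      using off_cases[of k gs] x by (metis less_trans)
    obtain j b where j: "j < length gs" "b < ?len j" "l = off gs j + b"
      using off_cases[of l gs] x by metis
    have "i < j \<and> \<pi> j < \<pi> i"
      using x(2,4) i j inv[of i j a b] off_less_iff[of i gs j a b] by auto
    then have "((i, j), (a, b)) \<in> U" using i j by (auto simp: U_def T_def)
    moreover have "f ((i, j), (a, b)) = x" using i j x by (simp add: f_def)
    ultimately show "x \<in> f ` U" by (metis imageI)
  next
    fix x assume "x \<in> f ` U"
    then obtain i j a b where ij: "x = (off gs i + a, off gs j + b)" "i < j" "j < length gs" "\<pi> j < \<pi> i"
        "a < ?len i" "b < ?len j"
      by (auto simp: f_def U_def T_def)
    then show "x \<in> S"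
      using inv[of i j a b] off_less_iff[of i gs j a b] off_less[of j gs b] by (auto simp: S_def)
  qed
  define F :: "nat \<times> nat \<Rightarrow> 'k" where
    "F = (\<lambda>(k, l). parity_sign (map vdeg (concat (map verts gs)) ! k * map vdeg (concat (map verts gs)) ! l))"
  define G :: "(nat \<times> nat) \<times> nat \<times> nat \<Rightarrow> 'k" where
    "G = (\<lambda>(p, q). parity_sign (?d (fst p) (fst q) * ?d (snd p) (snd q)))"
  have FG: "F (f x) = G x" if "x \<in> U" for x
  proof -
    obtain i j a b where x: "x = ((i, j), (a, b))" by (metis surj_pair)
    then have "i < length gs" "j < length gs" "a < ?len i" "b < ?len j"
      using that by (auto simp: U_def T_def)
    then show ?thesis by (simp add: x F_def G_def f_def off_less verts_concat_nth)
  qed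
  have "prod F S = prod F (f ` U)" using \<open>S = f ` U\<close> by simp
  also have "\<dots> = prod (\<lambda>x. F (f x)) U" by (subst prod.reindex[OF inj]) simp
  also have "\<dots> = prod G U" by (intro prod.cong refl FG)
  also have "\<dots> = (\<Prod>p\<in>T. \<Prod>q\<in>{..<?len (fst p)} \<times> {..<?len (snd p)}. G (p, q))"
    unfolding U_def by (subst prod.Sigma) (use finT in auto)
  also have "\<dots> = (\<Prod>(i, j)\<in>T. parity_sign (map gdeg gs ! i * map gdeg gs ! j))"
  proof (intro prod.cong refl, clarify)
    fix i j assume "(i, j) \<in> T"
    then have "i < length gs" "j < length gs" by (auto simp: T_def)
    then have "(parity_sign (map gdeg gs ! i * map gdeg gs ! j) :: 'k) =
        parity_sign (\<Sum>q\<in>{..<?len i} \<times> {..<?len j}. ?d i (fst q) * ?d j (snd q))"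
      by (simp add: gdeg_sum sum_product sum.cartesian_product case_prod_unfold)
    then show "(\<Prod>q\<in>{..<?len (fst (i, j))} \<times> {..<?len (snd (i, j))}.
G ((i, j), q))
        = parity_sign (map gdeg gs ! i * map gdeg gs ! j)"
      by (simp add: parity_sign_sum G_def)
  qed
  finally show ?thesis by (simp add: koszul_def S_def T_def F_def)
qed

end


lemma twist_sel [simp]:
  "gout (twist E i \<sigma> \<tau> g) = gout g" "gin (twist E i \<sigma> \<tau> g) = gin g"
  "verts (twist E i \<sigma> \<tau> g) = (verts g)[i := Vertex (outs (verts g ! i)) (ins (verts g ! i)) (vdeg (verts g ! i))
     (act E (outs (verts g ! i)) (ins (verts g ! i)) (vdeg (verts g ! i)) \<sigma> \<tau> (dec (verts g ! i)))]"
  "edges (twist E i \<sigma> \<tau> g) = map_prod (move_port i \<sigma>) (move_port i (inv \<tau>)) ` edges g"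
  by (simp_all add: twist_def Let_def set_dec_def)

lemma arity_update:
  assumes "i < length vs" "outs v = outs (vs ! i)" "ins v = ins (vs ! i)"
  shows "outs (vs[i := v] ! j) = outs (vs ! j)" "ins (vs[i := v] ! j) = ins (vs ! j)"
  using assms by (cases "i = j"; simp)+

lemma wf_twist:
  assumes g: "wf_graph g" and i: "i < length (verts g)"
    and \<sigma>: "\<sigma> permutes {..<outs (verts g ! i)}" and \<tau>: "\<tau> permutes {..<ins (verts g ! i)}"
  shows "wf_graph (twist E i \<sigma> \<tau> g)"
proof -
  let ?g = "twist E i \<sigma> \<tau> g"
  have src: "sources ?g = sources g" "targets ?g = targets g"
    using i by (auto simp: sources_def targets_def arity_update)
  have "bij_betw (move_port i \<sigma>) (sources g) (sources g)"
  proof (rule bij_betw_byWitness[where f' = "move_port i (inv \<sigma>)"])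
    show "\<forall>s\<in>sources g. move_port i (inv \<sigma>) (move_port i \<sigma> s) = s" "\<forall>s\<in>sources g. move_port i \<sigma> (move_port i (inv \<sigma>) s) = s"
      using permutes_inverses[OF \<sigma>] by (auto simp: sources_def)
    show "move_port i \<sigma> ` sources g \<subseteq> sources g" "move_port i (inv \<sigma>) ` sources g \<subseteq> sources g"
      using permutes_lessThan[OF \<sigma>] permutes_lessThan[OF permutes_inv[OF \<sigma>]] by (auto simp: sources_def)
  qed
  moreover have "bij_betw (move_port i (inv \<tau>)) (targets g) (targets g)"
  proof (rule bij_betw_byWitness[where f' = "move_port i \<tau>"])
    show "\<forall>s\<in>targets g. move_port i \<tau> (move_port i (inv \<tau>) s) = s" "\<forall>s\<in>targets g. move_port i (inv \<tau>) (move_port i \<tau> s) = s"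
      using permutes_inverses[OF \<tau>] by (auto simp: targets_def)
    show "move_port i (inv \<tau>) ` targets g \<subseteq> targets g" "move_port i \<tau> ` targets g \<subseteq> targets g"
      using permutes_lessThan[OF \<tau>] permutes_lessThan[OF permutes_inv[OF \<tau>]] by (auto simp: targets_def)
  qed
  ultimately show ?thesis
    using i by (intro wf_relabel[OF g, where f = "move_port i \<sigma>" and h = "move_port i (inv \<tau>)" and \<pi> = id])
      (auto simp: src)
qed

text \<open>Twisting a vertex is undone by permuting the legs of the graph substituted into it.\<close>

lemma subst_twist:
  assumes \<Gamma>: "wf_graph \<Gamma>" and gs: "\<And>g. g \<in> set gs \<Longrightarrow> wf_graph g" and fit: "fits \<Gamma> gs"
    and i: "i < length gs"
    and \<sigma>: "\<sigma> permutes {..<outs (verts \<Gamma> ! i)}" and \<tau>: "\<tau> permutes {..<ins (verts \<Gamma> ! i)}"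
  shows "subst_graph (twist E i \<sigma> \<tau> \<Gamma>) (gs[i := act_graph \<sigma> \<tau> (gs ! i)]) = subst_graph \<Gamma> gs"
    (is "subst_graph ?\<Gamma> ?gs = _")
proof -
  interpret S: substitution \<Gamma> gs
    using \<Gamma> gs fit by unfold_locales (auto simp: wf_graph_acyclic_wired)
  have len: "length (verts \<Gamma>) = length gs" by (rule S.arity)
  have wi: "wf_graph (act_graph \<sigma> \<tau> (gs ! i))"
    using wf_act_graph[of "gs ! i" \<sigma> \<tau>] gs i \<sigma> \<tau> S.arity by simp
  have wt: "wf_graph ?\<Gamma>" using wf_twist[OF \<Gamma> _ \<sigma> \<tau>] i len by simp
  have "fits ?\<Gamma> ?gs"
    using fit i len by (auto simp: fits_def list_all2_conv_all_nth nth_list_update)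
  moreover have "wf_graph (?gs ! k)" if "k < length gs" for k
    using that wi gs i by (cases "k = i") auto
  ultimately interpret S': substitution ?\<Gamma> ?gs
    using wt by unfold_locales (auto simp: wf_graph_acyclic_wired)
  have off: "off ?gs k = off gs k" for k
  proof -
    have "map (\<lambda>g. length (verts g)) ?gs = map (\<lambda>g. length (verts g)) gs"
      using i by (intro nth_equalityI) (auto simp: nth_list_update)
    then show ?thesis by (simp only: off_def)
  qed
  obtain l where l: "invariant \<Gamma> gs l" "\<And>s. s \<in> sources S.R \<Longrightarrow> l (Src s) = end_of S.R s" "\<And>t. l (Tgt t) = t"
    using S.extend_labels[OF labelled_end_of[OF S.R_wired]] by auto
  define l' where "l' x = (case x of JOut k p \<Rightarrow> l (JOut k (if k = i then inv \<sigma> p else p))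
     | JIn k q \<Rightarrow> l (JIn k (if k = i then \<tau> q else q)) | _ \<Rightarrow> l x)" for x
  note inv = permutes_inverses[OF \<sigma>] permutes_inverses[OF \<tau>]
  have "invariant ?\<Gamma> ?gs l'"
    unfolding invariant_iff
  proof (intro conjI allI impI)
    have lab: "labelled \<Gamma> (l \<circ> outer_src) (l \<circ> outer_tgt)" using l(1) by (simp add: invariant_iff)
    have 0: "l (outer_src s) = l (outer_tgt t)" if "(s, t) \<in> edges \<Gamma>" for s t
      using labelledD[OF lab that] by simp
    have 1: "l' (outer_src (move_port i \<sigma> s)) = l (outer_src s)" for s
      by (cases s) (auto simp: l'_def inv)
    have 2: "l' (outer_tgt (move_port i (inv \<tau>) s)) = l (outer_tgt s)" for s
      by (cases s) (auto simp: l'_def inv)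
    show "labelled ?\<Gamma> (l' \<circ> outer_src) (l' \<circ> outer_tgt)"
      by (auto simp: labelled_def 0 1 2)
    fix k assume "k < length ?gs"
    then have k: "k < length gs" by simp
    have lab: "labelled (gs ! k) (l \<circ> inner_src k (off gs k)) (l \<circ> inner_tgt k (off gs k))"
      using l(1) k by (simp add: invariant_iff)
    show "labelled (?gs ! k) (l' \<circ> inner_src k (off ?gs k)) (l' \<circ> inner_tgt k (off ?gs k))"
    proof (cases "k = i")
      case True
      have 0: "l (inner_src i (off gs i) s) = l (inner_tgt i (off gs i) t)" if "(s, t) \<in> edges (gs ! i)" for s t
        using labelledD[OF lab[unfolded True] that] by simp
      have 1: "l' (inner_src i (off gs i) (move_ext (inv \<tau>) s)) = l (inner_src i (off gs i) s)" for s
        by (cases s) (auto simp: l'_def inv)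
      have 2: "l' (inner_tgt i (off gs i) (move_ext \<sigma> s)) = l (inner_tgt i (off gs i) s)" for s
        by (cases s) (auto simp: l'_def inv)
      show ?thesis using True i by (auto simp: labelled_def off 0 1 2)
    next
      case False
      have 1: "l' \<circ> inner_src k (off gs k) = l \<circ> inner_src k (off gs k)"
      proof
        show "(l' \<circ> inner_src k (off gs k)) s = (l \<circ> inner_src k (off gs k)) s" for s
          using False by (cases s) (auto simp: l'_def)
      qed
      have 2: "l' \<circ> inner_tgt k (off gs k) = l \<circ> inner_tgt k (off gs k)"
      proof
        show "(l' \<circ> inner_tgt k (off gs k)) s = (l \<circ> inner_tgt k (off gs k)) s" for s
          using False by (cases s) (auto simp: l'_def)
      qed
      show ?thesis using lab False unfolding off 1 2 by simp
    qed
  qed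
  from invariant_labelled[OF this] have lab: "labelled S'.R (\<lambda>s. l (Src s)) (\<lambda>t. t)"
    by (simp add: l'_def o_def l(3))
  have "map verts ?gs = map verts gs" using i by (intro nth_equalityI) (auto simp: nth_list_update)
  then have v: "verts S'.R = verts S.R" by simp
  show ?thesis
    using l(2) wired_target_ex[OF S.R_wired] end_of_eq[OF S.R_wired] v
    by (intro wired_label_eq[OF S.R_wired wired_total[OF S'.R_wired] wired_bounded[OF S'.R_wired] lab])
      (simp_all del: subst_graph_sel(3,4), metis)
qed

section \<open>Formal combinations of decorated graphs\<close>

lemma formal_zero [simp]: "0 \<in> formal E m n d"
  by (simp add: formal_def)

lemma formal_add: "x \<in> formal E m n d \<Longrightarrow> y \<in> formal E m n d \<Longrightarrow> x + y \<in> formal E m n d"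
  using keys_add[of x y] by (auto simp: formal_def)

lemma formal_fscale: "x \<in> formal E m n d \<Longrightarrow> fscale c x \<in> formal E m n d"
  by (auto simp: formal_def in_keys_iff)

lemma formal_diff: "x \<in> formal E m n d \<Longrightarrow> y \<in> formal E m n d \<Longrightarrow> x - y \<in> formal E m n d"
  using formal_add[of x E m n d "fscale (- 1) y"] formal_fscale[of y E m n d "- 1"] by simp

lemma formal_basis [simp]: "basis g \<in> formal E m n d \<longleftrightarrow> g \<in> dgraphs E m n d"
  by (simp add: formal_def)

lemma formal_keys: "x \<in> formal E m n d \<Longrightarrow> g \<in> keys x \<Longrightarrow> g \<in> dgraphs E m n d"
  by (auto simp: formal_def)

lemma formal_lin:
  "(\<And>a. a \<in> keys x \<Longrightarrow> f a \<in> formal E m n d) \<Longrightarrow> lin f x \<in> formal E m n d"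
  by (rule lin_closed) (auto intro: formal_add formal_fscale)

lemma dgraphs_wf: "g \<in> dgraphs E m n d \<Longrightarrow> wf_graph g"
  by (simp add: dgraphs_def)

lemma dgraphs_arity: "g \<in> dgraphs E m n d \<Longrightarrow> gout g = m \<and> gin g = n \<and> gdeg g = d"
  by (simp add: dgraphs_def)

lemma dgraphs_dec:
  "g \<in> dgraphs E m n d \<Longrightarrow> i < length (verts g) \<Longrightarrow>
   dec (verts g ! i) \<in> car E (outs (verts g ! i)) (ins (verts g ! i)) (vdeg (verts g ! i))"
  by (simp add: dgraphs_def)

lemma wf_graph_cong:
  assumes "map (\<lambda>v. (outs v, ins v)) (verts g) = map (\<lambda>v. (outs v, ins v)) (verts h)"
    "gout g = gout h" "gin g = gin h" "edges g = edges h"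
  shows "wf_graph g \<longleftrightarrow> wf_graph h"
proof -
  have len: "length (verts g) = length (verts h)" using assms(1) by (metis length_map)
  have nth: "outs (verts g ! i) = outs (verts h ! i) \<and> ins (verts g ! i) = ins (verts h ! i)"
    if "i < length (verts h)" for i
    using arg_cong[OF assms(1), of "\<lambda>xs. xs ! i"] that len by simp
  have s: "sources g = sources h" "targets g = targets h"
    using nth assms len by (auto simp: sources_def targets_def)
  have e: "verts g = [] \<longleftrightarrow> verts h = []" using len by (metis length_0_conv)
  show ?thesis
    using assms(2-4) len
    by (simp add: wf_graph_def wired_def s steps_def connected_graph_def e)
qed

lemma set_dec_sel [simp]:
  "gout (set_dec g i e) = gout g" "gin (set_dec g i e) = gin g" "edges (set_dec g i e) = edges g"
  "verts (set_dec g i e) = (verts g)[i := Vertex (outs (verts g ! i)) (ins (verts g ! i)) (vdeg (verts g ! i)) e]"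
  by (simp_all add: set_dec_def)

lemma vdeg_update:
  "i < length vs \<Longrightarrow> vdeg v = vdeg (vs ! i) \<Longrightarrow> map vdeg (vs[i := v]) = map vdeg vs"
  by (intro nth_equalityI) (auto simp: nth_list_update)

lemma dgraphs_set_dec:
  assumes g: "g \<in> dgraphs E m n d" and i: "i < length (verts g)"
    and e: "e \<in> car E (outs (verts g ! i)) (ins (verts g ! i)) (vdeg (verts g ! i))"
  shows "set_dec g i e \<in> dgraphs E m n d"
proof -
  have "wf_graph (set_dec g i e) \<longleftrightarrow> wf_graph g"
    using i by (intro wf_graph_cong nth_equalityI) (auto simp: nth_list_update)
  moreover have "gdeg (set_dec g i e) = gdeg g" using i by (simp add: gdeg_def vdeg_update)
  moreover have "\<forall>v\<in>set (verts (set_dec g i e)). dec v \<in> car E (outs v) (ins v) (vdeg v)"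
    using g e set_update_subset_insert[of "verts g" i] by (fastforce simp: dgraphs_def)
  ultimately show ?thesis using g by (simp add: dgraphs_def)
qed

lemma dgraphs_act:
  assumes "g \<in> dgraphs E m n d" "\<sigma> permutes {..<m}" "\<tau> permutes {..<n}"
  shows "act_graph \<sigma> \<tau> g \<in> dgraphs E m n d"
  using assms wf_act_graph[of g \<sigma> \<tau>] by (auto simp: dgraphs_def gdeg_def)

lemma dgraphs_permute:
  assumes g: "g \<in> dgraphs E m n d" and \<pi>: "\<pi> permutes {..<length (verts g)}"
  shows "permute_vertices \<pi> g \<in> dgraphs E m n d"
proof -
  have ip: "inv \<pi> permutes {..<length (verts g)}" using \<pi> by (rule permutes_inv)
  have m: "mset (permute_list (inv \<pi>) (verts g)) = mset (verts g)" by (rule mset_permute_list[OF ip])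
  have "sum_list (map vdeg (permute_list (inv \<pi>) (verts g))) = sum_list (map vdeg (verts g))"
    using m by (metis mset_map sum_mset_sum_list)
  moreover have "set (permute_list (inv \<pi>) (verts g)) = set (verts g)" using m by (metis set_mset_mset)
  ultimately show ?thesis using g wf_permute_vertices[OF _ \<pi>] by (simp add: dgraphs_def gdeg_def)
qed

text \<open>No axioms are imposed on a \<open>\<Sigma>\<close>-bimodule, and this is the part of them that keeps the relators inside
  the formal combinations.\<close>

definition closed_sbimod :: "('k::field, 'a, 'z) sbimod_scheme \<Rightarrow> bool" where
  "closed_sbimod E \<longleftrightarrow> (\<forall>m n d.
     (\<forall>x\<in>car E m n d. \<forall>y\<in>car E m n d. add E m n d x y \<in> car E m n d) \<and>
     (\<forall>c. \<forall>x\<in>car E m n d. smul E m n d c x \<in> car E m n d) \<and>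
     (\<forall>\<sigma> \<tau>. \<forall>x\<in>car E m n d. \<sigma> permutes {..<m} \<longrightarrow> \<tau> permutes {..<n} \<longrightarrow>
        act E m n d \<sigma> \<tau> x \<in> car E m n d))"

lemma dgraphs_twist:
  assumes E: "closed_sbimod E" and g: "g \<in> dgraphs E m n d" and i: "i < length (verts g)"
    and \<sigma>: "\<sigma> permutes {..<outs (verts g ! i)}" and \<tau>: "\<tau> permutes {..<ins (verts g ! i)}"
  shows "twist E i \<sigma> \<tau> g \<in> dgraphs E m n d"
proof -
  let ?e = "act E (outs (verts g ! i)) (ins (verts g ! i)) (vdeg (verts g ! i)) \<sigma> \<tau> (dec (verts g ! i))"
  have "?e \<in> car E (outs (verts g ! i)) (ins (verts g ! i)) (vdeg (verts g ! i))"
    using E dgraphs_dec[OF g i] \<sigma> \<tau> by (simp add: closed_sbimod_def)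
  then have s: "set_dec g i ?e \<in> dgraphs E m n d" by (rule dgraphs_set_dec[OF g i])
  have "wf_graph (twist E i \<sigma> \<tau> g)" by (rule wf_twist[OF dgraphs_wf[OF g] i \<sigma> \<tau>])
  then show ?thesis using s by (simp add: dgraphs_def gdeg_def)
qed

lemma relator_formal:
  assumes E: "closed_sbimod E" and r: "graph_relator E m n d r"
  shows "r \<in> formal E m n d"
  using r
proof cases
  case (additive g i a b k e\<^sub>0 e e')
  then have "add E a b k e e' \<in> car E a b k" using E by (simp add: closed_sbimod_def)
  then show ?thesis using additive by (auto intro!: formal_diff dgraphs_set_dec)
next
  case (homogeneous g i a b k e\<^sub>0 e c)
  then have "smul E a b k c e \<in> car E a b k" using E by (simp add: closed_sbimod_def)
  then show ?thesis using homogeneous by (auto intro!: formal_diff formal_fscale dgraphs_set_dec)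
next
  case (reorder g \<pi>)
  then show ?thesis by (auto intro!: formal_diff formal_fscale dgraphs_permute)
next
  case (equivariant g i \<sigma> \<tau>)
  then show ?thesis by (auto intro!: formal_diff dgraphs_twist[OF E])
qed

lemma graph_rels_formal:
  assumes "closed_sbimod E"
  shows "graph_rels E m n d \<subseteq> formal E m n d"
  unfolding graph_rels_def
proof (rule fspace.span_minimal)
  show "Collect (graph_relator E m n d) \<subseteq> formal E m n d" using relator_formal[OF assms] by blast
  show "fspace.subspace (formal E m n d)"
    by (rule fspace.subspaceI) (auto intro: formal_add formal_fscale)
qed

lemma subst_dgraphs:
  assumes \<Gamma>: "wf_graph \<Gamma>"
    and gs: "list_all2 (\<lambda>g v. g \<in> dgraphs E (outs v) (ins v) (vdeg v)) gs (verts \<Gamma>)"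
  shows "subst_graph \<Gamma> gs \<in> dgraphs E (gout \<Gamma>) (gin \<Gamma>) (gdeg \<Gamma>)" "fits \<Gamma> gs"
    "\<And>g. g \<in> set gs \<Longrightarrow> wf_graph g"
proof -
  show fit: "fits \<Gamma> gs" using gs by (auto simp: fits_def list_all2_conv_all_nth dgraphs_arity)
  show wf: "wf_graph g" if "g \<in> set gs" for g
    using gs that by (auto simp: list_all2_conv_all_nth in_set_conv_nth dgraphs_wf)
  have "sum_list (map vdeg (concat (map verts gs))) = sum_list (map gdeg gs)"
    by (induction gs) (auto simp: gdeg_def)
  also have "map gdeg gs = map vdeg (verts \<Gamma>)"
    using gs by (intro nth_equalityI) (auto simp: list_all2_conv_all_nth dgraphs_arity)
  finally have "gdeg (subst_graph \<Gamma> gs) = gdeg \<Gamma>" by (simp add: gdeg_def)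
  moreover have "dec v \<in> car E (outs v) (ins v) (vdeg v)" if v: "v \<in> set (concat (map verts gs))" for v
  proof -
    obtain g where "g \<in> set gs" "v \<in> set (verts g)" using v by auto
    then obtain i where "i < length gs" "v \<in> set (verts (gs ! i))" by (metis in_set_conv_nth)
    then show ?thesis using gs by (auto simp: list_all2_conv_all_nth dgraphs_def)
  qed
  ultimately show "subst_graph \<Gamma> gs \<in> dgraphs E (gout \<Gamma>) (gin \<Gamma>) (gdeg \<Gamma>)"
    using wf_subst_graph[OF \<Gamma> wf fit] by (simp add: dgraphs_def)
qed

lemma keys_dgraphs:
  assumes "list_all2 (\<lambda>x v. x \<in> formal E (outs v) (ins v) (vdeg v)) xs vs"
    and "list_all2 (\<lambda>g x. g \<in> keys x) gs xs"
  shows "list_all2 (\<lambda>g v. g \<in> dgraphs E (outs v) (ins v) (vdeg v)) gs vs"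
  using assms by (auto simp: list_all2_conv_all_nth) (blast intro: formal_keys)

lemma msubst_formal:
  assumes "wf_graph \<Gamma>" "list_all2 (\<lambda>x v. x \<in> formal E (outs v) (ins v) (vdeg v)) xs (verts \<Gamma>)"
  shows "msubst \<Gamma> xs \<in> formal E (gout \<Gamma>) (gin \<Gamma>) (gdeg \<Gamma>)"
  unfolding msubst_mext
  by (rule mext_closed)
     (auto intro: formal_add formal_fscale subst_dgraphs(1)[OF assms(1)] keys_dgraphs[OF assms(2)])

lemma msubst_cong_edges:
  "gout \<Gamma> = gout \<Gamma>' \<Longrightarrow> gin \<Gamma> = gin \<Gamma>' \<Longrightarrow> edges \<Gamma> = edges \<Gamma>' \<Longrightarrow> msubst \<Gamma> xs = msubst \<Gamma>' xs"
  by (simp add: msubst_def subst_graph_def junction_wires_def)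

lemma
  assumes "i < length xs"
  shows msubst_diff: "msubst \<Gamma> (xs[i := x - y]) = msubst \<Gamma> (xs[i := x]) - msubst \<Gamma> (xs[i := y])"
    and msubst_add: "msubst \<Gamma> (xs[i := x + y]) = msubst \<Gamma> (xs[i := x]) + msubst \<Gamma> (xs[i := y])"
    and msubst_fscale: "msubst \<Gamma> (xs[i := fscale c x]) = fscale c (msubst \<Gamma> (xs[i := x]))"
proof -
  have u: "xs[i := x] = take i xs @ x # drop (Suc i) xs" for x
    using assms by (simp add: upd_conv_take_nth_drop)
  show "msubst \<Gamma> (xs[i := x - y]) = msubst \<Gamma> (xs[i := x]) - msubst \<Gamma> (xs[i := y])"
    by (simp add: u msubst_mext mext_diff)
  show "msubst \<Gamma> (xs[i := x + y]) = msubst \<Gamma> (xs[i := x]) + msubst \<Gamma> (xs[i := y])"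
    by (simp add: u msubst_mext mext_add)
  show "msubst \<Gamma> (xs[i := fscale c x]) = fscale c (msubst \<Gamma> (xs[i := x]))"
    by (simp add: u msubst_mext mext_fscale)
qed

definition act_comb :: "(nat \<Rightarrow> nat) \<Rightarrow> (nat \<Rightarrow> nat) \<Rightarrow> ('e dgraph \<Rightarrow>\<^sub>0 'k::field) \<Rightarrow> ('e dgraph \<Rightarrow>\<^sub>0 'k)" where
  "act_comb \<sigma> \<tau> = lin (\<lambda>g. basis (act_graph \<sigma> \<tau> g))"

lemma act_comb_formal:
  "x \<in> formal E m n d \<Longrightarrow> \<sigma> permutes {..<m} \<Longrightarrow> \<tau> permutes {..<n} \<Longrightarrow> act_comb \<sigma> \<tau> x \<in> formal E m n d"
  unfolding act_comb_def by (rule formal_lin) (auto dest: formal_keys intro: dgraphs_act)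

lemma act_graph_act:
  assumes "bij \<tau>'" "bij \<tau>"
  shows "act_graph \<sigma> \<tau> (act_graph \<sigma>' \<tau>' g) = act_graph (\<sigma> \<circ> \<sigma>') (\<tau>' \<circ> \<tau>) g"
proof -
  have "move_ext \<sigma> (move_ext \<sigma>' s) = move_ext (\<sigma> \<circ> \<sigma>') s" for \<sigma> \<sigma>' s by (cases s) auto
  moreover have "inv (\<tau>' \<circ> \<tau>) = inv \<tau> \<circ> inv \<tau>'" using assms by (simp add: o_inv_distrib)
  ultimately show ?thesis by (simp add: act_graph_def image_image map_prod_def case_prod_unfold)
qed

text \<open>The action is a substitution into a corolla with permuted legs. This is how ideals and morphisms,
  which are compatible with substitution, come to be compatible with the action.\<close>

lemma act_comb_msubst:
  assumes x: "x \<in> formal E m n d" and \<sigma>: "\<sigma> permutes {..<m}" and \<tau>: "\<tau> permutes {..<n}"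
    and v: "outs v = m" "ins v = n"
  shows "msubst (act_graph \<sigma> \<tau> (corolla v)) [x] = act_comb \<sigma> \<tau> x"
  unfolding msubst_mext act_comb_def
proof (simp, rule lin_cong)
  fix g assume "g \<in> keys x"
  then have "g \<in> dgraphs E m n d" using x by (rule formal_keys[rotated])
  then show "basis (subst_graph (act_graph \<sigma> \<tau> (corolla v)) [g]) = basis (act_graph \<sigma> \<tau> g)"
    using act_graph_subst[of g \<sigma> \<tau> v] \<sigma> \<tau> v by (simp add: dgraphs_def)
qed


section \<open>Ideals\<close>

lemma ideal_zero: "ideal E R m n d 0"
  by (rule ideal.graph) (simp add: graph_rels_def fspace.span_zero)

lemma ideal_uminus: "ideal E R m n d x \<Longrightarrow> ideal E R m n d (- x)"
  using ideal.scale[of E R m n d x "- 1"] by simp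

lemma ideal_diff: "ideal E R m n d x \<Longrightarrow> ideal E R m n d y \<Longrightarrow> ideal E R m n d (x - y)"
  using ideal.add[OF _ ideal_uminus, of E R m n d x y] by simp

lemma ideal_lin: "(\<And>a. a \<in> keys x \<Longrightarrow> ideal E R m n d (f a)) \<Longrightarrow> ideal E R m n d (lin f x)"
  using lin_closed[of "Collect (ideal E R m n d)" x f] by (auto intro: ideal_zero ideal.add ideal.scale)

lemma ideal_relator: "graph_relator E m n d r \<Longrightarrow> ideal E R m n d r"
  by (rule ideal.graph) (simp add: graph_rels_def fspace.span_base)

lemma ideal_formal:
  assumes E: "closed_sbimod E" shows "ideal E R m n d x \<Longrightarrow> x \<in> formal E m n d"
proof (induction rule: ideal.induct)
  case (graph r m n d)
  then show ?case using graph_rels_formal[OF E] by blast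
next
  case (subst \<Gamma> xs i a b k)
  then show ?case by (intro msubst_formal)
qed (auto intro: formal_add formal_fscale)

text \<open>The ideal is closed under substitution into graphs whose vertices carry arbitrary decorations:
  only the shape of the outer graph matters.\<close>

lemma ideal_msubst:
  fixes \<Gamma> :: "'x dgraph"
  assumes wf: "wf_graph \<Gamma>" and xs: "list_all2 (\<lambda>x v. x \<in> formal E (outs v) (ins v) (vdeg v)) xs (verts \<Gamma>)"
    and i: "i < length xs" and x: "ideal E R (outs (verts \<Gamma> ! i)) (ins (verts \<Gamma> ! i)) (vdeg (verts \<Gamma> ! i)) (xs ! i)"
  shows "ideal E R (gout \<Gamma>) (gin \<Gamma>) (gdeg \<Gamma>) (msubst \<Gamma> xs)"
proof -
  define \<Delta> :: "unit dgraph" where "\<Delta> = map_decs (\<lambda>_ _ _ _. ()) \<Gamma>"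
  have s: "gout \<Delta> = gout \<Gamma>" "gin \<Delta> = gin \<Gamma>" "edges \<Delta> = edges \<Gamma>"
    "verts \<Delta> = map (\<lambda>v. Vertex (outs v) (ins v) (vdeg v) ()) (verts \<Gamma>)"
    by (simp_all add: \<Delta>_def map_decs_def)
  have len: "length xs = length (verts \<Gamma>)" using xs by (rule list_all2_lengthD)
  have "wf_graph \<Delta> \<longleftrightarrow> wf_graph \<Gamma>" by (rule wf_graph_cong) (simp_all add: s)
  then have "ideal E R (gout \<Delta>) (gin \<Delta>) (gdeg \<Delta>) (msubst \<Delta> xs)"
    using wf xs i x len by (intro ideal.subst[where i = i]) (auto simp: s list_all2_conv_all_nth)
  moreover have "gdeg \<Delta> = gdeg \<Gamma>" by (simp add: gdeg_def s o_def)
  moreover have "msubst \<Delta> xs = msubst \<Gamma> xs" by (rule msubst_cong_edges) (simp_all add: s)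
  ultimately show ?thesis by (simp add: s)
qed

text \<open>Substitution is compatible with congruence modulo an ideal: change one argument at a time.\<close>

lemma ideal_msubst_cong:
  fixes \<Gamma> :: "'x dgraph"
  assumes wf: "wf_graph \<Gamma>" and E: "closed_sbimod E"
    and xs: "list_all2 (\<lambda>x v. x \<in> formal E (outs v) (ins v) (vdeg v)) xs (verts \<Gamma>)"
    and len: "length ys = length xs"
    and xy: "\<And>i. i < length xs \<Longrightarrow>
      ideal E R (outs (verts \<Gamma> ! i)) (ins (verts \<Gamma> ! i)) (vdeg (verts \<Gamma> ! i)) (ys ! i - xs ! i)"
  shows "ideal E R (gout \<Gamma>) (gin \<Gamma>) (gdeg \<Gamma>) (msubst \<Gamma> ys - msubst \<Gamma> xs)"
proof -
  let ?f = "\<lambda>i x. x \<in> formal E (outs (verts \<Gamma> ! i)) (ins (verts \<Gamma> ! i)) (vdeg (verts \<Gamma> ! i))"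
  have lx: "length xs = length (verts \<Gamma>)" using xs by (rule list_all2_lengthD)
  have fx: "?f i (xs ! i)" if "i < length xs" for i using xs that by (auto simp: list_all2_conv_all_nth)
  have fy: "?f i (ys ! i)" if "i < length xs" for i
    using formal_add[OF fx[OF that] ideal_formal[OF E xy[OF that]]] by simp
  define zs where "zs k = take k ys @ drop k xs" for k
  have zn: "zs k ! i = (if i < k then ys ! i else xs ! i)" "length (zs k) = length xs"
    if "k \<le> length xs" "i < length xs" for k i
    using that len by (auto simp: zs_def nth_append)
  have "ideal E R (gout \<Gamma>) (gin \<Gamma>) (gdeg \<Gamma>) (msubst \<Gamma> (zs k) - msubst \<Gamma> xs)" if "k \<le> length xs" for k
    using that
  proof (induction k)
    case 0
    then show ?case by (simp add: zs_def ideal_zero)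
  next
    case (Suc k)
    then have k: "k < length xs" by simp
    have lz: "length (zs k) = length xs" using zn(2)[of k k] k by simp
    have z1: "zs (Suc k) = (zs k)[k := ys ! k]"
      using k lz zn by (intro nth_equalityI) (auto simp: nth_list_update zs_def len)
    have z2: "zs k = (zs k)[k := xs ! k]"
      using k lz zn by (intro nth_equalityI) (auto simp: nth_list_update)
    have "msubst \<Gamma> (zs (Suc k)) - msubst \<Gamma> (zs k) = msubst \<Gamma> ((zs k)[k := ys ! k - xs ! k])"
      using k lz by (subst z2, subst z1) (simp add: msubst_diff)
    moreover have "ideal E R (gout \<Gamma>) (gin \<Gamma>) (gdeg \<Gamma>) (msubst \<Gamma> ((zs k)[k := ys ! k - xs ! k]))"
    proof (rule ideal_msubst[OF wf, where i = k])
      have "?f i ((zs k)[k := ys ! k - xs ! k] ! i)" if "i < length xs" for i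
        using that k lz fx fy ideal_formal[OF E xy[OF k]] by (auto simp: nth_list_update zn)
      then show "list_all2 (\<lambda>x v. x \<in> formal E (outs v) (ins v) (vdeg v)) ((zs k)[k := ys ! k - xs ! k]) (verts \<Gamma>)"
        by (simp add: list_all2_conv_all_nth lz lx)
    qed (use k lz xy[OF k] in simp_all)
    ultimately have "ideal E R (gout \<Gamma>) (gin \<Gamma>) (gdeg \<Gamma>) (msubst \<Gamma> (zs (Suc k)) - msubst \<Gamma> (zs k))" by simp
    from ideal.add[OF this Suc.IH] k show ?case by simp
  qed
  from this[of "length xs"] show ?thesis by (simp add: zs_def len)
qed

lemma ideal_act_comb:
  assumes E: "closed_sbimod E" and x: "ideal E R m n d x" and \<sigma>: "\<sigma> permutes {..<m}" and \<tau>: "\<tau> permutes {..<n}"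
  shows "ideal E R m n d (act_comb \<sigma> \<tau> x)"
proof -
  let ?v = "Vertex m n d ()"
  have f: "x \<in> formal E m n d" by (rule ideal_formal[OF E x])
  have "ideal E R m n d (msubst (act_graph \<sigma> \<tau> (corolla ?v)) [x])"
    using ideal_msubst[of "act_graph \<sigma> \<tau> (corolla ?v)" E "[x]" 0 R] wf_act_graph[OF wf_corolla[of ?v]] f x \<sigma> \<tau>
    by (simp add: gdeg_def)
  then show ?thesis using act_comb_msubst[OF f \<sigma> \<tau>, of ?v] by simp
qed

section \<open>Morphisms of presented properads given on generators\<close>

lemma keys_finite_comb: "x = (\<Sum>t\<in>keys x. fscale (lookup x t) (basis t))"
  using lin_basis_id[of x] by (simp add: lin_def)

lemma closed_sbimod_add:
  "closed_sbimod E \<Longrightarrow> x \<in> car E m n d \<Longrightarrow> y \<in> car E m n d \<Longrightarrow> add E m n d x y \<in> car E m n d"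
  by (simp add: closed_sbimod_def)

lemma free_sbimod_sel [simp]:
  "x \<in> car (free_sbimod ar) m n d \<longleftrightarrow>
     (\<forall>(\<sigma>, g, \<tau>)\<in>keys x. ar g = (m, n, d) \<and> \<sigma> permutes {..<m} \<and> \<tau> permutes {..<n})"
  "add (free_sbimod ar) m n d x y = x + y"
  "smul (free_sbimod ar) m n d c x = fscale c x"
  "act (free_sbimod ar) m n d \<sigma> \<tau> x = lin (\<lambda>(\<sigma>', g, \<tau>'). basis (\<sigma> \<circ> \<sigma>', g, \<tau>' \<circ> \<tau>)) x"
  by (auto simp: free_sbimod_def)

lemma closed_free_sbimod: "closed_sbimod (free_sbimod ar :: ('k::field, ('k, 'g) free_elt) sbimod)"
  unfolding closed_sbimod_def
proof (intro allI conjI ballI impI)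
  fix m n d and x y :: "('k, 'g) free_elt" and c :: 'k
  assume x: "x \<in> car (free_sbimod ar) m n d"
  show "smul (free_sbimod ar) m n d c x \<in> car (free_sbimod ar) m n d"
    using x by (auto simp: in_keys_iff)
  show "add (free_sbimod ar) m n d x y \<in> car (free_sbimod ar) m n d" if "y \<in> car (free_sbimod ar) m n d"
    using x that keys_add[of x y] by fastforce
  fix \<sigma> \<tau> assume \<sigma>: "\<sigma> permutes {..<m}" and \<tau>: "\<tau> permutes {..<n}"
  have "keys (lin (\<lambda>(\<sigma>', g, \<tau>'). basis (\<sigma> \<circ> \<sigma>', g, \<tau>' \<circ> \<tau>)) x) \<subseteq>
      (\<Union>(\<sigma>', g, \<tau>')\<in>keys x. {(\<sigma> \<circ> \<sigma>', g, \<tau>' \<circ> \<tau>)})"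
    by (rule order_trans[OF keys_lin]) auto
  then show "act (free_sbimod ar) m n d \<sigma> \<tau> x \<in> car (free_sbimod ar) m n d"
    using x permutes_compose[OF _ \<sigma>] permutes_compose[OF \<tau>] by fastforce
qed

text \<open>Decorations are combinations of permuted generators, and so the morphism that extends \<open>F\<close> is defined
  on them first.\<close>

definition dec_image :: "('g \<Rightarrow> ('e dgraph \<Rightarrow>\<^sub>0 'k)) \<Rightarrow> ('k::field, 'g) free_elt \<Rightarrow> ('e dgraph \<Rightarrow>\<^sub>0 'k)" where
  "dec_image F = lin (\<lambda>(\<sigma>, g, \<tau>). act_comb \<sigma> \<tau> (F g))"

definition graph_image :: "('g \<Rightarrow> ('e dgraph \<Rightarrow>\<^sub>0 'k)) \<Rightarrow> ('k::field, 'g) free_elt dgraph \<Rightarrow> ('e dgraph \<Rightarrow>\<^sub>0 'k)" where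
  "graph_image F g = msubst g (map (\<lambda>v. dec_image F (dec v)) (verts g))"

definition hom :: "('g \<Rightarrow> ('e dgraph \<Rightarrow>\<^sub>0 'k)) \<Rightarrow> (('k::field, 'g) free_elt dgraph \<Rightarrow>\<^sub>0 'k) \<Rightarrow> ('e dgraph \<Rightarrow>\<^sub>0 'k)" where
  "hom F = lin (graph_image F)"

definition generator_map :: "('g \<Rightarrow> nat \<times> nat \<times> int) \<Rightarrow> ('k::field, 'e, 'z) sbimod_scheme \<Rightarrow>
    ('g \<Rightarrow> ('e dgraph \<Rightarrow>\<^sub>0 'k)) \<Rightarrow> bool" where
  "generator_map ar E F \<longleftrightarrow> (\<forall>g m n d. ar g = (m, n, d) \<longrightarrow> F g \<in> formal E m n d)"

lemma hom_add: "hom F (x + y) = hom F x + hom F y"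
  and hom_diff: "hom F (x - y) = hom F x - hom F y"
  and hom_fscale: "hom F (fscale c x) = fscale c (hom F x)"
  and hom_zero [simp]: "hom F 0 = 0"
  and hom_basis: "hom F (basis g) = graph_image F g"
  and hom_uminus: "hom F (- x) = - hom F x"
  by (simp_all add: hom_def lin_add lin_diff lin_fscale lin_uminus)

lemma dec_image_formal:
  assumes F: "generator_map ar E F" and e: "e \<in> car (free_sbimod ar) m n d"
  shows "dec_image F e \<in> formal E m n d"
  unfolding dec_image_def
proof (rule formal_lin)
  fix t assume t: "t \<in> keys e"
  obtain \<sigma> g \<tau> where "t = (\<sigma>, g, \<tau>)" by (metis surj_pair)
  then show "(case t of (\<sigma>, g, \<tau>) \<Rightarrow> act_comb \<sigma> \<tau> (F g)) \<in> formal E m n d"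
    using e t F by (auto simp: generator_map_def intro!: act_comb_formal)
qed

lemma dec_images_formal:
  assumes F: "generator_map ar E F" and g: "g \<in> dgraphs (free_sbimod ar) m n d"
  shows "list_all2 (\<lambda>x v. x \<in> formal E (outs v) (ins v) (vdeg v)) (map (\<lambda>v. dec_image F (dec v)) (verts g)) (verts g)"
  using dec_image_formal[OF F dgraphs_dec[OF g]] by (simp add: list_all2_conv_all_nth)

lemma graph_image_formal:
  assumes F: "generator_map ar E F" and g: "g \<in> dgraphs (free_sbimod ar) m n d"
  shows "graph_image F g \<in> formal E m n d"
  using msubst_formal[OF dgraphs_wf[OF g] dec_images_formal[OF F g]] dgraphs_arity[OF g]
  by (simp add: graph_image_def)

lemma hom_formal:
  assumes F: "generator_map ar E F" and x: "x \<in> formal (free_sbimod ar) m n d"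
  shows "hom F x \<in> formal E m n d"
  unfolding hom_def by (rule formal_lin) (metis graph_image_formal[OF F] formal_keys[OF x])

lemma act_comb_act_comb:
  assumes "bij \<tau>'" "bij \<tau>"
  shows "act_comb \<sigma> \<tau> (act_comb \<sigma>' \<tau>' x) = act_comb (\<sigma> \<circ> \<sigma>') (\<tau>' \<circ> \<tau>) x"
  by (simp add: act_comb_def lin_lin act_graph_act[OF assms])

lemma dec_image_act:
  assumes e: "e \<in> car (free_sbimod ar) m n d" and \<tau>: "\<tau> permutes {..<n}"
  shows "dec_image F (act (free_sbimod ar) m n d \<sigma> \<tau> e) = act_comb \<sigma> \<tau> (dec_image F e)"
proof -
  have "dec_image F (act (free_sbimod ar) m n d \<sigma> \<tau> e) =
      lin (\<lambda>t. dec_image F (case t of (\<sigma>', g, \<tau>') \<Rightarrow> basis (\<sigma> \<circ> \<sigma>', g, \<tau>' \<circ> \<tau>))) e"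
    by (simp add: dec_image_def lin_lin)
  also have "\<dots> = lin (\<lambda>t. act_comb \<sigma> \<tau> (case t of (\<sigma>', g, \<tau>') \<Rightarrow> act_comb \<sigma>' \<tau>' (F g))) e"
  proof (rule lin_cong)
    fix t assume t: "t \<in> keys e"
    obtain \<sigma>' g \<tau>' where t': "t = (\<sigma>', g, \<tau>')" by (metis surj_pair)
    then have "\<tau>' permutes {..<n}" using e t by auto
    then have "bij \<tau>'" "bij \<tau>" using \<tau> by (auto intro: permutes_bij)
    then show "dec_image F (case t of (\<sigma>', g, \<tau>') \<Rightarrow> basis (\<sigma> \<circ> \<sigma>', g, \<tau>' \<circ> \<tau>)) =
        act_comb \<sigma> \<tau> (case t of (\<sigma>', g, \<tau>') \<Rightarrow> act_comb \<sigma>' \<tau>' (F g))"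
      by (simp add: t' dec_image_def act_comb_act_comb)
  qed
  also have "\<dots> = act_comb \<sigma> \<tau> (dec_image F e)"
    by (simp add: dec_image_def act_comb_def lin_lin)
  finally show ?thesis .
qed

lemma lin_fun_diff: "lin (\<lambda>a. f a - g a) x = lin f x - lin g x"
  by (simp add: lin_def fspace.scale_right_diff_distrib sum_subtractf)

lemma mext_fun_diff: "mext (\<lambda>as. f as - g as) xs = mext f xs - mext g xs"
proof (induction xs arbitrary: f g)
  case (Cons x xs)
  show ?case by (simp add: Cons lin_fun_diff)
qed simp

lemma mext_fun_scale: "mext (\<lambda>as. fscale c (f as)) xs = fscale c (mext f xs)"
  by (induction xs arbitrary: f) (auto simp: lin_fun_scale)

lemma mext_slot_map:
  "i < length xs \<Longrightarrow> mext f (xs[i := lin (\<lambda>a. basis (h a)) (xs ! i)]) = mext (\<lambda>as. f (as[i := h (as ! i)])) xs"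
proof (induction xs arbitrary: i f)
  case (Cons x xs)
  show ?case
  proof (cases i)
    case 0
    then show ?thesis by (simp add: lin_lin)
  next
    case (Suc j)
    then show ?thesis using Cons by simp
  qed
qed simp

text \<open>Images respect the relations of the free properad: reordering the vertices of \<open>g\<close> by \<open>\<pi>\<close>
  moves the blocks of vertices substituted for them, with the same sign.\<close>

lemma graph_image_relator:
  fixes F :: "'g \<Rightarrow> ('e dgraph \<Rightarrow>\<^sub>0 'k::field)"
  assumes F: "generator_map ar E F" and r: "graph_relator (free_sbimod ar) m n d r"
  shows "ideal E R m n d (hom F r)"
  using r
proof cases
  case (additive g i a b k e\<^sub>0 e e')
  let ?ys = "map (\<lambda>v. dec_image F (dec v)) (verts g)"
  have *: "graph_image F (set_dec g i e) = msubst g (?ys[i := dec_image F e])" for e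
    unfolding graph_image_def by (simp add: map_update) (rule msubst_cong_edges; simp)
  have "dec_image F (e + e') = dec_image F e + dec_image F e'" by (simp add: dec_image_def lin_add)
  then have "hom F r = 0" using additive by (simp add: hom_diff hom_basis * msubst_add)
  then show ?thesis by (simp add: ideal_zero)
next
  case (homogeneous g i a b k e\<^sub>0 e c)
  let ?ys = "map (\<lambda>v. dec_image F (dec v)) (verts g)"
  have *: "graph_image F (set_dec g i e) = msubst g (?ys[i := dec_image F e])" for e
    unfolding graph_image_def by (simp add: map_update) (rule msubst_cong_edges; simp)
  have "dec_image F (fscale c e) = fscale c (dec_image F e)" by (simp add: dec_image_def lin_fscale)
  then have "hom F r = 0" using homogeneous by (simp add: hom_diff hom_fscale hom_basis * msubst_fscale)
  then show ?thesis by (simp add: ideal_zero)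
next
  case (reorder g \<pi>)
  let ?ys = "map (\<lambda>v. dec_image F (dec v)) (verts g)"
  let ?k = "koszul \<pi> (map vdeg (verts g)) :: 'k"
  have wf: "wf_graph g" using reorder(2) by (rule dgraphs_wf)
  have mem: "list_all2 (\<lambda>h v. h \<in> dgraphs E (outs v) (ins v) (vdeg v)) hs (verts g)"
    if "list_all2 (\<lambda>h x. h \<in> keys x) hs ?ys" for hs
    by (rule keys_dgraphs[OF dec_images_formal[OF F reorder(2)] that])
  have "graph_image F (permute_vertices \<pi> g) = msubst (permute_vertices \<pi> g) (permute_list (inv \<pi>) ?ys)"
    using reorder(3) by (simp add: graph_image_def permute_list_map permutes_inv)
  also have "\<dots> = mext (\<lambda>hs. basis (subst_graph (permute_vertices \<pi> g) (permute_list (inv \<pi>) hs))) ?ys"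
    unfolding msubst_mext using reorder(3) by (intro mext_permute) (simp add: permutes_inv)
  also have "\<dots> = mext (\<lambda>hs. basis (permute_vertices (block_permutation \<pi> hs) (subst_graph g hs))) ?ys"
  proof (rule mext_cong)
    fix hs assume "list_all2 (\<lambda>h x. h \<in> keys x) hs ?ys"
    note m = mem[OF this]
    have "length hs = length (verts g)" using m by (rule list_all2_lengthD)
    then show "basis (subst_graph (permute_vertices \<pi> g) (permute_list (inv \<pi>) hs)) =
        basis (permute_vertices (block_permutation \<pi> hs) (subst_graph g hs))"
      using reorder(3) subst_permute_vertices[OF _ wf subst_dgraphs(3)[OF wf m] subst_dgraphs(2)[OF wf m], of \<pi>] by simp
  qed
  finally have "hom F r = mext (\<lambda>hs. basis (subst_graph g hs) -
      fscale ?k (basis (permute_vertices (block_permutation \<pi> hs) (subst_graph g hs)))) ?ys"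
    using reorder(1) by (simp add: hom_diff hom_fscale hom_basis mext_fun_diff mext_fun_scale)
      (simp add: graph_image_def msubst_mext)
  moreover have "mext (\<lambda>hs. basis (subst_graph g hs) -
      fscale ?k (basis (permute_vertices (block_permutation \<pi> hs) (subst_graph g hs)))) ?ys \<in> Collect (ideal E R m n d)"
  proof (rule mext_closed)
    fix hs assume "list_all2 (\<lambda>h x. h \<in> keys x) hs ?ys"
    note m = mem[OF this]
    have len: "length hs = length (verts g)" using m by (rule list_all2_lengthD)
    then have \<pi>: "\<pi> permutes {..<length hs}" using reorder(3) by simp
    have "map gdeg hs = map vdeg (verts g)"
      using m by (intro nth_equalityI) (auto simp: list_all2_conv_all_nth dgraphs_arity)
    then have k: "?k = koszul (block_permutation \<pi> hs) (map vdeg (verts (subst_graph g hs)))"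
      by (simp add: koszul_block[OF \<pi>])
    have "subst_graph g hs \<in> dgraphs E m n d"
      using subst_dgraphs(1)[OF wf m] dgraphs_arity[OF reorder(2)] by simp
    from graph_relator.reorder[OF this, of "block_permutation \<pi> hs"] block_permutes[OF \<pi>]
    show "basis (subst_graph g hs) - fscale ?k (basis (permute_vertices (block_permutation \<pi> hs) (subst_graph g hs)))
        \<in> Collect (ideal E R m n d)"
      unfolding k by (auto intro!: ideal_relator)
  qed (auto intro: ideal_zero ideal.add ideal.scale)
  ultimately show ?thesis by simp
next
  case (equivariant g i \<sigma> \<tau>)
  let ?ys = "map (\<lambda>v. dec_image F (dec v)) (verts g)"
  let ?v = "verts g ! i"
  have wf: "wf_graph g" using equivariant(2) by (rule dgraphs_wf)
  have "graph_image F (twist (free_sbimod ar) i \<sigma> \<tau> g) =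
      msubst (twist (free_sbimod ar) i \<sigma> \<tau> g) (?ys[i := act_comb \<sigma> \<tau> (?ys ! i)])"
    using dec_image_act[OF dgraphs_dec[OF equivariant(2,3)] equivariant(5), of F] equivariant(3)
    by (simp add: graph_image_def map_update del: free_sbimod_sel)
  also have "\<dots> = mext (\<lambda>hs. basis (subst_graph (twist (free_sbimod ar) i \<sigma> \<tau> g) (hs[i := act_graph \<sigma> \<tau> (hs ! i)]))) ?ys"
    unfolding msubst_mext act_comb_def using equivariant(3) by (intro mext_slot_map) simp
  also have "\<dots> = mext (\<lambda>hs. basis (subst_graph g hs)) ?ys"
  proof (rule mext_cong)
    fix hs assume "list_all2 (\<lambda>h x. h \<in> keys x) hs ?ys"
    note m = keys_dgraphs[OF dec_images_formal[OF F equivariant(2)] this]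
    have len: "length hs = length (verts g)" using m by (rule list_all2_lengthD)
    show "basis (subst_graph (twist (free_sbimod ar) i \<sigma> \<tau> g) (hs[i := act_graph \<sigma> \<tau> (hs ! i)])) = basis (subst_graph g hs)"
      using subst_twist[OF wf subst_dgraphs(3)[OF wf m] subst_dgraphs(2)[OF wf m], of i \<sigma> \<tau> "free_sbimod ar"] equivariant len by simp
  qed
  finally have "hom F r = 0"
    using equivariant(1) by (simp add: hom_diff hom_basis) (simp add: graph_image_def msubst_mext)
  then show ?thesis by (simp add: ideal_zero)
qed

lemma hom_graph_rels:
  assumes F: "generator_map ar E F" and x: "x \<in> graph_rels (free_sbimod ar) m n d"
  shows "ideal E R m n d (hom F x)"
proof -
  show ?thesis
  proof (rule fspace.span_induct[where P = "\<lambda>x. ideal E R m n d (hom F x)"])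
    show "x \<in> fspace.span (Collect (graph_relator (free_sbimod ar) m n d))"
      using x by (simp add: graph_rels_def)
    show "fspace.subspace {x. ideal E R m n d (hom F x)}"
      by (rule fspace.subspaceI) (auto simp: hom_add hom_fscale intro: ideal_zero ideal.add ideal.scale)
  qed (use graph_image_relator[OF F] in auto)
qed

lemma mext_basis2: "mext f (map2 (\<lambda>x y. basis (h x y)) xs ys) = f (map2 h xs ys)"
  using mext_basis[of f "map2 h xs ys"] by (simp add: o_def case_prod_unfold)

text \<open>A morphism commutes with substitution because substitution is associative.\<close>

lemma graph_image_subst:
  fixes \<Gamma> :: "'x dgraph"
  assumes F: "generator_map ar E F" and wf: "wf_graph \<Gamma>"
    and gs: "list_all2 (\<lambda>g v. g \<in> dgraphs (free_sbimod ar) (outs v) (ins v) (vdeg v)) gs (verts \<Gamma>)"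
  shows "graph_image F (subst_graph \<Gamma> gs) = msubst \<Gamma> (map (graph_image F) gs)"
proof -
  let ?ys = "\<lambda>g. map (\<lambda>v. dec_image F (dec v)) (verts g)"
  have g: "gs ! i \<in> dgraphs (free_sbimod ar) (outs (verts \<Gamma> ! i)) (ins (verts \<Gamma> ! i)) (vdeg (verts \<Gamma> ! i))"
    if "i < length gs" for i using gs that by (auto simp: list_all2_conv_all_nth)
  have "msubst (subst_graph \<Gamma> gs) (concat (map ?ys gs)) =
      mext (\<lambda>gs. basis (subst_graph \<Gamma> gs)) (map2 (\<lambda>g xs. mext (\<lambda>hs. basis (subst_graph g hs)) xs) gs (map ?ys gs))"
    unfolding msubst_mext
  proof (rule mext_mext)
    show "length (map ?ys gs) = length gs" by simp
    fix hss assume hss: "list_all2 (list_all2 (\<lambda>a x. a \<in> keys x)) hss (map ?ys gs)"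
    then have len: "length hss = length gs" by (simp add: list_all2_lengthD)
    have m: "list_all2 (\<lambda>h v. h \<in> dgraphs E (outs v) (ins v) (vdeg v)) (hss ! i) (verts (gs ! i))"
      if "i < length gs" for i
      using list_all2_nthD[OF hss, of i] that len
      by (intro keys_dgraphs[OF dec_images_formal[OF F g[OF that]]]) simp
    have wfg: "wf_graph (gs ! i)" if "i < length gs" for i using g[OF that] by (rule dgraphs_wf)
    have "subst_graph (subst_graph \<Gamma> gs) (concat hss) = subst_graph \<Gamma> (map2 subst_graph gs hss)"
    proof (rule subst_graph_assoc)
      show "acyclic_wired \<Gamma>" by (rule wf_graph_acyclic_wired[OF wf])
      show "acyclic_wired (gs ! i)" if "i < length gs" for i by (rule wf_graph_acyclic_wired[OF wfg[OF that]])
      show "fits \<Gamma> gs" by (rule subst_dgraphs(2)[OF wf gs])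
      show "length hss = length gs" by (rule len)
      show "fits (gs ! i) (hss ! i)" if "i < length gs" for i
        by (rule subst_dgraphs(2)[OF wfg[OF that] m[OF that]])
      show "acyclic_wired (hss ! i ! j)" if "i < length gs" "j < length (hss ! i)" for i j
        using subst_dgraphs(3)[OF wfg[OF that(1)] m[OF that(1)]] that(2) by (simp add: wf_graph_acyclic_wired)
    qed
    then show "basis (subst_graph (subst_graph \<Gamma> gs) (concat hss)) =
        mext (\<lambda>gs. basis (subst_graph \<Gamma> gs)) (map2 (\<lambda>g hs. basis (subst_graph g hs)) gs hss)"
      by (simp only: mext_basis2)
  qed
  moreover have "map2 (\<lambda>g xs. mext (\<lambda>hs. basis (subst_graph g hs)) xs) gs (map ?ys gs) = map (graph_image F) gs"
    by (intro nth_equalityI) (simp_all add: graph_image_def msubst_mext)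
  moreover have "concat (map ?ys gs) = ?ys (subst_graph \<Gamma> gs)"
    by (simp add: map_concat o_def)
  ultimately show ?thesis by (simp add: graph_image_def msubst_mext)
qed

lemma hom_msubst:
  fixes \<Gamma> :: "'x dgraph"
  assumes F: "generator_map ar E F" and wf: "wf_graph \<Gamma>"
    and xs: "list_all2 (\<lambda>x v. x \<in> formal (free_sbimod ar) (outs v) (ins v) (vdeg v)) xs (verts \<Gamma>)"
  shows "hom F (msubst \<Gamma> xs) = msubst \<Gamma> (map (hom F) xs)"
proof -
  have "hom F (msubst \<Gamma> xs) = mext (\<lambda>gs. graph_image F (subst_graph \<Gamma> gs)) xs"
    by (simp add: msubst_mext hom_def lin_mext)
  also have "\<dots> = mext (\<lambda>gs. msubst \<Gamma> (map (graph_image F) gs)) xs"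
    by (rule mext_cong) (rule graph_image_subst[OF F wf keys_dgraphs[OF xs]])
  also have "\<dots> = msubst \<Gamma> (map (hom F) xs)"
    by (simp add: msubst_mext hom_def mext_map_lin)
  finally show ?thesis .
qed

lemma hom_act_comb:
  assumes F: "generator_map ar E F" and x: "x \<in> formal (free_sbimod ar) m n d"
    and \<sigma>: "\<sigma> permutes {..<m}" and \<tau>: "\<tau> permutes {..<n}"
  shows "hom F (act_comb \<sigma> \<tau> x) = act_comb \<sigma> \<tau> (hom F x)"
proof -
  let ?v = "Vertex m n d ()"
  have "wf_graph (act_graph \<sigma> \<tau> (corolla ?v))" using wf_act_graph[OF wf_corolla[of ?v]] \<sigma> \<tau> by simp
  then have "hom F (msubst (act_graph \<sigma> \<tau> (corolla ?v)) [x]) = msubst (act_graph \<sigma> \<tau> (corolla ?v)) [hom F x]"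
    using hom_msubst[OF F, of "act_graph \<sigma> \<tau> (corolla ?v)" "[x]"] x by simp
  then show ?thesis
    using act_comb_msubst[OF x \<sigma> \<tau>, of ?v] act_comb_msubst[OF hom_formal[OF F x] \<sigma> \<tau>, of ?v] by simp
qed

lemma hom_ideal:
  assumes F: "generator_map ar E F"
    and R: "\<And>r m n d. r \<in> R \<Longrightarrow> r \<in> formal (free_sbimod ar) m n d \<Longrightarrow> ideal E R' m n d (hom F r)"
  shows "ideal (free_sbimod ar) R m n d x \<Longrightarrow> ideal E R' m n d (hom F x)"
proof (induction rule: ideal.induct)
  case (subst \<Gamma> xs i a b k)
  have "list_all2 (\<lambda>x v. x \<in> formal E (outs v) (ins v) (vdeg v)) (map (hom F) xs) (verts \<Gamma>)"
    using subst(2) hom_formal[OF F] by (auto simp: list_all2_conv_all_nth)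
  then have "ideal E R' (gout \<Gamma>) (gin \<Gamma>) (gdeg \<Gamma>) (msubst \<Gamma> (map (hom F) xs))"
    using subst by (intro ideal_msubst[where i = i]) auto
  then show ?case using hom_msubst[OF F subst(1,2)] by simp
qed (auto simp: hom_add hom_fscale intro: R hom_graph_rels[OF F] ideal.add ideal.scale)


text \<open>A corolla is, up to the relations, the combination of the corollas on the generators that its
  decoration is made of.\<close>

lemma corolla_dec_image:
  fixes e :: "('k::field, 'g) free_elt"
  assumes e: "e \<in> car (free_sbimod ar) m n d"
  shows "ideal (free_sbimod ar) R m n d (basis (corolla (Vertex m n d e)) - dec_image (\<lambda>g. basis (gen ar g)) e)"
proof -
  let ?E = "free_sbimod ar"
  let ?c = "\<lambda>e :: ('k, 'g) free_elt. basis (corolla (Vertex m n d e)) :: ('k, 'g) free_elt dgraph \<Rightarrow>\<^sub>0 'k"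
  have g: "corolla (Vertex m n d e) \<in> dgraphs ?E m n d" if "e \<in> car ?E m n d" for e
    using that wf_corolla by (auto simp: dgraphs_def gdeg_def)
  have sd: "set_dec (corolla (Vertex m n d e)) 0 e' = corolla (Vertex m n d e')" for e e' :: "('k, 'g) free_elt"
    by (simp add: set_dec_def corolla_def)
  have scale: "ideal ?E R m n d (?c (fscale c e) - fscale c (?c e))" if "e \<in> car ?E m n d" for c e
    using graph_relator.homogeneous[OF g[OF that], of 0 m n d e e c] that
    by (intro ideal_relator) (simp add: sd)
  have zero: "(0 :: ('k, 'g) free_elt) \<in> car ?E m n d" by simp
  have sum: "ideal ?E R m n d (?c (\<Sum>t\<in>A. fscale (lookup e t) (basis t)) - (\<Sum>t\<in>A. fscale (lookup e t) (?c (basis t))))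
       \<and> (\<Sum>t\<in>A. fscale (lookup e t) (basis t)) \<in> car ?E m n d"
    if "finite A" "A \<subseteq> keys e" for A
    using that
  proof (induction A rule: finite_induct)
    case empty
    then show ?case using scale[OF zero, of 0] by simp
  next
    case (insert t A)
    let ?s = "\<Sum>t\<in>A. fscale (lookup e t) (basis t)" and ?t = "fscale (lookup e t) (basis t)"
    have t: "basis t \<in> car ?E m n d" using e insert.prems by (cases t) auto
    have st: "?t \<in> car ?E m n d" using t by (cases t) (auto simp: in_keys_iff lookup_single when_def split: if_splits)
    have s: "?s \<in> car ?E m n d" and IH: "ideal ?E R m n d (?c ?s - (\<Sum>t\<in>A. fscale (lookup e t) (?c (basis t))))"
      using insert by auto
    have 1: "ideal ?E R m n d (?c (?t + ?s) - ?c ?t - ?c ?s)"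
      using graph_relator.additive[OF g[OF zero], of 0 m n d 0 ?t ?s] st s
      by (intro ideal_relator) (simp add: sd del: free_sbimod_sel(1))
    have "ideal ?E R m n d ((?c (?t + ?s) - ?c ?t - ?c ?s) + ((?c ?t - fscale (lookup e t) (?c (basis t)))
        + (?c ?s - (\<Sum>t\<in>A. fscale (lookup e t) (?c (basis t))))))"
      by (intro ideal.add 1 scale t IH)
    moreover have "?t + ?s \<in> car ?E m n d" 
      using closed_sbimod_add[OF closed_free_sbimod st s] by (simp del: free_sbimod_sel(1))
    ultimately show ?case using insert by (simp add: algebra_simps del: free_sbimod_sel(1))
  qed
  have corolla_sum: "ideal ?E R m n d (?c e - lin (\<lambda>t. ?c (basis t)) e)"
    using sum[of "keys e"] keys_finite_comb[of e] by (simp add: lin_def)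
  have "ideal ?E R m n d (lin (\<lambda>t. ?c (basis t) - (case t of (\<sigma>, g, \<tau>) \<Rightarrow> act_comb \<sigma> \<tau> (basis (gen ar g)))) e)"
  proof (rule ideal_lin)
    fix t assume t: "t \<in> keys e"
    obtain \<sigma> h \<tau> where t': "t = (\<sigma>, h, \<tau>)" by (metis surj_pair)
    have ar: "ar h = (m, n, d)" and \<sigma>: "\<sigma> permutes {..<m}" and \<tau>: "\<tau> permutes {..<n}"
      using t e t' by auto
    let ?v = "Vertex m n d (basis (id, h, id)) :: ('k, 'g) free_elt vertex"
    let ?g = "act_graph \<sigma> \<tau> (corolla ?v)"
    have "corolla ?v \<in> dgraphs ?E m n d" using ar by (intro g) (auto simp: permutes_id)
    then have gg: "?g \<in> dgraphs ?E m n d" using \<sigma> \<tau> by (rule dgraphs_act)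
    have "twist ?E 0 \<sigma> \<tau> ?g = corolla (Vertex m n d (basis t))"
    proof -
      let ?i = "\<lambda>q. (Ext q, Vtx 0 q)" and ?o = "\<lambda>p. (Vtx 0 p, Ext p)"
      have e: "edges (corolla v) = ?i ` {..<ins v} \<union> ?o ` {..<outs v}" for v :: "('k, 'g) free_elt vertex"
        by (auto simp: corolla_def)
      have "edges (twist ?E 0 \<sigma> \<tau> ?g) = ?i ` inv \<tau> ` {..<n} \<union> ?o ` \<sigma> ` {..<m}"
        by (simp add: e image_Un image_image)
      also have "\<dots> = edges (corolla (Vertex m n d (basis t :: ('k, 'g) free_elt)))"
        by (simp add: e permutes_image[OF \<sigma>] permutes_image[OF permutes_inv[OF \<tau>]])
      finally show ?thesis
        by (intro dgraph.expand) (simp add: t')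
    qed
    then have "ideal ?E R m n d (?c (basis t) - basis ?g)"
      using graph_relator.equivariant[OF gg, of 0 \<sigma> \<tau>] \<sigma> \<tau> by (intro ideal_relator) simp
    then show "ideal ?E R m n d (?c (basis t) - (case t of (\<sigma>, g, \<tau>) \<Rightarrow> act_comb \<sigma> \<tau> (basis (gen ar g))))"
      by (simp add: t' act_comb_def gen_def ar)
  qed
  moreover have "lin (\<lambda>t. ?c (basis t) - (case t of (\<sigma>, g, \<tau>) \<Rightarrow> act_comb \<sigma> \<tau> (basis (gen ar g :: ('k, 'g) free_elt dgraph)))) e
      = lin (\<lambda>t. ?c (basis t)) e - dec_image (\<lambda>g. basis (gen ar g :: ('k, 'g) free_elt dgraph)) e"
    by (simp only: dec_image_def lin_fun_diff)
  ultimately have "ideal ?E R m n d (lin (\<lambda>t. ?c (basis t)) e - dec_image (\<lambda>g. basis (gen ar g)) e)"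
    by (simp only:)
  from ideal.add[OF corolla_sum this] show ?thesis by simp
qed

text \<open>Hence a composite of morphisms that fixes the generators modulo the relations is the identity
  modulo the relations.\<close>

lemma hom_hom:
  fixes F :: "'g \<Rightarrow> (('k::field, 'h) free_elt dgraph \<Rightarrow>\<^sub>0 'k)" and G :: "'h \<Rightarrow> (('k, 'g) free_elt dgraph \<Rightarrow>\<^sub>0 'k)"
  assumes F: "generator_map ar (free_sbimod ar') F" and G: "generator_map ar' (free_sbimod ar) G"
    and GF: "\<And>g m n d. ar g = (m, n, d) \<Longrightarrow> ideal (free_sbimod ar) R m n d (hom G (F g) - basis (gen ar g))"
    and x: "x \<in> formal (free_sbimod ar) m n d"
  shows "ideal (free_sbimod ar) R m n d (hom G (hom F x) - x)"
proof -
  let ?E = "free_sbimod ar"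
  have dec: "ideal ?E R a b k (hom G (dec_image F e) - basis (corolla (Vertex a b k e)))"
    if e: "e \<in> car ?E a b k" for a b k e
  proof -
    have "ideal ?E R a b k (lin (\<lambda>t. case t of (\<sigma>, g, \<tau>) \<Rightarrow> act_comb \<sigma> \<tau> (hom G (F g) - basis (gen ar g))) e)"
    proof (rule ideal_lin)
      fix t assume t: "t \<in> keys e"
      obtain \<sigma> h \<tau> where t': "t = (\<sigma>, h, \<tau>)" by (metis surj_pair)
      then show "ideal ?E R a b k (case t of (\<sigma>, g, \<tau>) \<Rightarrow> act_comb \<sigma> \<tau> (hom G (F g) - basis (gen ar g)))"
        using e t GF by (auto intro!: ideal_act_comb[OF closed_free_sbimod])
    qed
    moreover have "lin (\<lambda>t. case t of (\<sigma>, g, \<tau>) \<Rightarrow> act_comb \<sigma> \<tau> (hom G (F g) - basis (gen ar g))) e =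
        hom G (dec_image F e) - dec_image (\<lambda>g. basis (gen ar g)) e"
    proof -
      have "hom G (dec_image F e) = lin (\<lambda>t. hom G (case t of (\<sigma>, g, \<tau>) \<Rightarrow> act_comb \<sigma> \<tau> (F g))) e"
        by (simp add: dec_image_def hom_def lin_lin)
      also have "\<dots> = lin (\<lambda>t. case t of (\<sigma>, g, \<tau>) \<Rightarrow> act_comb \<sigma> \<tau> (hom G (F g))) e"
      proof (rule lin_cong)
        fix t assume t: "t \<in> keys e"
        obtain \<sigma> h \<tau> where t': "t = (\<sigma>, h, \<tau>)" by (metis surj_pair)
        have "ar h = (a, b, k)" and \<sigma>: "\<sigma> permutes {..<a}" and \<tau>: "\<tau> permutes {..<b}"
          using e t t' by auto
        then have "F h \<in> formal (free_sbimod ar') a b k" using F by (simp add: generator_map_def)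
        from hom_act_comb[OF G this \<sigma> \<tau>] show "hom G (case t of (\<sigma>, g, \<tau>) \<Rightarrow> act_comb \<sigma> \<tau> (F g)) = (case t of (\<sigma>, g, \<tau>) \<Rightarrow> act_comb \<sigma> \<tau> (hom G (F g)))"
          by (simp add: t')
      qed
      finally show ?thesis
        by (simp add: dec_image_def act_comb_def lin_diff lin_fun_diff[symmetric] case_prod_unfold)
    qed
    ultimately have "ideal ?E R a b k (hom G (dec_image F e) - dec_image (\<lambda>g. basis (gen ar g)) e)" by simp
    from ideal_diff[OF this corolla_dec_image[OF e, of R]] show ?thesis by simp
  qed
  have graph: "ideal ?E R m n d (hom G (graph_image F g) - basis g)" if g: "g \<in> dgraphs ?E m n d" for g
  proof -
    let ?ys = "map (\<lambda>v. dec_image F (dec v)) (verts g)" and ?cs = "map (\<lambda>v. basis (corolla v) :: ('k, 'g) free_elt dgraph \<Rightarrow>\<^sub>0 'k) (verts g)"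
    have wf: "wf_graph g" using g by (rule dgraphs_wf)
    have "hom G (graph_image F g) = msubst g (map (hom G) ?ys)"
      unfolding graph_image_def by (rule hom_msubst[OF G wf dec_images_formal[OF F g]])
    moreover have "msubst g ?cs = basis g"
    proof -
      have "msubst g (map basis (map corolla (verts g)) :: (('k, 'g) free_elt dgraph \<Rightarrow>\<^sub>0 'k) list) = basis (subst_graph g (map corolla (verts g)))"
        unfolding msubst_mext by (rule mext_basis)
      then show ?thesis using subst_corollas_id[OF wf_graph_acyclic_wired[OF wf]] by (simp add: o_def)
    qed
    moreover have "ideal ?E R (gout g) (gin g) (gdeg g) (msubst g (map (hom G) ?ys) - msubst g ?cs)"
    proof (rule ideal_msubst_cong[OF wf closed_free_sbimod])
      show "list_all2 (\<lambda>x v. x \<in> formal ?E (outs v) (ins v) (vdeg v)) ?cs (verts g)"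
        using dgraphs_dec[OF g] wf_corolla by (auto simp: list_all2_conv_all_nth dgraphs_def gdeg_def)
      fix i assume i: "i < length ?cs"
      then show "ideal ?E R (outs (verts g ! i)) (ins (verts g ! i)) (vdeg (verts g ! i)) (map (hom G) ?ys ! i - ?cs ! i)"
        using dec[OF dgraphs_dec[OF g, of i]] by simp
    qed simp
    ultimately show ?thesis using dgraphs_arity[OF g] by simp
  qed
  have "hom G (hom F x) - x = lin (\<lambda>g. hom G (graph_image F g) - basis g) x"
    by (simp add: lin_fun_diff lin_basis_id) (simp add: hom_def lin_lin)
  then show ?thesis using graph formal_keys[OF x] by (simp add: ideal_lin)
qed

section \<open>String diagrams with named wires\<close>

text \<open>
  A diagram is given by the names of its output and input wires and by its vertices, each with the
  names of its outgoing and incoming wires. Equal names are joined.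
\<close>

type_synonym 'g nvertex = "'g \<times> nat list \<times> nat list"
type_synonym 'g diagram = "nat list \<times> nat list \<times> 'g nvertex list"

fun src_name :: "nat list \<Rightarrow> (nat list \<times> nat list) list \<Rightarrow> port \<Rightarrow> nat" where
  "src_name I W (Ext j) = I ! j"
| "src_name I W (Vtx i p) = fst (W ! i) ! p"

fun tgt_name :: "nat list \<Rightarrow> (nat list \<times> nat list) list \<Rightarrow> port \<Rightarrow> nat" where
  "tgt_name O' W (Ext j) = O' ! j"
| "tgt_name O' W (Vtx i q) = snd (W ! i) ! q"

text \<open>The names of a diagram are the labels of the graph that it draws.\<close>

definition wire_graph :: "nat list \<Rightarrow> nat list \<Rightarrow> (nat list \<times> nat list) list \<Rightarrow> 'e vertex list \<Rightarrow> 'e dgraph" where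
  "wire_graph O' I W vs = DGraph (length O') (length I) vs
     {(s, t). s \<in> sources (DGraph (length O') (length I) vs {}) \<and>
        t \<in> targets (DGraph (length O') (length I) vs {}) \<and> src_name I W s = tgt_name O' W t}"

definition arity_eqs :: "(nat list \<times> nat list) list \<Rightarrow> 'e vertex list \<Rightarrow> bool" where
  "arity_eqs W vs \<longleftrightarrow> list_all2 (\<lambda>w v. outs v = length (fst w) \<and> ins v = length (snd w)) W vs"

definition source_names :: "nat list \<Rightarrow> (nat list \<times> nat list) list \<Rightarrow> nat list" where
  "source_names I W = I @ concat (map fst W)"

definition target_names :: "nat list \<Rightarrow> (nat list \<times> nat list) list \<Rightarrow> nat list" where
  "target_names O' W = O' @ concat (map snd W)"

definition joined :: "nat list \<Rightarrow> nat list \<Rightarrow> (nat list \<times> nat list) list \<Rightarrow> bool" where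
  "joined O' I W \<longleftrightarrow> distinct (source_names I W) \<and> distinct (target_names O' W) \<and>
     set (source_names I W) = set (target_names O' W)"

text \<open>Later vertices feed earlier ones.\<close>

fun topological :: "(nat list \<times> nat list) list \<Rightarrow> bool" where
  "topological [] \<longleftrightarrow> True"
| "topological (w # W) \<longleftrightarrow> (\<forall>x\<in>set (fst w). x \<notin> set (concat (map snd (w # W)))) \<and> topological W"

text \<open>The wires that are met when walking once through the vertices, starting from the wires \<open>A\<close>.\<close>

fun spread :: "(nat list \<times> nat list) list \<Rightarrow> nat list \<Rightarrow> nat list" where
  "spread [] A = A"
| "spread (w # W) A = (if \<exists>x\<in>set (fst w @ snd w). x \<in> set A then spread W (fst w @ snd w @ A) else spread W A)"

text \<open>A condition that is decided by evaluation and ensures that the graph is well-formed. Three walks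
  through the vertices reach every wire in each of the diagrams that occur below.\<close>

definition well_drawn :: "nat list \<Rightarrow> nat list \<Rightarrow> (nat list \<times> nat list) list \<Rightarrow> bool" where
  "well_drawn O' I W \<longleftrightarrow> joined O' I W \<and> topological W \<and> source_names I W \<noteq> [] \<and>
     (\<forall>w\<in>set W. fst w @ snd w \<noteq> []) \<and>
     set (source_names I W) \<subseteq> set (spread W (spread W (spread W [hd (source_names I W)])))"

lemma wire_graph_sel [simp]:
  "gout (wire_graph O' I W vs) = length O'" "gin (wire_graph O' I W vs) = length I"
  "verts (wire_graph O' I W vs) = vs"
  by (simp_all add: wire_graph_def)

lemma wire_graph_edges:
  "(s, t) \<in> edges (wire_graph O' I W vs) \<longleftrightarrow> s \<in> sources (wire_graph O' I W vs) \<and>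
     t \<in> targets (wire_graph O' I W vs) \<and> src_name I W s = tgt_name O' W t"
  by (simp add: wire_graph_def sources_def targets_def)

lemma names_inj:
  assumes d: "distinct (A @ concat (map f W))"
    and N: "N = (\<lambda>s. case s of Ext j \<Rightarrow> A ! j | Vtx i p \<Rightarrow> f (W ! i) ! p)"
    and S: "S = {s. case s of Ext j \<Rightarrow> j < length A | Vtx i p \<Rightarrow> i < length W \<and> p < length (f (W ! i))}"
  shows "inj_on N S" "N ` S = set (A @ concat (map f W))"
proof -
  let ?C = "concat (map f W)" and ?L = "map (\<lambda>w. length (f w)) W"
  have nth: "f (W ! i) ! p = ?C ! (sum_list (take i ?L) + p)" if "i < length W" "p < length (f (W ! i))" for i p
    using concat_nth_sum[of i "map f W" p] that by (simp add: o_def)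
  have lt: "sum_list (take i ?L) + p < length ?C" if "i < length W" "p < length (f (W ! i))" for i p
    using sum_take_less[of i ?L p] that by (simp add: length_concat o_def)
  have mem: "f (W ! i) ! p \<in> set ?C" if "i < length W" "p < length (f (W ! i))" for i p
    using nth_mem[OF that(1)] nth_mem[OF that(2)] by auto
  show "inj_on N S"
  proof (rule inj_onI)
    fix s t assume s: "s \<in> S" and t: "t \<in> S" and e: "N s = N t"
    have dis: "A ! j \<notin> set ?C" if "j < length A" for j using d that by (auto simp: disjoint_iff)
    have ne: "A ! j \<noteq> f (W ! i) ! p" "f (W ! i) ! p \<noteq> A ! j"
      if "j < length A" "i < length W" "p < length (f (W ! i))" for i j p
      using mem[OF that(2,3)] dis[OF that(1)] by metis+
    show "s = t"
    proof (cases s)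
      case (Ext j)
      then obtain j' where "t = Ext j'" using s t e ne(1) by (cases t) (auto simp: S N)
      then show ?thesis using s t e d Ext by (auto simp: S N nth_eq_iff_index_eq)
    next
      case (Vtx i p)
      then obtain i' p' where t': "t = Vtx i' p'" using s t e ne(2) by (cases t) (auto simp: S N)
      have ip: "i < length W" "p < length (f (W ! i))" "i' < length W" "p' < length (f (W ! i'))"
        using s t Vtx t' by (auto simp: S)
      then have eq: "sum_list (take i ?L) + p = sum_list (take i' ?L) + p'"
        using e d lt nth Vtx t' by (simp add: N nth_eq_iff_index_eq)
      have "(i, p) = block ?L (sum_list (take i ?L) + p)" using block_sum[of i ?L p] ip by simp
      also have "\<dots> = block ?L (sum_list (take i' ?L) + p')" by (simp only: eq)
      also have "\<dots> = (i', p')" using block_sum[of i' ?L p'] ip by simp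
      finally show ?thesis using Vtx t' by simp
    qed
  qed
  show "N ` S = set (A @ ?C)"
  proof (intro equalityI subsetI)
    fix x assume "x \<in> N ` S"
    then obtain s where "s \<in> S" "x = N s" by auto
    then show "x \<in> set (A @ ?C)"
    proof (cases s)
      case (Vtx i p)
      then show ?thesis using mem[of i p] \<open>s \<in> S\<close> \<open>x = N s\<close> by (simp add: S N)
    qed (auto simp: S N)
  next
    fix x assume "x \<in> set (A @ ?C)"
    then consider j where "j < length A" "x = A ! j" | i p where "i < length W" "p < length (f (W ! i))" "x = f (W ! i) ! p"
      by (auto simp: in_set_conv_nth)
    then show "x \<in> N ` S"
    proof cases
      case 1
      then show ?thesis by (intro image_eqI[of _ _ "Ext j"]) (auto simp: S N)
    next
      case 2
      then show ?thesis by (intro image_eqI[of _ _ "Vtx i p"]) (auto simp: S N)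
    qed
  qed
qed

lemma src_name_bij:
  assumes "distinct (source_names I W)" "arity_eqs W (verts g)" "gin g = length I"
  shows "inj_on (src_name I W) (sources g)" "src_name I W ` sources g = set (source_names I W)"
proof -
  have N: "src_name I W = (\<lambda>s. case s of Ext j \<Rightarrow> I ! j | Vtx i p \<Rightarrow> fst (W ! i) ! p)"
    by (rule ext) (auto split: port.splits)
  have S: "sources g = {s. case s of Ext j \<Rightarrow> j < length I | Vtx i p \<Rightarrow> i < length W \<and> p < length (fst (W ! i))}"
  proof (rule set_eqI)
    show "s \<in> sources g \<longleftrightarrow> s \<in> {s. case s of Ext j \<Rightarrow> j < length I | Vtx i p \<Rightarrow> i < length W \<and> p < length (fst (W ! i))}" for s
      using assms(2,3) by (cases s) (auto simp: arity_eqs_def list_all2_conv_all_nth)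
  qed
  show "inj_on (src_name I W) (sources g)" "src_name I W ` sources g = set (source_names I W)"
    using names_inj[of I fst W, OF _ N S] assms(1) by (simp_all add: source_names_def)
qed

lemma tgt_name_bij:
  assumes "distinct (target_names O' W)" "arity_eqs W (verts g)" "gout g = length O'"
  shows "inj_on (tgt_name O' W) (targets g)" "tgt_name O' W ` targets g = set (target_names O' W)"
proof -
  have N: "tgt_name O' W = (\<lambda>s. case s of Ext j \<Rightarrow> O' ! j | Vtx i p \<Rightarrow> snd (W ! i) ! p)"
    by (rule ext) (auto split: port.splits)
  have S: "targets g = {s. case s of Ext j \<Rightarrow> j < length O' | Vtx i p \<Rightarrow> i < length W \<and> p < length (snd (W ! i))}"
  proof (rule set_eqI)
    show "s \<in> targets g \<longleftrightarrow> s \<in> {s. case s of Ext j \<Rightarrow> j < length O' | Vtx i p \<Rightarrow> i < length W \<and> p < length (snd (W ! i))}" for s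
      using assms(2,3) by (cases s) (auto simp: arity_eqs_def list_all2_conv_all_nth)
  qed
  show "inj_on (tgt_name O' W) (targets g)" "tgt_name O' W ` targets g = set (target_names O' W)"
    using names_inj[of O' snd W, OF _ N S] assms(1) by (simp_all add: target_names_def)
qed

lemma wired_wire_graph:
  assumes j: "joined O' I W" and a: "arity_eqs W vs"
  shows "wired (wire_graph O' I W vs)"
proof -
  let ?g = "wire_graph O' I W vs"
  have s: "inj_on (src_name I W) (sources ?g)" "src_name I W ` sources ?g = set (source_names I W)"
    using src_name_bij[of I W ?g] j a by (simp_all add: joined_def)
  have t: "inj_on (tgt_name O' W) (targets ?g)" "tgt_name O' W ` targets ?g = set (source_names I W)"
    using tgt_name_bij[of O' W ?g] j a by (simp_all add: joined_def)
  show ?thesis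
    unfolding wired_def
  proof (intro conjI ballI)
    show "edges ?g \<subseteq> sources ?g \<times> targets ?g" by (auto simp: wire_graph_edges)
    show "\<exists>!t. (x, t) \<in> edges ?g" if x: "x \<in> sources ?g" for x
    proof -
      have "src_name I W x \<in> tgt_name O' W ` targets ?g" using s t x by blast
      then obtain y where "y \<in> targets ?g" "src_name I W x = tgt_name O' W y" by blast
      then show ?thesis using x inj_onD[OF t(1)] by (intro ex1I[of _ y]) (auto simp: wire_graph_edges)
    qed
    show "\<exists>!s. (s, y) \<in> edges ?g" if y: "y \<in> targets ?g" for y
    proof -
      have "tgt_name O' W y \<in> src_name I W ` sources ?g" using s t y by blast
      then obtain x where "x \<in> sources ?g" "src_name I W x = tgt_name O' W y" by force
      then show ?thesis using y inj_onD[OF s(1)] by (intro ex1I[of _ x]) (auto simp: wire_graph_edges)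
    qed
  qed
qed

lemma topological_nth:
  "topological W \<Longrightarrow> i < length W \<Longrightarrow> j < length W \<Longrightarrow> x \<in> set (fst (W ! i)) \<Longrightarrow> x \<in> set (snd (W ! j)) \<Longrightarrow> j < i"
proof (induction W arbitrary: i j)
  case (Cons w W)
  show ?case
  proof (cases i)
    case 0
    then have "x \<in> set (fst w)" using Cons.prems by simp
    moreover have "x \<in> set (concat (map snd (w # W)))"
      using Cons.prems(3,5) nth_mem[OF Cons.prems(3)] by auto
    ultimately show ?thesis using Cons.prems(1) by auto
  next
    case (Suc i')
    then show ?thesis using Cons.prems Cons.IH[of i' "j - 1"] by (cases j) auto
  qed
qed simp

lemma spread_constant:
  assumes "\<And>w x y. w \<in> set W \<Longrightarrow> x \<in> set (fst w @ snd w) \<Longrightarrow> y \<in> set (fst w @ snd w) \<Longrightarrow> c x = c y"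
    and "\<And>x. x \<in> set A \<Longrightarrow> c x = b"
  shows "x \<in> set (spread W A) \<Longrightarrow> c x = b"
  using assms
proof (induction W arbitrary: A)
  case (Cons w W)
  show ?case
  proof (cases "\<exists>x\<in>set (fst w @ snd w). x \<in> set A")
    case True
    then obtain z where z: "z \<in> set (fst w @ snd w)" "z \<in> set A" by blast
    have w: "c y = b" if "y \<in> set (fst w @ snd w)" for y
      using Cons.prems(2)[of w y z] Cons.prems(3)[OF z(2)] z(1) that by simp
    have "x \<in> set (spread W (fst w @ snd w @ A))" using Cons.prems(1) True by simp
    then show ?thesis
    proof (rule Cons.IH)
      show "c x = c y" if "w' \<in> set W" "x \<in> set (fst w' @ snd w')" "y \<in> set (fst w' @ snd w')" for w' x y
        using Cons.prems(2)[of w' x y] that by simp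
      show "c y = b" if "y \<in> set (fst w @ snd w @ A)" for y
        using that w[of y] Cons.prems(3)[of y] by auto
    qed
  next
    case False
    then have "x \<in> set (spread W A)" using Cons.prems(1) by simp
    then show ?thesis
    proof (rule Cons.IH)
      show "c x = c y" if "w' \<in> set W" "x \<in> set (fst w' @ snd w')" "y \<in> set (fst w' @ snd w')" for w' x y
        using Cons.prems(2)[of w' x y] that by simp
    qed (rule Cons.prems(3))
  qed
qed simp

text \<open>A two-colouring of the ports is a two-colouring of the names. It spreads from one wire to all
  wires that are reached through vertices.\<close>

lemma wf_wire_graph:
  assumes d: "well_drawn O' I W" and a: "arity_eqs W vs"
  shows "wf_graph (wire_graph O' I W vs)"
proof -
  let ?g = "wire_graph O' I W vs"
  have j: "joined O' I W" and top: "topological W" and ne: "source_names I W \<noteq> []"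
    and vne: "\<And>w. w \<in> set W \<Longrightarrow> fst w @ snd w \<noteq> []"
    and sp: "set (source_names I W) \<subseteq> set (spread W (spread W (spread W [hd (source_names I W)])))"
    using d by (auto simp: well_drawn_def)
  have len: "length vs = length W" and ar: "i < length W \<Longrightarrow> outs (vs ! i) = length (fst (W ! i)) \<and> ins (vs ! i) = length (snd (W ! i))" for i
    using a by (auto simp: arity_eqs_def list_all2_conv_all_nth)
  have w: "wired ?g" by (rule wired_wire_graph[OF j a])
  have s: "inj_on (src_name I W) (sources ?g)" "src_name I W ` sources ?g = set (source_names I W)"
    using src_name_bij[of I W ?g] j a by (simp_all add: joined_def)
  have t: "tgt_name O' W ` targets ?g = set (source_names I W)"
    using tgt_name_bij[of O' W ?g] j a by (simp_all add: joined_def)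
  have "ranked ?g id"
    unfolding ranked_def
  proof clarify
    fix i k assume "(i, k) \<in> steps ?g"
    then obtain p q where "(Vtx i p, Vtx k q) \<in> edges ?g" by (auto simp: steps_def)
    then have ik: "i < length W" "p < length (fst (W ! i))" "k < length W" "q < length (snd (W ! k))"
        "fst (W ! i) ! p = snd (W ! k) ! q"
      using len ar by (auto simp: wire_graph_edges)
    have "fst (W ! i) ! p \<in> set (fst (W ! i))" by (rule nth_mem[OF ik(2)])
    moreover have "fst (W ! i) ! p \<in> set (snd (W ! k))" unfolding ik(5) by (rule nth_mem[OF ik(4)])
    ultimately show "id k < id i" using topological_nth[OF top ik(1,3)] by simp
  qed
  then have "acyclic (steps ?g)" by (rule ranked_acyclic)
  moreover have "monochrome ?g"
    unfolding monochrome_def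
  proof (intro allI impI)
    fix A B :: "port \<Rightarrow> bool" and D :: "nat \<Rightarrow> bool"
    assume lab: "labelled ?g A B"
      and A: "\<forall>i p. Vtx i p \<in> sources ?g \<longrightarrow> A (Vtx i p) = D i"
      and B: "\<forall>i q. Vtx i q \<in> targets ?g \<longrightarrow> B (Vtx i q) = D i"
    define c where "c x = A (inv_into (sources ?g) (src_name I W) x)" for x
    have cA: "c (src_name I W x) = A x" if "x \<in> sources ?g" for x
      using inv_into_f_f[OF s(1) that] by (simp add: c_def)
    have cB: "c (tgt_name O' W y) = B y" if y: "y \<in> targets ?g" for y
    proof -
      obtain x where x: "(x, y) \<in> edges ?g" "x \<in> sources ?g" using wired_source_ex[OF w y] by blast
      then have "tgt_name O' W y = src_name I W x" by (simp add: wire_graph_edges)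
      then show ?thesis using cA[OF x(2)] labelledD[OF lab x(1)] by simp
    qed
    have cD: "c x = D i" if i: "i < length W" and x: "x \<in> set (fst (W ! i) @ snd (W ! i))" for i x
    proof -
      consider p where "p < length (fst (W ! i))" "x = fst (W ! i) ! p" | q where "q < length (snd (W ! i))" "x = snd (W ! i) ! q"
        using x by (auto simp: in_set_conv_nth)
      then show ?thesis
      proof cases
        case 1
        then have v: "Vtx i p \<in> sources ?g" using i len ar by simp
        then show ?thesis using cA[OF v] A 1 by simp
      next
        case 2
        then have v: "Vtx i q \<in> targets ?g" using i len ar by simp
        then show ?thesis using cB[OF v] B 2 by simp
      qed
    qed
    have vert: "c x = c y" if "v \<in> set W" "x \<in> set (fst v @ snd v)" "y \<in> set (fst v @ snd v)" for v x y
      using that cD by (metis in_set_conv_nth)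
    let ?h = "hd (source_names I W)"
    have c1: "c x = c ?h" if "x \<in> set (spread W [?h])" for x
      by (rule spread_constant[OF vert _ that]) auto
    have c2: "c x = c ?h" if "x \<in> set (spread W (spread W [?h]))" for x
      by (rule spread_constant[OF vert c1 that])
    have c3: "c x = c ?h" if "x \<in> set (spread W (spread W (spread W [?h])))" for x
      by (rule spread_constant[OF vert c2 that])
    have all: "c x = c ?h" if "x \<in> set (source_names I W)" for x using c3 sp that by blast
    have "A x = c ?h" if x: "x \<in> sources ?g" for x
      using all[of "src_name I W x"] cA[OF x] s(2) x by blast
    moreover have "B y = c ?h" if y: "y \<in> targets ?g" for y
      using all[of "tgt_name O' W y"] cB[OF y] t y by blast
    moreover have "D i = c ?h" if i: "i < length vs" for i
    proof -
      have iW: "i < length W" using i len by simp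
      then obtain x where x: "x \<in> set (fst (W ! i) @ snd (W ! i))" using vne[OF nth_mem[OF iW]]
        by (metis list.set_sel(1))
      have "x \<in> set (source_names I W)"
        using x nth_mem[OF iW] j by (auto simp: joined_def source_names_def target_names_def)
      then show ?thesis using cD[OF iW x] all by simp
    qed
    ultimately show "\<exists>c. (\<forall>s\<in>sources ?g. A s = c) \<and> (\<forall>t\<in>targets ?g. B t = c) \<and> (\<forall>i<length (verts ?g). D i = c)"
      by (intro exI[of _ "c ?h"]) (simp del: in_sources in_targets)
  qed
  moreover have "vs \<noteq> [] \<or> I \<noteq> []" using ne len by (auto simp: source_names_def)
  ultimately show ?thesis using w by (auto simp: wf_graph_monochrome acyclic_wired_def)
qed


section \<open>Drawing a graph\<close>

text \<open>The graph \<open>g\<close> need not be connected, since the factors of a composite of strands and generators need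
  not be. It is determined by the names when each of them occurs once as a source and once as a target
  (\<open>drawn_eq\<close>).\<close>

definition drawn :: "'e dgraph \<Rightarrow> nat list \<Rightarrow> nat list \<Rightarrow> ('e vertex \<times> nat list \<times> nat list) list \<Rightarrow> bool" where
  "drawn g O' I V \<longleftrightarrow> gout g = length O' \<and> gin g = length I \<and> verts g = map fst V \<and>
     arity_eqs (map snd V) (map fst V) \<and> bounded_edges g \<and> total_edges g \<and>
     labelled g (src_name I (map snd V)) (tgt_name O' (map snd V))"

lemma drawn_eq:
  assumes g: "drawn g O' I V" and j: "joined O' I (map snd V)"
  shows "g = wire_graph O' I (map snd V) (map fst V)"
proof -
  have w: "wired (wire_graph O' I (map snd V) (map fst V))"
    using g by (intro wired_wire_graph[OF j]) (simp add: drawn_def)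
  show ?thesis
    using g by (intro wired_label_eq[OF w]) (auto simp: drawn_def wire_graph_edges)
qed

lemma drawn_wire_graph:
  assumes "joined O' I (map snd V)" "arity_eqs (map snd V) (map fst V)"
  shows "drawn (wire_graph O' I (map snd V) (map fst V)) O' I V"
  using wired_wire_graph[OF assms] assms
  by (auto simp: drawn_def wired_bounded wired_total labelled_def wire_graph_edges)

lemma drawn_strands:
  assumes "length O' = n" "length I = n" "\<And>i. i < n \<Longrightarrow> \<sigma> i < n \<and> O' ! \<sigma> i = I ! i"
  shows "drawn (strands n \<sigma>) O' I []"
  using assms
  by (auto simp: drawn_def strands_def arity_eqs_def bounded_edges_def total_edges_def labelled_def sources_def)

lemma drawn_corolla:
  assumes "outs v = length os" "ins v = length is"
  shows "drawn (corolla v) os is [(v, os, is)]"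
  using assms
  by (auto simp: drawn_def corolla_def arity_eqs_def bounded_edges_def total_edges_def labelled_def sources_def)

lemma arity_eqs_append: "arity_eqs V vs \<Longrightarrow> arity_eqs W ws \<Longrightarrow> arity_eqs (V @ W) (vs @ ws)"
  by (simp add: arity_eqs_def list_all2_appendI)

text \<open>The wires of the two factors are joined when the names along the common boundary agree.\<close>

lemma drawn_vcomp:
  assumes f: "drawn f O' M V" and g: "drawn g M' I W" and M: "M = M'"
  shows "drawn (f \<cdot> g) O' I (V @ W)"
proof -
  let ?n = "length (verts f)"
  have len: "length V = ?n" "length W = length (verts g)" using f g by (auto simp: drawn_def)
  have fb: "s \<in> sources f" "t \<in> targets f" "src_name M (map snd V) s = tgt_name O' (map snd V) t"
    if "(s, t) \<in> edges f" for s t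
    using f that by (auto simp: drawn_def dest: boundedD labelledD)
  have gb: "s \<in> sources g" "t \<in> targets g" "src_name I (map snd W) s = tgt_name M (map snd W) t"
    if "(s, t) \<in> edges g" for s t
    using g that M by (auto simp: drawn_def dest: boundedD labelledD)
  have ft: "\<exists>t. (s, t) \<in> edges f" if "s \<in> sources f" for s using f that by (auto simp: drawn_def total_edges_def)
  have gt: "\<exists>t. (s, t) \<in> edges g" if "s \<in> sources g" for s using g that by (auto simp: drawn_def total_edges_def)
  have ar: "gin f = length M" "gout g = length M" "gout f = length O'" "gin g = length I"
    using f g M by (auto simp: drawn_def)
  let ?sh = "shift_port ?n 0"
  have sh: "?sh s = Ext j \<longleftrightarrow> s = Ext j" "?sh s \<in> range Ext \<longleftrightarrow> s \<in> range Ext" for s j by (cases s; auto)+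
  have sel: "gout (f \<cdot> g) = gout f" "gin (f \<cdot> g) = gin g" "verts (f \<cdot> g) = verts f @ verts g"
    by (simp_all add: vcomp_def Let_def)
  have ed: "(s, t) \<in> edges (f \<cdot> g) \<longleftrightarrow> (s, t) \<in> edges f \<and> s \<notin> range Ext \<or>
     (\<exists>s' t'. (s', t') \<in> edges g \<and> s = ?sh s' \<and> t = ?sh t' \<and> t' \<notin> range Ext) \<or>
     (\<exists>j. (\<exists>s'. (s', Ext j) \<in> edges g \<and> s = ?sh s') \<and> (Ext j, t) \<in> edges f)" for s t
  proof -
    define G where "G = map_prod ?sh ?sh ` edges g"
    have G: "(s, t) \<in> G \<longleftrightarrow> (\<exists>s' t'. (s', t') \<in> edges g \<and> s = ?sh s' \<and> t = ?sh t')" for s t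
      unfolding G_def by auto
    have "(s, t) \<in> edges (f \<cdot> g) \<longleftrightarrow> (s, t) \<in> edges f \<and> s \<notin> range Ext \<or> (s, t) \<in> G \<and> t \<notin> range Ext \<or>
        (\<exists>j. (s, Ext j) \<in> G \<and> (Ext j, t) \<in> edges f)"
      by (simp add: vcomp_def G_def)
    moreover have "(s, t) \<in> G \<and> t \<notin> range Ext \<longleftrightarrow>
        (\<exists>s' t'. (s', t') \<in> edges g \<and> s = ?sh s' \<and> t = ?sh t' \<and> t' \<notin> range Ext)"
      unfolding G by (metis sh(2))
    moreover have "(s, Ext j) \<in> G \<longleftrightarrow> (\<exists>s'. (s', Ext j) \<in> edges g \<and> s = ?sh s')" for j
      unfolding G using sh(1) by metis
    ultimately show ?thesis by simp
  qed
  have srcf: "s \<in> sources (f \<cdot> g)" if "s \<in> sources f" "s \<notin> range Ext" for s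
    using that by (cases s) (auto simp: sel nth_append)
  have tgtf: "s \<in> targets (f \<cdot> g)" if "s \<in> targets f" for s
    using that by (cases s) (auto simp: sel nth_append)
  have srcg: "?sh s \<in> sources (f \<cdot> g)" if "s \<in> sources g" for s
    using that by (cases s) (auto simp: sel nth_append)
  have tgtg: "?sh s \<in> targets (f \<cdot> g)" if "s \<in> targets g" "s \<notin> range Ext" for s
    using that by (cases s) (auto simp: sel nth_append)
  let ?s = "src_name I (map snd (V @ W))" and ?t = "tgt_name O' (map snd (V @ W))"
  have nsf: "?s s = src_name M (map snd V) s" if "s \<in> sources f" "s \<notin> range Ext" for s
    using that len by (cases s) (auto simp: nth_append)
  have ntf: "?t s = tgt_name O' (map snd V) s" if "s \<in> targets f" for s
    using that len by (cases s) (auto simp: nth_append)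
  have nsg: "?s (?sh s) = src_name I (map snd W) s" if "s \<in> sources g" for s
    using that len by (cases s) (auto simp: nth_append)
  have ntg: "?t (?sh s) = tgt_name M (map snd W) s" if "s \<in> targets g" "s \<notin> range Ext" for s
    using that len by (cases s) (auto simp: nth_append)
  have "bounded_edges (f \<cdot> g)"
    unfolding bounded_edges_def
  proof clarify
    fix s t assume "(s, t) \<in> edges (f \<cdot> g)"
    then show "s \<in> sources (f \<cdot> g) \<and> t \<in> targets (f \<cdot> g)"
      unfolding ed using fb gb srcf tgtf srcg tgtg by blast
  qed
  moreover have "labelled (f \<cdot> g) ?s ?t"
    unfolding labelled_def
  proof clarify
    fix s t assume "(s, t) \<in> edges (f \<cdot> g)"
    then consider "(s, t) \<in> edges f" "s \<notin> range Ext"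
      | s' t' where "(s', t') \<in> edges g" "s = ?sh s'" "t = ?sh t'" "t' \<notin> range Ext"
      | j s' where "(s', Ext j) \<in> edges g" "s = ?sh s'" "(Ext j, t) \<in> edges f"
      unfolding ed by blast
    then show "?s s = ?t t"
    proof cases
      case 1
      then show ?thesis using nsf[of s] ntf[of t] fb[of s t] by simp
    next
      case (2 s' t')
      then show ?thesis using nsg[of s'] ntg[of t'] gb[of s' t'] by simp
    next
      case (3 j s')
      then show ?thesis using nsg[of s'] ntf[of t] gb[of s' "Ext j"] fb[of "Ext j" t] by simp
    qed
  qed
  moreover have "total_edges (f \<cdot> g)"
    unfolding total_edges_def
  proof
    fix s assume s: "s \<in> sources (f \<cdot> g)"
    have g_edge: "\<exists>t. (?sh s', t) \<in> edges (f \<cdot> g)" if s': "s' \<in> sources g" for s'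
    proof -
      obtain t where t: "(s', t) \<in> edges g" using gt[OF s'] by blast
      show ?thesis
      proof (cases t)
        case (Ext j)
        then have "Ext j \<in> sources f" using gb(2)[OF t] ar by simp
        then obtain t' where "(Ext j, t') \<in> edges f" using ft by blast
        then show ?thesis using t Ext unfolding ed by blast
      next
        case (Vtx i q)
        then have "t \<notin> range Ext" by auto
        then show ?thesis using t unfolding ed by blast
      qed
    qed
    show "\<exists>t. (s, t) \<in> edges (f \<cdot> g)"
    proof (cases s)
      case (Ext j)
      then show ?thesis using s g_edge[of "Ext j"] by (simp add: sel)
    next
      case (Vtx i p)
      show ?thesis
      proof (cases "i < ?n")
        case True
        then have "s \<in> sources f" using s Vtx by (simp add: sel nth_append)
        then obtain t where "(s, t) \<in> edges f" using ft by blast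
        moreover have "s \<notin> range Ext" using Vtx by auto
        ultimately show ?thesis unfolding ed by blast
      next
        case False
        then have "Vtx (i - ?n) p \<in> sources g" using s Vtx by (auto simp: sel nth_append)
        from g_edge[OF this] False show ?thesis using Vtx by simp
      qed
    qed
  qed
  ultimately show ?thesis using f g by (simp add: drawn_def sel arity_eqs_append)
qed

lemma drawn_hcomp:
  assumes f: "drawn f O' I V" and g: "drawn g O'' I' W"
  shows "drawn (f \<otimes> g) (O' @ O'') (I @ I') (V @ W)"
proof -
  let ?n = "length (verts f)"
  have len: "length V = ?n" "length W = length (verts g)" using f g by (auto simp: drawn_def)
  have fb: "s \<in> sources f" "t \<in> targets f" "src_name I (map snd V) s = tgt_name O' (map snd V) t"
    if "(s, t) \<in> edges f" for s t
    using f that by (auto simp: drawn_def dest: boundedD labelledD)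
  have gb: "s \<in> sources g" "t \<in> targets g" "src_name I' (map snd W) s = tgt_name O'' (map snd W) t"
    if "(s, t) \<in> edges g" for s t
    using g that by (auto simp: drawn_def dest: boundedD labelledD)
  have ft: "\<exists>t. (s, t) \<in> edges f" if "s \<in> sources f" for s using f that by (auto simp: drawn_def total_edges_def)
  have gt: "\<exists>t. (s, t) \<in> edges g" if "s \<in> sources g" for s using g that by (auto simp: drawn_def total_edges_def)
  have ar: "gin f = length I" "gout g = length O''" "gout f = length O'" "gin g = length I'"
    using f g by (auto simp: drawn_def)
  let ?ss = "shift_port ?n (length I)" and ?st = "shift_port ?n (length O')"
  have sel: "gout (f \<otimes> g) = gout f + gout g" "gin (f \<otimes> g) = gin f + gin g" "verts (f \<otimes> g) = verts f @ verts g"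
    by (simp_all add: hcomp_def)
  have ed: "(s, t) \<in> edges (f \<otimes> g) \<longleftrightarrow> (s, t) \<in> edges f \<or>
     (\<exists>s' t'. (s', t') \<in> edges g \<and> s = ?ss s' \<and> t = ?st t')" for s t
    unfolding hcomp_def using ar by (auto simp: image_iff map_prod_def)
  have srcf: "s \<in> sources (f \<otimes> g)" if "s \<in> sources f" for s
    using that by (cases s) (auto simp: sel nth_append)
  have tgtf: "s \<in> targets (f \<otimes> g)" if "s \<in> targets f" for s
    using that by (cases s) (auto simp: sel nth_append)
  have srcg: "?ss s \<in> sources (f \<otimes> g)" if "s \<in> sources g" for s
    using that ar by (cases s) (auto simp: sel nth_append)
  have tgtg: "?st s \<in> targets (f \<otimes> g)" if "s \<in> targets g" for s
    using that ar by (cases s) (auto simp: sel nth_append)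
  let ?s = "src_name (I @ I') (map snd (V @ W))" and ?t = "tgt_name (O' @ O'') (map snd (V @ W))"
  have nsf: "?s s = src_name I (map snd V) s" if "s \<in> sources f" for s
    using that len ar by (cases s) (auto simp: nth_append)
  have ntf: "?t s = tgt_name O' (map snd V) s" if "s \<in> targets f" for s
    using that len ar by (cases s) (auto simp: nth_append)
  have nsg: "?s (?ss s) = src_name I' (map snd W) s" if "s \<in> sources g" for s
    using that len by (cases s) (auto simp: nth_append)
  have ntg: "?t (?st s) = tgt_name O'' (map snd W) s" if "s \<in> targets g" for s
    using that len by (cases s) (auto simp: nth_append)
  have "bounded_edges (f \<otimes> g)"
    unfolding bounded_edges_def
  proof clarify
    fix s t assume "(s, t) \<in> edges (f \<otimes> g)"
    then show "s \<in> sources (f \<otimes> g) \<and> t \<in> targets (f \<otimes> g)"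
      unfolding ed using fb gb srcf tgtf srcg tgtg by blast
  qed
  moreover have "labelled (f \<otimes> g) ?s ?t"
    unfolding labelled_def
  proof clarify
    fix s t assume "(s, t) \<in> edges (f \<otimes> g)"
    then consider "(s, t) \<in> edges f" | s' t' where "(s', t') \<in> edges g" "s = ?ss s'" "t = ?st t'"
      unfolding ed by blast
    then show "?s s = ?t t"
    proof cases
      case 1
      then show ?thesis using nsf[of s] ntf[of t] fb[of s t] by simp
    next
      case (2 s' t')
      then show ?thesis using nsg[of s'] ntg[of t'] gb[of s' t'] by simp
    qed
  qed
  moreover have "total_edges (f \<otimes> g)"
    unfolding total_edges_def
  proof
    fix s assume s: "s \<in> sources (f \<otimes> g)"
    have g_edge: "\<exists>t. (?ss s', t) \<in> edges (f \<otimes> g)" if "s' \<in> sources g" for s'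
      using gt[OF that] unfolding ed by blast
    show "\<exists>t. (s, t) \<in> edges (f \<otimes> g)"
    proof (cases "s \<in> sources f")
      case True
      then show ?thesis using ft unfolding ed by blast
    next
      case False
      show ?thesis
      proof (cases s)
        case (Ext j)
        then have "Ext (j - length I) \<in> sources g" "length I \<le> j" using s False ar by (auto simp: sel)
        then show ?thesis using g_edge[of "Ext (j - length I)"] Ext by simp
      next
        case (Vtx i p)
        then have "Vtx (i - ?n) p \<in> sources g" "?n \<le> i" using s False by (auto simp: sel nth_append split: if_splits)
        then show ?thesis using g_edge[of "Vtx (i - ?n) p"] Vtx by simp
      qed
    qed
  qed
  ultimately show ?thesis using f g by (simp add: drawn_def sel arity_eqs_append)
qed

definition rename :: "(nat \<Rightarrow> nat) \<Rightarrow> 'v \<times> nat list \<times> nat list \<Rightarrow> 'v \<times> nat list \<times> nat list" where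
  "rename \<rho> = map_prod id (map_prod (map \<rho>) (map \<rho>))"

lemma rename_simp [simp]: "rename \<rho> (v, os, is) = (v, map \<rho> os, map \<rho> is)"
  by (simp add: rename_def)

lemma fst_rename [simp]: "fst (rename \<rho> v) = fst v"
  by (simp add: rename_def)

lemma rename_decorate: "rename \<rho> (map_prod f id v) = map_prod f id (rename \<rho> v)"
  by (cases v) simp

text \<open>A diagram inserted at a vertex is renamed by \<open>\<rho> i\<close> so that its boundary matches the names at that
  vertex. The renaming \<open>\<kappa>\<close> of the outer diagram is needed when an inserted diagram contains
  a strand, whose two ends then get the same name.\<close>

lemma drawn_subst_nth:
  fixes \<Gamma> :: "'x dgraph" and gs :: "'e dgraph list"
  assumes \<Gamma>: "drawn \<Gamma> O' I U" and wf: "wf_graph \<Gamma>" and len: "length gs = length U" "length Ws = length U"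
    and gs: "\<And>i. i < length gs \<Longrightarrow> wf_graph (gs ! i) \<and> drawn (gs ! i) (Os i) (Is i) (Vs i) \<and>
      map (\<rho> i) (Os i) = map \<kappa> (fst (snd (U ! i))) \<and> map (\<rho> i) (Is i) = map \<kappa> (snd (snd (U ! i))) \<and>
      Ws ! i = map (rename (\<rho> i)) (Vs i)"
  shows "drawn (subst_graph \<Gamma> gs) (map \<kappa> O') (map \<kappa> I) (concat Ws)"
proof -
  have g: "wf_graph (gs ! i)" "drawn (gs ! i) (Os i) (Is i) (Vs i)"
    "map (\<rho> i) (Os i) = map \<kappa> (fst (snd (U ! i)))" "map (\<rho> i) (Is i) = map \<kappa> (snd (snd (U ! i)))"
    "Ws ! i = map (rename (\<rho> i)) (Vs i)"
    if "i < length gs" for i using gs[OF that] by auto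
  have ar: "gout (gs ! i) = length (Os i)" "gin (gs ! i) = length (Is i)" "verts (gs ! i) = map fst (Vs i)"
    "bounded_edges (gs ! i)" "labelled (gs ! i) (src_name (Is i) (map snd (Vs i))) (tgt_name (Os i) (map snd (Vs i)))"
    "arity_eqs (map snd (Vs i)) (map fst (Vs i))"
    if "i < length gs" for i using g(2)[OF that] by (auto simp: drawn_def)
  have leni: "length (Os i) = length (fst (snd (U ! i)))" "length (Is i) = length (snd (snd (U ! i)))" if "i < length gs" for i
    using arg_cong[OF g(3)[OF that], of length] arg_cong[OF g(4)[OF that], of length] by simp_all
  have U: "verts \<Gamma> = map fst U" "arity_eqs (map snd U) (map fst U)" "gout \<Gamma> = length O'" "gin \<Gamma> = length I"
    "labelled \<Gamma> (src_name I (map snd U)) (tgt_name O' (map snd U))" "bounded_edges \<Gamma>"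
    using \<Gamma> by (auto simp: drawn_def)
  have fit: "fits \<Gamma> gs"
    unfolding fits_def list_all2_conv_all_nth
  proof (intro conjI allI impI)
    show "length gs = length (verts \<Gamma>)" using U(1) len by simp
    fix i assume i: "i < length gs"
    then have "outs (fst (U ! i)) = length (fst (snd (U ! i))) \<and> ins (fst (U ! i)) = length (snd (snd (U ! i)))"
      using list_all2_nthD[OF U(2)[unfolded arity_eqs_def], of i] len by simp
    then show "gout (gs ! i) = outs (verts \<Gamma> ! i)" "gin (gs ! i) = ins (verts \<Gamma> ! i)"
      using i len ar(1,2)[OF i] leni[OF i] by (simp_all add: U(1))
  qed
  interpret substitution \<Gamma> gs
    using wf g(1) fit by unfold_locales (auto simp: wf_graph_acyclic_wired)
  have lenV: "length (Vs i) = length (verts (gs ! i))" if "i < length gs" for i using ar(3)[OF that] by simp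
  have mlen: "map (\<lambda>g. length (verts g)) gs = map length Ws"
    using lenV len g(5) by (intro nth_equalityI) auto
  have V: "concat Ws ! (off gs i + j) = rename (\<rho> i) (Vs i ! j)"
    if "i < length gs" "j < length (verts (gs ! i))" for i j
    using concat_nth_sum[of i Ws j] that lenV len g(5) by (simp add: off_def mlen)
  have vR: "verts R = map fst (concat Ws)"
  proof -
    have "map verts gs = map (map fst) Ws"
      using ar(3) len g(5) by (intro nth_equalityI) auto
    then show ?thesis by (simp add: map_concat)
  qed
  then have lV: "length (concat Ws) = length (verts R)" by (metis length_map)
  have vert: "outs (verts (gs ! i) ! j) = length (fst (snd (Vs i ! j)))" "ins (verts (gs ! i) ! j) = length (snd (snd (Vs i ! j)))"
    if "i < length gs" "j < length (verts (gs ! i))" for i j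
    using list_all2_nthD[OF ar(6)[OF that(1), unfolded arity_eqs_def], of j] ar(3)[OF that(1)] that(2) by simp_all
  let ?S = "src_name (map \<kappa> I) (map snd (concat Ws))" and ?T = "tgt_name (map \<kappa> O') (map snd (concat Ws))"
  have S: "?S (Vtx (off gs i + j) p) = \<rho> i (src_name (Is i) (map snd (Vs i)) (Vtx j p))"
    if "i < length gs" "Vtx j p \<in> sources (gs ! i)" for i j p
    using that V[of i j] vert[of i j] lenV[of i] off_less[of i gs j] lV
    by (cases "Vs i ! j") (simp add: vR)
  have T: "?T (Vtx (off gs i + j) p) = \<rho> i (tgt_name (Os i) (map snd (Vs i)) (Vtx j p))"
    if "i < length gs" "Vtx j p \<in> targets (gs ! i)" for i j p
    using that V[of i j] vert[of i j] lenV[of i] off_less[of i gs j] lV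
    by (cases "Vs i ! j") (simp add: vR)
  define l where "l x = (case x of Src s \<Rightarrow> ?S s | Tgt t \<Rightarrow> ?T t
      | JIn i q \<Rightarrow> \<kappa> (snd (snd (U ! i)) ! q) | JOut i p \<Rightarrow> \<kappa> (fst (snd (U ! i)) ! p))" for x
  have "invariant \<Gamma> gs l"
    unfolding invariant_iff
  proof (intro conjI allI impI)
    have "labelled \<Gamma> (\<kappa> \<circ> src_name I (map snd U)) (\<kappa> \<circ> tgt_name O' (map snd U))"
      using U(5) by (auto simp: labelled_def)
    then show "labelled \<Gamma> (l \<circ> outer_src) (l \<circ> outer_tgt)"
    proof (rule labelled_cong[OF U(6)])
      show "(l \<circ> outer_src) s = (\<kappa> \<circ> src_name I (map snd U)) s" if "s \<in> sources \<Gamma>" for s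
        using that U by (cases s) (auto simp: l_def)
      show "(l \<circ> outer_tgt) s = (\<kappa> \<circ> tgt_name O' (map snd U)) s" if "s \<in> targets \<Gamma>" for s
        using that U by (cases s) (auto simp: l_def)
    qed
    fix i assume i: "i < length gs"
    have lab: "labelled (gs ! i) (\<rho> i \<circ> src_name (Is i) (map snd (Vs i))) (\<rho> i \<circ> tgt_name (Os i) (map snd (Vs i)))"
      using ar(5)[OF i] by (auto simp: labelled_def)
    show "labelled (gs ! i) (l \<circ> inner_src i (off gs i)) (l \<circ> inner_tgt i (off gs i))"
    proof (rule labelled_cong[OF ar(4)[OF i] lab])
      fix s assume s: "s \<in> sources (gs ! i)"
      show "(l \<circ> inner_src i (off gs i)) s = (\<rho> i \<circ> src_name (Is i) (map snd (Vs i))) s"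
      proof (cases s)
        case (Ext q)
        then have "q < length (Is i)" using s ar(2)[OF i] by simp
        then show ?thesis using Ext arg_cong[OF g(4)[OF i], of "\<lambda>xs. xs ! q"] leni[OF i] by (simp add: l_def)
      next
        case (Vtx j p)
        then show ?thesis using S[OF i, of j p] s by (simp add: l_def)
      qed
    next
      fix s assume s: "s \<in> targets (gs ! i)"
      show "(l \<circ> inner_tgt i (off gs i)) s = (\<rho> i \<circ> tgt_name (Os i) (map snd (Vs i))) s"
      proof (cases s)
        case (Ext q)
        then have "q < length (Os i)" using s ar(1)[OF i] by simp
        then show ?thesis using Ext arg_cong[OF g(3)[OF i], of "\<lambda>xs. xs ! q"] leni[OF i] by (simp add: l_def)
      next
        case (Vtx j p)
        then show ?thesis using T[OF i, of j p] s by (simp add: l_def)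
      qed
    qed
  qed
  from invariant_labelled[OF this] have "labelled R ?S ?T" by (simp add: l_def o_def)
  moreover have "arity_eqs (map snd (concat Ws)) (map fst (concat Ws))"
    unfolding arity_eqs_def list_all2_conv_all_nth
  proof (intro conjI allI impI)
    fix k assume "k < length (map snd (concat Ws))"
    then have k: "k < length (concat (map verts gs))" using lV by simp
    obtain i j where ij: "i < length gs" "j < length (verts (gs ! i))" "k = off gs i + j"
      using off_cases[OF k] by blast
    have lk: "k < length (concat Ws)" using k lV by simp
    have e: "concat Ws ! k = rename (\<rho> i) (Vs i ! j)" unfolding ij(3) by (rule V[OF ij(1,2)])
    have v: "fst (Vs i ! j) = verts (gs ! i) ! j" using ar(3)[OF ij(1)] ij(2) by simp
    show "outs (map fst (concat Ws) ! k) = length (fst (map snd (concat Ws) ! k))"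
      "ins (map fst (concat Ws) ! k) = length (snd (map snd (concat Ws) ! k))"
      unfolding nth_map[OF lk] e using vert[OF ij(1,2)] v by (simp_all add: rename_def)
  qed simp
  ultimately show ?thesis
    using R_wired vR U by (simp add: drawn_def wired_bounded wired_total del: subst_graph_sel(3,4))
qed

lemma drawn_subst:
  assumes \<Gamma>: "drawn \<Gamma> O' I U" "wf_graph \<Gamma>"
    and P: "list_all2 (\<lambda>(g, Oi, Ii, Vi, \<rho>) (v, os, is). wf_graph g \<and> drawn g Oi Ii Vi \<and>
       map \<rho> Oi = map \<kappa> os \<and> map \<rho> Ii = map \<kappa> is) P U"
  shows "drawn (subst_graph \<Gamma> (map fst P)) (map \<kappa> O') (map \<kappa> I)
     (concat (map (\<lambda>(g, Oi, Ii, Vi, \<rho>). map (rename \<rho>) Vi) P))"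
proof -
  have len: "length P = length U" using P by (rule list_all2_lengthD)
  show ?thesis
  proof (rule drawn_subst_nth[OF \<Gamma>, where Os = "\<lambda>i. fst (snd (P ! i))" and Is = "\<lambda>i. fst (snd (snd (P ! i)))"
        and Vs = "\<lambda>i. fst (snd (snd (snd (P ! i))))" and \<rho> = "\<lambda>i. snd (snd (snd (snd (P ! i))))"])
    fix i assume "i < length (map fst P)"
    then show "wf_graph (map fst P ! i) \<and> drawn (map fst P ! i) (fst (snd (P ! i))) (fst (snd (snd (P ! i)))) (fst (snd (snd (snd (P ! i))))) \<and>
      map (snd (snd (snd (snd (P ! i))))) (fst (snd (P ! i))) = map \<kappa> (fst (snd (U ! i))) \<and>
      map (snd (snd (snd (snd (P ! i))))) (fst (snd (snd (P ! i)))) = map \<kappa> (snd (snd (U ! i))) \<and>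
      map (\<lambda>(g, Oi, Ii, Vi, \<rho>). map (rename \<rho>) Vi) P ! i = map (rename (snd (snd (snd (snd (P ! i)))))) (fst (snd (snd (snd (P ! i)))))"
      using list_all2_nthD[OF P, of i] by (simp add: case_prod_unfold)
  qed (use len in simp_all)
qed


section \<open>Equations between diagrams on generators\<close>

definition gen_vertex :: "('g \<Rightarrow> nat \<times> nat \<times> int) \<Rightarrow> 'g \<Rightarrow> ('k::field, 'g) free_elt vertex" where
  "gen_vertex ar x = Vertex (fst (ar x)) (fst (snd (ar x))) (snd (snd (ar x))) (basis (id, x, id))"

lemma gen_vertex_sel [simp]:
  "outs (gen_vertex ar x) = fst (ar x)" "ins (gen_vertex ar x) = fst (snd (ar x))"
  "vdeg (gen_vertex ar x) = snd (snd (ar x))" "dec (gen_vertex ar x) = basis (id, x, id)"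
  by (simp_all add: gen_vertex_def)

lemma gen_corolla: "gen ar x = corolla (gen_vertex ar x)"
  by (simp add: gen_def gen_vertex_def case_prod_unfold)

abbreviation decorate :: "('g \<Rightarrow> nat \<times> nat \<times> int) \<Rightarrow> 'g nvertex list \<Rightarrow> (('k::field, 'g) free_elt vertex \<times> nat list \<times> nat list) list" where
  "decorate ar \<equiv> map (map_prod (gen_vertex ar) id)"

definition diag :: "('g \<Rightarrow> nat \<times> nat \<times> int) \<Rightarrow> 'g diagram \<Rightarrow> ('k::field, 'g) free_elt dgraph" where
  "diag ar D = (case D of (O', I, V) \<Rightarrow> wire_graph O' I (map snd V) (map (gen_vertex ar \<circ> fst) V))"

definition arity_ok :: "('g \<Rightarrow> nat \<times> nat \<times> int) \<Rightarrow> 'g nvertex list \<Rightarrow> bool" where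
  "arity_ok ar V \<longleftrightarrow> list_all (\<lambda>(x, os, is). fst (ar x) = length os \<and> fst (snd (ar x)) = length is) V"

text \<open>Well-drawn diagrams with the right arities draw connected graphs without directed cycles, and all
  of this is decided by evaluation.\<close>

definition ok :: "('g \<Rightarrow> nat \<times> nat \<times> int) \<Rightarrow> 'g diagram \<Rightarrow> bool" where
  "ok ar D \<longleftrightarrow> (case D of (O', I, V) \<Rightarrow> well_drawn O' I (map snd V) \<and> arity_ok ar V)"

lemma arity_ok_arity_eqs: "arity_ok ar V \<Longrightarrow> arity_eqs (map snd V) (map (gen_vertex ar \<circ> fst) V)"
  by (auto simp: arity_ok_def arity_eqs_def list_all_length list_all2_conv_all_nth case_prod_unfold)

lemma decorate_sel [simp]: "map snd (decorate ar V) = map snd V" "map fst (decorate ar V) = map (gen_vertex ar \<circ> fst) V"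
  by auto

lemma ok_wf: "ok ar D \<Longrightarrow> wf_graph (diag ar D)"
  by (auto simp: ok_def diag_def intro!: wf_wire_graph arity_ok_arity_eqs)

lemma gen_vertices_dec:
  assumes "arity_ok ar V" "v \<in> set (map (gen_vertex ar \<circ> fst) V)"
  shows "dec v \<in> car (free_sbimod ar) (outs v) (ins v) (vdeg v)"
  using assms by (auto simp: permutes_id)

lemma ok_dgraphs:
  assumes "ok ar (O', I, V)"
  shows "(diag ar (O', I, V) :: ('k::field, 'g) free_elt dgraph)
    \<in> dgraphs (free_sbimod ar) (length O') (length I) (\<Sum>v\<leftarrow>V. snd (snd (ar (fst v))))"
proof -
  have "wf_graph (diag ar (O', I, V) :: ('k, 'g) free_elt dgraph)" by (rule ok_wf[OF assms])
  moreover have "arity_ok ar V" using assms by (simp add: ok_def)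
  ultimately show ?thesis
    using gen_vertices_dec[of ar V] by (simp add: dgraphs_def diag_def gdeg_def o_def)
qed

lemma drawn_diag:
  assumes "joined O' I (map snd V)" "arity_ok ar V"
  shows "drawn (diag ar (O', I, V)) O' I (decorate ar V)"
  using drawn_wire_graph[of O' I "decorate ar V"] arity_ok_arity_eqs[OF assms(2)] assms(1)
  by (simp add: diag_def)

lemma drawn_diag_eq:
  assumes "drawn g O' I (decorate ar V)" "joined O' I (map snd V)"
  shows "g = diag ar (O', I, V)"
  using drawn_eq[OF assms(1)] assms(2) by (simp add: diag_def)

lemma drawn_gen:
  assumes "fst (ar x) = length os" "fst (snd (ar x)) = length is"
  shows "drawn (gen ar x) os is (decorate ar [(x, os, is)])"
  using drawn_corolla[of "gen_vertex ar x" os "is"] assms by (simp add: gen_corolla)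

lemma ok_joined: "ok ar (O', I, V) \<Longrightarrow> joined O' I (map snd V)" "ok ar (O', I, V) \<Longrightarrow> arity_ok ar V"
  by (simp_all add: ok_def well_drawn_def)

text \<open>Weaker than \<open>ok\<close>: a diagram that arises by rewriting is well-formed as a substitution of well-formed
  graphs, so only its names need to be checked.\<close>

definition drawable :: "('g \<Rightarrow> nat \<times> nat \<times> int) \<Rightarrow> 'g diagram \<Rightarrow> bool" where
  "drawable ar D \<longleftrightarrow> (case D of (O', I, V) \<Rightarrow> joined O' I (map snd V) \<and> arity_ok ar V)"

lemma ok_drawable: "ok ar D \<Longrightarrow> drawable ar D"
  by (auto simp: drawable_def ok_def well_drawn_def)

text \<open>\<open>eqn ar R c D\<^sub>1 D\<^sub>2\<close> is the equation \<open>D\<^sub>1 = c D\<^sub>2\<close> in the presented properad.\<close>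

definition eqn :: "('g \<Rightarrow> nat \<times> nat \<times> int) \<Rightarrow> (('k::field, 'g) free_elt dgraph \<Rightarrow>\<^sub>0 'k) set \<Rightarrow> 'k \<Rightarrow>
    'g diagram \<Rightarrow> 'g diagram \<Rightarrow> bool" where
  "eqn ar R c D\<^sub>1 D\<^sub>2 \<longleftrightarrow> (\<exists>m n d. diag ar D\<^sub>1 \<in> dgraphs (free_sbimod ar :: ('k, ('k, 'g) free_elt) sbimod) m n d \<and>
     diag ar D\<^sub>2 \<in> dgraphs (free_sbimod ar :: ('k, ('k, 'g) free_elt) sbimod) m n d \<and>
     ideal (free_sbimod ar) R m n d (basis (diag ar D\<^sub>1) - fscale c (basis (diag ar D\<^sub>2)))) \<and>
     drawable ar D\<^sub>1 \<and> drawable ar D\<^sub>2"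

lemma dgraphs_unique: "g \<in> dgraphs E m n d \<Longrightarrow> g \<in> dgraphs E m' n' d' \<Longrightarrow> m = m' \<and> n = n' \<and> d = d'"
  by (simp add: dgraphs_def)

lemma eqn_trans [trans]:
  assumes "eqn ar R c D\<^sub>1 D\<^sub>2" "eqn ar R c' D\<^sub>2 D\<^sub>3"
  shows "eqn ar R (c * c') D\<^sub>1 D\<^sub>3"
proof -
  obtain m n d where 1: "diag ar D\<^sub>1 \<in> dgraphs (free_sbimod ar :: ('b, ('b, 'a) free_elt) sbimod) m n d"
      "diag ar D\<^sub>2 \<in> dgraphs (free_sbimod ar :: ('b, ('b, 'a) free_elt) sbimod) m n d"
      "ideal (free_sbimod ar) R m n d (basis (diag ar D\<^sub>1) - fscale c (basis (diag ar D\<^sub>2)))"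
    using assms(1) by (auto simp: eqn_def)
  obtain m' n' d' where 2: "diag ar D\<^sub>2 \<in> dgraphs (free_sbimod ar :: ('b, ('b, 'a) free_elt) sbimod) m' n' d'"
      "diag ar D\<^sub>3 \<in> dgraphs (free_sbimod ar :: ('b, ('b, 'a) free_elt) sbimod) m' n' d'"
      "ideal (free_sbimod ar) R m' n' d' (basis (diag ar D\<^sub>2) - fscale c' (basis (diag ar D\<^sub>3)))"
    using assms(2) by (auto simp: eqn_def)
  have e: "m = m'" "n = n'" "d = d'" using dgraphs_unique[OF 1(2) 2(1)] by auto
  have "ideal (free_sbimod ar) R m n d ((basis (diag ar D\<^sub>1) - fscale c (basis (diag ar D\<^sub>2))) +
      fscale c (basis (diag ar D\<^sub>2) - fscale c' (basis (diag ar D\<^sub>3))))"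
    using 1(3) 2(3) e by (intro ideal.add ideal.scale) auto
  then have "ideal (free_sbimod ar) R m n d (basis (diag ar D\<^sub>1) - fscale (c * c') (basis (diag ar D\<^sub>3)))"
    by (simp add: fspace.scale_right_diff_distrib)
  then show ?thesis using 1 2 e assms unfolding eqn_def by blast
qed

lemma eqn_sym:
  assumes "eqn ar R c D\<^sub>1 D\<^sub>2" "c * c' = 1"
  shows "eqn ar R c' D\<^sub>2 D\<^sub>1"
proof -
  obtain m n d where 1: "diag ar D\<^sub>1 \<in> dgraphs (free_sbimod ar :: ('b, ('b, 'a) free_elt) sbimod) m n d"
      "diag ar D\<^sub>2 \<in> dgraphs (free_sbimod ar :: ('b, ('b, 'a) free_elt) sbimod) m n d"
      "ideal (free_sbimod ar) R m n d (basis (diag ar D\<^sub>1) - fscale c (basis (diag ar D\<^sub>2)))"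
    using assms(1) by (auto simp: eqn_def)
  have "ideal (free_sbimod ar) R m n d (fscale (- c') (basis (diag ar D\<^sub>1) - fscale c (basis (diag ar D\<^sub>2))))"
    using 1(3) by (rule ideal.scale)
  moreover have "fscale (- c') (basis (diag ar D\<^sub>1) - fscale c (basis (diag ar D\<^sub>2))) =
      (basis (diag ar D\<^sub>2) - fscale c' (basis (diag ar D\<^sub>1)) :: ('b, 'a) free_elt dgraph \<Rightarrow>\<^sub>0 'b)"
    using assms(2) by (simp add: fspace.scale_right_diff_distrib mult.commute)
  ultimately have "ideal (free_sbimod ar) R m n d (basis (diag ar D\<^sub>2) - fscale c' (basis (diag ar D\<^sub>1)))"
    by (simp only:)
  then show ?thesis using 1 assms(1) unfolding eqn_def by blast
qed

lemma eqn_relation: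
  fixes R :: "(('k::field, 'g) free_elt dgraph \<Rightarrow>\<^sub>0 'k) set"
  assumes r: "fscale e (basis g\<^sub>1 - fscale c (basis g\<^sub>2)) \<in> R" and e: "e \<noteq> 0"
    and d: "drawn g\<^sub>1 O1 I1 (decorate ar V1)" "drawn g\<^sub>2 O2 I2 (decorate ar V2)"
    and ok: "ok ar (O1, I1, V1)" "ok ar (O2, I2, V2)"
    and len: "length O1 = length O2" "length I1 = length I2"
    and deg: "(\<Sum>v\<leftarrow>V1. snd (snd (ar (fst v)))) = (\<Sum>v\<leftarrow>V2. snd (snd (ar (fst v))))"
  shows "eqn ar R c (O1, I1, V1) (O2, I2, V2)"
proof -
  let ?m = "length O1" and ?n = "length I1" and ?d = "\<Sum>v\<leftarrow>V1. snd (snd (ar (fst v)))"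
  have g: "g\<^sub>1 = diag ar (O1, I1, V1)" "g\<^sub>2 = diag ar (O2, I2, V2)"
    using drawn_diag_eq[OF d(1)] drawn_diag_eq[OF d(2)] ok_joined[OF ok(1)] ok_joined[OF ok(2)] by auto
  have m: "g\<^sub>1 \<in> dgraphs (free_sbimod ar) ?m ?n ?d" "g\<^sub>2 \<in> dgraphs (free_sbimod ar) ?m ?n ?d"
    unfolding g using ok_dgraphs[OF ok(1)] ok_dgraphs[OF ok(2)] by (simp_all only: len deg)
  have "ideal (free_sbimod ar) R ?m ?n ?d (fscale e (basis g\<^sub>1 - fscale c (basis g\<^sub>2)))"
    using r m by (intro ideal.rel) (auto intro!: formal_fscale formal_diff)
  from ideal.scale[OF this, of "inverse e"] e
  have "ideal (free_sbimod ar) R ?m ?n ?d (basis g\<^sub>1 - fscale c (basis g\<^sub>2))" by simp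
  then show ?thesis using m ok_drawable[OF ok(1)] ok_drawable[OF ok(2)] unfolding eqn_def g[symmetric] by blast
qed

text \<open>The pair \<open>(os, is)\<close> marks the place where the left-hand side occurs: it is regarded as one vertex of an
  outer graph, into which the difference of the two sides is substituted.\<close>

lemma eqn_context:
  fixes R :: "(('k::field, 'g) free_elt dgraph \<Rightarrow>\<^sub>0 'k) set"
  assumes rel: "eqn ar R c (O1, I1, V1) (O2, I2, V2)"
    and wd: "well_drawn O' I (map snd A @ (os, is) # map snd B)" and ar: "arity_ok ar A" "arity_ok ar B"
    and names: "map \<rho> O1 = os" "map \<rho> I1 = is" "map \<rho>' O2 = map \<kappa> os" "map \<rho>' I2 = map \<kappa> is"
    and j1: "joined O' I (map snd (A @ map (rename \<rho>) V1 @ B))"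
    and j2: "joined (map \<kappa> O') (map \<kappa> I) (map snd (map (rename \<kappa>) A @ map (rename \<rho>') V2 @ map (rename \<kappa>) B))"
  shows "eqn ar R c (O', I, A @ map (rename \<rho>) V1 @ B)
    (map \<kappa> O', map \<kappa> I, map (rename \<kappa>) A @ map (rename \<rho>') V2 @ map (rename \<kappa>) B)"
proof -
  let ?E = "free_sbimod ar :: ('k, ('k, 'g) free_elt) sbimod"
  obtain m n d where 1: "diag ar (O1, I1, V1) \<in> dgraphs ?E m n d" and 2: "diag ar (O2, I2, V2) \<in> dgraphs ?E m n d"
    and id: "ideal ?E R m n d (basis (diag ar (O1, I1, V1)) - fscale c (basis (diag ar (O2, I2, V2))))"
    using rel unfolding eqn_def by blast
  have j: "joined O1 I1 (map snd V1)" "joined O2 I2 (map snd V2)" "arity_ok ar V1" "arity_ok ar V2"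
    using rel by (auto simp: eqn_def drawable_def)
  have mn: "m = length os" "n = length is" "length O1 = m" "length I1 = n"
    using dgraphs_arity[OF 1] names(1,2) by (auto simp: diag_def)
  let ?h = "Vertex m n d 0 :: ('k, 'g) free_elt vertex"
  let ?U = "decorate ar A @ (?h, os, is) # decorate ar B"
  let ?\<Gamma> = "wire_graph O' I (map snd ?U) (map fst ?U) :: ('k, 'g) free_elt dgraph"
  have arU: "arity_eqs (map snd ?U) (map fst ?U)"
    using arity_ok_arity_eqs[OF ar(1)] arity_ok_arity_eqs[OF ar(2)] mn
    by (auto simp: arity_eqs_def intro!: list_all2_appendI)
  have wf: "wf_graph ?\<Gamma>" using wd by (intro wf_wire_graph arU) simp
  have dU: "drawn ?\<Gamma> O' I ?U" using wd arU by (intro drawn_wire_graph) (simp_all add: well_drawn_def)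
  let ?cA = "map (\<lambda>v. corolla (gen_vertex ar (fst v)) :: ('k, 'g) free_elt dgraph) A"
  let ?cB = "map (\<lambda>v. corolla (gen_vertex ar (fst v)) :: ('k, 'g) free_elt dgraph) B"
  have cor: "corolla (gen_vertex ar x) \<in> dgraphs ?E (fst (ar x)) (fst (snd (ar x))) (snd (snd (ar x)))" for x
    using wf_corolla by (auto simp: dgraphs_def gdeg_def permutes_id)
  have mem: "list_all2 (\<lambda>g v. g \<in> dgraphs ?E (outs v) (ins v) (vdeg v)) (?cA @ g # ?cB) (verts ?\<Gamma>)"
    if "g \<in> dgraphs ?E m n d" for g
    using that cor by (auto simp: list_all2_append list_all2_map1 list_all2_map2 list_all2_same)
  have dg: "subst_graph ?\<Gamma> (?cA @ g # ?cB) \<in> dgraphs ?E (gout ?\<Gamma>) (gin ?\<Gamma>) (gdeg ?\<Gamma>)" if "g \<in> dgraphs ?E m n d" for g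
    by (rule subst_dgraphs(1)[OF wf mem[OF that]])
  have P: "list_all2 (\<lambda>(g, Oi, Ii, Vi, \<rho>) (v, os, is). wf_graph g \<and> drawn g Oi Ii Vi \<and>
       map \<rho> Oi = map \<kappa>' os \<and> map \<rho> Ii = map \<kappa>' is)
       (map (\<lambda>v. (corolla (gen_vertex ar (fst v)) :: ('k, 'g) free_elt dgraph, fst (snd v), snd (snd v), decorate ar [v], \<kappa>')) V) (decorate ar V)"
    if "arity_ok ar V" for V \<kappa>'
    using that
  proof (induction V)
    case (Cons v V)
    obtain x os "is" where v: "v = (x, os, is)" by (metis surj_pair)
    then have "fst (ar x) = length os" "fst (snd (ar x)) = length is" "arity_ok ar V"
      using Cons.prems by (auto simp: arity_ok_def)
    then show ?case
      using Cons.IH drawn_corolla[of "gen_vertex ar x :: ('k, 'g) free_elt vertex" os "is"] wf_corolla by (simp add: v)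
  qed simp
  have res: "subst_graph ?\<Gamma> (?cA @ diag ar (Oi, Ii, V) # ?cB) =
      diag ar (map \<kappa>' O', map \<kappa>' I, map (rename \<kappa>') A @ map (rename \<rho>) V @ map (rename \<kappa>') B)"
    if D: "diag ar (Oi, Ii, V) \<in> dgraphs ?E m n d" and ji: "joined Oi Ii (map snd V)" "arity_ok ar V"
      and n: "map \<rho> Oi = map \<kappa>' os" "map \<rho> Ii = map \<kappa>' is"
      and jj: "joined (map \<kappa>' O') (map \<kappa>' I) (map snd (map (rename \<kappa>') A @ map (rename \<rho>) V @ map (rename \<kappa>') B))"
    for Oi Ii V \<rho> \<kappa>'
  proof -
    let ?dec = "decorate ar :: 'g nvertex list \<Rightarrow> (('k, 'g) free_elt vertex \<times> nat list \<times> nat list) list"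
    let ?P = "map (\<lambda>v. (corolla (gen_vertex ar (fst v)) :: ('k, 'g) free_elt dgraph, fst (snd v), snd (snd v), ?dec [v], \<kappa>')) A
      @ (diag ar (Oi, Ii, V) :: ('k, 'g) free_elt dgraph, Oi, Ii, ?dec V, \<rho>) #
      map (\<lambda>v. (corolla (gen_vertex ar (fst v)) :: ('k, 'g) free_elt dgraph, fst (snd v), snd (snd v), ?dec [v], \<kappa>')) B"
    have "list_all2 (\<lambda>(g, Oi, Ii, Vi, \<rho>) (v, os, is). wf_graph g \<and> drawn g Oi Ii Vi \<and>
       map \<rho> Oi = map \<kappa>' os \<and> map \<rho> Ii = map \<kappa>' is) ?P ?U"
      using P[OF ar(2), of \<kappa>'] dgraphs_wf[OF D] drawn_diag[OF ji] n
      by (intro list_all2_appendI[OF P[OF ar(1), of \<kappa>']]) simp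
    from drawn_subst[OF dU wf this]
    have "drawn (subst_graph ?\<Gamma> (map fst ?P)) (map \<kappa>' O') (map \<kappa>' I)
       (concat (map (\<lambda>(g, Oi, Ii, Vi, \<rho>). map (rename \<rho>) Vi) ?P))" .
    moreover have "concat (map (\<lambda>(g, Oi, Ii, Vi, \<rho>). map (rename \<rho>) Vi) ?P) =
        ?dec (map (rename \<kappa>') A @ map (rename \<rho>) V @ map (rename \<kappa>') B)"
      by (simp add: o_def concat_map_singleton rename_decorate)
    moreover have "map fst ?P = ?cA @ diag ar (Oi, Ii, V) # ?cB" by simp
    ultimately have "drawn (subst_graph ?\<Gamma> (?cA @ diag ar (Oi, Ii, V) # ?cB)) (map \<kappa>' O') (map \<kappa>' I)
        (?dec (map (rename \<kappa>') A @ map (rename \<rho>) V @ map (rename \<kappa>') B))" by (simp only:)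
    from drawn_diag_eq[OF this jj] show ?thesis .
  qed
  have r1: "subst_graph ?\<Gamma> (?cA @ diag ar (O1, I1, V1) # ?cB) = diag ar (O', I, A @ map (rename \<rho>) V1 @ B)"
  proof -
    have rid: "map (rename id) X = X" for X :: "'g nvertex list" by (induction X) (auto simp: rename_def)
    show ?thesis using res[OF 1 j(1,3), of \<rho> id] names j1 by (simp add: rid)
  qed
  have r2: "subst_graph ?\<Gamma> (?cA @ diag ar (O2, I2, V2) # ?cB) =
      diag ar (map \<kappa> O', map \<kappa> I, map (rename \<kappa>) A @ map (rename \<rho>') V2 @ map (rename \<kappa>) B)"
    by (rule res[OF 2 j(2,4) names(3,4) j2])
  let ?xs = "\<lambda>x. map basis ?cA @ x # map basis ?cB :: (('k, 'g) free_elt dgraph \<Rightarrow>\<^sub>0 'k) list"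
  have b: "msubst ?\<Gamma> (?xs (basis g)) = basis (subst_graph ?\<Gamma> (?cA @ g # ?cB))" for g
    using mext_basis[of "\<lambda>gs. basis (subst_graph ?\<Gamma> gs) :: ('k, 'g) free_elt dgraph \<Rightarrow>\<^sub>0 'k" "?cA @ g # ?cB"] by (simp add: msubst_mext)
  let ?b1 = "basis (diag ar (O1, I1, V1)) :: ('k, 'g) free_elt dgraph \<Rightarrow>\<^sub>0 'k"
  let ?b2 = "basis (diag ar (O2, I2, V2)) :: ('k, 'g) free_elt dgraph \<Rightarrow>\<^sub>0 'k"
  have "msubst ?\<Gamma> (?xs (?b1 - fscale c ?b2)) = msubst ?\<Gamma> (?xs ?b1) - fscale c (msubst ?\<Gamma> (?xs ?b2))"
    by (simp only: msubst_mext mext_diff mext_fscale)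
  moreover have "ideal ?E R (gout ?\<Gamma>) (gin ?\<Gamma>) (gdeg ?\<Gamma>) (msubst ?\<Gamma> (?xs (?b1 - fscale c ?b2)))"
  proof (rule ideal_msubst[OF wf, where i = "length A"])
    show "list_all2 (\<lambda>x v. x \<in> formal ?E (outs v) (ins v) (vdeg v)) (?xs (?b1 - fscale c ?b2)) (verts ?\<Gamma>)"
      using cor 1 2 by (auto simp: list_all2_append list_all2_map1 list_all2_map2 list_all2_same
          intro!: formal_diff formal_fscale)
    show "ideal ?E R (outs (verts ?\<Gamma> ! length A)) (ins (verts ?\<Gamma> ! length A)) (vdeg (verts ?\<Gamma> ! length A))
        (?xs (?b1 - fscale c ?b2) ! length A)"
      using id by (simp add: nth_append)
  qed simp
  ultimately have "ideal ?E R (gout ?\<Gamma>) (gin ?\<Gamma>) (gdeg ?\<Gamma>)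
      (basis (diag ar (O', I, A @ map (rename \<rho>) V1 @ B)) -
       fscale c (basis (diag ar (map \<kappa> O', map \<kappa> I, map (rename \<kappa>) A @ map (rename \<rho>') V2 @ map (rename \<kappa>) B))))"
    by (simp only: b r1 r2)
  moreover have ren: "arity_ok ar (map (rename \<rho>) X)" if "arity_ok ar X" for \<rho> X
    using that by (induction X) (auto simp: arity_ok_def)
  have "drawable ar (O', I, A @ map (rename \<rho>) V1 @ B)"
    "drawable ar (map \<kappa> O', map \<kappa> I, map (rename \<kappa>) A @ map (rename \<rho>') V2 @ map (rename \<kappa>) B)"
    using j1 j2 ren[OF ar(1)] ren[OF ar(2)] ren[OF j(3)] ren[OF j(4)] ar by (simp_all add: drawable_def arity_ok_def)
  ultimately show ?thesis using dg[OF 1] dg[OF 2] unfolding eqn_def r1 r2 by blast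
qed

text \<open>Two specializations: rewriting by an equation between diagrams with the same boundary, and
  contraction of a diagram that equals a strand.\<close>

lemma eqn_rewrite:
  assumes rel: "eqn ar R c (O1, I1, V1) (O2, I2, V2)"
    and names: "map \<rho> O1 = p" "map \<rho> I1 = q" "map \<rho> O2 = p" "map \<rho> I2 = q"
    and D: "V = A @ map (rename \<rho>) V1 @ B" "V' = A @ map (rename \<rho>) V2 @ B"
    and wd: "well_drawn O' I (map snd A @ (p, q) # map snd B)" and ar: "arity_ok ar A" "arity_ok ar B"
    and j: "joined O' I (map snd V)" "joined O' I (map snd V')"
  shows "eqn ar R c (O', I, V) (O', I, V')"
proof -
  have rid: "map (rename id) X = X" for X :: "'a nvertex list" by (induction X) (auto simp: rename_def)
  have "eqn ar R c (O', I, A @ map (rename \<rho>) V1 @ B)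
    (map id O', map id I, map (rename id) A @ map (rename \<rho>) V2 @ map (rename id) B)"
    by (rule eqn_context[OF rel wd ar names(1,2)]) (use names j in \<open>simp_all add: rid D\<close>)
  then show ?thesis by (simp add: rid D)
qed

lemma eqn_contract:
  assumes rel: "eqn ar R c (O1, I1, V1) ([0], [0], [])"
    and names: "map \<rho> O1 = [a]" "map \<rho> I1 = [b]" and \<kappa>: "\<kappa> a = \<kappa> b"
    and D: "V = A @ map (rename \<rho>) V1 @ B" "V' = map (rename \<kappa>) (A @ B)" "O'' = map \<kappa> O'" "I' = map \<kappa> I"
    and wd: "well_drawn O' I (map snd A @ ([a], [b]) # map snd B)" and ar: "arity_ok ar A" "arity_ok ar B"
    and j: "joined O' I (map snd V)" "joined O'' I' (map snd V')"
  shows "eqn ar R c (O', I, V) (O'', I', V')"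
proof -
  have "eqn ar R c (O', I, A @ map (rename \<rho>) V1 @ B)
    (map \<kappa> O', map \<kappa> I, map (rename \<kappa>) A @ map (rename (\<lambda>_. \<kappa> b)) [] @ map (rename \<kappa>) B)"
    by (rule eqn_context[OF rel wd ar names, where \<rho>' = "\<lambda>_. \<kappa> b"])
      (use j in \<open>simp_all add: D \<kappa>\<close>)
  then show ?thesis by (simp add: D)
qed

text \<open>The equation \<open>D = 0\<close> is written with \<open>D\<close> on both sides.\<close>

lemma eqn_zero: "eqn ar R 0 D\<^sub>1 D\<^sub>2 \<Longrightarrow> eqn ar R 0 D\<^sub>1 D\<^sub>1"
  by (auto simp: eqn_def)

lemma joined_iff:
  "joined O' I W \<longleftrightarrow> distinct (source_names I W) \<and> distinct (target_names O' W) \<and>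
     list_all (\<lambda>x. x \<in> set (target_names O' W)) (source_names I W) \<and>
     list_all (\<lambda>x. x \<in> set (source_names I W)) (target_names O' W)"
  by (auto simp: joined_def list_all_iff)

lemma drawn_permute:
  assumes g: "drawn g O' I V" "wf_graph g" and \<pi>: "\<pi> permutes {..<length V}"
  shows "drawn (permute_vertices \<pi> g) O' I (permute_list (inv \<pi>) V)"
proof -
  have len: "length V = length (verts g)" using g(1) by (simp add: drawn_def)
  have ip: "inv \<pi> permutes {..<length V}" by (rule permutes_inv[OF \<pi>])
  have w: "wired (permute_vertices \<pi> g)" using wf_permute_vertices[OF g(2), of \<pi>] \<pi> len by (simp add: wf_graph_def)
  have ar: "arity_eqs (map snd V) (map fst V)" using g(1) by (simp add: drawn_def)
  have nth: "permute_list (inv \<pi>) V ! \<pi> i = V ! i" if "i < length V" for i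
    by (rule verts_permuted[OF \<pi> that])
  have lab: "labelled g (src_name I (map snd V)) (tgt_name O' (map snd V))" "bounded_edges g" using g(1) by (auto simp: drawn_def)
  have "labelled (permute_vertices \<pi> g) (src_name I (map snd (permute_list (inv \<pi>) V))) (tgt_name O' (map snd (permute_list (inv \<pi>) V)))"
    unfolding labelled_def
  proof clarify
    fix x y assume "(x, y) \<in> edges (permute_vertices \<pi> g)"
    then obtain s t where st: "(s, t) \<in> edges g" "x = move_vertex \<pi> s" "y = move_vertex \<pi> t" by auto
    have "src_name I (map snd (permute_list (inv \<pi>) V)) x = src_name I (map snd V) s"
      using boundedD(1)[OF lab(2) st(1)] st(2) nth len permutes_lessThan[OF \<pi>] by (cases s) auto
    moreover have "tgt_name O' (map snd (permute_list (inv \<pi>) V)) y = tgt_name O' (map snd V) t"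
      using boundedD(2)[OF lab(2) st(1)] st(3) nth len permutes_lessThan[OF \<pi>] by (cases t) auto
    ultimately show "src_name I (map snd (permute_list (inv \<pi>) V)) x = tgt_name O' (map snd (permute_list (inv \<pi>) V)) y"
      using labelledD[OF lab(1) st(1)] by simp
  qed
  moreover have "arity_eqs (map snd (permute_list (inv \<pi>) V)) (map fst (permute_list (inv \<pi>) V))"
    using ar permutes_lessThan[OF ip] ip by (auto simp: arity_eqs_def list_all2_conv_all_nth permute_list_nth)
  ultimately show ?thesis
    using g(1) w ip by (simp add: drawn_def wired_bounded wired_total permute_list_map)
qed

text \<open>The relation that reorders the vertices of a graph, with its Koszul sign, on the level of diagrams.\<close>

lemma eqn_swap:
  fixes R :: "(('k::field, 'g) free_elt dgraph \<Rightarrow>\<^sub>0 'k) set"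
  assumes ok: "ok ar (O', I, A @ a # b # B)"
  shows "eqn ar R (parity_sign (snd (snd (ar (fst a))) * snd (snd (ar (fst b))))) (O', I, A @ a # b # B) (O', I, A @ b # a # B)"
proof -
  let ?E = "free_sbimod ar :: ('k, ('k, 'g) free_elt) sbimod"
  let ?V = "A @ a # b # B" and ?V' = "A @ b # a # B" and ?n = "length A"
  let ?g = "diag ar (O', I, ?V) :: ('k, 'g) free_elt dgraph"
  define \<pi> where "\<pi> = transpose ?n (Suc ?n)"
  have \<pi>: "\<pi> permutes {..<length ?V}" unfolding \<pi>_def by (rule permutes_swap_id) auto
  have inv: "inv \<pi> = \<pi>" by (simp add: \<pi>_def)
  have perm: "permute_list \<pi> ?V = ?V'"
  proof (rule nth_equalityI)
    fix i assume "i < length (permute_list \<pi> ?V)"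
    then have i: "i < length ?V" by simp
    have "(A @ a # b # B) ! \<pi> i = (A @ b # a # B) ! i"
      by (auto simp: \<pi>_def transpose_def nth_append nth_Cons split: nat.splits)
    then show "permute_list \<pi> ?V ! i = ?V' ! i" using permute_list_nth[OF \<pi> i] by simp
  qed simp
  have m: "?g \<in> dgraphs ?E (length O') (length I) (\<Sum>v\<leftarrow>?V. snd (snd (ar (fst v))))" by (rule ok_dgraphs[OF ok])
  have lenv: "length (verts ?g) = length ?V" by (simp add: diag_def)
  have dr: "drawable ar (O', I, ?V)" using ok by (rule ok_drawable)
  then have dr': "drawable ar (O', I, ?V')"
    by (auto simp: drawable_def arity_ok_def joined_def source_names_def target_names_def)
  have "drawn ?g O' I (decorate ar ?V)" using dr by (intro drawn_diag) (simp_all add: drawable_def)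
  moreover have "\<pi> permutes {..<length (decorate ar ?V)}" using \<pi> by simp
  ultimately have "drawn (permute_vertices \<pi> ?g) O' I (permute_list (inv \<pi>) (decorate ar ?V))"
    by (intro drawn_permute ok_wf[OF ok])
  then have "drawn (permute_vertices \<pi> ?g) O' I (decorate ar ?V')"
    by (simp only: inv permute_list_map[OF \<pi>] perm)
  then have p: "permute_vertices \<pi> ?g = diag ar (O', I, ?V')"
    using dr' by (intro drawn_diag_eq) (simp_all add: drawable_def)
  have "{(i, j). i < j \<and> j < length ?V \<and> \<pi> j < \<pi> i} = {(?n, Suc ?n)}"
    by (auto simp: \<pi>_def transpose_def split: if_splits)
  then have k: "koszul \<pi> (map vdeg (verts ?g)) = (parity_sign (snd (snd (ar (fst a))) * snd (snd (ar (fst b)))) :: 'k)"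
    by (simp add: koszul_def diag_def nth_append)
  have "graph_relator ?E (length O') (length I) (\<Sum>v\<leftarrow>?V. snd (snd (ar (fst v))))
      (basis ?g - fscale (koszul \<pi> (map vdeg (verts ?g))) (basis (permute_vertices \<pi> ?g)))"
    by (rule graph_relator.reorder[OF m]) (simp only: lenv \<pi>)
  from ideal_relator[OF this, of R] dgraphs_permute[OF m, of \<pi>] m \<pi> lenv dr dr'
  show ?thesis unfolding eqn_def k p by metis
qed


lemma mext_fscale_basis:
  "mext f (map (\<lambda>x. fscale (c x) (basis (h x))) xs) = fscale (prod_list (map c xs)) (f (map h xs))"
  by (induction xs arbitrary: f) (simp_all add: lin_fscale mult.commute)

lemma act_comb_id: "act_comb id id x = x"
proof -
  have "act_graph id id g = g" for g :: "'a dgraph"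
  proof -
    have "move_ext id = id" by (rule ext, case_tac x) auto
    then show ?thesis by (cases g) (simp add: act_graph_def map_prod_def)
  qed
  then show ?thesis by (simp add: act_comb_def lin_basis_id)
qed

text \<open>When every generator is sent to a multiple of a diagram, the image of a diagram is obtained by
  inserting these diagrams, with fresh names for their inner wires.\<close>

lemma hom_diag:
  fixes F :: "'g \<Rightarrow> (('k::field, 'h) free_elt dgraph \<Rightarrow>\<^sub>0 'k)"
  assumes F: "\<And>x. F x = fscale (c x) (basis (diag ar' (N x)))" and N: "\<And>x. ok ar' (N x)"
    and ok: "ok ar (O', I, V)"
    and \<rho>: "list_all2 (\<lambda>\<rho> (x, os, is). map \<rho> (fst (N x)) = os \<and> map \<rho> (fst (snd (N x))) = is) \<rho>s V"
    and V': "V' = concat (map2 (\<lambda>\<rho> v. map (rename \<rho>) (snd (snd (N (fst v))))) \<rho>s V)"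
    and j: "joined O' I (map snd V')"
  shows "hom F (basis (diag ar (O', I, V))) = fscale (prod_list (map (\<lambda>v. c (fst v)) V)) (basis (diag ar' (O', I, V')))"
proof -
  let ?g = "diag ar (O', I, V) :: ('k, 'g) free_elt dgraph"
  let ?N = "\<lambda>x. diag ar' (N x) :: ('k, 'h) free_elt dgraph"
  have "hom F (basis ?g) = msubst ?g (map (\<lambda>v. fscale (c (fst v)) (basis (?N (fst v)))) V)"
    by (simp add: hom_basis graph_image_def diag_def[of ar] o_def dec_image_def act_comb_id F)
  also have "\<dots> = fscale (prod_list (map (\<lambda>v. c (fst v)) V)) (basis (subst_graph ?g (map (\<lambda>v. ?N (fst v)) V)))"
    unfolding msubst_mext by (rule mext_fscale_basis)
  also have "subst_graph ?g (map (\<lambda>v. ?N (fst v)) V) = diag ar' (O', I, V')"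
  proof (rule drawn_diag_eq[OF _ j])
    let ?dec = "decorate ar' :: 'h nvertex list \<Rightarrow> (('k, 'h) free_elt vertex \<times> nat list \<times> nat list) list"
    let ?P = "map2 (\<lambda>\<rho> v. (?N (fst v), fst (N (fst v)), fst (snd (N (fst v))), ?dec (snd (snd (N (fst v)))), \<rho>)) \<rho>s V"
    have dN: "drawn (?N x) (fst (N x)) (fst (snd (N x))) (?dec (snd (snd (N x))))" for x
      using ok_drawable[OF N[of x]] drawn_diag[of "fst (N x)" "fst (snd (N x))" "snd (snd (N x))" ar']
      by (simp add: drawable_def case_prod_unfold)
    have len: "length \<rho>s = length V" using \<rho> by (rule list_all2_lengthD)
    have P: "list_all2 (\<lambda>(g, Oi, Ii, Vi, \<rho>) (v, os, is). wf_graph g \<and> drawn g Oi Ii Vi \<and>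
       map \<rho> Oi = map id os \<and> map \<rho> Ii = map id is) ?P (decorate ar V :: (('k, 'g) free_elt vertex \<times> nat list \<times> nat list) list)"
      unfolding list_all2_conv_all_nth
    proof (intro conjI allI impI)
      show "length ?P = length (decorate ar V)" using len by simp
      fix i assume "i < length ?P"
      then have i: "i < length V" "i < length \<rho>s" using len by auto
      show "(case ?P ! i of (g, Oi, Ii, Vi, \<rho>) \<Rightarrow> \<lambda>(v, os, is). wf_graph g \<and> drawn g Oi Ii Vi \<and>
          map \<rho> Oi = map id os \<and> map \<rho> Ii = map id is) (decorate ar V ! i)"
        using list_all2_nthD[OF \<rho> i(2)] i ok_wf[OF N] dN by (simp add: case_prod_unfold)
    qed
    have "drawn ?g O' I (decorate ar V)" using ok_drawable[OF ok] by (intro drawn_diag) (simp_all add: drawable_def)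
    from drawn_subst[OF this ok_wf[OF ok] P]
    have "drawn (subst_graph ?g (map fst ?P)) O' I (concat (map (\<lambda>(g, Oi, Ii, Vi, \<rho>). map (rename \<rho>) Vi) ?P))" by simp
    moreover have "map fst ?P = map (\<lambda>v. ?N (fst v)) V" using len by (intro nth_equalityI) auto
    moreover have "concat (map (\<lambda>(g, Oi, Ii, Vi, \<rho>). map (rename \<rho>) Vi) ?P) = ?dec V'"
      unfolding V' map_concat by (rule arg_cong[of _ _ concat]) (simp add: case_prod_unfold o_def rename_decorate)
    ultimately show "drawn (subst_graph ?g (map (\<lambda>v. ?N (fst v)) V)) O' I (?dec V')" by (simp only:)
  qed
  finally show ?thesis .
qed

text \<open>A morphism respects a relation as soon as the images of its two sides are equal.\<close>

lemma hom_relation: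
  fixes F :: "'g \<Rightarrow> (('k::field, 'h) free_elt dgraph \<Rightarrow>\<^sub>0 'k)"
  assumes F: "generator_map ar (free_sbimod ar') F"
    and r: "r = fscale e (basis g\<^sub>1 - fscale c (basis g\<^sub>2))"
    and m: "r \<in> formal (free_sbimod ar) m n d"
    and h: "hom F (basis g\<^sub>1) = fscale s\<^sub>1 (basis (diag ar' D\<^sub>1))" "hom F (basis g\<^sub>2) = fscale s\<^sub>2 (basis (diag ar' D\<^sub>2))"
    and s: "s\<^sub>1 * c' = c * s\<^sub>2" "s\<^sub>1 \<noteq> 0" and eq: "eqn ar' R' c' D\<^sub>1 D\<^sub>2"
  shows "ideal (free_sbimod ar') R' m n d (hom F r)"
proof (cases "r = 0")
  case False
  let ?x = "basis g\<^sub>1 - fscale c (basis g\<^sub>2)"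
  have "g\<^sub>1 \<in> keys r"
  proof (rule ccontr)
    assume "g\<^sub>1 \<notin> keys r"
    then have z: "e * (1 - c * (1 when g\<^sub>2 = g\<^sub>1)) = 0" by (simp add: in_keys_iff r lookup_minus lookup_single when_def)
    have "e \<noteq> 0" using False r by auto
    then have "g\<^sub>2 = g\<^sub>1" "c = 1" using z by (auto simp: when_def split: if_splits)
    then show False using False r by simp
  qed
  then have "g\<^sub>1 \<in> dgraphs (free_sbimod ar) m n d" using m by (auto simp: formal_def)
  then have "hom F (basis g\<^sub>1) \<in> formal (free_sbimod ar') m n d" by (intro hom_formal[OF F]) simp
  then have "fscale (inverse s\<^sub>1) (fscale s\<^sub>1 (basis (diag ar' D\<^sub>1) :: ('k, 'h) free_elt dgraph \<Rightarrow>\<^sub>0 'k)) \<in> formal (free_sbimod ar') m n d"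
    unfolding h by (rule formal_fscale)
  then have D: "(diag ar' D\<^sub>1 :: ('k, 'h) free_elt dgraph) \<in> dgraphs (free_sbimod ar') m n d" using s(2) by simp
  obtain m' n' d' where "(diag ar' D\<^sub>1 :: ('k, 'h) free_elt dgraph) \<in> dgraphs (free_sbimod ar') m' n' d'"
      "ideal (free_sbimod ar') R' m' n' d' (basis (diag ar' D\<^sub>1) - fscale c' (basis (diag ar' D\<^sub>2)))"
    using eq unfolding eqn_def by blast
  then have "ideal (free_sbimod ar') R' m n d (basis (diag ar' D\<^sub>1) - fscale c' (basis (diag ar' D\<^sub>2)))"
    using dgraphs_unique[OF D] by metis
  then have "ideal (free_sbimod ar') R' m n d (fscale (e * s\<^sub>1) (basis (diag ar' D\<^sub>1) - fscale c' (basis (diag ar' D\<^sub>2))))"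
    by (rule ideal.scale)
  moreover have "hom F r = fscale (e * s\<^sub>1) (basis (diag ar' D\<^sub>1) - fscale c' (basis (diag ar' D\<^sub>2)))"
    unfolding r hom_fscale hom_diff h using s(1)
    by (simp add: fspace.scale_right_diff_distrib mult.assoc)
  ultimately show ?thesis by simp
qed (simp add: ideal_zero)

lemma eqn_swap_at:
  fixes c :: "'k::field"
  assumes "V = A @ a # b # B" "V' = A @ b # a # B" "ok ar (O', I, V)"
    and "c = parity_sign (snd (snd (ar (fst a))) * snd (snd (ar (fst b))))"
  shows "eqn ar R c (O', I, V) (O', I, V')"
  using eqn_swap[of ar O' I A a b B R] assms by simp

lemma eqn_flip: "eqn ar R 1 D\<^sub>1 D\<^sub>2 \<Longrightarrow> eqn ar R 1 D\<^sub>2 D\<^sub>1"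
  and eqn_neg_flip: "eqn ar R (- 1) D\<^sub>1 D\<^sub>2 \<Longrightarrow> eqn ar R (- 1) D\<^sub>2 D\<^sub>1"
  by (auto intro: eqn_sym)

lemma eqn_of_relation:
  fixes R :: "(('k::field, 'g) free_elt dgraph \<Rightarrow>\<^sub>0 'k) set"
  assumes r: "r \<in> R" and rD: "r = fscale e (basis (diag ar D\<^sub>1) - fscale c (basis (diag ar D\<^sub>2)))" and e: "e \<noteq> 0"
    and ok: "ok ar D\<^sub>1" "ok ar D\<^sub>2"
    and len: "length (fst D\<^sub>1) = length (fst D\<^sub>2)" "length (fst (snd D\<^sub>1)) = length (fst (snd D\<^sub>2))"
    and deg: "(\<Sum>v\<leftarrow>snd (snd D\<^sub>1). snd (snd (ar (fst v)))) = (\<Sum>v\<leftarrow>snd (snd D\<^sub>2). snd (snd (ar (fst v))))"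
  shows "eqn ar R c D\<^sub>1 D\<^sub>2"
proof -
  obtain O1 I1 V1 O2 I2 V2 where D: "D\<^sub>1 = (O1, I1, V1)" "D\<^sub>2 = (O2, I2, V2)" by (metis surj_pair)
  have "drawn (diag ar D\<^sub>1 :: ('k, 'g) free_elt dgraph) O1 I1 (decorate ar V1)"
    "drawn (diag ar D\<^sub>2 :: ('k, 'g) free_elt dgraph) O2 I2 (decorate ar V2)"
    using ok_drawable[OF ok(1)] ok_drawable[OF ok(2)] unfolding D drawable_def by (auto intro: drawn_diag)
  then show ?thesis
    using eqn_relation[of e "diag ar D\<^sub>1" c "diag ar D\<^sub>2" R O1 I1 ar V1 O2 I2 V2] assms unfolding D by simp
qed

lemma draws_vcomp:
  assumes "drawn f O' M (decorate ar V)" "drawn g M' I (decorate ar W)" "M = M'"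
  shows "drawn (f \<cdot> g) O' I (decorate ar (V @ W))"
  using drawn_vcomp[OF assms] by simp

lemma draws_hcomp:
  assumes "drawn f O' I (decorate ar V)" "drawn g O'' I' (decorate ar W)"
  shows "drawn (f \<otimes> g) (O' @ O'') (I @ I') (decorate ar (V @ W))"
  using drawn_hcomp[OF assms] by simp

lemma draws_idd: "drawn idd [a] [a] (decorate ar [])"
  by simp (rule drawn_strands; simp)

lemma draws_tau: "drawn tau [b, a] [a, b] (decorate ar [])"
  by simp (rule drawn_strands; auto simp: less_2_cases_iff)

lemma draws_cyc: "drawn cyc [c, a, b] [a, b, c] (decorate ar [])"
  and draws_cyc_inv: "drawn cyc_inv [b, c, a] [a, b, c] (decorate ar [])"
proof -
  have 3: "i < 3 \<longleftrightarrow> i = 0 \<or> i = 1 \<or> i = (2::nat)" for i by auto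
  have m: "Suc (Suc 0) mod 3 = 2" "(2 + 2) mod 3 = (1::nat)" by simp_all
  show "drawn cyc [c, a, b] [a, b, c] (decorate ar [])"
    by simp (rule drawn_strands; auto simp: 3 m numeral_2_eq_2)
  show "drawn cyc_inv [b, c, a] [a, b, c] (decorate ar [])"
    by simp (rule drawn_strands; auto simp: 3 m numeral_2_eq_2)
qed

lemmas diagram_simps = well_drawn_def ok_def joined_iff source_names_def target_names_def arity_ok_def parity_sign_def


lemma diag_eqI:
  assumes "drawn g O'' I' (decorate ar W)" "O'' = O'" "I' = I" "W = V" "joined O' I (map snd V)"
  shows "g = diag ar (O', I, V)"
  using drawn_diag_eq[of g O' I ar V] assms by simp

section \<open>The relations in terms of diagrams\<close>

text \<open>
  The composites in the relations are drawn with the outputs numbered first, then the inputs, then the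
  inner wires; the numbers in the factors are those that make them fit together.
\<close>

lemma PU_drawn: "drawn (gen dpois_arity PU) [x] [] (decorate dpois_arity [(PU, [x], [])])"
  by (rule drawn_gen) simp_all

lemma PM_drawn: "drawn (gen dpois_arity PM) [x] [a, b] (decorate dpois_arity [(PM, [x], [a, b])])"
  by (rule drawn_gen) simp_all

lemma PW_drawn: "drawn (gen dpois_arity PW) [x, y] [a, b] (decorate dpois_arity [(PW, [x, y], [a, b])])"
  by (rule drawn_gen) simp_all

lemma dpois_idd: "idd = diag dpois_arity ([0], [0], [])"
  by (rule diag_eqI[OF draws_idd[of 0 dpois_arity]]) (simp_all add: diagram_simps)

lemma dpois_antisym_lhs:
  "tau \<cdot> ((gen dpois_arity PW) \<cdot> tau) =
   diag dpois_arity ([0, 1], [2, 3], [(PW, [1, 0], [3, 2])])"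
  by (rule diag_eqI[OF draws_vcomp[OF draws_tau[of 0 1 dpois_arity] draws_vcomp[OF PW_drawn[of 1 0 3 2] draws_tau[of 3 2 dpois_arity]]]])
    (simp_all add: diagram_simps)

lemma dpois_antisym_rhs:
  "gen dpois_arity PW =
   diag dpois_arity ([0, 1], [2, 3], [(PW, [0, 1], [2, 3])])"
  by (rule diag_eqI[OF PW_drawn[of 0 1 2 3]])
    (simp_all add: diagram_simps)

lemma dpois_assoc_lhs:
  "(gen dpois_arity PM) \<cdot> (idd \<otimes> (gen dpois_arity PM)) =
   diag dpois_arity ([0], [1, 2, 3], [(PM, [0], [1, 4]), (PM, [4], [2, 3])])"
  by (rule diag_eqI[OF draws_vcomp[OF PM_drawn[of 0 1 4] draws_hcomp[OF draws_idd[of 1 dpois_arity] PM_drawn[of 4 2 3]]]])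
    (simp_all add: diagram_simps)

lemma dpois_assoc_rhs:
  "(gen dpois_arity PM) \<cdot> ((gen dpois_arity PM) \<otimes> idd) =
   diag dpois_arity ([0], [1, 2, 3], [(PM, [0], [4, 3]), (PM, [4], [1, 2])])"
  by (rule diag_eqI[OF draws_vcomp[OF PM_drawn[of 0 4 3] draws_hcomp[OF PM_drawn[of 4 1 2] draws_idd[of 3 dpois_arity]]]])
    (simp_all add: diagram_simps)

lemma dpois_unit_left_lhs:
  "(gen dpois_arity PM) \<cdot> ((gen dpois_arity PU) \<otimes> idd) =
   diag dpois_arity ([0], [1], [(PM, [0], [2, 1]), (PU, [2], [])])"
  by (rule diag_eqI[OF draws_vcomp[OF PM_drawn[of 0 2 1] draws_hcomp[OF PU_drawn[of 2] draws_idd[of 1 dpois_arity]]]])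
    (simp_all add: diagram_simps)

lemma dpois_unit_right_lhs:
  "(gen dpois_arity PM) \<cdot> (idd \<otimes> (gen dpois_arity PU)) =
   diag dpois_arity ([0], [1], [(PM, [0], [1, 2]), (PU, [2], [])])"
  by (rule diag_eqI[OF draws_vcomp[OF PM_drawn[of 0 1 2] draws_hcomp[OF draws_idd[of 1 dpois_arity] PU_drawn[of 2]]]])
    (simp_all add: diagram_simps)

lemma dpois_leibniz_left_lhs:
  "((gen dpois_arity PM) \<otimes> idd) \<cdot> (idd \<otimes> (gen dpois_arity PW)) =
   diag dpois_arity ([0, 1], [2, 3, 4], [(PM, [0], [2, 5]), (PW, [5, 1], [3, 4])])"
  by (rule diag_eqI[OF draws_vcomp[OF draws_hcomp[OF PM_drawn[of 0 2 5] draws_idd[of 1 dpois_arity]] draws_hcomp[OF draws_idd[of 2 dpois_arity] PW_drawn[of 5 1 3 4]]]])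
    (simp_all add: diagram_simps)

lemma dpois_leibniz_left_rhs:
  "(gen dpois_arity PW) \<cdot> ((idd \<otimes> (gen dpois_arity PM)) \<cdot> (tau \<otimes> idd)) =
   diag dpois_arity ([0, 1], [2, 3, 4], [(PW, [0, 1], [3, 5]), (PM, [5], [2, 4])])"
  by (rule diag_eqI[OF draws_vcomp[OF PW_drawn[of 0 1 3 5] draws_vcomp[OF draws_hcomp[OF draws_idd[of 3 dpois_arity] PM_drawn[of 5 2 4]] draws_hcomp[OF draws_tau[of 3 2 dpois_arity] draws_idd[of 4 dpois_arity]]]]])
    (simp_all add: diagram_simps)

lemma dpois_leibniz_right_lhs:
  "((gen dpois_arity PM) \<otimes> idd) \<cdot> ((idd \<otimes> tau) \<cdot> ((gen dpois_arity PW) \<otimes> idd)) =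
   diag dpois_arity ([0, 1], [2, 3, 4], [(PM, [0], [5, 4]), (PW, [5, 1], [2, 3])])"
  by (rule diag_eqI[OF draws_vcomp[OF draws_hcomp[OF PM_drawn[of 0 5 4] draws_idd[of 1 dpois_arity]] draws_vcomp[OF draws_hcomp[OF draws_idd[of 5 dpois_arity] draws_tau[of 4 1 dpois_arity]] draws_hcomp[OF PW_drawn[of 5 1 2 3] draws_idd[of 4 dpois_arity]]]]])
    (simp_all add: diagram_simps)

lemma dpois_leibniz_right_rhs:
  "(gen dpois_arity PW) \<cdot> (((gen dpois_arity PM) \<otimes> idd) \<cdot> (idd \<otimes> tau)) =
   diag dpois_arity ([0, 1], [2, 3, 4], [(PW, [0, 1], [5, 3]), (PM, [5], [2, 4])])"
  by (rule diag_eqI[OF draws_vcomp[OF PW_drawn[of 0 1 5 3] draws_vcomp[OF draws_hcomp[OF PM_drawn[of 5 2 4] draws_idd[of 3 dpois_arity]] draws_hcomp[OF draws_idd[of 2 dpois_arity] draws_tau[of 4 3 dpois_arity]]]]])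
    (simp_all add: diagram_simps)

lemma dpois_cyclic_lhs:
  "((gen dpois_arity PW) \<otimes> idd) \<cdot> (idd \<otimes> (gen dpois_arity PW)) =
   diag dpois_arity ([0, 1, 2], [3, 4, 5], [(PW, [0, 1], [3, 7]), (PW, [7, 2], [4, 5])])"
  by (rule diag_eqI[OF draws_vcomp[OF draws_hcomp[OF PW_drawn[of 0 1 3 7] draws_idd[of 2 dpois_arity]] draws_hcomp[OF draws_idd[of 3 dpois_arity] PW_drawn[of 7 2 4 5]]]])
    (simp_all add: diagram_simps)

lemma dpois_cyclic_rhs:
  "cyc_inv \<cdot> ((((gen dpois_arity PW) \<otimes> idd) \<cdot> (idd \<otimes> (gen dpois_arity PW))) \<cdot> cyc) =
   diag dpois_arity ([0, 1, 2], [3, 4, 5], [(PW, [2, 0], [5, 6]), (PW, [6, 1], [3, 4])])"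
  by (rule diag_eqI[OF draws_vcomp[OF draws_cyc_inv[of 0 1 2 dpois_arity] draws_vcomp[OF draws_vcomp[OF draws_hcomp[OF PW_drawn[of 2 0 5 6] draws_idd[of 1 dpois_arity]] draws_hcomp[OF draws_idd[of 5 dpois_arity] PW_drawn[of 6 1 3 4]]] draws_cyc[of 5 3 4 dpois_arity]]]])
    (simp_all add: diagram_simps)

lemma dpois_mult_bracket_lhs:
  "(gen dpois_arity PM) \<cdot> (gen dpois_arity PW) =
   diag dpois_arity ([0], [1, 2], [(PM, [0], [3, 4]), (PW, [3, 4], [1, 2])])"
  by (rule diag_eqI[OF draws_vcomp[OF PM_drawn[of 0 3 4] PW_drawn[of 3 4 1 2]]])
    (simp_all add: diagram_simps)

lemma dpois_bracket_bracket_lhs: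
  "(gen dpois_arity PW) \<cdot> (gen dpois_arity PW) =
   diag dpois_arity ([0, 1], [2, 3], [(PW, [0, 1], [4, 5]), (PW, [4, 5], [2, 3])])"
  by (rule diag_eqI[OF draws_vcomp[OF PW_drawn[of 0 1 4 5] PW_drawn[of 4 5 2 3]]])
    (simp_all add: diagram_simps)

lemma dpois_rels_diag:
  "dpois_rels = {
     basis (diag dpois_arity ([0, 1], [2, 3], [(PW, [1, 0], [3, 2])])) + basis (diag dpois_arity ([0, 1], [2, 3], [(PW, [0, 1], [2, 3])])),
     basis (diag dpois_arity ([0], [1, 2, 3], [(PM, [0], [1, 4]), (PM, [4], [2, 3])])) + basis (diag dpois_arity ([0], [1, 2, 3], [(PM, [0], [4, 3]), (PM, [4], [1, 2])])),
     basis (diag dpois_arity ([0], [1], [(PM, [0], [2, 1]), (PU, [2], [])])) + basis (diag dpois_arity ([0], [0], [])),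
     basis (diag dpois_arity ([0], [1], [(PM, [0], [1, 2]), (PU, [2], [])])) - basis (diag dpois_arity ([0], [0], [])),
     basis (diag dpois_arity ([0, 1], [2, 3, 4], [(PM, [0], [2, 5]), (PW, [5, 1], [3, 4])])) + basis (diag dpois_arity ([0, 1], [2, 3, 4], [(PW, [0, 1], [3, 5]), (PM, [5], [2, 4])])),
     basis (diag dpois_arity ([0, 1], [2, 3, 4], [(PM, [0], [5, 4]), (PW, [5, 1], [2, 3])])) + basis (diag dpois_arity ([0, 1], [2, 3, 4], [(PW, [0, 1], [5, 3]), (PM, [5], [2, 4])])),
     basis (diag dpois_arity ([0, 1, 2], [3, 4, 5], [(PW, [0, 1], [3, 7]), (PW, [7, 2], [4, 5])])) - basis (diag dpois_arity ([0, 1, 2], [3, 4, 5], [(PW, [2, 0], [5, 6]), (PW, [6, 1], [3, 4])])),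
     basis (diag dpois_arity ([0], [1, 2], [(PM, [0], [3, 4]), (PW, [3, 4], [1, 2])])),
     basis (diag dpois_arity ([0, 1], [2, 3], [(PW, [0, 1], [4, 5]), (PW, [4, 5], [2, 3])]))}"
  unfolding dpois_rels_def Let_def by (simp only: dpois_idd[symmetric] dpois_antisym_lhs[symmetric] dpois_antisym_rhs[symmetric] dpois_assoc_lhs[symmetric] dpois_assoc_rhs[symmetric] dpois_unit_left_lhs[symmetric] dpois_unit_right_lhs[symmetric] dpois_leibniz_left_lhs[symmetric] dpois_leibniz_left_rhs[symmetric] dpois_leibniz_right_lhs[symmetric] dpois_leibniz_right_rhs[symmetric] dpois_cyclic_lhs[symmetric] dpois_cyclic_rhs[symmetric] dpois_mult_bracket_lhs[symmetric] dpois_bracket_bracket_lhs[symmetric])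

abbreviation "dpois_eqn \<equiv> eqn dpois_arity dpois_rels"

lemma dpois_antisym: "dpois_eqn (- 1) ([0, 1], [2, 3], [(PW, [1, 0], [3, 2])]) ([0, 1], [2, 3], [(PW, [0, 1], [2, 3])])"
  by (rule eqn_of_relation[where e = 1]) (simp_all add: dpois_rels_diag diagram_simps)

lemma dpois_assoc: "dpois_eqn (- 1) ([0], [1, 2, 3], [(PM, [0], [1, 4]), (PM, [4], [2, 3])]) ([0], [1, 2, 3], [(PM, [0], [4, 3]), (PM, [4], [1, 2])])"
  by (rule eqn_of_relation[where e = 1]) (simp_all add: dpois_rels_diag diagram_simps)

lemma dpois_unit_left: "dpois_eqn (- 1) ([0], [1], [(PM, [0], [2, 1]), (PU, [2], [])]) ([0], [0], [])"
  by (rule eqn_of_relation[where e = 1]) (simp_all add: dpois_rels_diag diagram_simps)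

lemma dpois_unit_right: "dpois_eqn 1 ([0], [1], [(PM, [0], [1, 2]), (PU, [2], [])]) ([0], [0], [])"
  by (rule eqn_of_relation[where e = 1]) (simp_all add: dpois_rels_diag diagram_simps)

lemma dpois_leibniz_left: "dpois_eqn (- 1) ([0, 1], [2, 3, 4], [(PM, [0], [2, 5]), (PW, [5, 1], [3, 4])]) ([0, 1], [2, 3, 4], [(PW, [0, 1], [3, 5]), (PM, [5], [2, 4])])"
  by (rule eqn_of_relation[where e = 1]) (simp_all add: dpois_rels_diag diagram_simps)

lemma dpois_leibniz_right: "dpois_eqn (- 1) ([0, 1], [2, 3, 4], [(PM, [0], [5, 4]), (PW, [5, 1], [2, 3])]) ([0, 1], [2, 3, 4], [(PW, [0, 1], [5, 3]), (PM, [5], [2, 4])])"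
  by (rule eqn_of_relation[where e = 1]) (simp_all add: dpois_rels_diag diagram_simps)

lemma dpois_cyclic: "dpois_eqn 1 ([0, 1, 2], [3, 4, 5], [(PW, [0, 1], [3, 7]), (PW, [7, 2], [4, 5])]) ([0, 1, 2], [3, 4, 5], [(PW, [2, 0], [5, 6]), (PW, [6, 1], [3, 4])])"
  by (rule eqn_of_relation[where e = 1]) (simp_all add: dpois_rels_diag diagram_simps)

lemma dpois_mult_bracket: "dpois_eqn 0 ([0], [1, 2], [(PM, [0], [3, 4]), (PW, [3, 4], [1, 2])]) ([0], [1, 2], [(PM, [0], [3, 4]), (PW, [3, 4], [1, 2])])"
  by (rule eqn_of_relation[where e = 1]) (simp_all add: dpois_rels_diag diagram_simps)

lemma BU_drawn: "drawn (gen bib_arity BU) [x] [] (decorate bib_arity [(BU, [x], [])])"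
  by (rule drawn_gen) simp_all

lemma BM_drawn: "drawn (gen bib_arity BM) [x] [a, b] (decorate bib_arity [(BM, [x], [a, b])])"
  by (rule drawn_gen) simp_all

lemma BDelta_drawn: "drawn (gen bib_arity BDelta) [x, y] [a] (decorate bib_arity [(BDelta, [x, y], [a])])"
  by (rule drawn_gen) simp_all

lemma bib_idd: "idd = diag bib_arity ([0], [0], [])"
  by (rule diag_eqI[OF draws_idd[of 0 bib_arity]]) (simp_all add: diagram_simps)

lemma bib_assoc_lhs:
  "(gen bib_arity BM) \<cdot> (idd \<otimes> (gen bib_arity BM)) =
   diag bib_arity ([0], [1, 2, 3], [(BM, [0], [1, 4]), (BM, [4], [2, 3])])"
  by (rule diag_eqI[OF draws_vcomp[OF BM_drawn[of 0 1 4] draws_hcomp[OF draws_idd[of 1 bib_arity] BM_drawn[of 4 2 3]]]])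
    (simp_all add: diagram_simps)

lemma bib_assoc_rhs:
  "(gen bib_arity BM) \<cdot> ((gen bib_arity BM) \<otimes> idd) =
   diag bib_arity ([0], [1, 2, 3], [(BM, [0], [4, 3]), (BM, [4], [1, 2])])"
  by (rule diag_eqI[OF draws_vcomp[OF BM_drawn[of 0 4 3] draws_hcomp[OF BM_drawn[of 4 1 2] draws_idd[of 3 bib_arity]]]])
    (simp_all add: diagram_simps)

lemma bib_coassoc_lhs:
  "(idd \<otimes> (gen bib_arity BDelta)) \<cdot> (gen bib_arity BDelta) =
   diag bib_arity ([0, 1, 2], [3], [(BDelta, [1, 2], [7]), (BDelta, [0, 7], [3])])"
  by (rule diag_eqI[OF draws_vcomp[OF draws_hcomp[OF draws_idd[of 0 bib_arity] BDelta_drawn[of 1 2 7]] BDelta_drawn[of 0 7 3]]])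
    (simp_all add: diagram_simps)

lemma bib_coassoc_rhs:
  "((gen bib_arity BDelta) \<otimes> idd) \<cdot> (gen bib_arity BDelta) =
   diag bib_arity ([0, 1, 2], [3], [(BDelta, [0, 1], [4]), (BDelta, [4, 2], [3])])"
  by (rule diag_eqI[OF draws_vcomp[OF draws_hcomp[OF BDelta_drawn[of 0 1 4] draws_idd[of 2 bib_arity]] BDelta_drawn[of 4 2 3]]])
    (simp_all add: diagram_simps)

lemma bib_bimod_left_lhs:
  "(gen bib_arity BDelta) \<cdot> (gen bib_arity BM) =
   diag bib_arity ([0, 1], [2, 3], [(BDelta, [0, 1], [4]), (BM, [4], [2, 3])])"
  by (rule diag_eqI[OF draws_vcomp[OF BDelta_drawn[of 0 1 4] BM_drawn[of 4 2 3]]])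
    (simp_all add: diagram_simps)

lemma bib_bimod_left_rhs:
  "((gen bib_arity BM) \<otimes> idd) \<cdot> (idd \<otimes> (gen bib_arity BDelta)) =
   diag bib_arity ([0, 1], [2, 3], [(BM, [0], [2, 4]), (BDelta, [4, 1], [3])])"
  by (rule diag_eqI[OF draws_vcomp[OF draws_hcomp[OF BM_drawn[of 0 2 4] draws_idd[of 1 bib_arity]] draws_hcomp[OF draws_idd[of 2 bib_arity] BDelta_drawn[of 4 1 3]]]])
    (simp_all add: diagram_simps)

lemma bib_bimod_right_rhs:
  "(idd \<otimes> (gen bib_arity BM)) \<cdot> ((gen bib_arity BDelta) \<otimes> idd) =
   diag bib_arity ([0, 1], [2, 3], [(BM, [1], [4, 3]), (BDelta, [0, 4], [2])])"
  by (rule diag_eqI[OF draws_vcomp[OF draws_hcomp[OF draws_idd[of 0 bib_arity] BM_drawn[of 1 4 3]] draws_hcomp[OF BDelta_drawn[of 0 4 2] draws_idd[of 3 bib_arity]]]])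
    (simp_all add: diagram_simps)

lemma bib_B_antisym_lhs:
  "(idd \<otimes> (gen bib_arity BM)) \<cdot> ((tau \<otimes> idd) \<cdot> (idd \<otimes> (gen bib_arity BDelta))) =
   diag bib_arity ([0, 1], [2, 3], [(BM, [1], [2, 4]), (BDelta, [0, 4], [3])])"
  by (rule diag_eqI[OF draws_vcomp[OF draws_hcomp[OF draws_idd[of 0 bib_arity] BM_drawn[of 1 2 4]] draws_vcomp[OF draws_hcomp[OF draws_tau[of 0 2 bib_arity] draws_idd[of 4 bib_arity]] draws_hcomp[OF draws_idd[of 2 bib_arity] BDelta_drawn[of 0 4 3]]]]])
    (simp_all add: diagram_simps)

lemma bib_B_antisym_rhs:
  "tau \<cdot> (((idd \<otimes> (gen bib_arity BM)) \<cdot> ((tau \<otimes> idd) \<cdot> (idd \<otimes> (gen bib_arity BDelta)))) \<cdot> tau) =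
   diag bib_arity ([0, 1], [2, 3], [(BM, [0], [3, 4]), (BDelta, [1, 4], [2])])"
  by (rule diag_eqI[OF draws_vcomp[OF draws_tau[of 0 1 bib_arity] draws_vcomp[OF draws_vcomp[OF draws_hcomp[OF draws_idd[of 1 bib_arity] BM_drawn[of 0 3 4]] draws_vcomp[OF draws_hcomp[OF draws_tau[of 1 3 bib_arity] draws_idd[of 4 bib_arity]] draws_hcomp[OF draws_idd[of 3 bib_arity] BDelta_drawn[of 1 4 2]]]] draws_tau[of 3 2 bib_arity]]]])
    (simp_all add: diagram_simps)

lemma bib_B_twisted_rhs:
  "(((gen bib_arity BM) \<otimes> idd) \<cdot> ((idd \<otimes> tau) \<cdot> ((gen bib_arity BDelta) \<otimes> idd))) \<cdot> tau =
   diag bib_arity ([0, 1], [2, 3], [(BM, [0], [4, 2]), (BDelta, [4, 1], [3])])"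
  by (rule diag_eqI[OF draws_vcomp[OF draws_vcomp[OF draws_hcomp[OF BM_drawn[of 0 4 2] draws_idd[of 1 bib_arity]] draws_vcomp[OF draws_hcomp[OF draws_idd[of 4 bib_arity] draws_tau[of 2 1 bib_arity]] draws_hcomp[OF BDelta_drawn[of 4 1 3] draws_idd[of 2 bib_arity]]]] draws_tau[of 3 2 bib_arity]]])
    (simp_all add: diagram_simps)

lemma bib_mult_comult_lhs:
  "(gen bib_arity BM) \<cdot> (gen bib_arity BDelta) =
   diag bib_arity ([0], [1], [(BM, [0], [2, 3]), (BDelta, [2, 3], [1])])"
  by (rule diag_eqI[OF draws_vcomp[OF BM_drawn[of 0 2 3] BDelta_drawn[of 2 3 1]]])
    (simp_all add: diagram_simps)

lemma bib_mult_tau_comult_lhs: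
  "(gen bib_arity BM) \<cdot> (tau \<cdot> (gen bib_arity BDelta)) =
   diag bib_arity ([0], [1], [(BM, [0], [3, 2]), (BDelta, [2, 3], [1])])"
  by (rule diag_eqI[OF draws_vcomp[OF BM_drawn[of 0 3 2] draws_vcomp[OF draws_tau[of 3 2 bib_arity] BDelta_drawn[of 2 3 1]]]])
    (simp_all add: diagram_simps)

lemma bib_unit_left_lhs:
  "(gen bib_arity BM) \<cdot> ((gen bib_arity BU) \<otimes> idd) =
   diag bib_arity ([0], [1], [(BM, [0], [2, 1]), (BU, [2], [])])"
  by (rule diag_eqI[OF draws_vcomp[OF BM_drawn[of 0 2 1] draws_hcomp[OF BU_drawn[of 2] draws_idd[of 1 bib_arity]]]])
    (simp_all add: diagram_simps)

lemma bib_unit_right_lhs: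
  "(gen bib_arity BM) \<cdot> (idd \<otimes> (gen bib_arity BU)) =
   diag bib_arity ([0], [1], [(BM, [0], [1, 2]), (BU, [2], [])])"
  by (rule diag_eqI[OF draws_vcomp[OF BM_drawn[of 0 1 2] draws_hcomp[OF draws_idd[of 1 bib_arity] BU_drawn[of 2]]]])
    (simp_all add: diagram_simps)

lemma bib_rels_diag:
  "bib_rels = {
     basis (diag bib_arity ([0], [1, 2, 3], [(BM, [0], [1, 4]), (BM, [4], [2, 3])])) + basis (diag bib_arity ([0], [1, 2, 3], [(BM, [0], [4, 3]), (BM, [4], [1, 2])])),
     basis (diag bib_arity ([0, 1, 2], [3], [(BDelta, [1, 2], [7]), (BDelta, [0, 7], [3])])) - basis (diag bib_arity ([0, 1, 2], [3], [(BDelta, [0, 1], [4]), (BDelta, [4, 2], [3])])),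
     - basis (diag bib_arity ([0, 1], [2, 3], [(BDelta, [0, 1], [4]), (BM, [4], [2, 3])])) + basis (diag bib_arity ([0, 1], [2, 3], [(BM, [0], [2, 4]), (BDelta, [4, 1], [3])])),
     - basis (diag bib_arity ([0, 1], [2, 3], [(BDelta, [0, 1], [4]), (BM, [4], [2, 3])])) + basis (diag bib_arity ([0, 1], [2, 3], [(BM, [1], [4, 3]), (BDelta, [0, 4], [2])])),
     basis (diag bib_arity ([0, 1], [2, 3], [(BM, [1], [2, 4]), (BDelta, [0, 4], [3])])) + basis (diag bib_arity ([0, 1], [2, 3], [(BM, [0], [3, 4]), (BDelta, [1, 4], [2])])),
     basis (diag bib_arity ([0, 1], [2, 3], [(BM, [1], [2, 4]), (BDelta, [0, 4], [3])])) + basis (diag bib_arity ([0, 1], [2, 3], [(BM, [0], [4, 2]), (BDelta, [4, 1], [3])])),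
     basis (diag bib_arity ([0], [1], [(BM, [0], [2, 3]), (BDelta, [2, 3], [1])])),
     basis (diag bib_arity ([0], [1], [(BM, [0], [3, 2]), (BDelta, [2, 3], [1])])),
     basis (diag bib_arity ([0], [1], [(BM, [0], [2, 1]), (BU, [2], [])])) + basis (diag bib_arity ([0], [0], [])),
     basis (diag bib_arity ([0], [1], [(BM, [0], [1, 2]), (BU, [2], [])])) - basis (diag bib_arity ([0], [0], []))}"
  unfolding bib_rels_def Let_def by (simp only: bib_idd[symmetric] bib_assoc_lhs[symmetric] bib_assoc_rhs[symmetric] bib_coassoc_lhs[symmetric] bib_coassoc_rhs[symmetric] bib_bimod_left_lhs[symmetric] bib_bimod_left_rhs[symmetric] bib_bimod_right_rhs[symmetric] bib_B_antisym_lhs[symmetric] bib_B_antisym_rhs[symmetric] bib_B_twisted_rhs[symmetric] bib_mult_comult_lhs[symmetric] bib_mult_tau_comult_lhs[symmetric] bib_unit_left_lhs[symmetric] bib_unit_right_lhs[symmetric])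

abbreviation "bib_eqn \<equiv> eqn bib_arity bib_rels"

lemma bib_assoc: "bib_eqn (- 1) ([0], [1, 2, 3], [(BM, [0], [1, 4]), (BM, [4], [2, 3])]) ([0], [1, 2, 3], [(BM, [0], [4, 3]), (BM, [4], [1, 2])])"
  by (rule eqn_of_relation[where e = 1]) (simp_all add: bib_rels_diag diagram_simps)

lemma bib_coassoc: "bib_eqn 1 ([0, 1, 2], [3], [(BDelta, [1, 2], [7]), (BDelta, [0, 7], [3])]) ([0, 1, 2], [3], [(BDelta, [0, 1], [4]), (BDelta, [4, 2], [3])])"
  by (rule eqn_of_relation[where e = 1]) (simp_all add: bib_rels_diag diagram_simps)

lemma bib_bimod_left: "bib_eqn 1 ([0, 1], [2, 3], [(BM, [0], [2, 4]), (BDelta, [4, 1], [3])]) ([0, 1], [2, 3], [(BDelta, [0, 1], [4]), (BM, [4], [2, 3])])"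
  by (rule eqn_of_relation[where e = 1]) (simp_all add: bib_rels_diag diagram_simps)

lemma bib_bimod_right: "bib_eqn 1 ([0, 1], [2, 3], [(BM, [1], [4, 3]), (BDelta, [0, 4], [2])]) ([0, 1], [2, 3], [(BDelta, [0, 1], [4]), (BM, [4], [2, 3])])"
  by (rule eqn_of_relation[where e = 1]) (simp_all add: bib_rels_diag diagram_simps)

lemma bib_B_antisym: "bib_eqn (- 1) ([0, 1], [2, 3], [(BM, [1], [2, 4]), (BDelta, [0, 4], [3])]) ([0, 1], [2, 3], [(BM, [0], [3, 4]), (BDelta, [1, 4], [2])])"
  by (rule eqn_of_relation[where e = 1]) (simp_all add: bib_rels_diag diagram_simps)

lemma bib_B_twisted: "bib_eqn (- 1) ([0, 1], [2, 3], [(BM, [1], [2, 4]), (BDelta, [0, 4], [3])]) ([0, 1], [2, 3], [(BM, [0], [4, 2]), (BDelta, [4, 1], [3])])"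
  by (rule eqn_of_relation[where e = 1]) (simp_all add: bib_rels_diag diagram_simps)

lemma bib_mult_tau_comult: "bib_eqn 0 ([0], [1], [(BM, [0], [3, 2]), (BDelta, [2, 3], [1])]) ([0], [1], [(BM, [0], [3, 2]), (BDelta, [2, 3], [1])])"
  by (rule eqn_of_relation[where e = 1]) (simp_all add: bib_rels_diag diagram_simps)

lemma bib_unit_left: "bib_eqn (- 1) ([0], [1], [(BM, [0], [2, 1]), (BU, [2], [])]) ([0], [0], [])"
  by (rule eqn_of_relation[where e = 1]) (simp_all add: bib_rels_diag diagram_simps)

lemma bib_unit_right: "bib_eqn 1 ([0], [1], [(BM, [0], [1, 2]), (BU, [2], [])]) ([0], [0], [])"
  by (rule eqn_of_relation[where e = 1]) (simp_all add: bib_rels_diag diagram_simps)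

section \<open>Consequences of the relations of double Poisson gebras\<close>

text \<open>The bracket \<open>w\<close> is recovered from \<open>w (u \<otimes> id)\<close>: the derivation rule moves the product from the
  output to the input that the unit occupies, where the two cancel.\<close>

lemma dpois_mult_unit:
  "dpois_eqn (- 1) ([0, 1], [2, 3], [(PM, [1], [2, 4]), (PW, [0, 4], [5, 3]), (PU, [5], [])])
     ([0, 1], [2, 3], [(PW, [0, 1], [2, 3])])"
proof -
  have "dpois_eqn (- 1) ([0, 1], [2, 3], [(PM, [1], [2, 4]), (PW, [0, 4], [5, 3]), (PU, [5], [])])
     ([0, 1], [2, 3], [(PM, [1], [2, 4]), (PW, [4, 0], [3, 5]), (PU, [5], [])])"
    by (rule eqn_rewrite[OF dpois_antisym,
          where \<rho> = "(!) [4, 0, 3, 5]" and p = "[4, 0]" and q = "[3, 5]" and A = "[(PM, [1], [2, 4])]" and B = "[(PU, [5], [])]"])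
      (simp_all add: diagram_simps)
  also have "dpois_eqn (- 1) \<dots> ([0, 1], [2, 3], [(PW, [1, 0], [3, 4]), (PM, [4], [2, 5]), (PU, [5], [])])"
    by (rule eqn_rewrite[OF dpois_leibniz_left,
          where \<rho> = "(!) [1, 0, 2, 3, 5, 4]" and p = "[1, 0]" and q = "[2, 3, 5]" and A = "[]" and B = "[(PU, [5], [])]"])
      (simp_all add: diagram_simps)
  also have "dpois_eqn 1 \<dots> ([0, 1], [2, 3], [(PW, [1, 0], [3, 2])])"
    by (rule eqn_contract[OF dpois_unit_right,
          where \<rho> = "(!) [4, 2, 5]" and \<kappa> = "\<lambda>x. if x = 4 then 2 else x" and a = 4 and b = 2 and A = "[(PW, [1, 0], [3, 4])]" and B = "[]"])
      (simp_all add: diagram_simps)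
  also have "dpois_eqn (- 1) \<dots> ([0, 1], [2, 3], [(PW, [0, 1], [2, 3])])"
    by (rule eqn_rewrite[OF dpois_antisym,
          where \<rho> = "(!) [0, 1, 2, 3]" and p = "[0, 1]" and q = "[2, 3]" and A = "[]" and B = "[]"])
      (simp_all add: diagram_simps)
  finally show ?thesis by simp
qed

text \<open>The same by the derivation rule on the other side.\<close>

lemma dpois_bracket_unit:
  "dpois_eqn 1 ([0, 1], [2, 3], [(PM, [0], [4, 2]), (PW, [4, 1], [5, 3]), (PU, [5], [])])
     ([0, 1], [2, 3], [(PW, [0, 1], [2, 3])])"
proof -
  have "dpois_eqn (- 1) ([0, 1], [2, 3], [(PM, [0], [4, 2]), (PW, [4, 1], [5, 3]), (PU, [5], [])])
     ([0, 1], [2, 3], [(PW, [0, 1], [4, 3]), (PM, [4], [5, 2]), (PU, [5], [])])"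
    by (rule eqn_rewrite[OF dpois_leibniz_right,
          where \<rho> = "(!) [0, 1, 5, 3, 2, 4]" and p = "[0, 1]" and q = "[5, 3, 2]" and A = "[]" and B = "[(PU, [5], [])]"])
      (simp_all add: diagram_simps)
  also have "dpois_eqn (- 1) \<dots> ([0, 1], [2, 3], [(PW, [0, 1], [2, 3])])"
    by (rule eqn_contract[OF dpois_unit_left,
          where \<rho> = "(!) [4, 2, 5]" and \<kappa> = "\<lambda>x. if x = 4 then 2 else x" and a = 4 and b = 2 and A = "[(PW, [0, 1], [4, 3])]" and B = "[]"])
      (simp_all add: diagram_simps)
  finally show ?thesis by simp
qed

text \<open>The cyclic relation on two brackets that both contain a unit. The bracket that loses its
  unit to the rotation regains one by \<open>dpois_mult_unit\<close>, whose product is absorbed at the other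
  bracket.\<close>

lemma dpois_image_coassoc:
  "dpois_eqn 1 ([0, 1, 2], [3], [(PW, [0, 1], [5, 4]), (PU, [5], []), (PW, [4, 2], [6, 3]), (PU, [6], [])])
     ([0, 1, 2], [3], [(PW, [1, 2], [6, 7]), (PU, [6], []), (PW, [0, 7], [8, 3]), (PU, [8], [])])"
proof -
  have "dpois_eqn (- 1) ([0, 1, 2], [3], [(PW, [0, 1], [5, 4]), (PU, [5], []), (PW, [4, 2], [6, 3]), (PU, [6], [])])
     ([0, 1, 2], [3], [(PW, [0, 1], [5, 4]), (PW, [4, 2], [6, 3]), (PU, [5], []), (PU, [6], [])])"
    by (rule eqn_swap_at[where A = "[(PW, [0, 1], [5, 4])]" and a = "(PU, [5], [])" and b = "(PW, [4, 2], [6, 3])" and B = "[(PU, [6], [])]"]) (simp_all add: diagram_simps)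
  also have "dpois_eqn 1 \<dots> ([0, 1, 2], [3], [(PW, [2, 0], [3, 4]), (PW, [4, 1], [5, 6]), (PU, [5], []), (PU, [6], [])])"
    by (rule eqn_rewrite[OF dpois_cyclic,
          where \<rho> = "(!) [0, 1, 2, 5, 6, 3, 4, 4]" and p = "[0, 1, 2]" and q = "[5, 6, 3]" and A = "[]" and B = "[(PU, [5], []), (PU, [6], [])]"])
      (simp_all add: diagram_simps)
  also have "dpois_eqn (- 1) \<dots> ([0, 1, 2], [3], [(PW, [0, 2], [4, 3]), (PW, [4, 1], [5, 6]), (PU, [5], []), (PU, [6], [])])"
    by (rule eqn_rewrite[OF dpois_antisym,
          where \<rho> = "(!) [0, 2, 4, 3]" and p = "[0, 2]" and q = "[4, 3]" and A = "[]" and B = "[(PW, [4, 1], [5, 6]), (PU, [5], []), (PU, [6], [])]"])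
      (simp_all add: diagram_simps)
  also have "dpois_eqn (- 1) \<dots> ([0, 1, 2], [3], [(PM, [2], [4, 7]), (PW, [0, 7], [8, 3]), (PU, [8], []), (PW, [4, 1], [5, 6]), (PU, [5], []), (PU, [6], [])])"
    by (rule eqn_rewrite[OF dpois_mult_unit[THEN eqn_neg_flip],
          where \<rho> = "(!) [0, 2, 4, 3, 7, 8]" and p = "[0, 2]" and q = "[4, 3]" and A = "[]" and B = "[(PW, [4, 1], [5, 6]), (PU, [5], []), (PU, [6], [])]"])
      (simp_all add: diagram_simps)
  also have "dpois_eqn (- 1) \<dots> ([0, 1, 2], [3], [(PM, [2], [4, 7]), (PW, [0, 7], [8, 3]), (PW, [4, 1], [5, 6]), (PU, [8], []), (PU, [5], []), (PU, [6], [])])"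
    by (rule eqn_swap_at[where A = "[(PM, [2], [4, 7]), (PW, [0, 7], [8, 3])]" and a = "(PU, [8], [])" and b = "(PW, [4, 1], [5, 6])" and B = "[(PU, [5], []), (PU, [6], [])]"]) (simp_all add: diagram_simps)
  also have "dpois_eqn (- 1) \<dots> ([0, 1, 2], [3], [(PM, [2], [4, 7]), (PW, [4, 1], [5, 6]), (PW, [0, 7], [8, 3]), (PU, [8], []), (PU, [5], []), (PU, [6], [])])"
    by (rule eqn_swap_at[where A = "[(PM, [2], [4, 7])]" and a = "(PW, [0, 7], [8, 3])" and b = "(PW, [4, 1], [5, 6])" and B = "[(PU, [8], []), (PU, [5], []), (PU, [6], [])]"]) (simp_all add: diagram_simps)
  also have "dpois_eqn (- 1) \<dots> ([0, 1, 2], [3], [(PM, [2], [4, 7]), (PW, [4, 1], [5, 6]), (PW, [0, 7], [8, 3]), (PU, [5], []), (PU, [8], []), (PU, [6], [])])"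
    by (rule eqn_swap_at[where A = "[(PM, [2], [4, 7]), (PW, [4, 1], [5, 6]), (PW, [0, 7], [8, 3])]" and a = "(PU, [8], [])" and b = "(PU, [5], [])" and B = "[(PU, [6], [])]"]) (simp_all add: diagram_simps)
  also have "dpois_eqn (- 1) \<dots> ([0, 1, 2], [3], [(PM, [2], [4, 7]), (PW, [4, 1], [5, 6]), (PU, [5], []), (PW, [0, 7], [8, 3]), (PU, [8], []), (PU, [6], [])])"
    by (rule eqn_swap_at[where A = "[(PM, [2], [4, 7]), (PW, [4, 1], [5, 6])]" and a = "(PW, [0, 7], [8, 3])" and b = "(PU, [5], [])" and B = "[(PU, [8], []), (PU, [6], [])]"]) (simp_all add: diagram_simps)
  also have "dpois_eqn 1 \<dots> ([0, 1, 2], [3], [(PW, [2, 1], [7, 6]), (PW, [0, 7], [8, 3]), (PU, [8], []), (PU, [6], [])])"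
    by (rule eqn_rewrite[OF dpois_bracket_unit,
          where \<rho> = "(!) [2, 1, 7, 6, 4, 5]" and p = "[2, 1]" and q = "[7, 6]" and A = "[]" and B = "[(PW, [0, 7], [8, 3]), (PU, [8], []), (PU, [6], [])]"])
      (simp_all add: diagram_simps)
  also have "dpois_eqn (- 1) \<dots> ([0, 1, 2], [3], [(PW, [1, 2], [6, 7]), (PW, [0, 7], [8, 3]), (PU, [8], []), (PU, [6], [])])"
    by (rule eqn_rewrite[OF dpois_antisym,
          where \<rho> = "(!) [1, 2, 6, 7]" and p = "[1, 2]" and q = "[6, 7]" and A = "[]" and B = "[(PW, [0, 7], [8, 3]), (PU, [8], []), (PU, [6], [])]"])
      (simp_all add: diagram_simps)
  also have "dpois_eqn (- 1) \<dots> ([0, 1, 2], [3], [(PW, [1, 2], [6, 7]), (PW, [0, 7], [8, 3]), (PU, [6], []), (PU, [8], [])])"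
    by (rule eqn_swap_at[where A = "[(PW, [1, 2], [6, 7]), (PW, [0, 7], [8, 3])]" and a = "(PU, [8], [])" and b = "(PU, [6], [])" and B = "[]"]) (simp_all add: diagram_simps)
  also have "dpois_eqn (- 1) \<dots> ([0, 1, 2], [3], [(PW, [1, 2], [6, 7]), (PU, [6], []), (PW, [0, 7], [8, 3]), (PU, [8], [])])"
    by (rule eqn_swap_at[where A = "[(PW, [1, 2], [6, 7])]" and a = "(PW, [0, 7], [8, 3])" and b = "(PU, [6], [])" and B = "[(PU, [8], [])]"]) (simp_all add: diagram_simps)
  finally show ?thesis by simp
qed

lemma dpois_image_bimod_left:
  "dpois_eqn 1 ([0, 1], [2, 3], [(PM, [0], [2, 4]), (PW, [4, 1], [5, 3]), (PU, [5], [])])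
     ([0, 1], [2, 3], [(PW, [0, 1], [5, 4]), (PU, [5], []), (PM, [4], [2, 3])])"
proof -
  have "dpois_eqn (- 1) ([0, 1], [2, 3], [(PM, [0], [2, 4]), (PW, [4, 1], [5, 3]), (PU, [5], [])])
     ([0, 1], [2, 3], [(PW, [0, 1], [5, 4]), (PM, [4], [2, 3]), (PU, [5], [])])"
    by (rule eqn_rewrite[OF dpois_leibniz_left,
          where \<rho> = "(!) [0, 1, 2, 5, 3, 4]" and p = "[0, 1]" and q = "[2, 5, 3]" and A = "[]" and B = "[(PU, [5], [])]"])
      (simp_all add: diagram_simps)
  also have "dpois_eqn (- 1) \<dots> ([0, 1], [2, 3], [(PW, [0, 1], [5, 4]), (PU, [5], []), (PM, [4], [2, 3])])"
    by (rule eqn_swap_at[where A = "[(PW, [0, 1], [5, 4])]" and a = "(PM, [4], [2, 3])" and b = "(PU, [5], [])" and B = "[]"]) (simp_all add: diagram_simps)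
  finally show ?thesis by simp
qed

lemma dpois_image_bimod_right:
  "dpois_eqn 1 ([0, 1], [2, 3], [(PM, [1], [4, 3]), (PW, [0, 4], [5, 2]), (PU, [5], [])])
     ([0, 1], [2, 3], [(PW, [0, 1], [5, 4]), (PU, [5], []), (PM, [4], [2, 3])])"
proof -
  have "dpois_eqn (- 1) ([0, 1], [2, 3], [(PM, [1], [4, 3]), (PW, [0, 4], [5, 2]), (PU, [5], [])])
     ([0, 1], [2, 3], [(PM, [1], [4, 3]), (PW, [4, 0], [2, 5]), (PU, [5], [])])"
    by (rule eqn_rewrite[OF dpois_antisym,
          where \<rho> = "(!) [4, 0, 2, 5]" and p = "[4, 0]" and q = "[2, 5]" and A = "[(PM, [1], [4, 3])]" and B = "[(PU, [5], [])]"])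
      (simp_all add: diagram_simps)
  also have "dpois_eqn (- 1) \<dots> ([0, 1], [2, 3], [(PW, [1, 0], [4, 5]), (PM, [4], [2, 3]), (PU, [5], [])])"
    by (rule eqn_rewrite[OF dpois_leibniz_right,
          where \<rho> = "(!) [1, 0, 2, 5, 3, 4]" and p = "[1, 0]" and q = "[2, 5, 3]" and A = "[]" and B = "[(PU, [5], [])]"])
      (simp_all add: diagram_simps)
  also have "dpois_eqn (- 1) \<dots> ([0, 1], [2, 3], [(PW, [0, 1], [5, 4]), (PM, [4], [2, 3]), (PU, [5], [])])"
    by (rule eqn_rewrite[OF dpois_antisym,
          where \<rho> = "(!) [0, 1, 5, 4]" and p = "[0, 1]" and q = "[5, 4]" and A = "[]" and B = "[(PM, [4], [2, 3]), (PU, [5], [])]"])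
      (simp_all add: diagram_simps)
  also have "dpois_eqn (- 1) \<dots> ([0, 1], [2, 3], [(PW, [0, 1], [5, 4]), (PU, [5], []), (PM, [4], [2, 3])])"
    by (rule eqn_swap_at[where A = "[(PW, [0, 1], [5, 4])]" and a = "(PM, [4], [2, 3])" and b = "(PU, [5], [])" and B = "[]"]) (simp_all add: diagram_simps)
  finally show ?thesis by simp
qed

text \<open>Both sides are \<open>w\<close> up to sign, by \<open>dpois_mult_unit\<close>; what remains is its antisymmetry.\<close>

lemma dpois_image_B_antisym:
  "dpois_eqn (- 1) ([0, 1], [2, 3], [(PM, [1], [2, 4]), (PW, [0, 4], [5, 3]), (PU, [5], [])])
     ([0, 1], [2, 3], [(PM, [0], [3, 4]), (PW, [1, 4], [5, 2]), (PU, [5], [])])"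
proof -
  have "dpois_eqn (- 1) ([0, 1], [2, 3], [(PM, [1], [2, 4]), (PW, [0, 4], [5, 3]), (PU, [5], [])])
     ([0, 1], [2, 3], [(PW, [0, 1], [2, 3])])"
    by (rule eqn_rewrite[OF dpois_mult_unit,
          where \<rho> = "(!) [0, 1, 2, 3, 4, 5]" and p = "[0, 1]" and q = "[2, 3]" and A = "[]" and B = "[]"])
      (simp_all add: diagram_simps)
  also have "dpois_eqn (- 1) \<dots> ([0, 1], [2, 3], [(PW, [1, 0], [3, 2])])"
    by (rule eqn_rewrite[OF dpois_antisym[THEN eqn_neg_flip],
          where \<rho> = "(!) [0, 1, 2, 3]" and p = "[0, 1]" and q = "[2, 3]" and A = "[]" and B = "[]"])
      (simp_all add: diagram_simps)
  also have "dpois_eqn (- 1) \<dots> ([0, 1], [2, 3], [(PM, [0], [3, 4]), (PW, [1, 4], [5, 2]), (PU, [5], [])])"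
    by (rule eqn_rewrite[OF dpois_mult_unit[THEN eqn_neg_flip],
          where \<rho> = "(!) [1, 0, 3, 2, 4, 5]" and p = "[1, 0]" and q = "[3, 2]" and A = "[]" and B = "[]"])
      (simp_all add: diagram_simps)
  finally show ?thesis by simp
qed

lemma dpois_image_B_twisted:
  "dpois_eqn (- 1) ([0, 1], [2, 3], [(PM, [1], [2, 4]), (PW, [0, 4], [5, 3]), (PU, [5], [])])
     ([0, 1], [2, 3], [(PM, [0], [4, 2]), (PW, [4, 1], [5, 3]), (PU, [5], [])])"
proof -
  have "dpois_eqn (- 1) ([0, 1], [2, 3], [(PM, [1], [2, 4]), (PW, [0, 4], [5, 3]), (PU, [5], [])])
     ([0, 1], [2, 3], [(PW, [0, 1], [2, 3])])"
    by (rule eqn_rewrite[OF dpois_mult_unit,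
          where \<rho> = "(!) [0, 1, 2, 3, 4, 5]" and p = "[0, 1]" and q = "[2, 3]" and A = "[]" and B = "[]"])
      (simp_all add: diagram_simps)
  also have "dpois_eqn 1 \<dots> ([0, 1], [2, 3], [(PM, [0], [4, 2]), (PW, [4, 1], [5, 3]), (PU, [5], [])])"
    by (rule eqn_rewrite[OF dpois_bracket_unit[THEN eqn_flip],
          where \<rho> = "(!) [0, 1, 2, 3, 4, 5]" and p = "[0, 1]" and q = "[2, 3]" and A = "[]" and B = "[]"])
      (simp_all add: diagram_simps)
  finally show ?thesis by simp
qed

lemma dpois_image_mult_comult:
  "dpois_eqn 0 ([0], [1], [(PM, [0], [2, 3]), (PW, [2, 3], [4, 1]), (PU, [4], [])])
     ([0], [1], [(PM, [0], [2, 3]), (PW, [2, 3], [4, 1]), (PU, [4], [])])"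
proof -
  have "dpois_eqn 0 ([0], [1], [(PM, [0], [2, 3]), (PW, [2, 3], [4, 1]), (PU, [4], [])])
     ([0], [1], [(PM, [0], [2, 3]), (PW, [2, 3], [4, 1]), (PU, [4], [])])"
    by (rule eqn_rewrite[OF dpois_mult_bracket,
          where \<rho> = "(!) [0, 4, 1, 2, 3]" and p = "[0]" and q = "[4, 1]" and A = "[]" and B = "[(PU, [4], [])]"])
      (simp_all add: diagram_simps)
  then show ?thesis by (rule eqn_zero)
qed

lemma dpois_image_mult_tau_comult:
  "dpois_eqn 0 ([0], [1], [(PM, [0], [3, 2]), (PW, [2, 3], [4, 1]), (PU, [4], [])])
     ([0], [1], [(PM, [0], [3, 2]), (PW, [2, 3], [4, 1]), (PU, [4], [])])"
proof -
  have "dpois_eqn (- 1) ([0], [1], [(PM, [0], [3, 2]), (PW, [2, 3], [4, 1]), (PU, [4], [])])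
     ([0], [1], [(PM, [0], [3, 2]), (PW, [3, 2], [1, 4]), (PU, [4], [])])"
    by (rule eqn_rewrite[OF dpois_antisym,
          where \<rho> = "(!) [3, 2, 1, 4]" and p = "[3, 2]" and q = "[1, 4]" and A = "[(PM, [0], [3, 2])]" and B = "[(PU, [4], [])]"])
      (simp_all add: diagram_simps)
  also have "dpois_eqn 0 \<dots> ([0], [1], [(PM, [0], [3, 2]), (PW, [3, 2], [1, 4]), (PU, [4], [])])"
    by (rule eqn_rewrite[OF dpois_mult_bracket,
          where \<rho> = "(!) [0, 1, 4, 3, 2]" and p = "[0]" and q = "[1, 4]" and A = "[]" and B = "[(PU, [4], [])]"])
      (simp_all add: diagram_simps)
  finally have "dpois_eqn 0 ([0], [1], [(PM, [0], [3, 2]), (PW, [2, 3], [4, 1]), (PU, [4], [])]) ([0], [1], [(PM, [0], [3, 2]), (PW, [3, 2], [1, 4]), (PU, [4], [])])" by simp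
  then show ?thesis by (rule eqn_zero)
qed

section \<open>Consequences of the relations of balanced infinitesimal bialgebras\<close>

lemma bib_image_leibniz_left:
  "bib_eqn (- 1) ([0, 1], [2, 3, 4], [(BM, [1], [3, 6]), (BDelta, [0, 6], [5]), (BM, [5], [2, 4])])
     ([0, 1], [2, 3, 4], [(BM, [0], [2, 5]), (BM, [1], [3, 6]), (BDelta, [5, 6], [4])])"
proof -
  have "bib_eqn 1 ([0, 1], [2, 3, 4], [(BM, [1], [3, 6]), (BDelta, [0, 6], [5]), (BM, [5], [2, 4])])
     ([0, 1], [2, 3, 4], [(BM, [1], [3, 6]), (BM, [0], [2, 5]), (BDelta, [5, 6], [4])])"
    by (rule eqn_rewrite[OF bib_bimod_left[THEN eqn_flip],
          where \<rho> = "(!) [0, 6, 2, 4, 5]" and p = "[0, 6]" and q = "[2, 4]" and A = "[(BM, [1], [3, 6])]" and B = "[]"])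
      (simp_all add: diagram_simps)
  also have "bib_eqn (- 1) \<dots> ([0, 1], [2, 3, 4], [(BM, [0], [2, 5]), (BM, [1], [3, 6]), (BDelta, [5, 6], [4])])"
    by (rule eqn_swap_at[where A = "[]" and a = "(BM, [1], [3, 6])" and b = "(BM, [0], [2, 5])" and B = "[(BDelta, [5, 6], [4])]"]) (simp_all add: diagram_simps)
  finally show ?thesis by simp
qed

text \<open>The twisted form of \<open>B\<close> has its product at the first output, where it can be reassociated with
  the product that follows.\<close>

lemma bib_image_leibniz_right:
  "bib_eqn (- 1) ([0, 1], [2, 3, 4], [(BM, [0], [5, 4]), (BM, [1], [2, 6]), (BDelta, [5, 6], [3])])
     ([0, 1], [2, 3, 4], [(BM, [1], [5, 6]), (BDelta, [0, 6], [3]), (BM, [5], [2, 4])])"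
proof -
  have "bib_eqn (- 1) ([0, 1], [2, 3, 4], [(BM, [0], [5, 4]), (BM, [1], [2, 6]), (BDelta, [5, 6], [3])])
     ([0, 1], [2, 3, 4], [(BM, [0], [5, 4]), (BM, [5], [6, 2]), (BDelta, [6, 1], [3])])"
    by (rule eqn_rewrite[OF bib_B_twisted,
          where \<rho> = "(!) [5, 1, 2, 3, 6]" and p = "[5, 1]" and q = "[2, 3]" and A = "[(BM, [0], [5, 4])]" and B = "[]"])
      (simp_all add: diagram_simps)
  also have "bib_eqn (- 1) \<dots> ([0, 1], [2, 3, 4], [(BM, [0], [6, 5]), (BM, [5], [2, 4]), (BDelta, [6, 1], [3])])"
    by (rule eqn_rewrite[OF bib_assoc[THEN eqn_neg_flip],
          where \<rho> = "(!) [0, 6, 2, 4, 5]" and p = "[0]" and q = "[6, 2, 4]" and A = "[]" and B = "[(BDelta, [6, 1], [3])]"])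
      (simp_all add: diagram_simps)
  also have "bib_eqn 1 \<dots> ([0, 1], [2, 3, 4], [(BM, [0], [6, 5]), (BDelta, [6, 1], [3]), (BM, [5], [2, 4])])"
    by (rule eqn_swap_at[where A = "[(BM, [0], [6, 5])]" and a = "(BM, [5], [2, 4])" and b = "(BDelta, [6, 1], [3])" and B = "[]"]) (simp_all add: diagram_simps)
  also have "bib_eqn (- 1) \<dots> ([0, 1], [2, 3, 4], [(BM, [1], [5, 6]), (BDelta, [0, 6], [3]), (BM, [5], [2, 4])])"
    by (rule eqn_rewrite[OF bib_B_twisted[THEN eqn_neg_flip],
          where \<rho> = "(!) [0, 1, 5, 3, 6]" and p = "[0, 1]" and q = "[5, 3]" and A = "[]" and B = "[(BM, [5], [2, 4])]"])
      (simp_all add: diagram_simps)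
  finally show ?thesis by simp
qed

text \<open>After antisymmetry the products of the two brackets are composable and can be reassociated. Then
  the bimodule relations carry one product through a coproduct to its other output. Now the
  coproducts are composable as well, and coassociativity applies.\<close>

lemma bib_image_cyclic:
  "bib_eqn 1 ([0, 1, 2], [3, 4, 5], [(BM, [0], [5, 7]), (BDelta, [2, 7], [6]), (BM, [1], [3, 8]), (BDelta, [6, 8], [4])])
     ([0, 1, 2], [3, 4, 5], [(BM, [1], [3, 8]), (BDelta, [0, 8], [7]), (BM, [2], [4, 6]), (BDelta, [7, 6], [5])])"
proof -
  have "bib_eqn (- 1) ([0, 1, 2], [3, 4, 5], [(BM, [0], [5, 7]), (BDelta, [2, 7], [6]), (BM, [1], [3, 8]), (BDelta, [6, 8], [4])])
     ([0, 1, 2], [3, 4, 5], [(BM, [2], [6, 7]), (BDelta, [0, 7], [5]), (BM, [1], [3, 8]), (BDelta, [6, 8], [4])])"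
    by (rule eqn_rewrite[OF bib_B_antisym[THEN eqn_neg_flip],
          where \<rho> = "(!) [0, 2, 6, 5, 7]" and p = "[0, 2]" and q = "[6, 5]" and A = "[]" and B = "[(BM, [1], [3, 8]), (BDelta, [6, 8], [4])]"])
      (simp_all add: diagram_simps)
  also have "bib_eqn (- 1) \<dots> ([0, 1, 2], [3, 4, 5], [(BM, [2], [6, 7]), (BDelta, [0, 7], [5]), (BM, [6], [4, 8]), (BDelta, [1, 8], [3])])"
    by (rule eqn_rewrite[OF bib_B_antisym,
          where \<rho> = "(!) [6, 1, 3, 4, 8]" and p = "[6, 1]" and q = "[3, 4]" and A = "[(BM, [2], [6, 7]), (BDelta, [0, 7], [5])]" and B = "[]"])
      (simp_all add: diagram_simps)
  also have "bib_eqn 1 \<dots> ([0, 1, 2], [3, 4, 5], [(BM, [2], [6, 7]), (BM, [6], [4, 8]), (BDelta, [0, 7], [5]), (BDelta, [1, 8], [3])])"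
    by (rule eqn_swap_at[where A = "[(BM, [2], [6, 7])]" and a = "(BDelta, [0, 7], [5])" and b = "(BM, [6], [4, 8])" and B = "[(BDelta, [1, 8], [3])]"]) (simp_all add: diagram_simps)
  also have "bib_eqn (- 1) \<dots> ([0, 1, 2], [3, 4, 5], [(BM, [2], [4, 6]), (BM, [6], [8, 7]), (BDelta, [0, 7], [5]), (BDelta, [1, 8], [3])])"
    by (rule eqn_rewrite[OF bib_assoc[THEN eqn_neg_flip],
          where \<rho> = "(!) [2, 4, 8, 7, 6]" and p = "[2]" and q = "[4, 8, 7]" and A = "[]" and B = "[(BDelta, [0, 7], [5]), (BDelta, [1, 8], [3])]"])
      (simp_all add: diagram_simps)
  also have "bib_eqn 1 \<dots> ([0, 1, 2], [3, 4, 5], [(BM, [2], [4, 6]), (BM, [6], [8, 7]), (BDelta, [1, 8], [3]), (BDelta, [0, 7], [5])])"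
    by (rule eqn_swap_at[where A = "[(BM, [2], [4, 6]), (BM, [6], [8, 7])]" and a = "(BDelta, [0, 7], [5])" and b = "(BDelta, [1, 8], [3])" and B = "[]"]) (simp_all add: diagram_simps)
  also have "bib_eqn 1 \<dots> ([0, 1, 2], [3, 4, 5], [(BM, [2], [4, 6]), (BDelta, [1, 6], [8]), (BM, [8], [3, 7]), (BDelta, [0, 7], [5])])"
    by (rule eqn_rewrite[OF bib_bimod_right,
          where \<rho> = "(!) [1, 6, 3, 7, 8]" and p = "[1, 6]" and q = "[3, 7]" and A = "[(BM, [2], [4, 6])]" and B = "[(BDelta, [0, 7], [5])]"])
      (simp_all add: diagram_simps)
  also have "bib_eqn 1 \<dots> ([0, 1, 2], [3, 4, 5], [(BM, [2], [4, 6]), (BM, [1], [3, 8]), (BDelta, [8, 6], [7]), (BDelta, [0, 7], [5])])"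
    by (rule eqn_rewrite[OF bib_bimod_left[THEN eqn_flip],
          where \<rho> = "(!) [1, 6, 3, 7, 8]" and p = "[1, 6]" and q = "[3, 7]" and A = "[(BM, [2], [4, 6])]" and B = "[(BDelta, [0, 7], [5])]"])
      (simp_all add: diagram_simps)
  also have "bib_eqn 1 \<dots> ([0, 1, 2], [3, 4, 5], [(BM, [2], [4, 6]), (BM, [1], [3, 8]), (BDelta, [0, 8], [7]), (BDelta, [7, 6], [5])])"
    by (rule eqn_rewrite[OF bib_coassoc,
          where \<rho> = "(!) [0, 8, 6, 5, 7, 0, 0, 7]" and p = "[0, 8, 6]" and q = "[5]" and A = "[(BM, [2], [4, 6]), (BM, [1], [3, 8])]" and B = "[]"])
      (simp_all add: diagram_simps)
  also have "bib_eqn (- 1) \<dots> ([0, 1, 2], [3, 4, 5], [(BM, [1], [3, 8]), (BM, [2], [4, 6]), (BDelta, [0, 8], [7]), (BDelta, [7, 6], [5])])"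
    by (rule eqn_swap_at[where A = "[]" and a = "(BM, [2], [4, 6])" and b = "(BM, [1], [3, 8])" and B = "[(BDelta, [0, 8], [7]), (BDelta, [7, 6], [5])]"]) (simp_all add: diagram_simps)
  also have "bib_eqn 1 \<dots> ([0, 1, 2], [3, 4, 5], [(BM, [1], [3, 8]), (BDelta, [0, 8], [7]), (BM, [2], [4, 6]), (BDelta, [7, 6], [5])])"
    by (rule eqn_swap_at[where A = "[(BM, [1], [3, 8])]" and a = "(BM, [2], [4, 6])" and b = "(BDelta, [0, 8], [7])" and B = "[(BDelta, [7, 6], [5])]"]) (simp_all add: diagram_simps)
  finally show ?thesis by simp
qed

text \<open>After antisymmetry, reassociating the products produces the composite \<open>m \<tau> \<Delta>\<close>.\<close>

lemma bib_image_mult_bracket: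
  "bib_eqn 0 ([0], [1, 2], [(BM, [0], [3, 4]), (BM, [4], [1, 5]), (BDelta, [3, 5], [2])])
     ([0], [1, 2], [(BM, [0], [3, 4]), (BM, [4], [1, 5]), (BDelta, [3, 5], [2])])"
proof -
  have "bib_eqn (- 1) ([0], [1, 2], [(BM, [0], [3, 4]), (BM, [4], [1, 5]), (BDelta, [3, 5], [2])])
     ([0], [1, 2], [(BM, [0], [3, 4]), (BM, [3], [2, 5]), (BDelta, [4, 5], [1])])"
    by (rule eqn_rewrite[OF bib_B_antisym,
          where \<rho> = "(!) [3, 4, 1, 2, 5]" and p = "[3, 4]" and q = "[1, 2]" and A = "[(BM, [0], [3, 4])]" and B = "[]"])
      (simp_all add: diagram_simps)
  also have "bib_eqn (- 1) \<dots> ([0], [1, 2], [(BM, [0], [2, 3]), (BM, [3], [5, 4]), (BDelta, [4, 5], [1])])"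
    by (rule eqn_rewrite[OF bib_assoc[THEN eqn_neg_flip],
          where \<rho> = "(!) [0, 2, 5, 4, 3]" and p = "[0]" and q = "[2, 5, 4]" and A = "[]" and B = "[(BDelta, [4, 5], [1])]"])
      (simp_all add: diagram_simps)
  also have "bib_eqn 0 \<dots> ([0], [1, 2], [(BM, [0], [2, 3]), (BM, [3], [5, 4]), (BDelta, [4, 5], [1])])"
    by (rule eqn_rewrite[OF bib_mult_tau_comult,
          where \<rho> = "(!) [3, 1, 4, 5]" and p = "[3]" and q = "[1]" and A = "[(BM, [0], [2, 3])]" and B = "[]"])
      (simp_all add: diagram_simps)
  finally have "bib_eqn 0 ([0], [1, 2], [(BM, [0], [3, 4]), (BM, [4], [1, 5]), (BDelta, [3, 5], [2])]) ([0], [1, 2], [(BM, [0], [2, 3]), (BM, [3], [5, 4]), (BDelta, [4, 5], [1])])" by simp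
  then show ?thesis by (rule eqn_zero)
qed

text \<open>After antisymmetry of the second bracket, associativity and coassociativity together produce \<open>m \<tau> \<Delta>\<close> in
  the middle.\<close>

lemma bib_image_bracket_bracket:
  "bib_eqn 0 ([0, 1], [2, 3], [(BM, [1], [4, 6]), (BDelta, [0, 6], [5]), (BM, [5], [2, 7]), (BDelta, [4, 7], [3])])
     ([0, 1], [2, 3], [(BM, [1], [4, 6]), (BDelta, [0, 6], [5]), (BM, [5], [2, 7]), (BDelta, [4, 7], [3])])"
proof -
  have "bib_eqn (- 1) ([0, 1], [2, 3], [(BM, [1], [4, 6]), (BDelta, [0, 6], [5]), (BM, [5], [2, 7]), (BDelta, [4, 7], [3])])
     ([0, 1], [2, 3], [(BM, [1], [4, 6]), (BDelta, [0, 6], [5]), (BM, [4], [3, 7]), (BDelta, [5, 7], [2])])"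
    by (rule eqn_rewrite[OF bib_B_antisym,
          where \<rho> = "(!) [4, 5, 2, 3, 7]" and p = "[4, 5]" and q = "[2, 3]" and A = "[(BM, [1], [4, 6]), (BDelta, [0, 6], [5])]" and B = "[]"])
      (simp_all add: diagram_simps)
  also have "bib_eqn 1 \<dots> ([0, 1], [2, 3], [(BM, [1], [4, 6]), (BM, [4], [3, 7]), (BDelta, [0, 6], [5]), (BDelta, [5, 7], [2])])"
    by (rule eqn_swap_at[where A = "[(BM, [1], [4, 6])]" and a = "(BDelta, [0, 6], [5])" and b = "(BM, [4], [3, 7])" and B = "[(BDelta, [5, 7], [2])]"]) (simp_all add: diagram_simps)
  also have "bib_eqn (- 1) \<dots> ([0, 1], [2, 3], [(BM, [1], [3, 4]), (BM, [4], [7, 6]), (BDelta, [0, 6], [5]), (BDelta, [5, 7], [2])])"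
    by (rule eqn_rewrite[OF bib_assoc[THEN eqn_neg_flip],
          where \<rho> = "(!) [1, 3, 7, 6, 4]" and p = "[1]" and q = "[3, 7, 6]" and A = "[]" and B = "[(BDelta, [0, 6], [5]), (BDelta, [5, 7], [2])]"])
      (simp_all add: diagram_simps)
  also have "bib_eqn 1 \<dots> ([0, 1], [2, 3], [(BM, [1], [3, 4]), (BM, [4], [7, 6]), (BDelta, [6, 7], [5]), (BDelta, [0, 5], [2])])"
    by (rule eqn_rewrite[OF bib_coassoc[THEN eqn_flip],
          where \<rho> = "(!) [0, 6, 7, 2, 5, 0, 0, 5]" and p = "[0, 6, 7]" and q = "[2]" and A = "[(BM, [1], [3, 4]), (BM, [4], [7, 6])]" and B = "[]"])
      (simp_all add: diagram_simps)
  also have "bib_eqn 0 \<dots> ([0, 1], [2, 3], [(BM, [1], [3, 4]), (BM, [4], [7, 6]), (BDelta, [6, 7], [5]), (BDelta, [0, 5], [2])])"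
    by (rule eqn_rewrite[OF bib_mult_tau_comult,
          where \<rho> = "(!) [4, 5, 6, 7]" and p = "[4]" and q = "[5]" and A = "[(BM, [1], [3, 4])]" and B = "[(BDelta, [0, 5], [2])]"])
      (simp_all add: diagram_simps)
  finally have "bib_eqn 0 ([0, 1], [2, 3], [(BM, [1], [4, 6]), (BDelta, [0, 6], [5]), (BM, [5], [2, 7]), (BDelta, [4, 7], [3])]) ([0, 1], [2, 3], [(BM, [1], [3, 4]), (BM, [4], [7, 6]), (BDelta, [6, 7], [5]), (BDelta, [0, 5], [2])])" by simp
  then show ?thesis by (rule eqn_zero)
qed

text \<open>A unit in the first input of \<open>B\<close> cancels its product.\<close>

lemma bib_comult_recovered:
  "bib_eqn (- 1) ([0, 1], [2], [(BM, [1], [3, 4]), (BDelta, [0, 4], [2]), (BU, [3], [])])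
     ([0, 1], [2], [(BDelta, [0, 1], [2])])"
proof -
  have "bib_eqn 1 ([0, 1], [2], [(BM, [1], [3, 4]), (BDelta, [0, 4], [2]), (BU, [3], [])])
     ([0, 1], [2], [(BM, [1], [3, 4]), (BU, [3], []), (BDelta, [0, 4], [2])])"
    by (rule eqn_swap_at[where A = "[(BM, [1], [3, 4])]" and a = "(BDelta, [0, 4], [2])" and b = "(BU, [3], [])" and B = "[]"]) (simp_all add: diagram_simps)
  also have "bib_eqn (- 1) \<dots> ([0, 1], [2], [(BDelta, [0, 1], [2])])"
    by (rule eqn_contract[OF bib_unit_left,
          where \<rho> = "(!) [1, 4, 3]" and \<kappa> = "\<lambda>x. if x = 4 then 1 else x" and a = 1 and b = 4 and A = "[]" and B = "[(BDelta, [0, 4], [2])]"])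
      (simp_all add: diagram_simps)
  finally show ?thesis by simp
qed

section \<open>The two morphisms\<close>

text \<open>
  The images of the generators, with \<open>- w (u \<otimes> id)\<close> for \<open>\<Delta>\<close> and \<open>B\<close> for \<open>w\<close>. Diagrams and signs are kept
  apart because diagrams can be inserted into each other.
\<close>

fun bib_image :: "bib_gen \<Rightarrow> dpois_gen diagram" where
  "bib_image BU = ([0], [], [(PU, [0], [])])"
| "bib_image BM = ([0], [1, 2], [(PM, [0], [1, 2])])"
| "bib_image BDelta = ([0, 1], [2], [(PW, [0, 1], [3, 2]), (PU, [3], [])])"

fun bib_coeff :: "bib_gen \<Rightarrow> 'k::field" where
  "bib_coeff BDelta = - 1"
| "bib_coeff _ = 1"

definition bib_to_dpois :: "bib_gen \<Rightarrow> (('k::field, dpois_gen) free_elt dgraph \<Rightarrow>\<^sub>0 'k)" where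
  "bib_to_dpois x = fscale (bib_coeff x) (basis (diag dpois_arity (bib_image x)))"

fun dpois_image :: "dpois_gen \<Rightarrow> bib_gen diagram" where
  "dpois_image PU = ([0], [], [(BU, [0], [])])"
| "dpois_image PM = ([0], [1, 2], [(BM, [0], [1, 2])])"
| "dpois_image PW = ([0, 1], [2, 3], [(BM, [1], [2, 4]), (BDelta, [0, 4], [3])])"

fun dpois_coeff :: "dpois_gen \<Rightarrow> 'k::field" where
  "dpois_coeff _ = 1"

definition dpois_to_bib :: "dpois_gen \<Rightarrow> (('k::field, bib_gen) free_elt dgraph \<Rightarrow>\<^sub>0 'k)" where
  "dpois_to_bib x = fscale (dpois_coeff x) (basis (diag bib_arity (dpois_image x)))"

lemma bib_image_ok: "ok dpois_arity (bib_image x)"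
  by (cases x) (simp_all add: diagram_simps)

lemma dpois_image_ok: "ok bib_arity (dpois_image x)"
  by (cases x) (simp_all add: diagram_simps)

lemma generator_map_bib: "generator_map bib_arity (free_sbimod dpois_arity) (bib_to_dpois :: _ \<Rightarrow> _ \<Rightarrow>\<^sub>0 'k::field)"
  unfolding generator_map_def
proof (intro allI impI)
  fix x m n d assume x: "bib_arity x = (m, n, d)"
  have "(diag dpois_arity (bib_image x) :: ('k, dpois_gen) free_elt dgraph) \<in> dgraphs (free_sbimod dpois_arity) m n d"
    using ok_dgraphs[of dpois_arity "fst (bib_image x)" "fst (snd (bib_image x))" "snd (snd (bib_image x))"] bib_image_ok[of x] x
    by (cases x) (auto simp: numeral_2_eq_2)
  then show "bib_to_dpois x \<in> formal (free_sbimod dpois_arity :: ('k, _) sbimod) m n d"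
    by (simp add: bib_to_dpois_def formal_fscale)
qed

lemma generator_map_dpois: "generator_map dpois_arity (free_sbimod bib_arity) (dpois_to_bib :: _ \<Rightarrow> _ \<Rightarrow>\<^sub>0 'k::field)"
  unfolding generator_map_def
proof (intro allI impI)
  fix x m n d assume x: "dpois_arity x = (m, n, d)"
  have "(diag bib_arity (dpois_image x) :: ('k, bib_gen) free_elt dgraph) \<in> dgraphs (free_sbimod bib_arity) m n d"
    using ok_dgraphs[of bib_arity "fst (dpois_image x)" "fst (snd (dpois_image x))" "snd (snd (dpois_image x))"] dpois_image_ok[of x] x
    by (cases x) (auto simp: numeral_2_eq_2)
  then show "dpois_to_bib x \<in> formal (free_sbimod bib_arity :: ('k, _) sbimod) m n d"
    by (simp add: dpois_to_bib_def formal_fscale)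
qed

lemma hom_bib_to_dpois:
  assumes "ok bib_arity (O', I, V)"
    and "list_all2 (\<lambda>\<rho> (x, os, is). map \<rho> (fst (bib_image x)) = os \<and> map \<rho> (fst (snd (bib_image x))) = is) \<rho>s V"
    and "V' = concat (map2 (\<lambda>\<rho> v. map (rename \<rho>) (snd (snd (bib_image (fst v))))) \<rho>s V)"
    and "joined O' I (map snd V')" and "c = prod_list (map (\<lambda>v. bib_coeff (fst v)) V)"
  shows "hom bib_to_dpois (basis (diag bib_arity (O', I, V))) = fscale c (basis (diag dpois_arity (O', I, V')))"
  using hom_diag[OF bib_to_dpois_def bib_image_ok assms(1-4)] assms(5) by simp

lemma hom_dpois_to_bib:
  assumes "ok dpois_arity (O', I, V)"
    and "list_all2 (\<lambda>\<rho> (x, os, is). map \<rho> (fst (dpois_image x)) = os \<and> map \<rho> (fst (snd (dpois_image x))) = is) \<rho>s V"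
    and "V' = concat (map2 (\<lambda>\<rho> v. map (rename \<rho>) (snd (snd (dpois_image (fst v))))) \<rho>s V)"
    and "joined O' I (map snd V')" and "c = prod_list (map (\<lambda>v. dpois_coeff (fst v)) V)"
  shows "hom dpois_to_bib (basis (diag dpois_arity (O', I, V))) = fscale c (basis (diag bib_arity (O', I, V')))"
  using hom_diag[OF dpois_to_bib_def dpois_image_ok assms(1-4)] assms(5) by simp

text \<open>The images of the two sides of a relation are diagrams up to sign. The equation between these is a
  relation of the target or one of the consequences above.\<close>

lemma hom_bib_to_dpois_relation:
  assumes r: "r \<in> bib_rels" and m: "r \<in> formal (free_sbimod bib_arity) m n d"
  shows "ideal (free_sbimod dpois_arity) dpois_rels m n d (hom bib_to_dpois r)"
proof -
  have assoc: ?thesis if r: "r = basis (diag bib_arity ([0], [1, 2, 3], [(BM, [0], [1, 4]), (BM, [4], [2, 3])])) + basis (diag bib_arity ([0], [1, 2, 3], [(BM, [0], [4, 3]), (BM, [4], [1, 2])]))"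
  proof -
    have "hom bib_to_dpois (basis (diag bib_arity ([0], [1, 2, 3], [(BM, [0], [1, 4]), (BM, [4], [2, 3])]))) =
      fscale 1 (basis (diag dpois_arity ([0], [1, 2, 3], [(PM, [0], [1, 4]), (PM, [4], [2, 3])])))"
      by (rule hom_bib_to_dpois[where \<rho>s = "[(!) [0, 1, 4], (!) [4, 2, 3]]"]) (simp_all add: diagram_simps)
    moreover have "hom bib_to_dpois (basis (diag bib_arity ([0], [1, 2, 3], [(BM, [0], [4, 3]), (BM, [4], [1, 2])]))) =
      fscale 1 (basis (diag dpois_arity ([0], [1, 2, 3], [(PM, [0], [4, 3]), (PM, [4], [1, 2])])))"
      by (rule hom_bib_to_dpois[where \<rho>s = "[(!) [0, 4, 3], (!) [4, 1, 2]]"]) (simp_all add: diagram_simps)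
    ultimately show ?thesis
      by (rule hom_relation[OF generator_map_bib _ m _ _ _ _ dpois_assoc, where e = 1 and c = "(- 1)", rotated]) (simp_all add: r)
  qed
  have coassoc: ?thesis if r: "r = basis (diag bib_arity ([0, 1, 2], [3], [(BDelta, [1, 2], [7]), (BDelta, [0, 7], [3])])) - basis (diag bib_arity ([0, 1, 2], [3], [(BDelta, [0, 1], [4]), (BDelta, [4, 2], [3])]))"
  proof -
    have "hom bib_to_dpois (basis (diag bib_arity ([0, 1, 2], [3], [(BDelta, [1, 2], [7]), (BDelta, [0, 7], [3])]))) =
      fscale 1 (basis (diag dpois_arity ([0, 1, 2], [3], [(PW, [1, 2], [6, 7]), (PU, [6], []), (PW, [0, 7], [8, 3]), (PU, [8], [])])))"
      by (rule hom_bib_to_dpois[where \<rho>s = "[(!) [1, 2, 7, 6], (!) [0, 7, 3, 8]]"]) (simp_all add: diagram_simps)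
    moreover have "hom bib_to_dpois (basis (diag bib_arity ([0, 1, 2], [3], [(BDelta, [0, 1], [4]), (BDelta, [4, 2], [3])]))) =
      fscale 1 (basis (diag dpois_arity ([0, 1, 2], [3], [(PW, [0, 1], [5, 4]), (PU, [5], []), (PW, [4, 2], [6, 3]), (PU, [6], [])])))"
      by (rule hom_bib_to_dpois[where \<rho>s = "[(!) [0, 1, 4, 5], (!) [4, 2, 3, 6]]"]) (simp_all add: diagram_simps)
    ultimately show ?thesis
      by (rule hom_relation[OF generator_map_bib _ m _ _ _ _ dpois_image_coassoc[THEN eqn_flip], where e = 1 and c = "1", rotated]) (simp_all add: r)
  qed
  have bimod_left: ?thesis if r: "r = - basis (diag bib_arity ([0, 1], [2, 3], [(BDelta, [0, 1], [4]), (BM, [4], [2, 3])])) + basis (diag bib_arity ([0, 1], [2, 3], [(BM, [0], [2, 4]), (BDelta, [4, 1], [3])]))"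
  proof -
    have "hom bib_to_dpois (basis (diag bib_arity ([0, 1], [2, 3], [(BM, [0], [2, 4]), (BDelta, [4, 1], [3])]))) =
      fscale (- 1) (basis (diag dpois_arity ([0, 1], [2, 3], [(PM, [0], [2, 4]), (PW, [4, 1], [5, 3]), (PU, [5], [])])))"
      by (rule hom_bib_to_dpois[where \<rho>s = "[(!) [0, 2, 4], (!) [4, 1, 3, 5]]"]) (simp_all add: diagram_simps)
    moreover have "hom bib_to_dpois (basis (diag bib_arity ([0, 1], [2, 3], [(BDelta, [0, 1], [4]), (BM, [4], [2, 3])]))) =
      fscale (- 1) (basis (diag dpois_arity ([0, 1], [2, 3], [(PW, [0, 1], [5, 4]), (PU, [5], []), (PM, [4], [2, 3])])))"
      by (rule hom_bib_to_dpois[where \<rho>s = "[(!) [0, 1, 4, 5], (!) [4, 2, 3]]"]) (simp_all add: diagram_simps)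
    ultimately show ?thesis
      by (rule hom_relation[OF generator_map_bib _ m _ _ _ _ dpois_image_bimod_left, where e = 1 and c = "1", rotated]) (simp_all add: r)
  qed
  have bimod_right: ?thesis if r: "r = - basis (diag bib_arity ([0, 1], [2, 3], [(BDelta, [0, 1], [4]), (BM, [4], [2, 3])])) + basis (diag bib_arity ([0, 1], [2, 3], [(BM, [1], [4, 3]), (BDelta, [0, 4], [2])]))"
  proof -
    have "hom bib_to_dpois (basis (diag bib_arity ([0, 1], [2, 3], [(BM, [1], [4, 3]), (BDelta, [0, 4], [2])]))) =
      fscale (- 1) (basis (diag dpois_arity ([0, 1], [2, 3], [(PM, [1], [4, 3]), (PW, [0, 4], [5, 2]), (PU, [5], [])])))"
      by (rule hom_bib_to_dpois[where \<rho>s = "[(!) [1, 4, 3], (!) [0, 4, 2, 5]]"]) (simp_all add: diagram_simps)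
    moreover have "hom bib_to_dpois (basis (diag bib_arity ([0, 1], [2, 3], [(BDelta, [0, 1], [4]), (BM, [4], [2, 3])]))) =
      fscale (- 1) (basis (diag dpois_arity ([0, 1], [2, 3], [(PW, [0, 1], [5, 4]), (PU, [5], []), (PM, [4], [2, 3])])))"
      by (rule hom_bib_to_dpois[where \<rho>s = "[(!) [0, 1, 4, 5], (!) [4, 2, 3]]"]) (simp_all add: diagram_simps)
    ultimately show ?thesis
      by (rule hom_relation[OF generator_map_bib _ m _ _ _ _ dpois_image_bimod_right, where e = 1 and c = "1", rotated]) (simp_all add: r)
  qed
  have B_antisym: ?thesis if r: "r = basis (diag bib_arity ([0, 1], [2, 3], [(BM, [1], [2, 4]), (BDelta, [0, 4], [3])])) + basis (diag bib_arity ([0, 1], [2, 3], [(BM, [0], [3, 4]), (BDelta, [1, 4], [2])]))"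
  proof -
    have "hom bib_to_dpois (basis (diag bib_arity ([0, 1], [2, 3], [(BM, [1], [2, 4]), (BDelta, [0, 4], [3])]))) =
      fscale (- 1) (basis (diag dpois_arity ([0, 1], [2, 3], [(PM, [1], [2, 4]), (PW, [0, 4], [5, 3]), (PU, [5], [])])))"
      by (rule hom_bib_to_dpois[where \<rho>s = "[(!) [1, 2, 4], (!) [0, 4, 3, 5]]"]) (simp_all add: diagram_simps)
    moreover have "hom bib_to_dpois (basis (diag bib_arity ([0, 1], [2, 3], [(BM, [0], [3, 4]), (BDelta, [1, 4], [2])]))) =
      fscale (- 1) (basis (diag dpois_arity ([0, 1], [2, 3], [(PM, [0], [3, 4]), (PW, [1, 4], [5, 2]), (PU, [5], [])])))"
      by (rule hom_bib_to_dpois[where \<rho>s = "[(!) [0, 3, 4], (!) [1, 4, 2, 5]]"]) (simp_all add: diagram_simps)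
    ultimately show ?thesis
      by (rule hom_relation[OF generator_map_bib _ m _ _ _ _ dpois_image_B_antisym, where e = 1 and c = "(- 1)", rotated]) (simp_all add: r)
  qed
  have B_twisted: ?thesis if r: "r = basis (diag bib_arity ([0, 1], [2, 3], [(BM, [1], [2, 4]), (BDelta, [0, 4], [3])])) + basis (diag bib_arity ([0, 1], [2, 3], [(BM, [0], [4, 2]), (BDelta, [4, 1], [3])]))"
  proof -
    have "hom bib_to_dpois (basis (diag bib_arity ([0, 1], [2, 3], [(BM, [1], [2, 4]), (BDelta, [0, 4], [3])]))) =
      fscale (- 1) (basis (diag dpois_arity ([0, 1], [2, 3], [(PM, [1], [2, 4]), (PW, [0, 4], [5, 3]), (PU, [5], [])])))"
      by (rule hom_bib_to_dpois[where \<rho>s = "[(!) [1, 2, 4], (!) [0, 4, 3, 5]]"]) (simp_all add: diagram_simps)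
    moreover have "hom bib_to_dpois (basis (diag bib_arity ([0, 1], [2, 3], [(BM, [0], [4, 2]), (BDelta, [4, 1], [3])]))) =
      fscale (- 1) (basis (diag dpois_arity ([0, 1], [2, 3], [(PM, [0], [4, 2]), (PW, [4, 1], [5, 3]), (PU, [5], [])])))"
      by (rule hom_bib_to_dpois[where \<rho>s = "[(!) [0, 4, 2], (!) [4, 1, 3, 5]]"]) (simp_all add: diagram_simps)
    ultimately show ?thesis
      by (rule hom_relation[OF generator_map_bib _ m _ _ _ _ dpois_image_B_twisted, where e = 1 and c = "(- 1)", rotated]) (simp_all add: r)
  qed
  have mult_comult: ?thesis if r: "r = basis (diag bib_arity ([0], [1], [(BM, [0], [2, 3]), (BDelta, [2, 3], [1])]))"
  proof -
    have "hom bib_to_dpois (basis (diag bib_arity ([0], [1], [(BM, [0], [2, 3]), (BDelta, [2, 3], [1])]))) =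
      fscale (- 1) (basis (diag dpois_arity ([0], [1], [(PM, [0], [2, 3]), (PW, [2, 3], [4, 1]), (PU, [4], [])])))"
      by (rule hom_bib_to_dpois[where \<rho>s = "[(!) [0, 2, 3], (!) [2, 3, 1, 4]]"]) (simp_all add: diagram_simps)
    from hom_relation[OF generator_map_bib _ m this this _ _ dpois_image_mult_comult, where e = 1 and c = "0"]
    show ?thesis by (simp add: r)
  qed
  have mult_tau_comult: ?thesis if r: "r = basis (diag bib_arity ([0], [1], [(BM, [0], [3, 2]), (BDelta, [2, 3], [1])]))"
  proof -
    have "hom bib_to_dpois (basis (diag bib_arity ([0], [1], [(BM, [0], [3, 2]), (BDelta, [2, 3], [1])]))) =
      fscale (- 1) (basis (diag dpois_arity ([0], [1], [(PM, [0], [3, 2]), (PW, [2, 3], [4, 1]), (PU, [4], [])])))"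
      by (rule hom_bib_to_dpois[where \<rho>s = "[(!) [0, 3, 2], (!) [2, 3, 1, 4]]"]) (simp_all add: diagram_simps)
    from hom_relation[OF generator_map_bib _ m this this _ _ dpois_image_mult_tau_comult, where e = 1 and c = "0"]
    show ?thesis by (simp add: r)
  qed
  have unit_left: ?thesis if r: "r = basis (diag bib_arity ([0], [1], [(BM, [0], [2, 1]), (BU, [2], [])])) + basis (diag bib_arity ([0], [0], []))"
  proof -
    have "hom bib_to_dpois (basis (diag bib_arity ([0], [1], [(BM, [0], [2, 1]), (BU, [2], [])]))) =
      fscale 1 (basis (diag dpois_arity ([0], [1], [(PM, [0], [2, 1]), (PU, [2], [])])))"
      by (rule hom_bib_to_dpois[where \<rho>s = "[(!) [0, 2, 1], (!) [2]]"]) (simp_all add: diagram_simps)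
    moreover have "hom bib_to_dpois (basis (diag bib_arity ([0], [0], []))) =
      fscale 1 (basis (diag dpois_arity ([0], [0], [])))"
      by (rule hom_bib_to_dpois[where \<rho>s = "[]"]) (simp_all add: diagram_simps)
    ultimately show ?thesis
      by (rule hom_relation[OF generator_map_bib _ m _ _ _ _ dpois_unit_left, where e = 1 and c = "(- 1)", rotated]) (simp_all add: r)
  qed
  have unit_right: ?thesis if r: "r = basis (diag bib_arity ([0], [1], [(BM, [0], [1, 2]), (BU, [2], [])])) - basis (diag bib_arity ([0], [0], []))"
  proof -
    have "hom bib_to_dpois (basis (diag bib_arity ([0], [1], [(BM, [0], [1, 2]), (BU, [2], [])]))) =
      fscale 1 (basis (diag dpois_arity ([0], [1], [(PM, [0], [1, 2]), (PU, [2], [])])))"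
      by (rule hom_bib_to_dpois[where \<rho>s = "[(!) [0, 1, 2], (!) [2]]"]) (simp_all add: diagram_simps)
    moreover have "hom bib_to_dpois (basis (diag bib_arity ([0], [0], []))) =
      fscale 1 (basis (diag dpois_arity ([0], [0], [])))"
      by (rule hom_bib_to_dpois[where \<rho>s = "[]"]) (simp_all add: diagram_simps)
    ultimately show ?thesis
      by (rule hom_relation[OF generator_map_bib _ m _ _ _ _ dpois_unit_right, where e = 1 and c = "1", rotated]) (simp_all add: r)
  qed
  show ?thesis using r unfolding bib_rels_diag by (elim insertE emptyE) (erule assoc | erule coassoc | erule bimod_left | erule bimod_right | erule B_antisym | erule B_twisted | erule mult_comult | erule mult_tau_comult | erule unit_left | erule unit_right)+
qed

lemma hom_dpois_to_bib_relation:
  assumes r: "r \<in> dpois_rels" and m: "r \<in> formal (free_sbimod dpois_arity) m n d"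
  shows "ideal (free_sbimod bib_arity) bib_rels m n d (hom dpois_to_bib r)"
proof -
  have antisym: ?thesis if r: "r = basis (diag dpois_arity ([0, 1], [2, 3], [(PW, [1, 0], [3, 2])])) + basis (diag dpois_arity ([0, 1], [2, 3], [(PW, [0, 1], [2, 3])]))"
  proof -
    have "hom dpois_to_bib (basis (diag dpois_arity ([0, 1], [2, 3], [(PW, [1, 0], [3, 2])]))) =
      fscale 1 (basis (diag bib_arity ([0, 1], [2, 3], [(BM, [0], [3, 4]), (BDelta, [1, 4], [2])])))"
      by (rule hom_dpois_to_bib[where \<rho>s = "[(!) [1, 0, 3, 2, 4]]"]) (simp_all add: diagram_simps)
    moreover have "hom dpois_to_bib (basis (diag dpois_arity ([0, 1], [2, 3], [(PW, [0, 1], [2, 3])]))) =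
      fscale 1 (basis (diag bib_arity ([0, 1], [2, 3], [(BM, [1], [2, 4]), (BDelta, [0, 4], [3])])))"
      by (rule hom_dpois_to_bib[where \<rho>s = "[(!) [0, 1, 2, 3, 4]]"]) (simp_all add: diagram_simps)
    ultimately show ?thesis
      by (rule hom_relation[OF generator_map_dpois _ m _ _ _ _ bib_B_antisym[THEN eqn_neg_flip], where e = 1 and c = "(- 1)", rotated]) (simp_all add: r)
  qed
  have assoc: ?thesis if r: "r = basis (diag dpois_arity ([0], [1, 2, 3], [(PM, [0], [1, 4]), (PM, [4], [2, 3])])) + basis (diag dpois_arity ([0], [1, 2, 3], [(PM, [0], [4, 3]), (PM, [4], [1, 2])]))"
  proof -
    have "hom dpois_to_bib (basis (diag dpois_arity ([0], [1, 2, 3], [(PM, [0], [1, 4]), (PM, [4], [2, 3])]))) =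
      fscale 1 (basis (diag bib_arity ([0], [1, 2, 3], [(BM, [0], [1, 4]), (BM, [4], [2, 3])])))"
      by (rule hom_dpois_to_bib[where \<rho>s = "[(!) [0, 1, 4], (!) [4, 2, 3]]"]) (simp_all add: diagram_simps)
    moreover have "hom dpois_to_bib (basis (diag dpois_arity ([0], [1, 2, 3], [(PM, [0], [4, 3]), (PM, [4], [1, 2])]))) =
      fscale 1 (basis (diag bib_arity ([0], [1, 2, 3], [(BM, [0], [4, 3]), (BM, [4], [1, 2])])))"
      by (rule hom_dpois_to_bib[where \<rho>s = "[(!) [0, 4, 3], (!) [4, 1, 2]]"]) (simp_all add: diagram_simps)
    ultimately show ?thesis
      by (rule hom_relation[OF generator_map_dpois _ m _ _ _ _ bib_assoc, where e = 1 and c = "(- 1)", rotated]) (simp_all add: r)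
  qed
  have unit_left: ?thesis if r: "r = basis (diag dpois_arity ([0], [1], [(PM, [0], [2, 1]), (PU, [2], [])])) + basis (diag dpois_arity ([0], [0], []))"
  proof -
    have "hom dpois_to_bib (basis (diag dpois_arity ([0], [1], [(PM, [0], [2, 1]), (PU, [2], [])]))) =
      fscale 1 (basis (diag bib_arity ([0], [1], [(BM, [0], [2, 1]), (BU, [2], [])])))"
      by (rule hom_dpois_to_bib[where \<rho>s = "[(!) [0, 2, 1], (!) [2]]"]) (simp_all add: diagram_simps)
    moreover have "hom dpois_to_bib (basis (diag dpois_arity ([0], [0], []))) =
      fscale 1 (basis (diag bib_arity ([0], [0], [])))"
      by (rule hom_dpois_to_bib[where \<rho>s = "[]"]) (simp_all add: diagram_simps)
    ultimately show ?thesis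
      by (rule hom_relation[OF generator_map_dpois _ m _ _ _ _ bib_unit_left, where e = 1 and c = "(- 1)", rotated]) (simp_all add: r)
  qed
  have unit_right: ?thesis if r: "r = basis (diag dpois_arity ([0], [1], [(PM, [0], [1, 2]), (PU, [2], [])])) - basis (diag dpois_arity ([0], [0], []))"
  proof -
    have "hom dpois_to_bib (basis (diag dpois_arity ([0], [1], [(PM, [0], [1, 2]), (PU, [2], [])]))) =
      fscale 1 (basis (diag bib_arity ([0], [1], [(BM, [0], [1, 2]), (BU, [2], [])])))"
      by (rule hom_dpois_to_bib[where \<rho>s = "[(!) [0, 1, 2], (!) [2]]"]) (simp_all add: diagram_simps)
    moreover have "hom dpois_to_bib (basis (diag dpois_arity ([0], [0], []))) =
      fscale 1 (basis (diag bib_arity ([0], [0], [])))"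
      by (rule hom_dpois_to_bib[where \<rho>s = "[]"]) (simp_all add: diagram_simps)
    ultimately show ?thesis
      by (rule hom_relation[OF generator_map_dpois _ m _ _ _ _ bib_unit_right, where e = 1 and c = "1", rotated]) (simp_all add: r)
  qed
  have leibniz_left: ?thesis if r: "r = basis (diag dpois_arity ([0, 1], [2, 3, 4], [(PM, [0], [2, 5]), (PW, [5, 1], [3, 4])])) + basis (diag dpois_arity ([0, 1], [2, 3, 4], [(PW, [0, 1], [3, 5]), (PM, [5], [2, 4])]))"
  proof -
    have "hom dpois_to_bib (basis (diag dpois_arity ([0, 1], [2, 3, 4], [(PM, [0], [2, 5]), (PW, [5, 1], [3, 4])]))) =
      fscale 1 (basis (diag bib_arity ([0, 1], [2, 3, 4], [(BM, [0], [2, 5]), (BM, [1], [3, 6]), (BDelta, [5, 6], [4])])))"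
      by (rule hom_dpois_to_bib[where \<rho>s = "[(!) [0, 2, 5], (!) [5, 1, 3, 4, 6]]"]) (simp_all add: diagram_simps)
    moreover have "hom dpois_to_bib (basis (diag dpois_arity ([0, 1], [2, 3, 4], [(PW, [0, 1], [3, 5]), (PM, [5], [2, 4])]))) =
      fscale 1 (basis (diag bib_arity ([0, 1], [2, 3, 4], [(BM, [1], [3, 6]), (BDelta, [0, 6], [5]), (BM, [5], [2, 4])])))"
      by (rule hom_dpois_to_bib[where \<rho>s = "[(!) [0, 1, 3, 5, 6], (!) [5, 2, 4]]"]) (simp_all add: diagram_simps)
    ultimately show ?thesis
      by (rule hom_relation[OF generator_map_dpois _ m _ _ _ _ bib_image_leibniz_left[THEN eqn_neg_flip], where e = 1 and c = "(- 1)", rotated]) (simp_all add: r)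
  qed
  have leibniz_right: ?thesis if r: "r = basis (diag dpois_arity ([0, 1], [2, 3, 4], [(PM, [0], [5, 4]), (PW, [5, 1], [2, 3])])) + basis (diag dpois_arity ([0, 1], [2, 3, 4], [(PW, [0, 1], [5, 3]), (PM, [5], [2, 4])]))"
  proof -
    have "hom dpois_to_bib (basis (diag dpois_arity ([0, 1], [2, 3, 4], [(PM, [0], [5, 4]), (PW, [5, 1], [2, 3])]))) =
      fscale 1 (basis (diag bib_arity ([0, 1], [2, 3, 4], [(BM, [0], [5, 4]), (BM, [1], [2, 6]), (BDelta, [5, 6], [3])])))"
      by (rule hom_dpois_to_bib[where \<rho>s = "[(!) [0, 5, 4], (!) [5, 1, 2, 3, 6]]"]) (simp_all add: diagram_simps)
    moreover have "hom dpois_to_bib (basis (diag dpois_arity ([0, 1], [2, 3, 4], [(PW, [0, 1], [5, 3]), (PM, [5], [2, 4])]))) =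
      fscale 1 (basis (diag bib_arity ([0, 1], [2, 3, 4], [(BM, [1], [5, 6]), (BDelta, [0, 6], [3]), (BM, [5], [2, 4])])))"
      by (rule hom_dpois_to_bib[where \<rho>s = "[(!) [0, 1, 5, 3, 6], (!) [5, 2, 4]]"]) (simp_all add: diagram_simps)
    ultimately show ?thesis
      by (rule hom_relation[OF generator_map_dpois _ m _ _ _ _ bib_image_leibniz_right, where e = 1 and c = "(- 1)", rotated]) (simp_all add: r)
  qed
  have cyclic: ?thesis if r: "r = basis (diag dpois_arity ([0, 1, 2], [3, 4, 5], [(PW, [0, 1], [3, 7]), (PW, [7, 2], [4, 5])])) - basis (diag dpois_arity ([0, 1, 2], [3, 4, 5], [(PW, [2, 0], [5, 6]), (PW, [6, 1], [3, 4])]))"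
  proof -
    have "hom dpois_to_bib (basis (diag dpois_arity ([0, 1, 2], [3, 4, 5], [(PW, [0, 1], [3, 7]), (PW, [7, 2], [4, 5])]))) =
      fscale 1 (basis (diag bib_arity ([0, 1, 2], [3, 4, 5], [(BM, [1], [3, 8]), (BDelta, [0, 8], [7]), (BM, [2], [4, 6]), (BDelta, [7, 6], [5])])))"
      by (rule hom_dpois_to_bib[where \<rho>s = "[(!) [0, 1, 3, 7, 8], (!) [7, 2, 4, 5, 6]]"]) (simp_all add: diagram_simps)
    moreover have "hom dpois_to_bib (basis (diag dpois_arity ([0, 1, 2], [3, 4, 5], [(PW, [2, 0], [5, 6]), (PW, [6, 1], [3, 4])]))) =
      fscale 1 (basis (diag bib_arity ([0, 1, 2], [3, 4, 5], [(BM, [0], [5, 7]), (BDelta, [2, 7], [6]), (BM, [1], [3, 8]), (BDelta, [6, 8], [4])])))"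
      by (rule hom_dpois_to_bib[where \<rho>s = "[(!) [2, 0, 5, 6, 7], (!) [6, 1, 3, 4, 8]]"]) (simp_all add: diagram_simps)
    ultimately show ?thesis
      by (rule hom_relation[OF generator_map_dpois _ m _ _ _ _ bib_image_cyclic[THEN eqn_flip], where e = 1 and c = "1", rotated]) (simp_all add: r)
  qed
  have mult_bracket: ?thesis if r: "r = basis (diag dpois_arity ([0], [1, 2], [(PM, [0], [3, 4]), (PW, [3, 4], [1, 2])]))"
  proof -
    have "hom dpois_to_bib (basis (diag dpois_arity ([0], [1, 2], [(PM, [0], [3, 4]), (PW, [3, 4], [1, 2])]))) =
      fscale 1 (basis (diag bib_arity ([0], [1, 2], [(BM, [0], [3, 4]), (BM, [4], [1, 5]), (BDelta, [3, 5], [2])])))"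
      by (rule hom_dpois_to_bib[where \<rho>s = "[(!) [0, 3, 4], (!) [3, 4, 1, 2, 5]]"]) (simp_all add: diagram_simps)
    from hom_relation[OF generator_map_dpois _ m this this _ _ bib_image_mult_bracket, where e = 1 and c = "0"]
    show ?thesis by (simp add: r)
  qed
  have bracket_bracket: ?thesis if r: "r = basis (diag dpois_arity ([0, 1], [2, 3], [(PW, [0, 1], [4, 5]), (PW, [4, 5], [2, 3])]))"
  proof -
    have "hom dpois_to_bib (basis (diag dpois_arity ([0, 1], [2, 3], [(PW, [0, 1], [4, 5]), (PW, [4, 5], [2, 3])]))) =
      fscale 1 (basis (diag bib_arity ([0, 1], [2, 3], [(BM, [1], [4, 6]), (BDelta, [0, 6], [5]), (BM, [5], [2, 7]), (BDelta, [4, 7], [3])])))"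
      by (rule hom_dpois_to_bib[where \<rho>s = "[(!) [0, 1, 4, 5, 6], (!) [4, 5, 2, 3, 7]]"]) (simp_all add: diagram_simps)
    from hom_relation[OF generator_map_dpois _ m this this _ _ bib_image_bracket_bracket, where e = 1 and c = "0"]
    show ?thesis by (simp add: r)
  qed
  show ?thesis using r unfolding dpois_rels_diag by (elim insertE emptyE) (erule antisym | erule assoc | erule unit_left | erule unit_right | erule leibniz_left | erule leibniz_right | erule cyclic | erule mult_bracket | erule bracket_bracket)+
qed

lemma hom_bib_to_dpois_generator:
  "bib_arity x = (m, n, d) \<Longrightarrow> ideal (free_sbimod bib_arity) (bib_rels :: (('k::field, bib_gen) free_elt dgraph \<Rightarrow>\<^sub>0 'k) set) m n d
     (hom dpois_to_bib (bib_to_dpois x) - basis (gen bib_arity x))"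
proof -
  assume ar: "bib_arity x = (m, n, d)"
  have BU: ?thesis if x: "x = BU"
  proof -
    have "hom dpois_to_bib (basis (diag dpois_arity ([0], [], [(PU, [0], [])]))) =
      fscale 1 (basis (diag bib_arity ([0], [], [(BU, [0], [])])))"
      by (rule hom_dpois_to_bib[where \<rho>s = "[(!) [0]]"]) (simp_all add: diagram_simps)
    then have h: "hom dpois_to_bib (bib_to_dpois x) = fscale 1 (basis (diag bib_arity ([0], [], [(BU, [0], [])])) :: _ \<Rightarrow>\<^sub>0 'k)"
      by (simp add: x bib_to_dpois_def hom_fscale hom_uminus)
    have g: "gen bib_arity x = diag bib_arity ([0], [], [(BU, [0], [])])"
      unfolding x by (rule diag_eqI[OF drawn_gen[of bib_arity BU "[0]" "[]"]]) (simp_all add: diagram_simps)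
    show ?thesis unfolding h g by (simp add: ideal_zero)
  qed
  have BM: ?thesis if x: "x = BM"
  proof -
    have "hom dpois_to_bib (basis (diag dpois_arity ([0], [1, 2], [(PM, [0], [1, 2])]))) =
      fscale 1 (basis (diag bib_arity ([0], [1, 2], [(BM, [0], [1, 2])])))"
      by (rule hom_dpois_to_bib[where \<rho>s = "[(!) [0, 1, 2]]"]) (simp_all add: diagram_simps)
    then have h: "hom dpois_to_bib (bib_to_dpois x) = fscale 1 (basis (diag bib_arity ([0], [1, 2], [(BM, [0], [1, 2])])) :: _ \<Rightarrow>\<^sub>0 'k)"
      by (simp add: x bib_to_dpois_def hom_fscale hom_uminus)
    have g: "gen bib_arity x = diag bib_arity ([0], [1, 2], [(BM, [0], [1, 2])])"
      unfolding x by (rule diag_eqI[OF drawn_gen[of bib_arity BM "[0]" "[1, 2]"]]) (simp_all add: diagram_simps)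
    show ?thesis unfolding h g by (simp add: ideal_zero)
  qed
  have BDelta: ?thesis if x: "x = BDelta"
  proof -
    have "hom dpois_to_bib (basis (diag dpois_arity ([0, 1], [2], [(PW, [0, 1], [3, 2]), (PU, [3], [])]))) =
      fscale 1 (basis (diag bib_arity ([0, 1], [2], [(BM, [1], [3, 4]), (BDelta, [0, 4], [2]), (BU, [3], [])])))"
      by (rule hom_dpois_to_bib[where \<rho>s = "[(!) [0, 1, 3, 2, 4], (!) [3]]"]) (simp_all add: diagram_simps)
    then have h: "hom dpois_to_bib (bib_to_dpois x) = fscale (- 1) (basis (diag bib_arity ([0, 1], [2], [(BM, [1], [3, 4]), (BDelta, [0, 4], [2]), (BU, [3], [])])) :: _ \<Rightarrow>\<^sub>0 'k)"
      by (simp add: x bib_to_dpois_def hom_fscale hom_uminus)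
    have g: "gen bib_arity x = diag bib_arity ([0, 1], [2], [(BDelta, [0, 1], [2])])"
      unfolding x by (rule diag_eqI[OF drawn_gen[of bib_arity BDelta "[0, 1]" "[2]"]]) (simp_all add: diagram_simps)
    obtain a b k where "diag bib_arity ([0, 1], [2], [(BDelta, [0, 1], [2])]) \<in> dgraphs (free_sbimod bib_arity :: ('k, _) sbimod) a b k"
        "ideal (free_sbimod bib_arity) bib_rels a b k (basis (diag bib_arity ([0, 1], [2], [(BM, [1], [3, 4]), (BDelta, [0, 4], [2]), (BU, [3], [])])) - fscale (- 1 :: 'k) (basis (diag bib_arity ([0, 1], [2], [(BDelta, [0, 1], [2])]))))"
      using bib_comult_recovered unfolding eqn_def by blast
    moreover have "(gen bib_arity x :: ('k, _) free_elt dgraph) \<in> dgraphs (free_sbimod bib_arity :: ('k, _) sbimod) m n d"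
      using ar wf_corolla by (auto simp: gen_def dgraphs_def gdeg_def permutes_id)
    ultimately have "ideal (free_sbimod bib_arity) bib_rels m n d
        (fscale (- 1 :: 'k) (basis (diag bib_arity ([0, 1], [2], [(BM, [1], [3, 4]), (BDelta, [0, 4], [2]), (BU, [3], [])])) - fscale (- 1) (basis (diag bib_arity ([0, 1], [2], [(BDelta, [0, 1], [2])])))))"
      unfolding g using dgraphs_unique ideal.scale by metis
    then show ?thesis unfolding h g by simp
  qed
  show ?thesis by (cases x) (use BU BM BDelta in blast)+
qed

lemma hom_dpois_to_bib_generator:
  "dpois_arity x = (m, n, d) \<Longrightarrow> ideal (free_sbimod dpois_arity) (dpois_rels :: (('k::field, dpois_gen) free_elt dgraph \<Rightarrow>\<^sub>0 'k) set) m n d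
     (hom bib_to_dpois (dpois_to_bib x) - basis (gen dpois_arity x))"
proof -
  assume ar: "dpois_arity x = (m, n, d)"
  have PU: ?thesis if x: "x = PU"
  proof -
    have "hom bib_to_dpois (basis (diag bib_arity ([0], [], [(BU, [0], [])]))) =
      fscale 1 (basis (diag dpois_arity ([0], [], [(PU, [0], [])])))"
      by (rule hom_bib_to_dpois[where \<rho>s = "[(!) [0]]"]) (simp_all add: diagram_simps)
    then have h: "hom bib_to_dpois (dpois_to_bib x) = fscale 1 (basis (diag dpois_arity ([0], [], [(PU, [0], [])])) :: _ \<Rightarrow>\<^sub>0 'k)"
      by (simp add: x dpois_to_bib_def hom_fscale hom_uminus)
    have g: "gen dpois_arity x = diag dpois_arity ([0], [], [(PU, [0], [])])"
      unfolding x by (rule diag_eqI[OF drawn_gen[of dpois_arity PU "[0]" "[]"]]) (simp_all add: diagram_simps)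
    show ?thesis unfolding h g by (simp add: ideal_zero)
  qed
  have PM: ?thesis if x: "x = PM"
  proof -
    have "hom bib_to_dpois (basis (diag bib_arity ([0], [1, 2], [(BM, [0], [1, 2])]))) =
      fscale 1 (basis (diag dpois_arity ([0], [1, 2], [(PM, [0], [1, 2])])))"
      by (rule hom_bib_to_dpois[where \<rho>s = "[(!) [0, 1, 2]]"]) (simp_all add: diagram_simps)
    then have h: "hom bib_to_dpois (dpois_to_bib x) = fscale 1 (basis (diag dpois_arity ([0], [1, 2], [(PM, [0], [1, 2])])) :: _ \<Rightarrow>\<^sub>0 'k)"
      by (simp add: x dpois_to_bib_def hom_fscale hom_uminus)
    have g: "gen dpois_arity x = diag dpois_arity ([0], [1, 2], [(PM, [0], [1, 2])])"
      unfolding x by (rule diag_eqI[OF drawn_gen[of dpois_arity PM "[0]" "[1, 2]"]]) (simp_all add: diagram_simps)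
    show ?thesis unfolding h g by (simp add: ideal_zero)
  qed
  have PW: ?thesis if x: "x = PW"
  proof -
    have "hom bib_to_dpois (basis (diag bib_arity ([0, 1], [2, 3], [(BM, [1], [2, 4]), (BDelta, [0, 4], [3])]))) =
      fscale (- 1) (basis (diag dpois_arity ([0, 1], [2, 3], [(PM, [1], [2, 4]), (PW, [0, 4], [5, 3]), (PU, [5], [])])))"
      by (rule hom_bib_to_dpois[where \<rho>s = "[(!) [1, 2, 4], (!) [0, 4, 3, 5]]"]) (simp_all add: diagram_simps)
    then have h: "hom bib_to_dpois (dpois_to_bib x) = fscale (- 1) (basis (diag dpois_arity ([0, 1], [2, 3], [(PM, [1], [2, 4]), (PW, [0, 4], [5, 3]), (PU, [5], [])])) :: _ \<Rightarrow>\<^sub>0 'k)"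
      by (simp add: x dpois_to_bib_def hom_fscale hom_uminus)
    have g: "gen dpois_arity x = diag dpois_arity ([0, 1], [2, 3], [(PW, [0, 1], [2, 3])])"
      unfolding x by (rule diag_eqI[OF drawn_gen[of dpois_arity PW "[0, 1]" "[2, 3]"]]) (simp_all add: diagram_simps)
    obtain a b k where "diag dpois_arity ([0, 1], [2, 3], [(PW, [0, 1], [2, 3])]) \<in> dgraphs (free_sbimod dpois_arity :: ('k, _) sbimod) a b k"
        "ideal (free_sbimod dpois_arity) dpois_rels a b k (basis (diag dpois_arity ([0, 1], [2, 3], [(PM, [1], [2, 4]), (PW, [0, 4], [5, 3]), (PU, [5], [])])) - fscale (- 1 :: 'k) (basis (diag dpois_arity ([0, 1], [2, 3], [(PW, [0, 1], [2, 3])]))))"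
      using dpois_mult_unit unfolding eqn_def by blast
    moreover have "(gen dpois_arity x :: ('k, _) free_elt dgraph) \<in> dgraphs (free_sbimod dpois_arity :: ('k, _) sbimod) m n d"
      using ar wf_corolla by (auto simp: gen_def dgraphs_def gdeg_def permutes_id)
    ultimately have "ideal (free_sbimod dpois_arity) dpois_rels m n d
        (fscale (- 1 :: 'k) (basis (diag dpois_arity ([0, 1], [2, 3], [(PM, [1], [2, 4]), (PW, [0, 4], [5, 3]), (PU, [5], [])])) - fscale (- 1) (basis (diag dpois_arity ([0, 1], [2, 3], [(PW, [0, 1], [2, 3])])))))"
      unfolding g using dgraphs_unique ideal.scale by metis
    then show ?thesis unfolding h g by simp
  qed
  show ?thesis by (cases x) (use PU PM PW in blast)+
qed

section \<open>Isomorphisms of quotients\<close>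

text \<open>Half of the statement that \<open>h\<close> and \<open>h'\<close> are mutually inverse isomorphisms of \<open>\<Sigma>\<close>-bimodules. An
  isomorphism is given by two such halves, so that each construction is treated in one direction only.\<close>

definition bimod_map :: "('k, 'a, 'y) sbimod_scheme \<Rightarrow> ('k, 'b, 'z) sbimod_scheme \<Rightarrow>
    (nat \<Rightarrow> nat \<Rightarrow> int \<Rightarrow> 'a \<Rightarrow> 'b) \<Rightarrow> (nat \<Rightarrow> nat \<Rightarrow> int \<Rightarrow> 'b \<Rightarrow> 'a) \<Rightarrow> bool" where
  "bimod_map C C' h h' \<longleftrightarrow> (\<forall>m n d.
     (\<forall>x\<in>car C m n d. h m n d x \<in> car C' m n d \<and> h' m n d (h m n d x) = x) \<and>
     (\<forall>x\<in>car C m n d. \<forall>y\<in>car C m n d. h m n d (add C m n d x y) = add C' m n d (h m n d x) (h m n d y)) \<and>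
     (\<forall>c. \<forall>x\<in>car C m n d. h m n d (smul C m n d c x) = smul C' m n d c (h m n d x)) \<and>
     (\<forall>\<sigma> \<tau>. \<forall>x\<in>car C m n d. \<sigma> permutes {..<m} \<longrightarrow> \<tau> permutes {..<n} \<longrightarrow>
        h m n d (act C m n d \<sigma> \<tau> x) = act C' m n d \<sigma> \<tau> (h m n d x)))"

lemma bimod_mapD:
  assumes "bimod_map C C' h h'"
  shows "x \<in> car C m n d \<Longrightarrow> h m n d x \<in> car C' m n d"
    and "x \<in> car C m n d \<Longrightarrow> h' m n d (h m n d x) = x"
    and "x \<in> car C m n d \<Longrightarrow> y \<in> car C m n d \<Longrightarrow> h m n d (add C m n d x y) = add C' m n d (h m n d x) (h m n d y)"
    and "x \<in> car C m n d \<Longrightarrow> h m n d (smul C m n d c x) = smul C' m n d c (h m n d x)"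
    and "x \<in> car C m n d \<Longrightarrow> \<sigma> permutes {..<m} \<Longrightarrow> \<tau> permutes {..<n} \<Longrightarrow>
      h m n d (act C m n d \<sigma> \<tau> x) = act C' m n d \<sigma> \<tau> (h m n d x)"
  using assms unfolding bimod_map_def by blast+

definition linear_action :: "('k::field, 'a, 'z) sbimod_scheme \<Rightarrow> bool" where
  "linear_action P \<longleftrightarrow> (\<forall>m n d \<sigma> \<tau>. \<sigma> permutes {..<m} \<longrightarrow> \<tau> permutes {..<n} \<longrightarrow>
     (\<forall>x\<in>car P m n d. \<forall>y\<in>car P m n d.
        act P m n d \<sigma> \<tau> (add P m n d x y) = add P m n d (act P m n d \<sigma> \<tau> x) (act P m n d \<sigma> \<tau> y)) \<and>
     (\<forall>c. \<forall>x\<in>car P m n d. act P m n d \<sigma> \<tau> (smul P m n d c x) = smul P m n d c (act P m n d \<sigma> \<tau> x)))"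

text \<open>The same for properads. That the underlying bimodule is closed under its operations, with a linear
  action, is recorded here because it is what the linear dual inherits.\<close>

definition properad_map :: "('k::field, 'a) dg_properad \<Rightarrow> ('k, 'b) dg_properad \<Rightarrow>
    (nat \<Rightarrow> nat \<Rightarrow> int \<Rightarrow> 'a \<Rightarrow> 'b) \<Rightarrow> (nat \<Rightarrow> nat \<Rightarrow> int \<Rightarrow> 'b \<Rightarrow> 'a) \<Rightarrow> bool" where
  "properad_map P Q f f' \<longleftrightarrow> bimod_map P Q f f' \<and> closed_sbimod P \<and> linear_action P \<and>
     (\<forall>m n d. \<forall>g\<in>dgraphs P m n d. ev P g \<in> car P m n d \<and> f m n d (ev P g) = ev Q (map_decs f g))"

lemma coset_eq_iff:
  assumes N: "0 \<in> N" "\<And>x y. x \<in> N \<Longrightarrow> y \<in> N \<Longrightarrow> x + y \<in> N" "\<And>x. x \<in> N \<Longrightarrow> - x \<in> N"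
  shows "coset N x = coset N y \<longleftrightarrow> x - y \<in> N"
proof
  assume "coset N x = coset N y"
  moreover have "x \<in> coset N x" using N(1) by (simp add: coset_def)
  ultimately show "x - y \<in> N" by (simp add: coset_def)
next
  assume xy: "x - y \<in> N"
  have "z - x \<in> N \<longleftrightarrow> z - y \<in> N" for z
    using N(2)[OF _ xy, of "z - x"] N(2)[OF _ N(3)[OF xy], of "z - y"] by auto
  then show "coset N x = coset N y" by (simp add: coset_def)
qed

lemma UN_eq_const: "a \<in> A \<Longrightarrow> (\<And>x. x \<in> A \<Longrightarrow> f x = c) \<Longrightarrow> (\<Union>x\<in>A. f x) = c"
  by auto

abbreviation iset :: "('g \<Rightarrow> nat \<times> nat \<times> int) \<Rightarrow> (('k::field, 'g) free_elt dgraph \<Rightarrow>\<^sub>0 'k) set \<Rightarrow>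
    nat \<Rightarrow> nat \<Rightarrow> int \<Rightarrow> (('k, 'g) free_elt dgraph \<Rightarrow>\<^sub>0 'k) set" where
  "iset ar R \<equiv> \<lambda>m n d. Collect (ideal (free_sbimod ar) R m n d)"

lemma icoset_eq: "coset (iset ar R m n d) x = coset (iset ar R m n d) y \<longleftrightarrow> ideal (free_sbimod ar) R m n d (x - y)"
  by (subst coset_eq_iff) (auto intro: ideal_zero ideal.add ideal_uminus)

lemma icoset_self: "x \<in> coset (iset ar R m n d) x"
  by (simp add: coset_def ideal_zero)

abbreviation pres :: "('g \<Rightarrow> nat \<times> nat \<times> int) \<Rightarrow> (('k::field, 'g) free_elt dgraph \<Rightarrow>\<^sub>0 'k) set \<Rightarrow>
    ('k, (('k, 'g) free_elt dgraph \<Rightarrow>\<^sub>0 'k) set) dg_properad" where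
  "pres ar R \<equiv> presented_properad (free_sbimod ar) R"

lemma pres_car: "X \<in> car (pres ar R) m n d \<longleftrightarrow> (\<exists>x\<in>formal (free_sbimod ar) m n d. X = coset (iset ar R m n d) x)"
  by (auto simp: presented_properad_def graph_quotient_def)

lemma pres_add: "add (pres ar R) m n d (coset (iset ar R m n d) x) (coset (iset ar R m n d) y) = coset (iset ar R m n d) (x + y)"
proof -
  let ?N = "iset ar R m n d"
  have "coset ?N (x' + y') = coset ?N (x + y)" if "x' \<in> coset ?N x" "y' \<in> coset ?N y" for x' y'
  proof -
    have "ideal (free_sbimod ar) R m n d ((x' - x) + (y' - y))"
      using that by (intro ideal.add) (simp_all add: coset_def)
    then show ?thesis unfolding icoset_eq by (simp add: algebra_simps)
  qed
  then have "(\<Union>x'\<in>coset ?N x. \<Union>y'\<in>coset ?N y. coset ?N (x' + y')) = coset ?N (x + y)"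
    by (intro UN_eq_const[OF icoset_self])
  then show ?thesis by (simp add: presented_properad_def graph_quotient_def)
qed

lemma pres_smul: "smul (pres ar R) m n d c (coset (iset ar R m n d) x) = coset (iset ar R m n d) (fscale c x)"
proof -
  let ?N = "iset ar R m n d"
  have "coset ?N (fscale c x') = coset ?N (fscale c x)" if "x' \<in> coset ?N x" for x'
  proof -
    have "ideal (free_sbimod ar) R m n d (fscale c (x' - x))"
      using that by (intro ideal.scale) (simp add: coset_def)
    then show ?thesis unfolding icoset_eq by (simp add: fspace.scale_right_diff_distrib)
  qed
  then have "(\<Union>x'\<in>coset ?N x. coset ?N (fscale c x')) = coset ?N (fscale c x)"
    by (intro UN_eq_const[OF icoset_self])
  then show ?thesis by (simp add: presented_properad_def graph_quotient_def)
qed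

lemma pres_act:
  assumes \<sigma>: "\<sigma> permutes {..<m}" and \<tau>: "\<tau> permutes {..<n}"
  shows "act (pres ar R) m n d \<sigma> \<tau> (coset (iset ar R m n d) x) = coset (iset ar R m n d) (act_comb \<sigma> \<tau> x)"
proof -
  let ?N = "iset ar R m n d"
  have "coset ?N (act_comb \<sigma> \<tau> x') = coset ?N (act_comb \<sigma> \<tau> x)" if "x' \<in> coset ?N x" for x'
  proof -
    have "ideal (free_sbimod ar) R m n d (act_comb \<sigma> \<tau> (x' - x))"
      using that by (intro ideal_act_comb[OF closed_free_sbimod _ \<sigma> \<tau>]) (simp add: coset_def)
    then show ?thesis unfolding icoset_eq by (simp add: act_comb_def lin_diff)
  qed
  then have "(\<Union>x'\<in>coset ?N x. coset ?N (act_comb \<sigma> \<tau> x')) = coset ?N (act_comb \<sigma> \<tau> x)"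
    by (intro UN_eq_const[OF icoset_self])
  then show ?thesis by (simp add: presented_properad_def graph_quotient_def act_comb_def)
qed

text \<open>The evaluation of a graph of cosets may be computed from any representatives, since two
  choices differ by an element of the ideal.\<close>

lemma pres_ev:
  fixes \<Gamma> :: "(('k::field, 'g) free_elt dgraph \<Rightarrow>\<^sub>0 'k) set dgraph"
  assumes wf: "wf_graph \<Gamma>" and xs: "list_all2 (\<lambda>x v. x \<in> formal (free_sbimod ar) (outs v) (ins v) (vdeg v)) xs (verts \<Gamma>)"
    and dec: "list_all2 (\<lambda>x v. dec v = coset (iset ar R (outs v) (ins v) (vdeg v)) x) xs (verts \<Gamma>)"
  shows "ev (pres ar R) \<Gamma> = coset (iset ar R (gout \<Gamma>) (gin \<Gamma>) (gdeg \<Gamma>)) (msubst \<Gamma> xs)"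
proof -
  let ?N = "iset ar R (gout \<Gamma>) (gin \<Gamma>) (gdeg \<Gamma>)"
  have *: "coset ?N (msubst \<Gamma> ys) = coset ?N (msubst \<Gamma> xs)" if ys: "list_all2 (\<lambda>y v. y \<in> dec v) ys (verts \<Gamma>)" for ys
    unfolding icoset_eq
  proof (rule ideal_msubst_cong[OF wf closed_free_sbimod xs])
    show "length ys = length xs" using ys dec by (simp add: list_all2_lengthD)
    fix i assume "i < length xs"
    then show "ideal (free_sbimod ar) R (outs (verts \<Gamma> ! i)) (ins (verts \<Gamma> ! i)) (vdeg (verts \<Gamma> ! i)) (ys ! i - xs ! i)"
      using list_all2_nthD[OF dec, of i] list_all2_nthD2[OF ys, of i] list_all2_lengthD[OF dec]
      by (simp add: coset_def)
  qed
  have xs_mem: "list_all2 (\<lambda>y v. y \<in> dec v) xs (verts \<Gamma>)"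
    using dec icoset_self by (auto simp: list_all2_conv_all_nth)
  have "(\<Union>ys\<in>{ys. list_all2 (\<lambda>y v. y \<in> dec v) ys (verts \<Gamma>)}. coset ?N (msubst \<Gamma> ys)) = coset ?N (msubst \<Gamma> xs)"
    by (rule UN_eq_const[OF CollectI[of "\<lambda>ys. list_all2 (\<lambda>y v. y \<in> dec v) ys (verts \<Gamma>)", OF xs_mem]]) (rule *, erule CollectD)
  then show ?thesis by (simp add: presented_properad_def graph_quotient_def)
qed

lemma closed_pres: "closed_sbimod (pres ar R)"
  unfolding closed_sbimod_def
proof (intro allI conjI ballI impI)
  fix m n d X assume "X \<in> car (pres ar R) m n d"
  then obtain x where x: "x \<in> formal (free_sbimod ar) m n d" "X = coset (iset ar R m n d) x" by (auto simp: pres_car)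
  show "smul (pres ar R) m n d c X \<in> car (pres ar R) m n d" for c
    unfolding x(2) pres_smul pres_car using formal_fscale[OF x(1)] by blast
  show "act (pres ar R) m n d \<sigma> \<tau> X \<in> car (pres ar R) m n d" if "\<sigma> permutes {..<m}" "\<tau> permutes {..<n}" for \<sigma> \<tau>
    unfolding x(2) pres_act[OF that] pres_car using act_comb_formal[OF x(1) that] by blast
  fix Y assume "Y \<in> car (pres ar R) m n d"
  then obtain y where y: "y \<in> formal (free_sbimod ar) m n d" "Y = coset (iset ar R m n d) y" by (auto simp: pres_car)
  show "add (pres ar R) m n d X Y \<in> car (pres ar R) m n d"
    unfolding x(2) y(2) pres_add pres_car using formal_add[OF x(1) y(1)] by blast
qed

lemma linear_action_pres: "linear_action (pres ar R)"
  unfolding linear_action_def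
proof (intro allI conjI ballI impI)
  fix m n d \<sigma> \<tau> X assume p: "\<sigma> permutes {..<m}" "\<tau> permutes {..<n}" and "X \<in> car (pres ar R) m n d"
  then obtain x where x: "x \<in> formal (free_sbimod ar) m n d" "X = coset (iset ar R m n d) x" by (auto simp: pres_car)
  show "act (pres ar R) m n d \<sigma> \<tau> (smul (pres ar R) m n d c X) = smul (pres ar R) m n d c (act (pres ar R) m n d \<sigma> \<tau> X)" for c
    unfolding x(2) pres_smul pres_act[OF p] by (simp add: act_comb_def lin_fscale)
  fix Y assume "Y \<in> car (pres ar R) m n d"
  then obtain y where y: "y \<in> formal (free_sbimod ar) m n d" "Y = coset (iset ar R m n d) y" by (auto simp: pres_car)
  show "act (pres ar R) m n d \<sigma> \<tau> (add (pres ar R) m n d X Y) =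
      add (pres ar R) m n d (act (pres ar R) m n d \<sigma> \<tau> X) (act (pres ar R) m n d \<sigma> \<tau> Y)"
    unfolding x(2) y(2) pres_add pres_act[OF p] by (simp add: act_comb_def lin_add)
qed

definition descend :: "('g \<Rightarrow> (('k::field, 'h) free_elt dgraph \<Rightarrow>\<^sub>0 'k)) \<Rightarrow> ('h \<Rightarrow> nat \<times> nat \<times> int) \<Rightarrow>
    (('k, 'h) free_elt dgraph \<Rightarrow>\<^sub>0 'k) set \<Rightarrow> nat \<Rightarrow> nat \<Rightarrow> int \<Rightarrow>
    (('k, 'g) free_elt dgraph \<Rightarrow>\<^sub>0 'k) set \<Rightarrow> (('k, 'h) free_elt dgraph \<Rightarrow>\<^sub>0 'k) set" where
  "descend F ar' R' m n d X = (\<Union>x\<in>X. coset (iset ar' R' m n d) (hom F x))"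

lemma map_decs_sel [simp]:
  "gout (map_decs f g) = gout g" "gin (map_decs f g) = gin g" "edges (map_decs f g) = edges g"
  "verts (map_decs f g) = map (\<lambda>v. Vertex (outs v) (ins v) (vdeg v) (f (outs v) (ins v) (vdeg v) (dec v))) (verts g)"
  by (simp_all add: map_decs_def)

lemma wf_map_decs: "wf_graph (map_decs f g) \<longleftrightarrow> wf_graph g"
  by (rule wf_graph_cong) (simp_all)

lemma gdeg_map_decs [simp]: "gdeg (map_decs f g) = gdeg g"
  by (simp add: gdeg_def o_def)

text \<open>A map on generators that respects the relations descends to the quotients and commutes with all
  operations because \<open>hom\<close> commutes with substitution.\<close>

lemma properad_map_descend:
  fixes F :: "'g \<Rightarrow> (('k::field, 'h) free_elt dgraph \<Rightarrow>\<^sub>0 'k)" and G :: "'h \<Rightarrow> (('k, 'g) free_elt dgraph \<Rightarrow>\<^sub>0 'k)"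
  assumes F: "generator_map ar (free_sbimod ar') F" and G: "generator_map ar' (free_sbimod ar) G"
    and R: "\<And>r m n d. r \<in> R \<Longrightarrow> r \<in> formal (free_sbimod ar) m n d \<Longrightarrow> ideal (free_sbimod ar') R' m n d (hom F r)"
    and R': "\<And>r m n d. r \<in> R' \<Longrightarrow> r \<in> formal (free_sbimod ar') m n d \<Longrightarrow> ideal (free_sbimod ar) R m n d (hom G r)"
    and GF: "\<And>g m n d. ar g = (m, n, d) \<Longrightarrow> ideal (free_sbimod ar) R m n d (hom G (F g) - basis (gen ar g))"
  shows "properad_map (pres ar R) (pres ar' R') (descend F ar' R') (descend G ar R)"
proof -
  let ?P = "pres ar R" and ?Q = "pres ar' R'" and ?f = "descend F ar' R'" and ?f' = "descend G ar R"
  have f: "?f m n d (coset (iset ar R m n d) x) = coset (iset ar' R' m n d) (hom F x)" for m n d x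
    unfolding descend_def
  proof (rule UN_eq_const[OF icoset_self])
    fix y assume "y \<in> coset (iset ar R m n d) x"
    then have "ideal (free_sbimod ar') R' m n d (hom F (y - x))" by (intro hom_ideal[OF F R]) (simp_all add: coset_def)
    then show "coset (iset ar' R' m n d) (hom F y) = coset (iset ar' R' m n d) (hom F x)"
      unfolding icoset_eq by (simp add: hom_diff)
  qed
  have f': "?f' m n d (coset (iset ar' R' m n d) x) = coset (iset ar R m n d) (hom G x)" for m n d x
    unfolding descend_def
  proof (rule UN_eq_const[OF icoset_self])
    fix y assume "y \<in> coset (iset ar' R' m n d) x"
    then have "ideal (free_sbimod ar) R m n d (hom G (y - x))" by (intro hom_ideal[OF G R']) (simp_all add: coset_def)
    then show "coset (iset ar R m n d) (hom G y) = coset (iset ar R m n d) (hom G x)"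
      unfolding icoset_eq by (simp add: hom_diff)
  qed
  have "bimod_map ?P ?Q ?f ?f'"
    unfolding bimod_map_def
  proof (intro allI conjI ballI impI)
    fix m n d X assume "X \<in> car ?P m n d"
    then obtain x where x: "x \<in> formal (free_sbimod ar) m n d" "X = coset (iset ar R m n d) x" by (auto simp: pres_car)
    show "?f m n d X \<in> car ?Q m n d"
      unfolding x(2) f pres_car using hom_formal[OF F x(1)] by blast
    show "?f' m n d (?f m n d X) = X"
      unfolding x(2) f f' icoset_eq by (rule hom_hom[OF F G GF x(1)])
    show "?f m n d (smul ?P m n d c X) = smul ?Q m n d c (?f m n d X)" for c
      unfolding x(2) pres_smul f hom_fscale ..
    show "?f m n d (act ?P m n d \<sigma> \<tau> X) = act ?Q m n d \<sigma> \<tau> (?f m n d X)"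
      if "\<sigma> permutes {..<m}" "\<tau> permutes {..<n}" for \<sigma> \<tau>
      unfolding x(2) pres_act[OF that] f hom_act_comb[OF F x(1) that] ..
    fix Y assume "Y \<in> car ?P m n d"
    then obtain y where y: "y \<in> formal (free_sbimod ar) m n d" "Y = coset (iset ar R m n d) y" by (auto simp: pres_car)
    show "?f m n d (add ?P m n d X Y) = add ?Q m n d (?f m n d X) (?f m n d Y)"
      unfolding x(2) y(2) pres_add f hom_add ..
  qed
  moreover have "ev ?P \<Gamma> \<in> car ?P m n d \<and> ?f m n d (ev ?P \<Gamma>) = ev ?Q (map_decs ?f \<Gamma>)" if \<Gamma>: "\<Gamma> \<in> dgraphs ?P m n d" for \<Gamma> m n d
  proof -
    have wf: "wf_graph \<Gamma>" and a: "gout \<Gamma> = m" "gin \<Gamma> = n" "gdeg \<Gamma> = d" using \<Gamma> by (auto simp: dgraphs_def)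
    have "\<forall>i<length (verts \<Gamma>). \<exists>x. x \<in> formal (free_sbimod ar) (outs (verts \<Gamma> ! i)) (ins (verts \<Gamma> ! i)) (vdeg (verts \<Gamma> ! i)) \<and>
        dec (verts \<Gamma> ! i) = coset (iset ar R (outs (verts \<Gamma> ! i)) (ins (verts \<Gamma> ! i)) (vdeg (verts \<Gamma> ! i))) x"
      using dgraphs_dec[OF \<Gamma>] by (auto simp: pres_car)
    then obtain r where r: "\<And>i. i < length (verts \<Gamma>) \<Longrightarrow> r i \<in> formal (free_sbimod ar) (outs (verts \<Gamma> ! i)) (ins (verts \<Gamma> ! i)) (vdeg (verts \<Gamma> ! i)) \<and>
        dec (verts \<Gamma> ! i) = coset (iset ar R (outs (verts \<Gamma> ! i)) (ins (verts \<Gamma> ! i)) (vdeg (verts \<Gamma> ! i))) (r i)"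
      by metis
    define xs where "xs = map r [0..<length (verts \<Gamma>)]"
    have xs: "list_all2 (\<lambda>x v. x \<in> formal (free_sbimod ar) (outs v) (ins v) (vdeg v)) xs (verts \<Gamma>)"
      using r by (simp add: xs_def list_all2_conv_all_nth)
    have dec: "list_all2 (\<lambda>x v. dec v = coset (iset ar R (outs v) (ins v) (vdeg v)) x) xs (verts \<Gamma>)"
      using r by (simp add: xs_def list_all2_conv_all_nth)
    have ev: "ev ?P \<Gamma> = coset (iset ar R m n d) (msubst \<Gamma> xs)"
      using pres_ev[OF wf xs dec] by (simp add: a)
    have fm: "msubst \<Gamma> xs \<in> formal (free_sbimod ar) m n d" using msubst_formal[OF wf xs] by (simp add: a)
    have "ev ?Q (map_decs ?f \<Gamma>) = coset (iset ar' R' m n d) (msubst (map_decs ?f \<Gamma>) (map (hom F) xs))"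
    proof -
      have "wf_graph (map_decs ?f \<Gamma>)" using wf by (simp add: wf_map_decs)
      moreover have "list_all2 (\<lambda>x v. x \<in> formal (free_sbimod ar') (outs v) (ins v) (vdeg v)) (map (hom F) xs) (verts (map_decs ?f \<Gamma>))"
        using xs hom_formal[OF F] by (auto simp: list_all2_conv_all_nth)
      moreover have "list_all2 (\<lambda>x v. dec v = coset (iset ar' R' (outs v) (ins v) (vdeg v)) x) (map (hom F) xs) (verts (map_decs ?f \<Gamma>))"
        using dec by (auto simp: list_all2_conv_all_nth f)
      ultimately show ?thesis using pres_ev[of "map_decs ?f \<Gamma>" ar' "map (hom F) xs" R'] by (simp add: a)
    qed
    moreover have "msubst (map_decs ?f \<Gamma>) (map (hom F) xs) = hom F (msubst \<Gamma> xs)"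
      using hom_msubst[OF F wf xs] msubst_cong_edges[of "map_decs ?f \<Gamma>" \<Gamma>] by simp
    ultimately show ?thesis unfolding ev f pres_car using fm by auto
  qed
  ultimately show ?thesis
    unfolding properad_map_def using closed_pres linear_action_pres by blast
qed

section \<open>Transport of structure along isomorphisms of decorations\<close>

definition comb_map :: "(nat \<Rightarrow> nat \<Rightarrow> int \<Rightarrow> 'a \<Rightarrow> 'b) \<Rightarrow> ('a dgraph \<Rightarrow>\<^sub>0 'k::field) \<Rightarrow> ('b dgraph \<Rightarrow>\<^sub>0 'k)" where
  "comb_map h = lin (\<lambda>g. basis (map_decs h g))"

lemma comb_map_simps:
  "comb_map h (basis g) = basis (map_decs h g)" "comb_map h (x + y) = comb_map h x + comb_map h y"
  "comb_map h (x - y) = comb_map h x - comb_map h y" "comb_map h (fscale c x) = fscale c (comb_map h x)"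
  "comb_map h 0 = 0" "comb_map h (sum F A) = (\<Sum>a\<in>A. comb_map h (F a))"
  "comb_map h (lin G z) = lin (\<lambda>a. comb_map h (G a)) z"
  by (simp_all add: comb_map_def lin_add lin_diff lin_fscale lin_sum lin_lin)

lemma dgraphs_map_decs:
  assumes h: "bimod_map C C' h h'" and g: "g \<in> dgraphs C m n d"
  shows "map_decs h g \<in> dgraphs C' m n d" "map_decs h' (map_decs h g) = g"
proof -
  have d: "dec v \<in> car C (outs v) (ins v) (vdeg v)" if "v \<in> set (verts g)" for v
    using g that by (simp add: dgraphs_def)
  show "map_decs h g \<in> dgraphs C' m n d"
    using g bimod_mapD(1)[OF h d] by (auto simp: dgraphs_def wf_map_decs)
  have "verts (map_decs h' (map_decs h g)) = verts g"
    using bimod_mapD(2)[OF h d] by (auto intro!: map_idI vertex.expand)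
  then show "map_decs h' (map_decs h g) = g" by (intro dgraph.expand conjI) simp_all
qed

lemma comb_map_formal:
  assumes h: "bimod_map C C' h h'" and x: "x \<in> formal C m n d"
  shows "comb_map h x \<in> formal C' m n d" "comb_map h' (comb_map h x) = x"
proof -
  show "comb_map h x \<in> formal C' m n d"
    unfolding comb_map_def
  proof (rule formal_lin)
    fix g assume "g \<in> keys x"
    from dgraphs_map_decs(1)[OF h formal_keys[OF x this]] show "basis (map_decs h g) \<in> formal C' m n d" by simp
  qed
  have "comb_map h' (comb_map h x) = lin (\<lambda>g. basis (map_decs h' (map_decs h g))) x"
    by (simp add: comb_map_def lin_lin)
  also have "\<dots> = lin basis x"
    by (rule lin_cong) (simp add: dgraphs_map_decs(2)[OF h formal_keys[OF x]])
  finally show "comb_map h' (comb_map h x) = x" by (simp add: lin_basis_id)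
qed

lemma map_decs_set_dec:
  "i < length (verts g) \<Longrightarrow>
   map_decs h (set_dec g i e) = set_dec (map_decs h g) i (h (outs (verts g ! i)) (ins (verts g ! i)) (vdeg (verts g ! i)) e)"
  by (rule dgraph.expand) (simp add: map_update)

lemma map_decs_permute:
  assumes "\<pi> permutes {..<length (verts g)}"
  shows "map_decs h (permute_vertices \<pi> g) = permute_vertices \<pi> (map_decs h g)"
  by (rule dgraph.expand) (simp add: permute_list_map[OF permutes_inv[OF assms]])

lemma map_decs_act: "map_decs h (act_graph \<sigma> \<tau> g) = act_graph \<sigma> \<tau> (map_decs h g)"
  by (rule dgraph.expand) simp

lemma map_decs_twist:
  assumes h: "bimod_map C C' h h'" and g: "g \<in> dgraphs C m n d" and i: "i < length (verts g)"
    and \<sigma>: "\<sigma> permutes {..<outs (verts g ! i)}" and \<tau>: "\<tau> permutes {..<ins (verts g ! i)}"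
  shows "map_decs h (twist C i \<sigma> \<tau> g) = twist C' i \<sigma> \<tau> (map_decs h g)"
  using i bimod_mapD(5)[OF h dgraphs_dec[OF g i] \<sigma> \<tau>] by (intro dgraph.expand) (simp add: map_update)

lemma map_decs_subst: "map_decs h (subst_graph \<Gamma> gs) = subst_graph \<Gamma> (map (map_decs h) gs)"
proof -
  have "(\<Sum>j<i. length (verts (map (map_decs h) gs ! j))) = (\<Sum>j<i. length (verts (gs ! j)))" if "i < length gs" for i
    using that by (intro sum.cong) auto
  then have "junction_wires \<Gamma> (map (map_decs h) gs) = junction_wires \<Gamma> gs"
    unfolding junction_wires_def Let_def by (intro arg_cong2[where f = "(\<union>)"] refl SUP_cong) simp_all
  then show ?thesis
    by (intro dgraph.expand) (simp add: subst_graph_def map_concat o_def)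
qed

lemma comb_map_msubst:
  fixes xs :: "('a dgraph \<Rightarrow>\<^sub>0 'k::field) list"
  shows "comb_map h (msubst \<Gamma> xs) = msubst \<Gamma> (map (comb_map h) xs)"
proof -
  have "mext (\<lambda>gs. basis (subst_graph \<Gamma> gs)) (map (\<lambda>g. basis (map_decs h g)) gs) =
      (basis (subst_graph \<Gamma> (map (map_decs h) gs)) :: _ \<Rightarrow>\<^sub>0 'k)" for gs
    using mext_basis[of "\<lambda>gs. basis (subst_graph \<Gamma> gs)" "map (map_decs h) gs"] by (simp add: o_def)
  then show ?thesis
    by (simp add: comb_map_def msubst_mext lin_mext mext_map_lin map_decs_subst)
qed

lemma comb_map_act_comb: "comb_map h (act_comb \<sigma> \<tau> x) = act_comb \<sigma> \<tau> (comb_map h x)"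
  by (simp add: comb_map_def act_comb_def lin_lin map_decs_act)

lemma comb_map_relator:
  assumes h: "bimod_map C C' h h'" and r: "graph_relator C m n d r"
  shows "graph_relator C' m n d (comb_map h r)"
  using r
proof cases
  case (additive g i a b k e\<^sub>0 e e')
  then have "graph_relator C' m n d (basis (set_dec (map_decs h g) i (add C' a b k (h a b k e) (h a b k e'))) -
      basis (set_dec (map_decs h g) i (h a b k e)) - basis (set_dec (map_decs h g) i (h a b k e')))"
    using dgraphs_map_decs(1)[OF h] bimod_mapD(1)[OF h]
    by (intro graph_relator.additive[where e\<^sub>0 = "h a b k e\<^sub>0"]) simp_all
  then show ?thesis using additive by (simp add: comb_map_simps map_decs_set_dec bimod_mapD(3)[OF h])
next
  case (homogeneous g i a b k e\<^sub>0 e c)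
  then have "graph_relator C' m n d (basis (set_dec (map_decs h g) i (smul C' a b k c (h a b k e))) -
      fscale c (basis (set_dec (map_decs h g) i (h a b k e))))"
    using dgraphs_map_decs(1)[OF h] bimod_mapD(1)[OF h]
    by (intro graph_relator.homogeneous[where e\<^sub>0 = "h a b k e\<^sub>0"]) simp_all
  then show ?thesis using homogeneous by (simp add: comb_map_simps map_decs_set_dec bimod_mapD(4)[OF h])
next
  case (reorder g \<pi>)
  then have "graph_relator C' m n d (basis (map_decs h g) -
      fscale (koszul \<pi> (map vdeg (verts (map_decs h g)))) (basis (permute_vertices \<pi> (map_decs h g))))"
    using dgraphs_map_decs(1)[OF h] by (intro graph_relator.reorder) simp_all
  then show ?thesis using reorder by (simp add: comb_map_simps map_decs_permute o_def)
next
  case (equivariant g i \<sigma> \<tau>)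
  then have "graph_relator C' m n d (basis (twist C' i \<sigma> \<tau> (map_decs h g)) - basis (map_decs h g))"
    using dgraphs_map_decs(1)[OF h] by (intro graph_relator.equivariant) simp_all
  then show ?thesis using equivariant by (simp add: comb_map_simps map_decs_twist[OF h])
qed

lemma comb_map_graph_rels:
  assumes h: "bimod_map C C' h h'" and x: "x \<in> graph_rels C m n d"
  shows "comb_map h x \<in> graph_rels C' m n d"
  using x unfolding graph_rels_def
proof (rule fspace.span_induct[where P = "\<lambda>x. comb_map h x \<in> fspace.span (Collect (graph_relator C' m n d))"])
  fix y assume "y \<in> Collect (graph_relator C m n d)"
  then show "comb_map h y \<in> fspace.span (Collect (graph_relator C' m n d))"
    using comb_map_relator[OF h] by (simp add: fspace.span_base)
next
  show "fspace.subspace {x. comb_map h x \<in> fspace.span (Collect (graph_relator C' m n d))}"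
    by (rule fspace.subspaceI) (auto simp: comb_map_simps fspace.span_zero fspace.span_add fspace.span_scale)
qed

text \<open>Relators go to relators, and since this also holds for the inverse, cosets go onto cosets. The
  closure of \<open>C'\<close> serves to invert the map on the relators, which have to be formal combinations.\<close>

lemma comb_map_coset:
  assumes h: "bimod_map C C' h h'" and h': "bimod_map C' C h' h" and C': "closed_sbimod C'"
  shows "comb_map h ` coset (graph_rels C m n d) x = coset (graph_rels C' m n d) (comb_map h x)"
proof (intro equalityI subsetI)
  fix z assume "z \<in> comb_map h ` coset (graph_rels C m n d) x"
  then obtain y where y: "y - x \<in> graph_rels C m n d" "z = comb_map h y" by (auto simp: coset_def)
  show "z \<in> coset (graph_rels C' m n d) (comb_map h x)"
    using comb_map_graph_rels[OF h y(1)] y(2) by (simp add: coset_def comb_map_simps)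
next
  fix z assume "z \<in> coset (graph_rels C' m n d) (comb_map h x)"
  then have z: "z - comb_map h x \<in> graph_rels C' m n d" by (simp add: coset_def)
  let ?r = "comb_map h' (z - comb_map h x)"
  have "comb_map h (x + ?r) = comb_map h x + comb_map h ?r" by (rule comb_map_simps(2))
  also have "comb_map h ?r = z - comb_map h x"
    using z graph_rels_formal[OF C'] by (intro comb_map_formal(2)[OF h', of _ m n d]) blast
  finally have "z = comb_map h (x + ?r)" by simp
  moreover have "x + ?r \<in> coset (graph_rels C m n d) x"
    using comb_map_graph_rels[OF h' z] by (simp add: coset_def)
  ultimately show "z \<in> comb_map h ` coset (graph_rels C m n d) x" by (rule image_eqI)
qed


section \<open>Isomorphic coproperads have isomorphic cobar constructions\<close>

text \<open>Half of an isomorphism of partial coproperads. Decompositions are classes of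
  combinations of two-level graphs, and a class is mapped into a class.\<close>

definition coproperad_map :: "('k::field, 'a) partial_coproperad \<Rightarrow> ('k, 'b) partial_coproperad \<Rightarrow>
    (nat \<Rightarrow> nat \<Rightarrow> int \<Rightarrow> 'a \<Rightarrow> 'b) \<Rightarrow> (nat \<Rightarrow> nat \<Rightarrow> int \<Rightarrow> 'b \<Rightarrow> 'a) \<Rightarrow> bool" where
  "coproperad_map C C' h h' \<longleftrightarrow> bimod_map C C' h h' \<and> closed_sbimod C \<and>
     (\<forall>m n d. \<forall>\<phi>\<in>car C m n d. \<forall>t\<in>decomp C m n d \<phi>.
        keys t \<subseteq> {g \<in> dgraphs C m n d. two_level g} \<and> comb_map h t \<in> decomp C' m n d (h m n d \<phi>))"

text \<open>The map that \<open>h\<close> induces on desuspensions.\<close>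

definition shift_degree :: "(nat \<Rightarrow> nat \<Rightarrow> int \<Rightarrow> 'a \<Rightarrow> 'b) \<Rightarrow> nat \<Rightarrow> nat \<Rightarrow> int \<Rightarrow> 'a \<Rightarrow> 'b" where
  "shift_degree h m n d = h m n (d + 1)"

lemma desusp_sel [simp]:
  "car (desusp C) m n d = car C m n (d + 1)" "add (desusp C) m n d = add C m n (d + 1)"
  "smul (desusp C) m n d = smul C m n (d + 1)" "act (desusp C) m n d = act C m n (d + 1)"
  by (simp_all add: desusp_def)

lemma bimod_map_desusp: "bimod_map C C' h h' \<Longrightarrow> bimod_map (desusp C) (desusp C') (shift_degree h) (shift_degree h')"
  by (simp add: bimod_map_def shift_degree_def)

lemma closed_desusp: "closed_sbimod C \<Longrightarrow> closed_sbimod (desusp C)"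
  by (simp add: closed_sbimod_def)

lemma two_level_map_decs [simp]: "two_level (map_decs h g) \<longleftrightarrow> two_level g"
  by (simp add: two_level_def wf_map_decs steps_def)

lemma comb_map_desusp_two:
  assumes "keys t \<subseteq> {g. two_level g}"
  shows "comb_map (shift_degree h) (lin desusp_two t) = lin desusp_two (comb_map h t)"
proof -
  have "comb_map (shift_degree h) (desusp_two g) = desusp_two (map_decs h g)" if "two_level g" for g
  proof -
    have "0 < length (verts g)" using that by (simp add: two_level_def)
    then show ?thesis
      by (simp add: desusp_two_def comb_map_simps o_def map_decs_def shift_degree_def)
  qed
  then have "lin (\<lambda>g. comb_map (shift_degree h) (desusp_two g)) t = lin (\<lambda>g. desusp_two (map_decs h g)) t"
    using assms by (intro lin_cong) blast
  then show ?thesis unfolding comb_map_simps(7) by (simp add: comb_map_def lin_lin)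
qed

text \<open>The effect of \<open>map_decs\<close> on a single vertex, for choices \<open>\<delta>\<close> that depend on a vertex.\<close>

definition map_vertex :: "(nat \<Rightarrow> nat \<Rightarrow> int \<Rightarrow> 'a \<Rightarrow> 'b) \<Rightarrow> 'a vertex \<Rightarrow> 'b vertex" where
  "map_vertex h v = Vertex (outs v) (ins v) (vdeg v) (h (outs v) (ins v) (vdeg v) (dec v))"

lemma map_vertex_sel [simp]:
  "outs (map_vertex h v) = outs v" "ins (map_vertex h v) = ins v" "vdeg (map_vertex h v) = vdeg v"
  "dec (map_vertex h v) = h (outs v) (ins v) (vdeg v) (dec v)"
  by (simp_all add: map_vertex_def)

lemma map_decs_corolla: "map_decs h (corolla v) = corolla (map_vertex h v)"
  by (simp add: map_decs_def corolla_def map_vertex_def)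

lemma verts_map_decs: "verts (map_decs h g) = map (map_vertex h) (verts g)"
  by (simp add: map_vertex_def[abs_def])

text \<open>The derivation is a sum of substitutions at one vertex, and substitution commutes with changing
  decorations.\<close>

lemma comb_map_deriv_graph:
  assumes "\<And>v. v \<in> set (verts g) \<Longrightarrow> \<delta>' (map_vertex h v) = comb_map h (\<delta> v)"
  shows "comb_map h (deriv_graph \<delta> g) = deriv_graph \<delta>' (map_decs h g)"
proof -
  have *: "map (comb_map h) ((map (\<lambda>v. basis (corolla v)) (verts g))[i := \<delta> (verts g ! i)]) =
      (map (\<lambda>v. basis (corolla v)) (verts (map_decs h g)))[i := \<delta>' (verts (map_decs h g) ! i)]"
    if "i < length (verts g)" for i
    using that assms[of "verts g ! i"]
    by (simp add: verts_map_decs map_update comb_map_simps o_def map_decs_corolla del: map_decs_sel(4))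
  have e: "msubst (map_decs h g) xs = msubst g xs" for xs by (rule msubst_cong_edges) simp_all
  have s: "(\<Sum>j<i. vdeg (verts (map_decs h g) ! j)) = (\<Sum>j<i. vdeg (verts g ! j))" if "i < length (verts g)" for i
    using that by (intro sum.cong) simp_all
  show ?thesis
    unfolding deriv_graph_def comb_map_simps comb_map_msubst e
    using * s by (intro sum.cong) (simp_all del: map_decs_sel(4) add: verts_map_decs)
qed

lemma list_all2_image:
  "list_all2 (\<lambda>y v. y \<in> F ` D v) ys vs \<longleftrightarrow> (\<exists>xs. ys = map F xs \<and> list_all2 (\<lambda>x v. x \<in> D v) xs vs)"
proof (induction vs arbitrary: ys)
  case (Cons v vs)
  show ?case
  proof
    assume "list_all2 (\<lambda>y v. y \<in> F ` D v) ys (v # vs)"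
    then obtain y zs where y: "ys = y # zs" "y \<in> F ` D v" "list_all2 (\<lambda>y v. y \<in> F ` D v) zs vs"
      by (auto simp: list_all2_Cons2)
    then obtain x xs where "y = F x" "x \<in> D v" "zs = map F xs" "list_all2 (\<lambda>x v. x \<in> D v) xs vs"
      using Cons.IH by blast
    then show "\<exists>xs. ys = map F xs \<and> list_all2 (\<lambda>x v. x \<in> D v) xs (v # vs)"
      using y(1) by (intro exI[of _ "x # xs"]) simp
  qed (auto simp: list_all2_conv_all_nth)
qed auto

lemma cobar_sel:
  fixes C :: "('k::field_char_0, 'a) partial_coproperad"
  shows "car (cobar C) m n d = coset (graph_rels (desusp C) m n d) ` formal (desusp C) m n d"
    and "add (cobar C) m n d X Y = (\<Union>x\<in>X. \<Union>y\<in>Y. coset (graph_rels (desusp C) m n d) (x + y))"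
    and "smul (cobar C) m n d c X = (\<Union>x\<in>X. coset (graph_rels (desusp C) m n d) (fscale c x))"
    and "act (cobar C) m n d \<sigma> \<tau> X = (\<Union>x\<in>X. coset (graph_rels (desusp C) m n d) (act_comb \<sigma> \<tau> x))"
    and "ev (cobar C) \<Gamma> = (\<Union>xs\<in>{xs. list_all2 (\<lambda>x v. x \<in> dec v) xs (verts \<Gamma>)}.
             coset (graph_rels (desusp C) (gout \<Gamma>) (gin \<Gamma>) (gdeg \<Gamma>)) (msubst \<Gamma> xs))"
    and "diff (cobar C) m n d X = \<Union>{coset (graph_rels (desusp C) m n (d - 1)) (lin (deriv_graph \<delta>) x) |x \<delta>.
        x \<in> X \<and> (\<forall>g\<in>keys x. \<forall>v\<in>set (verts g).
          \<delta> v \<in> lin desusp_two ` decomp C (outs v) (ins v) (vdeg v + 1) (dec v))}"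
  by (simp_all add: cobar_def free_properad_def graph_quotient_def act_comb_def)

lemma cobar_diff_mem:
  fixes C :: "('k::field_char_0, 'a) partial_coproperad"
  shows "z \<in> diff (cobar C) m n d X \<longleftrightarrow> (\<exists>x \<delta>. x \<in> X \<and>
     (\<forall>g\<in>keys x. \<forall>v\<in>set (verts g). \<delta> v \<in> lin desusp_two ` decomp C (outs v) (ins v) (vdeg v + 1) (dec v)) \<and>
     z \<in> coset (graph_rels (desusp C) m n (d - 1)) (lin (deriv_graph \<delta>) x))"
  unfolding cobar_sel by blast

lemma coproperad_mapD:
  assumes "coproperad_map C C' h h'"
  shows "bimod_map C C' h h'" "closed_sbimod C"
    and "\<phi> \<in> car C m n d \<Longrightarrow> t \<in> decomp C m n d \<phi> \<Longrightarrow> keys t \<subseteq> {g \<in> dgraphs C m n d. two_level g}"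
    and "\<phi> \<in> car C m n d \<Longrightarrow> t \<in> decomp C m n d \<phi> \<Longrightarrow> comb_map h t \<in> decomp C' m n d (h m n d \<phi>)"
  using assms unfolding coproperad_map_def by blast+

lemma shift_decomp:
  fixes C :: "('k::field_char_0, 'a) partial_coproperad" and C' :: "('k, 'b) partial_coproperad"
  assumes h: "coproperad_map C C' h h'" and v: "dec v \<in> car C (outs v) (ins v) (vdeg v + 1)"
    and s: "s \<in> lin desusp_two ` decomp C (outs v) (ins v) (vdeg v + 1) (dec v)"
  shows "comb_map (shift_degree h) s \<in> lin desusp_two `
      decomp C' (outs v) (ins v) (vdeg v + 1) (dec (map_vertex (shift_degree h) v))"
    and "comb_map (shift_degree h') (comb_map (shift_degree h) s) = s"
proof -
  obtain t where t: "s = lin desusp_two t" "t \<in> decomp C (outs v) (ins v) (vdeg v + 1) (dec v)" using s by blast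
  note k = coproperad_mapD(3)[OF h v t(2)]
  have tf: "t \<in> formal C (outs v) (ins v) (vdeg v + 1)" using k by (auto simp: formal_def)
  have t2: "keys t \<subseteq> {g. two_level g}" using k by blast
  have e: "comb_map (shift_degree h) s = lin desusp_two (comb_map h t)"
    unfolding t(1) by (rule comb_map_desusp_two[OF t2])
  show "comb_map (shift_degree h) s \<in> lin desusp_two `
      decomp C' (outs v) (ins v) (vdeg v + 1) (dec (map_vertex (shift_degree h) v))"
    unfolding e using coproperad_mapD(4)[OF h v t(2)] by (simp add: shift_degree_def)
  have "keys (comb_map h t) \<subseteq> {g. two_level g}"
    using keys_lin[of "\<lambda>g. basis (map_decs h g)" t] t2 unfolding comb_map_def by fastforce
  then have "comb_map (shift_degree h') (lin desusp_two (comb_map h t)) = lin desusp_two (comb_map h' (comb_map h t))"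
    by (rule comb_map_desusp_two)
  then show "comb_map (shift_degree h') (comb_map (shift_degree h) s) = s"
    unfolding e by (simp only: comb_map_formal(2)[OF coproperad_mapD(1)[OF h] tf] t(1))
qed

text \<open>A choice \<open>\<delta>\<close> of representatives of the decompositions is transported to the other side along with
  the decorations, and back; the two differentials are thus taken over the same choices.\<close>

lemma cobar_diff_map:
  fixes C :: "('k::field_char_0, 'a) partial_coproperad" and C' :: "('k, 'b) partial_coproperad"
  assumes h: "coproperad_map C C' h h'" and h': "coproperad_map C' C h' h"
    and X: "X \<subseteq> formal (desusp C) m n d"
  shows "comb_map (shift_degree h) ` diff (cobar C) m n d X = diff (cobar C') m n d (comb_map (shift_degree h) ` X)"
proof -
  let ?M = "comb_map (shift_degree h) :: ('a dgraph \<Rightarrow>\<^sub>0 'k) \<Rightarrow> _"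
  let ?M' = "comb_map (shift_degree h') :: ('b dgraph \<Rightarrow>\<^sub>0 'k) \<Rightarrow> _"
  let ?v = "map_vertex (shift_degree h)" and ?v' = "map_vertex (shift_degree h')"
  note b = bimod_map_desusp[OF coproperad_mapD(1)[OF h]] and b' = bimod_map_desusp[OF coproperad_mapD(1)[OF h']]
  note c' = closed_desusp[OF coproperad_mapD(2)[OF h']]
  let ?ok = "\<lambda>x \<delta>. \<forall>g\<in>keys x. \<forall>v\<in>set (verts g). \<delta> v \<in> lin desusp_two ` decomp C (outs v) (ins v) (vdeg v + 1) (dec v)"
  let ?ok' = "\<lambda>x \<delta>. \<forall>g\<in>keys x. \<forall>v\<in>set (verts g). \<delta> v \<in> lin desusp_two ` decomp C' (outs v) (ins v) (vdeg v + 1) (dec v)"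
  have car: "dec v \<in> car C (outs v) (ins v) (vdeg v + 1)" if "x \<in> X" "g \<in> keys x" "v \<in> set (verts g)" for x g v
    using formal_keys[OF subsetD[OF X that(1)] that(2)] that(3) by (simp add: dgraphs_def)
  have vv: "?v' (?v v) = v" if "dec v \<in> car C (outs v) (ins v) (vdeg v + 1)" for v
    using bimod_mapD(2)[OF coproperad_mapD(1)[OF h] that] by (cases v) (simp add: map_vertex_def shift_degree_def)
  have deriv: "?M (lin (deriv_graph \<delta>) x) = lin (deriv_graph \<delta>') (?M x)"
    if "\<And>g v. g \<in> keys x \<Longrightarrow> v \<in> set (verts g) \<Longrightarrow> \<delta>' (?v v) = ?M (\<delta> v)" for x \<delta> \<delta>'
  proof -
    have "?M (lin (deriv_graph \<delta>) x) = lin (\<lambda>g. deriv_graph \<delta>' (map_decs (shift_degree h) g)) x"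
      unfolding comb_map_simps(7) by (intro lin_cong comb_map_deriv_graph that)
    then show ?thesis by (simp add: comb_map_def lin_lin)
  qed
  have keys_M: "\<exists>g\<in>keys x. g' = map_decs (shift_degree h) g" if "g' \<in> keys (?M x)" for g' x
    using that keys_lin[of "\<lambda>g. basis (map_decs (shift_degree h) g)" x] unfolding comb_map_def by fastforce
  show ?thesis
  proof (intro equalityI subsetI)
    fix z' assume "z' \<in> ?M ` diff (cobar C) m n d X"
    then obtain z where zd: "z' = ?M z" "z \<in> diff (cobar C) m n d X" by blast
    from zd(2)[unfolded cobar_diff_mem] obtain x \<delta> where x: "x \<in> X" "?ok x \<delta>"
      and z: "z \<in> coset (graph_rels (desusp C) m n (d - 1)) (lin (deriv_graph \<delta>) x)" by blast
    define \<delta>' where "\<delta>' w = ?M (\<delta> (?v' w))" for w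
    have "z' \<in> ?M ` coset (graph_rels (desusp C) m n (d - 1)) (lin (deriv_graph \<delta>) x)" using z zd(1) by blast
    also have "\<dots> = coset (graph_rels (desusp C') m n (d - 1)) (?M (lin (deriv_graph \<delta>) x))"
      by (rule comb_map_coset[OF b b' c'])
    also have "?M (lin (deriv_graph \<delta>) x) = lin (deriv_graph \<delta>') (?M x)"
      by (rule deriv) (simp add: \<delta>'_def vv car[OF x(1)])
    finally have "z' \<in> coset (graph_rels (desusp C') m n (d - 1)) (lin (deriv_graph \<delta>') (?M x))" .
    moreover have "?ok' (?M x) \<delta>'"
    proof (intro ballI)
      fix g' w assume "g' \<in> keys (?M x)" and w: "w \<in> set (verts g')"
      then obtain g where g: "g \<in> keys x" "g' = map_decs (shift_degree h) g" using keys_M by blast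
      then obtain v where v: "v \<in> set (verts g)" "w = ?v v" using w unfolding g(2) verts_map_decs by auto
      note cv = car[OF x(1) g(1) v(1)]
      have "\<delta> v \<in> lin desusp_two ` decomp C (outs v) (ins v) (vdeg v + 1) (dec v)" using x(2) g(1) v(1) by blast
      from shift_decomp(1)[OF h cv this]
      show "\<delta>' w \<in> lin desusp_two ` decomp C' (outs w) (ins w) (vdeg w + 1) (dec w)"
        unfolding \<delta>'_def v(2) vv[OF cv] map_vertex_sel(1-3) .
    qed
    ultimately show "z' \<in> diff (cobar C') m n d (?M ` X)" unfolding cobar_diff_mem using x(1) by blast
  next
    fix z' assume "z' \<in> diff (cobar C') m n d (?M ` X)"
    then obtain x \<delta>' where x: "x \<in> X" "?ok' (?M x) \<delta>'" and z: "z' \<in> coset (graph_rels (desusp C') m n (d - 1)) (lin (deriv_graph \<delta>') (?M x))"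
      unfolding cobar_diff_mem by blast
    define \<delta> where "\<delta> v = ?M' (\<delta>' (?v v))" for v
    have key: "\<delta> v \<in> lin desusp_two ` decomp C (outs v) (ins v) (vdeg v + 1) (dec v) \<and> \<delta>' (?v v) = ?M (\<delta> v)"
      if g: "g \<in> keys x" and v: "v \<in> set (verts g)" for g v
    proof -
      note cv = car[OF x(1) g v]
      have gf: "g \<in> dgraphs (desusp C) m n d" using formal_keys[OF subsetD[OF X x(1)] g] .
      have "x = ?M' (?M x)" using comb_map_formal(2)[OF b subsetD[OF X x(1)]] by simp
      then have "g \<in> keys (?M' (?M x))" using g by simp
      then obtain g' where g': "g' \<in> keys (?M x)" "g = map_decs (shift_degree h') g'"
        using keys_lin[of "\<lambda>g. basis (map_decs (shift_degree h') g)" "?M x"] unfolding comb_map_def by fastforce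
      have "g' \<in> dgraphs (desusp C') m n d"
        using formal_keys[OF comb_map_formal(1)[OF b subsetD[OF X x(1)]] g'(1)] .
      then have "map_decs (shift_degree h) g = g'" unfolding g'(2) by (rule dgraphs_map_decs(2)[OF b'])
      then have "?v v \<in> set (verts g')" using v by (metis verts_map_decs image_eqI set_map)
      then have m: "\<delta>' (?v v) \<in> lin desusp_two ` decomp C' (outs (?v v)) (ins (?v v)) (vdeg (?v v) + 1) (dec (?v v))"
        using x(2) g'(1) by blast
      have cv': "dec (?v v) \<in> car C' (outs (?v v)) (ins (?v v)) (vdeg (?v v) + 1)"
        using bimod_mapD(1)[OF coproperad_mapD(1)[OF h] cv] by (simp add: shift_degree_def)
      show ?thesis
        using shift_decomp[OF h' cv' m] unfolding vv[OF cv] by (simp add: \<delta>_def)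
    qed
    have "?M (lin (deriv_graph \<delta>) x) = lin (deriv_graph \<delta>') (?M x)" by (rule deriv) (use key in blast)
    then have "z' \<in> ?M ` coset (graph_rels (desusp C) m n (d - 1)) (lin (deriv_graph \<delta>) x)"
      using z by (simp add: comb_map_coset[OF b b' c'])
    moreover have "coset (graph_rels (desusp C) m n (d - 1)) (lin (deriv_graph \<delta>) x) \<subseteq> diff (cobar C) m n d X"
      unfolding cobar_diff_mem subset_iff using x(1) key by blast
    ultimately show "z' \<in> ?M ` diff (cobar C) m n d X" by blast
  qed
qed

lemma cobar_car_formal:
  fixes C :: "('k::field_char_0, 'a) partial_coproperad"
  assumes C: "closed_sbimod C" and X: "X \<in> car (cobar C) m n d"
  shows "X \<subseteq> formal (desusp C) m n d"
proof
  fix y assume y: "y \<in> X"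
  obtain x where x: "x \<in> formal (desusp C) m n d" "X = coset (graph_rels (desusp C) m n d) x"
    using X by (auto simp: cobar_sel)
  have "y - x \<in> formal (desusp C) m n d"
    using y x(2) graph_rels_formal[OF closed_desusp[OF C], of m n d] by (auto simp: coset_def)
  from formal_add[OF this x(1)] show "y \<in> formal (desusp C) m n d" by simp
qed

text \<open>All operations of the cobar construction are unions of cosets over representatives, so mapping the
  representatives commutes with them.\<close>

theorem cobar_iso:
  fixes C :: "('k::field_char_0, 'a) partial_coproperad" and C' :: "('k, 'b) partial_coproperad"
  assumes h: "coproperad_map C C' h h'" and h': "coproperad_map C' C h' h"
  shows "dg_properad_iso (cobar C) (cobar C') (\<lambda>m n d X. comb_map (shift_degree h) ` X)"
proof -
  let ?M = "comb_map (shift_degree h) :: ('a dgraph \<Rightarrow>\<^sub>0 'k) \<Rightarrow> _"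
  let ?M' = "comb_map (shift_degree h') :: ('b dgraph \<Rightarrow>\<^sub>0 'k) \<Rightarrow> _"
  note b = bimod_map_desusp[OF coproperad_mapD(1)[OF h]] and b' = bimod_map_desusp[OF coproperad_mapD(1)[OF h']]
  note c = coproperad_mapD(2)[OF h] and c' = coproperad_mapD(2)[OF h']
  note cos = comb_map_coset[OF b b' closed_desusp[OF c']] and cos' = comb_map_coset[OF b' b closed_desusp[OF c]]
  have into: "?M ` X \<in> car (cobar C') m n d" if "X \<in> car (cobar C) m n d" for X m n d
    using that comb_map_formal(1)[OF b] by (auto simp: cobar_sel cos)
  have into': "?M' ` X \<in> car (cobar C) m n d" if "X \<in> car (cobar C') m n d" for X m n d
    using that comb_map_formal(1)[OF b'] by (auto simp: cobar_sel cos')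
  have inv: "?M' ` ?M ` X = X" if "X \<in> car (cobar C) m n d" for X m n d
    using comb_map_formal(2)[OF b] cobar_car_formal[OF c that] by (force simp: image_image)
  have inv': "?M ` ?M' ` X = X" if "X \<in> car (cobar C') m n d" for X m n d
    using comb_map_formal(2)[OF b'] cobar_car_formal[OF c' that] by (force simp: image_image)
  have ev: "?M ` ev (cobar C) g = ev (cobar C') (map_decs (\<lambda>m n d X. ?M ` X) g)" for g
  proof -
    have "{ys. list_all2 (\<lambda>y v. y \<in> dec v) ys (verts (map_decs (\<lambda>m n d X. ?M ` X) g))} =
        map ?M ` {xs. list_all2 (\<lambda>x v. x \<in> dec v) xs (verts g)}"
      by (auto simp: list_all2_map2 list_all2_image)
    moreover have "msubst (map_decs (\<lambda>m n d X. ?M ` X) g) ys = msubst g ys" for ys :: "('b dgraph \<Rightarrow>\<^sub>0 'k) list"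
      by (rule msubst_cong_edges) simp_all
    ultimately show ?thesis
      by (simp add: cobar_sel image_UN cos comb_map_msubst del: map_decs_sel(4))
  qed
  show ?thesis
    unfolding dg_properad_iso_def
  proof (intro allI conjI ballI impI)
    fix m n d
    show "bij_betw ((`) ?M) (car (cobar C) m n d) (car (cobar C') m n d)"
      by (rule bij_betw_byWitness[where f' = "(`) ?M'"]) (use into into' inv inv' in auto)
    show "?M ` add (cobar C) m n d X Y = add (cobar C') m n d (?M ` X) (?M ` Y)" for X Y
      by (simp add: cobar_sel image_UN cos comb_map_simps)
    show "?M ` smul (cobar C) m n d k X = smul (cobar C') m n d k (?M ` X)" for k X
      by (simp add: cobar_sel image_UN cos comb_map_simps)
    show "?M ` act (cobar C) m n d \<sigma> \<tau> X = act (cobar C') m n d \<sigma> \<tau> (?M ` X)" for \<sigma> \<tau> X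
      by (simp add: cobar_sel image_UN cos comb_map_act_comb)
    show "?M ` ev (cobar C) g = ev (cobar C') (map_decs (\<lambda>m n d X. ?M ` X) g)" for g
      by (rule ev)
    show "?M ` diff (cobar C) m n d X = diff (cobar C') m n d (?M ` X)" if "X \<in> car (cobar C) m n d" for X
      by (rule cobar_diff_map[OF h h' cobar_car_formal[OF c that]])
  qed
qed


section \<open>Duality\<close>

definition dual_map :: "('k::field, 'b, 'z) sbimod_scheme \<Rightarrow> (nat \<Rightarrow> nat \<Rightarrow> int \<Rightarrow> 'b \<Rightarrow> 'a) \<Rightarrow>
    nat \<Rightarrow> nat \<Rightarrow> int \<Rightarrow> ('a \<Rightarrow> 'k) \<Rightarrow> ('b \<Rightarrow> 'k)" where
  "dual_map Q f m n d \<phi> y = (if y \<in> car Q m n (- d) then \<phi> (f m n (- d) y) else 0)"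

lemma dual_sel:
  "\<phi> \<in> car (dual_coproperad P) m n d \<longleftrightarrow> (\<forall>x. x \<notin> car P m n (- d) \<longrightarrow> \<phi> x = 0) \<and>
       (\<forall>x\<in>car P m n (- d). \<forall>y\<in>car P m n (- d). \<phi> (add P m n (- d) x y) = \<phi> x + \<phi> y) \<and>
       (\<forall>c. \<forall>x\<in>car P m n (- d). \<phi> (smul P m n (- d) c x) = c * \<phi> x)"
  "add (dual_coproperad P) m n d \<phi> \<psi> = (\<lambda>x. \<phi> x + \<psi> x)"
  "smul (dual_coproperad P) m n d c \<phi> = (\<lambda>x. c * \<phi> x)"
  "act (dual_coproperad P) m n d \<sigma> \<tau> \<phi> =
     (\<lambda>x. if x \<in> car P m n (- d) then \<phi> (act P m n (- d) (inv \<sigma>) (inv \<tau>) x) else 0)"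
  by (simp_all add: dual_coproperad_def dual_sbimod_def Let_def)

lemma dgraphs_dual: "dgraphs (dual_sbimod P) m n d = dgraphs (dual_coproperad P) m n d"
  by (simp add: dgraphs_def dual_coproperad_def Let_def)

lemma decomp_dual:
  "t \<in> decomp (dual_coproperad P) m n d \<phi> \<longleftrightarrow> keys t \<subseteq> {h \<in> dgraphs (dual_coproperad P) m n d. two_level h} \<and>
       (\<forall>g\<in>dgraphs P m n (- d). two_level g \<longrightarrow> (\<Sum>h\<in>keys t. lookup t h * pairing h g) = \<phi> (ev P g))"
  by (simp add: dgraphs_dual[symmetric]) (simp add: dual_coproperad_def Let_def)

lemma properad_mapD:
  assumes "properad_map P Q f f'"
  shows "bimod_map P Q f f'" "closed_sbimod P" "linear_action P"
    and "g \<in> dgraphs P m n d \<Longrightarrow> ev P g \<in> car P m n d"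
    and "g \<in> dgraphs P m n d \<Longrightarrow> f m n d (ev P g) = ev Q (map_decs f g)"
  using assms unfolding properad_map_def by blast+

lemma closed_sbimodD:
  assumes "closed_sbimod E"
  shows "x \<in> car E m n d \<Longrightarrow> y \<in> car E m n d \<Longrightarrow> add E m n d x y \<in> car E m n d"
    and "x \<in> car E m n d \<Longrightarrow> smul E m n d c x \<in> car E m n d"
    and "x \<in> car E m n d \<Longrightarrow> \<sigma> permutes {..<m} \<Longrightarrow> \<tau> permutes {..<n} \<Longrightarrow> act E m n d \<sigma> \<tau> x \<in> car E m n d"
  using assms unfolding closed_sbimod_def by blast+

lemma closed_dual:
  assumes P: "closed_sbimod P" "linear_action P"
  shows "closed_sbimod (dual_coproperad P)"
  unfolding closed_sbimod_def
proof (intro allI conjI ballI impI)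
  fix m n d \<phi> assume \<phi>: "\<phi> \<in> car (dual_coproperad P) m n d"
  show "add (dual_coproperad P) m n d \<phi> \<psi> \<in> car (dual_coproperad P) m n d" if "\<psi> \<in> car (dual_coproperad P) m n d" for \<psi>
    using \<phi> that by (simp add: dual_sel algebra_simps)
  show "smul (dual_coproperad P) m n d c \<phi> \<in> car (dual_coproperad P) m n d" for c
    using \<phi> by (simp add: dual_sel algebra_simps)
  fix \<sigma> \<tau> assume "\<sigma> permutes {..<m}" "\<tau> permutes {..<n}"
  then have p: "inv \<sigma> permutes {..<m}" "inv \<tau> permutes {..<n}" by (simp_all add: permutes_inv)
  show "act (dual_coproperad P) m n d \<sigma> \<tau> \<phi> \<in> car (dual_coproperad P) m n d"
    using \<phi> P(2) closed_sbimodD[OF P(1)] p by (simp add: dual_sel linear_action_def)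
qed

lemma bimod_map_dual:
  assumes f: "properad_map P Q f f'" and f': "properad_map Q P f' f"
  shows "bimod_map (dual_coproperad P) (dual_coproperad Q) (dual_map Q f') (dual_map P f)"
  unfolding bimod_map_def
proof (intro allI conjI ballI impI)
  note b = bimod_mapD[OF properad_mapD(1)[OF f]] and b' = bimod_mapD[OF properad_mapD(1)[OF f']]
  note c' = closed_sbimodD[OF properad_mapD(2)[OF f']]
  fix m n d \<phi> assume \<phi>: "\<phi> \<in> car (dual_coproperad P) m n d"
  show "dual_map Q f' m n d \<phi> \<in> car (dual_coproperad Q) m n d"
    using \<phi> b' c' by (simp add: dual_sel dual_map_def)
  show "dual_map P f m n d (dual_map Q f' m n d \<phi>) = \<phi>"
    using \<phi> b(1,2) by (auto simp: dual_sel dual_map_def fun_eq_iff)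
  show "dual_map Q f' m n d (add (dual_coproperad P) m n d \<phi> \<psi>) =
      add (dual_coproperad Q) m n d (dual_map Q f' m n d \<phi>) (dual_map Q f' m n d \<psi>)" for \<psi>
    by (simp add: dual_sel dual_map_def fun_eq_iff)
  show "dual_map Q f' m n d (smul (dual_coproperad P) m n d c \<phi>) =
      smul (dual_coproperad Q) m n d c (dual_map Q f' m n d \<phi>)" for c
    by (simp add: dual_sel dual_map_def fun_eq_iff)
  fix \<sigma> \<tau> assume "\<sigma> permutes {..<m}" "\<tau> permutes {..<n}"
  then have p: "inv \<sigma> permutes {..<m}" "inv \<tau> permutes {..<n}" by (simp_all add: permutes_inv)
  show "dual_map Q f' m n d (act (dual_coproperad P) m n d \<sigma> \<tau> \<phi>) =
      act (dual_coproperad Q) m n d \<sigma> \<tau> (dual_map Q f' m n d \<phi>)"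
    using b'(1) b'(5)[OF _ p] c'(3)[OF _ p] by (simp add: dual_sel dual_map_def fun_eq_iff)
qed

lemma sum_comb_map:
  fixes t :: "'a dgraph \<Rightarrow>\<^sub>0 'k::field" and F :: "'b dgraph \<Rightarrow> 'k"
  shows "(\<Sum>k\<in>keys (comb_map h t). lookup (comb_map h t) k * F k) = (\<Sum>k\<in>keys t. lookup t k * F (map_decs h k))"
proof -
  have *: "(\<Sum>k\<in>keys t. lookup t k * F k) = lookup (lin (\<lambda>k. Poly_Mapping.single () (F k)) t) ()"
    for F and t :: "'c \<Rightarrow>\<^sub>0 'k"
    by (simp add: lin_def lookup_sum)
  show ?thesis unfolding * by (simp add: comb_map_def lin_lin)
qed

text \<open>The transpose of \<open>f'\<close> on functionals is adjoint to \<open>f'\<close> on graphs.\<close>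

lemma pairing_dual_map:
  assumes k: "two_level k" and g: "g \<in> dgraphs Q m n d" "two_level g"
  shows "pairing (map_decs (dual_map Q f') k) g = pairing k (map_decs f' g)"
proof -
  have l: "length (verts k) = 2" "length (verts g) = 2" using k g by (simp_all add: two_level_def)
  have c: "map (\<lambda>v. (outs v, ins v, vdeg v)) (verts (map_decs (dual_map Q f') k)) = map (\<lambda>v. (outs v, ins v, vdeg v)) (verts k)"
    "map (\<lambda>v. (outs v, ins v, - vdeg v)) (verts (map_decs f' g)) = map (\<lambda>v. (outs v, ins v, - vdeg v)) (verts g)"
    by simp_all
  have d: "dec (verts (map_decs (dual_map Q f') k) ! i) (dec (verts g ! i)) = dec (verts k ! i) (dec (verts (map_decs f' g) ! i))"
    if e: "map (\<lambda>v. (outs v, ins v, vdeg v)) (verts k) = map (\<lambda>v. (outs v, ins v, - vdeg v)) (verts g)" and i: "i < 2" for i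
  proof -
    have "outs (verts k ! i) = outs (verts g ! i) \<and> ins (verts k ! i) = ins (verts g ! i) \<and> vdeg (verts k ! i) = - vdeg (verts g ! i)"
      using arg_cong[OF e, of "\<lambda>xs. xs ! i"] i l by simp
    then show ?thesis using dgraphs_dec[OF g(1), of i] i l by (simp add: dual_map_def)
  qed
  have v: "vdeg (verts (map_decs (dual_map Q f') k) ! 1) = vdeg (verts k ! 1)"
    "vdeg (verts (map_decs f' g) ! 0) = vdeg (verts g ! 0)"
    using l by simp_all
  show ?thesis
    unfolding pairing_def c using d[of 0] d[of 1] v l by (simp del: map_decs_sel(4))
qed

text \<open>A combination that represents the decomposition of \<open>\<phi>\<close> is mapped to one that pairs with a graph as the
  original one pairs with the transported graph, hence to \<open>\<phi>\<close> of the transported composite.\<close>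

theorem coproperad_map_dual:
  assumes f: "properad_map P Q f f'" and f': "properad_map Q P f' f"
  shows "coproperad_map (dual_coproperad P) (dual_coproperad Q) (dual_map Q f') (dual_map P f)"
  unfolding coproperad_map_def
proof (intro conjI allI ballI)
  show b: "bimod_map (dual_coproperad P) (dual_coproperad Q) (dual_map Q f') (dual_map P f)"
    by (rule bimod_map_dual[OF f f'])
  show "closed_sbimod (dual_coproperad P)" by (rule closed_dual[OF properad_mapD(2,3)[OF f]])
  fix m n d \<phi> t assume t: "t \<in> decomp (dual_coproperad P) m n d \<phi>"
  show k: "keys t \<subseteq> {g \<in> dgraphs (dual_coproperad P) m n d. two_level g}" using t by (simp add: decomp_dual)
  have "keys (comb_map (dual_map Q f') t) \<subseteq> {g \<in> dgraphs (dual_coproperad Q) m n d. two_level g}"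
    using keys_lin[of "\<lambda>g. basis (map_decs (dual_map Q f') g)" t] k dgraphs_map_decs(1)[OF b]
    unfolding comb_map_def by fastforce
  moreover have "(\<Sum>k\<in>keys (comb_map (dual_map Q f') t). lookup (comb_map (dual_map Q f') t) k * pairing k g) =
      dual_map Q f' m n d \<phi> (ev Q g)" if g: "g \<in> dgraphs Q m n (- d)" "two_level g" for g
  proof -
    have "(\<Sum>k\<in>keys (comb_map (dual_map Q f') t). lookup (comb_map (dual_map Q f') t) k * pairing k g) =
        (\<Sum>k\<in>keys t. lookup t k * pairing (map_decs (dual_map Q f') k) g)" by (rule sum_comb_map)
    also have "\<dots> = (\<Sum>k\<in>keys t. lookup t k * pairing k (map_decs f' g))"
      using k by (intro sum.cong refl arg_cong2[where f = "(*)"] pairing_dual_map[OF _ g]) blast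
    also have "\<dots> = \<phi> (ev P (map_decs f' g))"
      using t dgraphs_map_decs(1)[OF properad_mapD(1)[OF f'] g(1)] g(2) by (simp add: decomp_dual)
    also have "\<dots> = dual_map Q f' m n d \<phi> (ev Q g)"
      using properad_mapD(4,5)[OF f' g(1)] by (simp add: dual_map_def)
    finally show ?thesis .
  qed
  ultimately show "comb_map (dual_map Q f') t \<in> decomp (dual_coproperad Q) m n d (dual_map Q f' m n d \<phi>)"
    by (simp add: decomp_dual)
qed


section \<open>The isomorphism\<close>

theorem theorem14:
  shows "\<exists>f. dg_properad_iso (cBIB_inf :: ('k::field_char_0, _) dg_properad) cDPois_inf f"
proof -
  let ?f = "descend bib_to_dpois dpois_arity dpois_rels" and ?f' = "descend dpois_to_bib bib_arity bib_rels"
  have "properad_map (uBIB :: ('k, _) dg_properad) uDPois ?f ?f'"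
    unfolding uBIB_def uDPois_def
    by (rule properad_map_descend[OF generator_map_bib generator_map_dpois hom_bib_to_dpois_relation
          hom_dpois_to_bib_relation hom_bib_to_dpois_generator])
  moreover have "properad_map (uDPois :: ('k, _) dg_properad) uBIB ?f' ?f"
    unfolding uBIB_def uDPois_def
    by (rule properad_map_descend[OF generator_map_dpois generator_map_bib hom_dpois_to_bib_relation
          hom_bib_to_dpois_relation hom_dpois_to_bib_generator])
  ultimately have "dg_properad_iso (cBIB_inf :: ('k, _) dg_properad) cDPois_inf
      (\<lambda>m n d X. comb_map (shift_degree (dual_map uDPois ?f')) ` X)"
    unfolding cBIB_inf_def cDPois_inf_def by (intro cobar_iso[OF coproperad_map_dual coproperad_map_dual])
  then show ?thesis by blast
qed

end
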